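(* Under the standing assumptions listed in the context, the rate function $$\mathcal G(\lambda)=\begin{cases}\mathcal H(\lambda\,|\,P^\lambda_\mu)=\int_{\mathbb R}\mathcal H(\lambda^\omega\,|\,P^{\lambda,\omega})\,\mu(d\omega)&\text{if }\lambda_2=\mu,\\+\infty&\text{otherwise}\end{cases}\qquad(\lambda\in\mathcal Y)$$ has a unique zero $\lambda^\ast$, which is characterized by: $\lambda^\ast(dx,d\omega)=\lambda^{\ast,\omega}(dx)\mu(d\omega)$, where for $\mu$-a.e. $\omega$, $t\mapsto\lambda^{\ast,\omega}_t(dx)$ is the unique weak solution of the McKean–Vlasov equation $$\lambda_0^\omega(dx)=\gamma^\omega(dx),\qquad\partial_t\lambda_t^\omega=\mathscr L^\omega\lambda_t^\omega,$$ with $\mathscr L^\omega$ the nonlinear operator $$\mathscr L^\omega\lambda_t^\omega=\frac12\partial_x^2\lambda_t^\omega-\partial_x\Big(\big(\beta^{\lambda_t,\omega}+g(\cdot,\omega)\big)\lambda_t^\omega\Big).$$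
   Context: **Spaces.** $T>0$ is fixed; $\mathcal E=\mathcal C([0,T],\mathbb R)$ (sup norm), $\mathcal F=\mathbb R$. For a Polish space $\mathcal X$, $\mathcal M(\mathcal X)$ is the set of Borel probability measures with the weak topology; $\mathcal Y=\mathcal M(\mathcal E\times\mathcal F)$. For $\lambda\in\mathcal Y$, $\lambda_2$ is its second marginal, $\lambda(dx,d\omega)=\lambda^\omega(dx)\lambda_2(d\omega)$ its disintegration, $\lambda_t\in\mathcal M(\mathbb R\times\mathbb R)$ the image of $\lambda$ under $(x,\omega)\mapsto(x_t,\omega)$, and $\lambda_t^\omega$ the law of $x_t$ under $\lambda^\omega$; when $\lambda_2=\mu$, $\lambda_t(dx,d\omega)=\lambda_t^\omega(dx)\mu(d\omega)$, so the equations for different $\omega$ are coupled through $\lambda_t$. $\mathcal H(\cdot|\cdot)$ is relative entropy. **Coefficients.** $f:\mathbb R^3\to\mathbb R$, $(x,\omega,\tilde\omega)\mapsto f(x,\omega,\tilde\omega)$, is $\mathcal C^2$ in $x$, and $f,\partial_xf,\partial_x^2f$ are bounded in $(x,\omega,\tilde\omega)$ by a uniform constant $C_f$; $f(x,\omega,\tilde\omega)=f(-x,\tilde\omega,\omega)$. $g:\mathbb R^2\to\mathbb R$ satisfies, for some $C_g>0$, $k_1,k_2\ge0$ and all $x,y,\omega,\tilde\omega$: $|g(x,\omega)|\le C_g(1+|\omega|^{k_1})$; $|g(x,\omega)-g(x,\tilde\omega)|\le C_g|\omega-\tilde\omega|(1+|\omega|^{k_2}+|\tilde\omega|^{k_2})$;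 $|g(x,\omega)-g(y,\omega)|\le C_g|x-y|$. **Initial laws.** $\{\gamma^\omega\}_{\omega\in\mathbb R}\subset\mathcal M(\mathbb R)$ is Feller: $\omega\mapsto\int\phi\,d\gamma^\omega$ is continuous for every bounded continuous $\phi$. Each $\gamma^\omega$ has exponential moments of every order; $\ell_\omega(r)=\ln\int e^{r|x|}\gamma^\omega(dx)$; there is $\tau\ge0$ such that for each $r\in\mathbb R$ there is $C(r)$ with $\ell_\omega(r)\le C(r)(1+|\omega|^\tau)$ for all $\omega$. **Disorder.** $\{\omega_i\}_{i\ge1}$ is a fixed deterministic real sequence and $\mu\in\mathcal M(\mathbb R)$ with: (D1) $\frac1N\sum_{i\le N}\delta_{\omega_i}\to\mu$ weakly; (D2) there is $p>1$ such that for all $r\in\mathbb R$, $\frac1N\sum_{i\le N}\ell_{\omega_i}(r)^p\to\int\ell_\omega(r)^p\mu(d\omega)<\infty$; (D3) there is $\iota$ with $\iota>k_1$, $\iota>\tau$, $\iota\ge k_2+1$ and $\frac1N\sum_{i\le N}|\omega_i|^\iota\to\int|\omega|^\iota\mu(d\omega)<\infty$. **Rate function data.** For $q\in\mathcal M(\mathbb R\times\mathbb R)$: $\beta^{q,\omega}(x)=-\int\partial_xf(x-\tilde x,\omega,\tilde\omega)q(d\tilde x,d\tilde\omega)$. For $\lambda\in\mathcal Y$, $P^{\lambda,\omega}\in\mathcal M(\mathcal E)$ is the law of the unique strong solution of $dx_t=\beta^{\lambda_t,\omega}(x_t)dt+g(x_t,\omega)dt+db_t$, $x_0\sim\gamma^\omega$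 ($b$ standard Brownian motion), and $P^\lambda_\mu(dx,d\omega)=P^{\lambda,\omega}(dx)\mu(d\omega)$. *)

theory Defs
  imports "HOL-Probability.Probability"
begin

section \<open>Path space and random measures\<close>

text \<open>
  \<open>C([0,T], \<real>)\<close> with the sup metric.  Paths are extensional functions on \<open>{0..T}\<close>, so that each
  path has exactly one representative.
\<close>

definition path_metric :: "real \<Rightarrow> (real \<Rightarrow> real) metric" where
  "path_metric T = cfunspace (top_of_set {0..T}) euclidean_metric"

definition path_space :: "real \<Rightarrow> (real \<Rightarrow> real) measure" where
  "path_space T =
     sigma (mspace (path_metric T)) {U. openin (mtopology_of (path_metric T)) U}"

text \<open>
  The space \<open>\<Y>\<close> of Borel probability measures on \<open>C([0,T]) \<times> \<real>\<close>.  Both factors are separable metric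
  spaces, so the Borel sigma-algebra of the product is the product sigma-algebra.
\<close>

definition path_disorder_measures :: "real \<Rightarrow> ((real \<Rightarrow> real) \<times> real) measure set" where
  "path_disorder_measures T = space (prob_algebra (path_space T \<Otimes>\<^sub>M borel))"

definition second_marginal :: "('a \<times> real) measure \<Rightarrow> real measure" where
  "second_marginal lam = distr lam borel snd"

text \<open>The image of \<open>\<lambda>\<close> under \<open>(x,\<omega>) \<mapsto> (x\<^sub>t,\<omega>)\<close>.\<close>

definition time_marginal ::
  "((real \<Rightarrow> real) \<times> real) measure \<Rightarrow> real \<Rightarrow> (real \<times> real) measure" where
  "time_marginal lam t = distr lam (borel \<Otimes>\<^sub>M borel) (\<lambda>(x, \<omega>). (x t, \<omega>))"

text \<open>The measure \<open>\<kappa>\<^sup>\<omega>(dx) \<mu>(d\<omega>)\<close> on \<open>M \<Otimes>\<^sub>M borel\<close>.\<close>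

definition semidirect ::
  "'a measure \<Rightarrow> real measure \<Rightarrow> (real \<Rightarrow> 'a measure) \<Rightarrow> ('a \<times> real) measure" where
  "semidirect M \<mu> \<kappa> = \<mu> \<bind> (\<lambda>\<omega>. distr (\<kappa> \<omega>) (M \<Otimes>\<^sub>M borel) (\<lambda>x. (x, \<omega>)))"

text \<open>
  \<open>\<kappa>\<close> is a regular conditional law \<open>\<omega> \<mapsto> \<lambda>\<^sup>\<omega>\<close>.  It is determined only up to null sets of the second
  marginal, hence a relation rather than a function of \<open>\<lambda>\<close>.
\<close>

definition disintegration ::
  "real \<Rightarrow> ((real \<Rightarrow> real) \<times> real) measure \<Rightarrow> (real \<Rightarrow> (real \<Rightarrow> real) measure) \<Rightarrow> bool" where
  "disintegration T lam \<kappa> \<longleftrightarrow>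
     \<kappa> \<in> borel \<rightarrow>\<^sub>M prob_algebra (path_space T) \<and>
     lam = semidirect (path_space T) (second_marginal lam) \<kappa>"

text \<open>
  Relative entropy \<open>\<H>(\<nu>|\<pi>) = \<integral> ln (d\<nu>/d\<pi>) d\<nu>\<close>, infinite unless \<open>\<nu> \<lless> \<pi>\<close>.  For probability measures the
  negative part of \<open>ln (d\<nu>/d\<pi>)\<close> is always \<open>\<nu>\<close>-integrable and the integral is nonnegative; so
  non-integrability means that the integral is \<open>\<infinity>\<close>, and \<open>ennreal\<close> truncates nothing.
\<close>

definition relative_entropy :: "'a measure \<Rightarrow> 'a measure \<Rightarrow> ennreal" where
  "relative_entropy \<nu> \<pi> =
     (if absolutely_continuous \<pi> \<nu> \<and> integrable \<nu> (entropy_density (exp 1) \<pi> \<nu>)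
      then ennreal (KL_divergence (exp 1) \<pi> \<nu>) else \<infinity>)"


section \<open>Standing assumptions\<close>

text \<open>\<open>|x|\<^sup>k\<close> for real \<open>k \<ge> 0\<close>, with \<open>0\<^sup>0 = 1\<close> (whereas \<open>0 powr 0 = 0\<close>).\<close>

definition abs_pow :: "real \<Rightarrow> real \<Rightarrow> real" where
  "abs_pow x k = (if k = 0 then 1 else \<bar>x\<bar> powr k)"

definition dx :: "(real \<Rightarrow> real \<Rightarrow> real \<Rightarrow> real) \<Rightarrow> real \<Rightarrow> real \<Rightarrow> real \<Rightarrow> real" where
  "dx f x \<omega> \<omega>' = deriv (\<lambda>y. f y \<omega> \<omega>') x"

text \<open>Borel measurability of \<open>f\<close> is needed for the integrals in \<open>\<beta>\<close> to make sense.\<close>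

definition interaction_assms :: "(real \<Rightarrow> real \<Rightarrow> real \<Rightarrow> real) \<Rightarrow> real \<Rightarrow> bool" where
  "interaction_assms f Cf \<longleftrightarrow>
     (\<lambda>(x, \<omega>, \<omega>'). f x \<omega> \<omega>') \<in> borel_measurable (borel :: (real \<times> real \<times> real) measure) \<and>
     (\<forall>x \<omega> \<omega>'. (\<lambda>y. f y \<omega> \<omega>') field_differentiable (at x)) \<and>
     (\<forall>x \<omega> \<omega>'. (\<lambda>y. dx f y \<omega> \<omega>') field_differentiable (at x)) \<and>
     (\<forall>\<omega> \<omega>'. continuous_on UNIV (\<lambda>x. dx (dx f) x \<omega> \<omega>')) \<and>
     (\<forall>x \<omega> \<omega>'. \<bar>f x \<omega> \<omega>'\<bar> \<le> Cf \<and> \<bar>dx f x \<omega> \<omega>'\<bar> \<le> Cf \<and> \<bar>dx (dx f) x \<omega> \<omega>'\<bar> \<le> Cf) \<and>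
     (\<forall>x \<omega> \<omega>'. f x \<omega> \<omega>' = f (- x) \<omega>' \<omega>)"

definition local_drift_assms :: "(real \<Rightarrow> real \<Rightarrow> real) \<Rightarrow> real \<Rightarrow> real \<Rightarrow> real \<Rightarrow> bool" where
  "local_drift_assms g Cg k1 k2 \<longleftrightarrow>
     Cg > 0 \<and> k1 \<ge> 0 \<and> k2 \<ge> 0 \<and>
     (\<forall>x \<omega>. \<bar>g x \<omega>\<bar> \<le> Cg * (1 + abs_pow \<omega> k1)) \<and>
     (\<forall>x \<omega> \<omega>'. \<bar>g x \<omega> - g x \<omega>'\<bar> \<le> Cg * \<bar>\<omega> - \<omega>'\<bar> * (1 + abs_pow \<omega> k2 + abs_pow \<omega>' k2)) \<and>
     (\<forall>x y \<omega>. \<bar>g x \<omega> - g y \<omega>\<bar> \<le> Cg * \<bar>x - y\<bar>)"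

text \<open>The logarithmic moment generating function \<open>\<ell>\<^sub>\<omega>(r)\<close>.\<close>

definition log_mgf :: "(real \<Rightarrow> real measure) \<Rightarrow> real \<Rightarrow> real \<Rightarrow> real" where
  "log_mgf \<gamma> \<omega> r = ln (\<integral>x. exp (r * \<bar>x\<bar>) \<partial>\<gamma> \<omega>)"

definition initial_assms :: "(real \<Rightarrow> real measure) \<Rightarrow> real \<Rightarrow> bool" where
  "initial_assms \<gamma> \<tau> \<longleftrightarrow>
     (\<forall>\<omega>. \<gamma> \<omega> \<in> space (prob_algebra borel)) \<and>
     (\<forall>\<phi> :: real \<Rightarrow> real. continuous_on UNIV \<phi> \<longrightarrow> bounded (range \<phi>) \<longrightarrow>
        continuous_on UNIV (\<lambda>\<omega>. \<integral>x. \<phi> x \<partial>\<gamma> \<omega>)) \<and>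
     (\<forall>\<omega> r. integrable (\<gamma> \<omega>) (\<lambda>x. exp (r * \<bar>x\<bar>))) \<and>
     \<tau> \<ge> 0 \<and>
     (\<forall>r. \<exists>C. \<forall>\<omega>. log_mgf \<gamma> \<omega> r \<le> C * (1 + abs_pow \<omega> \<tau>))"

definition empirical_measure :: "(nat \<Rightarrow> real) \<Rightarrow> nat \<Rightarrow> real measure" where
  "empirical_measure w N = distr (uniform_count_measure {1..N}) borel w"

text \<open>
  The disorder sequence is \<open>w 1, w 2, \<dots>\<close>; \<open>w 0\<close> plays no role.  The absolute value in the moment
  condition on \<open>\<ell>\<close> matters only for \<open>r < 0\<close>, where \<open>\<ell>\<^sub>\<omega>(r) \<le> 0\<close>.
\<close>

definition disorder_assms ::
  "(real \<Rightarrow> real measure) \<Rightarrow> real \<Rightarrow> real \<Rightarrow> real \<Rightarrow> (nat \<Rightarrow> real) \<Rightarrow> real measure \<Rightarrow> real \<Rightarrow> real \<Rightarrow> bool"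
where
  "disorder_assms \<gamma> \<tau> k1 k2 w \<mu> p \<iota> \<longleftrightarrow>
     \<mu> \<in> space (prob_algebra borel) \<and>
     weak_conv_m (empirical_measure w) \<mu> \<and>
     p > 1 \<and>
     (\<forall>r. integrable \<mu> (\<lambda>\<omega>. \<bar>log_mgf \<gamma> \<omega> r\<bar> powr p) \<and>
          (\<lambda>N. (\<Sum>i=1..N. \<bar>log_mgf \<gamma> (w i) r\<bar> powr p) / real N)
             \<longlonglongrightarrow> (\<integral>\<omega>. \<bar>log_mgf \<gamma> \<omega> r\<bar> powr p \<partial>\<mu>)) \<and>
     \<iota> > k1 \<and> \<iota> > \<tau> \<and> \<iota> \<ge> k2 + 1 \<and>
     integrable \<mu> (\<lambda>\<omega>. \<bar>\<omega>\<bar> powr \<iota>) \<and>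
     (\<lambda>N. (\<Sum>i=1..N. \<bar>w i\<bar> powr \<iota>) / real N) \<longlonglongrightarrow> (\<integral>\<omega>. \<bar>\<omega>\<bar> powr \<iota> \<partial>\<mu>)"


section \<open>Strong solutions and their laws\<close>

definition brownian_motion :: "real \<Rightarrow> 'a measure \<Rightarrow> (real \<Rightarrow> 'a \<Rightarrow> real) \<Rightarrow> bool" where
  "brownian_motion T M b \<longleftrightarrow>
     prob_space M \<and>
     (\<forall>t\<in>{0..T}. b t \<in> borel_measurable M) \<and>
     (\<forall>z\<in>space M. b 0 z = 0 \<and> continuous_on {0..T} (\<lambda>t. b t z)) \<and>
     (\<forall>s t. 0 \<le> s \<and> s < t \<and> t \<le> T \<longrightarrow>
        distributed M lborel (\<lambda>z. b t z - b s z) (normal_density 0 (sqrt (t - s)))) \<and>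
     (\<forall>(n::nat) (\<theta> :: nat \<Rightarrow> real). mono \<theta> \<and> range \<theta> \<subseteq> {0..T} \<longrightarrow>
        prob_space.indep_vars M (\<lambda>_. borel) (\<lambda>i z. b (\<theta> (Suc i)) z - b (\<theta> i) z) {..<n})"

text \<open>The sigma-algebra generated by \<open>\<xi>\<close>, \<open>(b\<^sub>s)\<close> for \<open>s \<le> t\<close>, and the null sets.\<close>

definition augmented_filtration ::
  "'a measure \<Rightarrow> ('a \<Rightarrow> real) \<Rightarrow> (real \<Rightarrow> 'a \<Rightarrow> real) \<Rightarrow> real \<Rightarrow> 'a measure" where
  "augmented_filtration M \<xi> b t = sigma (space M)
     ({\<xi> -` A \<inter> space M | A. A \<in> sets borel} \<union>
      {b s -` A \<inter> space M | s A. s \<in> {0..t} \<and> A \<in> sets borel} \<union>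
      null_sets M)"

text \<open>
  \<open>x\<close> is a strong solution on \<open>[0,T]\<close> of \<open>dx\<^sub>t = drift t x\<^sub>t dt + db\<^sub>t\<close>, \<open>x\<^sub>0 = \<xi>\<close>, driven by the Brownian
  motion \<open>b\<close>, with \<open>\<xi>\<close> of law \<open>\<rho>\<close> independent of \<open>b\<close>.
\<close>

definition strong_solution ::
  "real \<Rightarrow> (real \<Rightarrow> real \<Rightarrow> real) \<Rightarrow> real measure \<Rightarrow>
   'a measure \<Rightarrow> ('a \<Rightarrow> real) \<Rightarrow> (real \<Rightarrow> 'a \<Rightarrow> real) \<Rightarrow> (real \<Rightarrow> 'a \<Rightarrow> real) \<Rightarrow> bool" where
  "strong_solution T drift \<rho> M \<xi> b x \<longleftrightarrow>
     brownian_motion T M b \<and>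
     \<xi> \<in> borel_measurable M \<and> distr M borel \<xi> = \<rho> \<and>
     prob_space.indep_set M
       {\<xi> -` A \<inter> space M | A. A \<in> sets borel}
       {(\<lambda>z. \<lambda>t\<in>{0..T}. b t z) -` A \<inter> space M | A. A \<in> sets (PiM {0..T} (\<lambda>_. borel))} \<and>
     (\<forall>t\<in>{0..T}. x t \<in> borel_measurable (augmented_filtration M \<xi> b t)) \<and>
     (\<forall>z\<in>space M. continuous_on {0..T} (\<lambda>t. x t z)) \<and>
     (AE z in M. set_integrable lborel {0..T} (\<lambda>s. drift s (x s z)) \<and>
        (\<forall>t\<in>{0..T}. x t z = \<xi> z + (LBINT s:{0..t}. drift s (x s z)) + b t z))"

text \<open>
  The law on path space of the strong solution.  The sample space type \<open>real \<times> (real \<Rightarrow> real)\<close> is no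
  restriction: a strong solution is a function of the pair \<open>(\<xi>, b)\<close>.
\<close>

definition sde_law ::
  "real \<Rightarrow> (real \<Rightarrow> real \<Rightarrow> real) \<Rightarrow> real measure \<Rightarrow> (real \<Rightarrow> real) measure" where
  "sde_law T drift \<rho> =
     (THE P. \<exists>(M :: (real \<times> (real \<Rightarrow> real)) measure) \<xi> b x.
        strong_solution T drift \<rho> M \<xi> b x \<and>
        P = distr M (path_space T) (\<lambda>z. \<lambda>t\<in>{0..T}. x t z))"


section \<open>The rate function\<close>

definition mean_field_drift ::
  "(real \<Rightarrow> real \<Rightarrow> real \<Rightarrow> real) \<Rightarrow> (real \<times> real) measure \<Rightarrow> real \<Rightarrow> real \<Rightarrow> real" where
  "mean_field_drift f q \<omega> x = - (\<integral>(x', \<omega>'). dx f (x - x') \<omega> \<omega>' \<partial>q)"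

text \<open>
  \<open>path_law\<close> is \<open>P\<^sup>\<lambda>\<^sup>,\<^sup>\<omega>\<close> and \<open>path_law_joint\<close> is \<open>P\<^sup>\<lambda>\<^sub>\<mu>\<close>, as functions of the flow \<open>q t = \<lambda>\<^sub>t\<close>, through which
  alone they depend on \<open>\<lambda>\<close>.
\<close>

definition path_law ::
  "real \<Rightarrow> (real \<Rightarrow> real \<Rightarrow> real \<Rightarrow> real) \<Rightarrow> (real \<Rightarrow> real \<Rightarrow> real) \<Rightarrow> (real \<Rightarrow> real measure) \<Rightarrow>
   (real \<Rightarrow> (real \<times> real) measure) \<Rightarrow> real \<Rightarrow> (real \<Rightarrow> real) measure" where
  "path_law T f g \<gamma> q \<omega> =
     sde_law T (\<lambda>t x. mean_field_drift f (q t) \<omega> x + g x \<omega>) (\<gamma> \<omega>)"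

definition path_law_joint ::
  "real \<Rightarrow> (real \<Rightarrow> real \<Rightarrow> real \<Rightarrow> real) \<Rightarrow> (real \<Rightarrow> real \<Rightarrow> real) \<Rightarrow> (real \<Rightarrow> real measure) \<Rightarrow>
   real measure \<Rightarrow> (real \<Rightarrow> (real \<times> real) measure) \<Rightarrow> ((real \<Rightarrow> real) \<times> real) measure" where
  "path_law_joint T f g \<gamma> \<mu> q = semidirect (path_space T) \<mu> (path_law T f g \<gamma> q)"

definition rate_function ::
  "real \<Rightarrow> (real \<Rightarrow> real \<Rightarrow> real \<Rightarrow> real) \<Rightarrow> (real \<Rightarrow> real \<Rightarrow> real) \<Rightarrow> (real \<Rightarrow> real measure) \<Rightarrow>
   real measure \<Rightarrow> ((real \<Rightarrow> real) \<times> real) measure \<Rightarrow> ennreal" where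
  "rate_function T f g \<gamma> \<mu> lam =
     (if second_marginal lam = \<mu>
      then relative_entropy lam (path_law_joint T f g \<gamma> \<mu> (time_marginal lam))
      else \<infinity>)"


section \<open>The McKean--Vlasov equation\<close>

definition test_function :: "(real \<Rightarrow> real) \<Rightarrow> bool" where
  "test_function \<phi> \<longleftrightarrow>
     (\<forall>n x. (deriv ^^ n) \<phi> field_differentiable (at x)) \<and>
     (\<exists>R. \<forall>x. \<bar>x\<bar> > R \<longrightarrow> \<phi> x = 0)"

text \<open>The flow \<open>t \<mapsto> \<nu>\<^sub>t\<^sup>\<omega>(dx) \<mu>(d\<omega>)\<close> that couples the equations for the different \<open>\<omega>\<close>.\<close>

definition joint_flow ::
  "real measure \<Rightarrow> (real \<Rightarrow> real \<Rightarrow> real measure) \<Rightarrow> real \<Rightarrow> (real \<times> real) measure" where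
  "joint_flow \<mu> \<nu> t = semidirect borel \<mu> (\<lambda>\<omega>. \<nu> \<omega> t)"

text \<open>
  Weak solutions \<open>\<nu> \<omega> t = \<nu>\<^sub>t\<^sup>\<omega>\<close> of the coupled system: measurable in \<open>\<omega>\<close>, weakly continuous in \<open>t\<close>, and
  satisfying the equation integrated over \<open>[0,t]\<close> and tested against smooth compactly supported \<open>\<phi>\<close>,
  that is, with the formal adjoint \<open>\<phi>''/2 + (\<beta> + g) \<phi>'\<close> of \<open>\<L>\<^sup>\<omega>\<close>.
\<close>

definition mckean_vlasov_weak_solution ::
  "real \<Rightarrow> (real \<Rightarrow> real \<Rightarrow> real \<Rightarrow> real) \<Rightarrow> (real \<Rightarrow> real \<Rightarrow> real) \<Rightarrow> (real \<Rightarrow> real measure) \<Rightarrow>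
   real measure \<Rightarrow> (real \<Rightarrow> real \<Rightarrow> real measure) \<Rightarrow> bool" where
  "mckean_vlasov_weak_solution T f g \<gamma> \<mu> \<nu> \<longleftrightarrow>
     (\<forall>t\<in>{0..T}. (\<lambda>\<omega>. \<nu> \<omega> t) \<in> borel \<rightarrow>\<^sub>M prob_algebra borel) \<and>
     (AE \<omega> in \<mu>.
        (\<forall>\<phi> :: real \<Rightarrow> real. continuous_on UNIV \<phi> \<longrightarrow> bounded (range \<phi>) \<longrightarrow>
           continuous_on {0..T} (\<lambda>t. \<integral>x. \<phi> x \<partial>\<nu> \<omega> t)) \<and>
        \<nu> \<omega> 0 = \<gamma> \<omega> \<and>
        (\<forall>\<phi>. test_function \<phi> \<longrightarrow> (\<forall>t\<in>{0..T}.
           (\<integral>x. \<phi> x \<partial>\<nu> \<omega> t) = (\<integral>x. \<phi> x \<partial>\<nu> \<omega> 0) +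
             (LBINT s:{0..t}. (\<integral>x. deriv (deriv \<phi>) x / 2 +
                (mean_field_drift f (joint_flow \<mu> \<nu> s) \<omega> x + g x \<omega>) * deriv \<phi> x \<partial>\<nu> \<omega> s)))))"

definition unique_mckean_vlasov_weak_solution ::
  "real \<Rightarrow> (real \<Rightarrow> real \<Rightarrow> real \<Rightarrow> real) \<Rightarrow> (real \<Rightarrow> real \<Rightarrow> real) \<Rightarrow> (real \<Rightarrow> real measure) \<Rightarrow>
   real measure \<Rightarrow> (real \<Rightarrow> real \<Rightarrow> real measure) \<Rightarrow> bool" where
  "unique_mckean_vlasov_weak_solution T f g \<gamma> \<mu> \<nu> \<longleftrightarrow>
     mckean_vlasov_weak_solution T f g \<gamma> \<mu> \<nu> \<and>
     (\<forall>\<nu>'. mckean_vlasov_weak_solution T f g \<gamma> \<mu> \<nu>' \<longrightarrow>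
        (AE \<omega> in \<mu>. \<forall>t\<in>{0..T}. \<nu>' \<omega> t = \<nu> \<omega> t))"

end

theory Submission
  imports Defs "HOL-Computational_Algebra.Polynomial"
begin

text \<open>
  The noise is additive, so the strong solution is a deterministic functional of initial value and
  Brownian path, and for each \<open>\<omega>\<close> the path law is a measurable kernel in \<open>\<omega>\<close>.  By the chain rule the
  relative entropy of two semidirect products is the averaged relative entropy of the kernels, and it
  vanishes only if they agree: \<open>\<G>(\<lambda>) = 0\<close> means that \<open>\<lambda>\<close> is the path law driven by its own flow.  Such a
  fixed point is a fixed point of a map on drift fields \<open>\<beta>(\<omega>,t,x)\<close> which, by Gronwall, contracts the
  norm \<open>sup e\<^sup>-\<^sup>\<kappa>\<^sup>t |\<beta>|\<close> by a factor \<open>1/2\<close>; hence existence and uniqueness.  A weak solution of the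
  McKean-Vlasov equation solves a linear Fokker-Planck equation with its own drift frozen; since linear
  solutions are unique (Duhamel's formula and the gradient bound \<open>|\<partial>\<^sub>xP\<^sub>t\<phi>| \<le> sup|\<phi>| / \<surd>t\<close> of the heat
  semigroup), it consists of the marginals of the path law with this drift, which therefore is the
  fixed point.
\<close>

section \<open>Path space\<close>

text \<open>Two obstacles shape the proof. First, \<open>g\<close> may grow in \<omega>, and
  \<open>f\<close> is only measurable in its disorder arguments. Measures on path space offer no
  norm that is uniform in \<omega>, but interaction fields do: they are bounded and Lipschitz in x
  by \<open>Cf\<close> for every \<omega>, and stable under uniform limits, while \<open>g\<close>
  is common to both drifts, cancels in differences and contributes only its Lipschitz constant
  \<open>Cg\<close>. With weight rate \<open>L + (2 * Cf + 2)\<close>, where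
  \<open>L = Cf + Cg\<close>, the contraction factor is \<open>Cf / (2 * Cf + 2)\<close>. Second,
  for fixed \<omega> the drift is bounded but only Lipschitz in x and continuous in t, so the
  backward equation with this drift need not supply smooth test functions. The heat semigroup does,
  and the drift enters as a perturbation, on time intervals so short that the singularity of the
  gradient integrates to a small factor. No stochastic integral occurs: the weak equation for path
  laws follows from Taylor expansion over small time steps and independence of increments.\<close>

definition paths :: "real => (real => real) set" where
 "paths T = {x \<in> extensional {0..T}. continuous_on {0..T} x}"

lemma mspace_path_metric: "mspace (path_metric T) = paths T" unfolding path_metric_def paths_def
 by (subst compactin_mspace_cfunspace) (auto simp: compactin_subtopology)

lemma mdist_path_metric_less:
 assumes "0 < T" "x \<in> paths T" "y \<in> paths T" "mdist (path_metric T) x y < e" "t \<in> {0..T}"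
 shows "\<bar>x t - y t\<bar> < e" using cfunspace_mdist_lt[of "top_of_set {0..T}" x euclidean_metric y e t] assms
 unfolding mspace_path_metric[symmetric] path_metric_def
 by (auto simp: compactin_subtopology dist_real_def simp del: mspace_cfunspace)

lemma mdist_path_metric_le:
 assumes "0 \<le> e" "!!t. t \<in> {0..T} ==> \<bar>x t - y t\<bar> \<le> e"
 shows "mdist (path_metric T) x y \<le> e"
 unfolding path_metric_def by (rule mdist_cfunspace_le) (use assms in \<open>auto simp: dist_real_def\<close>)

lemma openin_path_metric:
 "openin (mtopology_of (path_metric T)) U \<longleftrightarrow>
  U \<subseteq> paths T \<and> (\<forall>x\<in>U. \<exists>e>0. \<forall>y\<in>paths T. mdist (path_metric T) x y < e --> y \<in> U)"
proof -
 interpret M: Metric_space "mspace (path_metric T)" "mdist (path_metric T)" by simp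
 have eq: "M.mball x r \<subseteq> U \<longleftrightarrow> (\<forall>y\<in>paths T. mdist (path_metric T) x y < r --> y \<in> U)"
  if "x \<in> paths T" for x r using that unfolding mspace_path_metric[symmetric] by (auto simp: M.in_mball)
 show ?thesis
 proof (cases "U \<subseteq> paths T")
  case True
  then have "(\<exists>r>0. M.mball x r \<subseteq> U) \<longleftrightarrow> (\<exists>r>0. \<forall>y\<in>paths T. mdist (path_metric T) x y < r --> y \<in> U)"
   if "x \<in> U" for x using eq that by (simp add: subset_iff)
  then show ?thesis
   using True unfolding mtopology_of_def M.openin_mtopology by (simp add: Ball_def mspace_path_metric)
 next
  case False
  then show ?thesis unfolding mtopology_of_def M.openin_mtopology by (simp add: mspace_path_metric)
 qed
qed

lemma space_path_space: "space (path_space T) = paths T" unfolding path_space_def using openin_path_metric[of T]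
 by (subst space_measure_of) (auto simp: mspace_path_metric)

lemma sets_path_space:
 "sets (path_space T) = sigma_sets (paths T) {U. openin (mtopology_of (path_metric T)) U}"
 unfolding path_space_def using openin_path_metric[of T] by (subst sets_measure_of) (auto simp: mspace_path_metric)

lemma measurable_path_eval_Icc:
 assumes T: "0 < T" and t: "t \<in> {0..T}"
 shows "(%x. x t) \<in> borel_measurable (path_space T)"
proof (rule borel_measurableI)
 fix V :: "real set" assume V: "open V"
 have "openin (mtopology_of (path_metric T)) ((%x. x t) -` V \<inter> paths T)" unfolding openin_path_metric
 proof (intro conjI ballI)
  fix x assume x: "x \<in> (%x. x t) -` V \<inter> paths T"
  then obtain e where e: "e > 0" "!!y. \<bar>y - x t\<bar> < e ==> y \<in> V"
   using V by (auto simp: open_dist dist_real_def)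
  show "\<exists>e>0. \<forall>y\<in>paths T. mdist (path_metric T) x y < e --> y \<in> (%x. x t) -` V \<inter> paths T"
   using e x mdist_path_metric_less[OF T _ _ _ t, of x] by (intro exI[of _ e]) (auto simp: abs_minus_commute)
 qed auto
 then show "(%x. x t) -` V \<inter> space (path_space T) \<in> sets (path_space T)"
  by (auto simp: space_path_space sets_path_space intro: sigma_sets.Basic)
qed

lemma measurable_path_eval:
 assumes "0 < T" shows "(%x. x t) \<in> borel_measurable (path_space T)"
proof (cases "t \<in> {0..T}")
 case False
 then have "x t = undefined" if "x \<in> space (path_space T)" for x
  using that by (auto simp: space_path_space paths_def extensional_def)
 then show ?thesis using measurable_cong[of "path_space T" "%x. x t" "%_. undefined" borel] by simp
qed (use measurable_path_eval_Icc assms in auto)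

section \<open>Countable generation of the Borel sets of path space\<close>

definition rat_poly :: "rat list => real => real" where
 "rat_poly l t = (\<Sum>i<length l. real_of_rat (l ! i) * t ^ i)"

lemma rat_poly_dense:
 assumes T: "0 < T" and x: "continuous_on {0..T} x" and e: "0 < e"
 shows "\<exists>l. \<forall>t\<in>{0..T}. \<bar>x t - rat_poly l t\<bar> < e"
proof -
 obtain p where p: "real_polynomial_function p" "!!t. t \<in> {0..T} ==> \<bar>x t - p t\<bar> < e/2"
  using Stone_Weierstrass_real_polynomial_function[of "{0..T}" x "e/2"] x e by auto
 then obtain a n where pa: "p = (%t. \<Sum>i\<le>n. a i * t ^ i)"
  using real_polynomial_function_iff_sum by metis
 \<comment> \<open>The sum bounds the sum of powers of any t in [0,T], so replacing each coefficient
   by a rational within e/(2c) moves the polynomial by at most e/2. The summand 1 makes c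
   positive.\<close>
 define c where "c = (\<Sum>i\<le>n. T ^ i) + 1"
 have c: "c > 0" using T by (auto simp: c_def intro!: add_nonneg_pos sum_nonneg)
 have "\<exists>q. \<bar>a i - real_of_rat q\<bar> < e / (2 * c)" for i
 proof -
  have "a i < a i + e / (2*c)" using e c by simp
  then obtain q where "a i < real_of_rat q" "real_of_rat q < a i + e / (2*c)" using of_rat_dense by blast
  then show ?thesis by (intro exI[of _ q]) auto
 qed
 then obtain q where q: "!!i. \<bar>a i - real_of_rat (q i)\<bar> < e / (2 * c)" by metis
 define l where "l = map q [0..<Suc n]"
 have "\<bar>x t - rat_poly l t\<bar> < e" if t: "t \<in> {0..T}" for t
 proof -
  have "rat_poly l t = (\<Sum>i\<le>n. real_of_rat (q i) * t ^ i)"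
   unfolding rat_poly_def l_def by (simp add: lessThan_Suc_atMost del: upt_Suc)
  then have "\<bar>p t - rat_poly l t\<bar> = \<bar>\<Sum>i\<le>n. (a i - real_of_rat (q i)) * t ^ i\<bar>"
   by (simp add: pa sum_subtractf left_diff_distrib)
  also have "\<dots> \<le> (\<Sum>i\<le>n. \<bar>(a i - real_of_rat (q i)) * t ^ i\<bar>)" by (rule sum_abs)
  also have "\<dots> \<le> (\<Sum>i\<le>n. e / (2 * c) * T ^ i)" using t e c T unfolding abs_mult power_abs
   by (intro sum_mono mult_mono less_imp_le[OF q] power_mono) auto
  also have "\<dots> = e / (2 * c) * (c - 1)" by (simp add: c_def sum_distrib_left)
  also have "\<dots> \<le> e / 2" using c e by (simp add: field_simps)
  finally show ?thesis using p(2)[OF t] by linarith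
 qed
 then show ?thesis by blast
qed

lemma continuous_le_rational:
 assumes T: "0 < T" and h: "continuous_on {0..T} (h::real=>real)"
  and le: "!!t. t \<in> {0..T} \<inter> \<rat> ==> \<bar>h t\<bar> \<le> r" and t: "t \<in> {0..T}"
 shows "\<bar>h t\<bar> \<le> r"
proof (rule ccontr)
 assume "\<not> \<bar>h t\<bar> \<le> r"
 then have "0 < \<bar>h t\<bar> - r" by simp
 with h t obtain d where d: "d > 0" "!!s. s \<in> {0..T} ==> \<bar>s - t\<bar> < d ==> \<bar>h s - h t\<bar> < \<bar>h t\<bar> - r"
  unfolding continuous_on_iff dist_real_def by (metis abs_minus_commute)
 have "max 0 (t - d) < min T (t + d)" using T t d by auto
 then obtain s where s: "s \<in> \<rat>" "max 0 (t - d) < s" "s < min T (t + d)" using Rats_dense_in_real by blast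
 then have "\<bar>h s\<bar> \<le> r" "\<bar>h s - h t\<bar> < \<bar>h t\<bar> - r" using le[of s] d(2)[of s] by auto
 then show False by linarith
qed

text \<open>Closed sup-norm balls of radius 1/(n+1) about rational polynomials. Testing rational
  times only makes each ball a countable intersection of coordinate conditions; by continuity this
  equals testing all times.\<close>

definition path_tube :: "real => rat list \<times> nat => (real => real) set" where
 "path_tube T = (%(l, n). {x \<in> paths T. \<forall>t\<in>{0..T} \<inter> \<rat>. \<bar>x t - rat_poly l t\<bar> \<le> 1 / Suc n})"

lemma continuous_rat_poly: "continuous_on A (rat_poly l)" unfolding rat_poly_def by (intro continuous_intros)

text \<open>A rational polynomial closer than 1/(n+1) to x puts x into its tube, and every path in
  that tube is within 2/(n+1) of x. As the tubes are countably many, this reduces the Borel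
  sigma-algebra to coordinate evaluations.\<close>

lemma open_eq_Union_path_tubes:
 assumes T: "0 < T" and U: "openin (mtopology_of (path_metric T)) U"
 shows "U = \<Union>(path_tube T ` {k. path_tube T k \<subseteq> U})"
proof safe
 fix x assume x: "x \<in> U"
 with U obtain e where e: "e > 0" "!!y. y \<in> paths T ==> mdist (path_metric T) x y < e ==> y \<in> U"
  and xT: "x \<in> paths T" unfolding openin_path_metric by blast
 obtain n where n: "1 / Suc n < e / 3" using e(1) nat_approx_posE[of "e/3"] by auto
 obtain l where l: "!!t. t \<in> {0..T} ==> \<bar>x t - rat_poly l t\<bar> < 1 / Suc n"
  using rat_poly_dense[OF T, of x "1 / Suc n"] xT by (auto simp: paths_def simp del: of_nat_Suc atLeastAtMost_iff)
 have "path_tube T (l, n) \<subseteq> U"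
 proof
  fix y assume y: "y \<in> path_tube T (l, n)"
  then have yT: "y \<in> paths T" by (simp add: path_tube_def)
  have "\<bar>x t - y t\<bar> \<le> 2 / Suc n" if t: "t \<in> {0..T}" for t
  proof -
   have "\<bar>y t - rat_poly l t\<bar> \<le> 1 / Suc n"
    by (rule continuous_le_rational[OF T _ _ t, of "%t. y t - rat_poly l t"])
     (use y yT in \<open>auto simp: path_tube_def paths_def intro!: continuous_intros continuous_rat_poly\<close>)
   then have "\<bar>x t - y t\<bar> \<le> 1 / Suc n + 1 / Suc n" using l[OF t] by linarith
   then show ?thesis by simp
  qed
  then have "mdist (path_metric T) x y \<le> 2 / Suc n" by (intro mdist_path_metric_le) auto
  also have "\<dots> < e" using n e(1) by (simp add: field_simps)
  finally show "y \<in> U" using e yT by auto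
 qed
 moreover have "x \<in> path_tube T (l, n)" using l xT by (auto simp: path_tube_def intro: less_imp_le)
 ultimately show "x \<in> \<Union>(path_tube T ` {k. path_tube T k \<subseteq> U})" by blast
qed auto

lemma path_tube_in_sets:
 assumes T: "0 < T" and M: "space M = paths T" "!!t. t \<in> {0..T} ==> (%x. x t) \<in> borel_measurable M"
 shows "path_tube T k \<in> sets M"
proof -
 have "path_tube T k = {x \<in> space M. \<forall>q. real_of_rat q \<in> {0..T} -->
   \<bar>x (real_of_rat q) - rat_poly (fst k) (real_of_rat q)\<bar> \<le> 1 / Suc (snd k)}"
  by (auto simp: path_tube_def M Rats_def split: prod.split)
 also have "\<dots> \<in> sets M"
 proof (rule sets.sets_Collect_countable_All)
  fix q
  show "{x \<in> space M. real_of_rat q \<in> {0..T} -->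
   \<bar>x (real_of_rat q) - rat_poly (fst k) (real_of_rat q)\<bar> \<le> 1 / Suc (snd k)} \<in> sets M"
  proof (cases "real_of_rat q \<in> {0..T}")
   case True
   then have "(%x. x (real_of_rat q)) \<in> borel_measurable M" using M by auto
   then have "(%x. \<bar>x (real_of_rat q) - rat_poly (fst k) (real_of_rat q)\<bar>) \<in> borel_measurable M"
    by (intro borel_measurable_abs borel_measurable_diff borel_measurable_const)
   then have "{x \<in> space M. \<bar>x (real_of_rat q) - rat_poly (fst k) (real_of_rat q)\<bar> \<le> 1 / Suc (snd k)} \<in> sets M"
    by (rule borel_measurable_le[OF _ borel_measurable_const])
   then show ?thesis by (simp only: True simp_thms)
  next
   case False
   then show ?thesis by (simp only: False simp_thms Collect_mem_eq sets.top)
  qed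
 qed
 finally show ?thesis .
qed

lemma sets_path_space_subset:
 assumes T: "0 < T" and M: "space M = paths T" "!!k. path_tube T k \<in> sets M"
 shows "sets (path_space T) \<subseteq> sets M" unfolding sets_path_space M(1)[symmetric]
proof (rule sets.sigma_sets_subset, safe)
 fix U assume U: "openin (mtopology_of (path_metric T)) U"
 show "U \<in> sets M" by (subst open_eq_Union_path_tubes[OF T U], rule sets.countable_Union) (use M in auto)
qed

text \<open>Every Borel set of paths is the trace on \<open>paths T\<close> of a set in the product
  sigma-algebra, and for maps into the product coordinatewise measurability is enough. This
  criterion is behind all path-valued random variables below.\<close>

lemma measurable_path_spaceI:
 assumes T: "0 < T" and f: "!!z. z \<in> space M ==> f z \<in> paths T"
  and m: "!!t. t \<in> {0..T} ==> (%z. f z t) \<in> borel_measurable M"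
 shows "f \<in> M \<rightarrow>\<^sub>M path_space T"
proof (rule measurable_sigma_sets[where A="{U. openin (mtopology_of (path_metric T)) U}" and \<Omega>="paths T"])
 fix U assume U: "U \<in> {U. openin (mtopology_of (path_metric T)) U}"
 have "sets (path_space T) \<subseteq> sets (vimage_algebra (paths T) (%x. x) (PiM {0..T} (%_. borel)))"
  (is "_ \<subseteq> sets ?V")
 proof (rule sets_path_space_subset[OF T])
  have id: "(%x. x) \<in> paths T \<rightarrow> space (PiM {0..T} (%_. borel))"
   by (auto simp: space_PiM paths_def PiE_def)
  show "path_tube T k \<in> sets ?V" for k
  proof (rule path_tube_in_sets[OF T])
   fix t assume "t \<in> {0..T}"
   then show "(%x. x t) \<in> borel_measurable ?V"
    by (intro measurable_compose[OF measurable_vimage_algebra1[OF id]] measurable_component_singleton)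
  qed simp
 qed simp
 then have "U \<in> sets ?V" using U by (auto simp: sets_path_space intro: sigma_sets.Basic)
 then obtain B where B: "B \<in> sets (PiM {0..T} (%_. borel))" "U = B \<inter> paths T"
  by (subst (asm) sets_vimage_algebra2) (auto simp: space_PiM paths_def PiE_def)
 have f': "(%z. restrict (f z) {0..T}) \<in> M \<rightarrow>\<^sub>M PiM {0..T} (%_. borel)"
  by (intro measurable_restrict m)
 have "restrict (f z) {0..T} = f z" if "z \<in> space M" for z
  using f[OF that] by (auto simp: paths_def extensional_restrict)
 then have "f \<in> M \<rightarrow>\<^sub>M PiM {0..T} (%_. borel)" by (rule iffD1[OF measurable_cong f'])
 then have "f -` B \<inter> space M \<in> sets M" using B(1) by (rule measurable_sets)
 also have "f -` B \<inter> space M = f -` U \<inter> space M" using B f by auto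
 finally show "f -` U \<inter> space M \<in> sets M" .
qed (use f openin_path_metric in \<open>auto simp: sets_path_space\<close>)

lemma measurable_path_space_PiM:
 assumes "0 < T" shows "(%x. x) \<in> path_space T \<rightarrow>\<^sub>M PiM {0..T} (%_. borel)"
 by (rule measurable_PiM_single')
  (use assms in \<open>auto simp: space_path_space paths_def extensional_def intro: measurable_path_eval\<close>)

text \<open>Links the two sigma-algebras in use: independence in \<open>strong_solution\<close>
  refers to the product sigma-algebra, path laws to the Borel sets of
  \<open>path_space T\<close>.\<close>

lemma sets_path_space_eq_PiM:
 assumes T: "0 < T" and A: "A \<in> sets (path_space T)"
 obtains B where "B \<in> sets (PiM {0..T} (%_. borel :: real measure))" "A = B \<inter> paths T"
proof -
 let ?V = "vimage_algebra (paths T) (%x. x) (PiM {0..T} (%_. borel :: real measure))"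
 have id: "(%x. x) \<in> paths T \<rightarrow> space (PiM {0..T} (%_. borel))"
  by (auto simp: space_PiM paths_def PiE_def)
 have "(%x. x) \<in> ?V \<rightarrow>\<^sub>M path_space T"
 proof (rule measurable_path_spaceI[OF T])
  fix t assume "t \<in> {0..T}"
  then show "(%x. x t) \<in> borel_measurable ?V"
   by (intro measurable_compose[OF measurable_vimage_algebra1[OF id]] measurable_component_singleton)
 qed simp
 from measurable_sets[OF this A] have "A \<in> sets ?V"
  using sets.sets_into_space[OF A] by (simp add: space_path_space Int_absorb2)
 then show ?thesis by (subst (asm) sets_vimage_algebra2) (use id that in auto)
qed

text \<open>Finite-dimensional distributions fix the image on the product space, and since Borel
  sets of paths are traces of product sets, nothing is lost on the way back.\<close>

lemma path_measure_eqI: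
 assumes T: "0 < T" and P: "prob_space P" "sets P = sets (path_space T)"
  and Q: "prob_space Q" "sets Q = sets (path_space T)"
  and eq: "!!J. finite J ==> J \<subseteq> {0..T} ==>
   distr P (PiM J (%_. borel)) (%x. restrict x J) = distr Q (PiM J (%_. borel)) (%x. restrict x J)"
 shows "P = Q"
proof -
 note [measurable] = measurable_path_space_PiM[OF T]
 have [measurable_cong]: "sets P = sets (path_space T)" "sets Q = sets (path_space T)" by fact+
 have sp: "space P = paths T" "space Q = paths T"
  using P(2) Q(2) by (auto dest!: sets_eq_imp_space_eq simp: space_path_space)
 let ?d = "%P. distr P (PiM {0..T} (%_. borel)) (%x. x)"
 interpret P: prob_space P by fact
 have dd: "distr (?d P) (PiM J (%_. borel)) (%x. restrict x J) =
   distr P (PiM J (%_. borel)) (%x. restrict x J)"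
  if "J \<subseteq> {0..T}" "sets P = sets (path_space T)" for J and P
 proof -
  have [measurable_cong]: "sets P = sets (path_space T)" by fact
  show ?thesis
   by (subst distr_distr) (use that in \<open>auto intro: measurable_restrict_subset simp: comp_def\<close>)
 qed
 have "?d P = ?d Q"
 proof (rule measure_eqI_PiM_infinite)
  fix J F assume J: "finite J" "J \<subseteq> {0..T}" and F: "!!i. i \<in> J ==> F i \<in> sets (borel::real measure)"
  have "emeasure (?d R) (prod_emb {0..T} (%_. borel) J (Pi\<^sub>E J F)) =
    emeasure (distr (?d R) (PiM J (%_. borel)) (%x. restrict x J)) (Pi\<^sub>E J F)" for R
  proof -
   have m: "(%x. restrict x J) \<in> ?d R \<rightarrow>\<^sub>M PiM J (%_. borel)"
    using J by (simp add: measurable_restrict_subset)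
   show ?thesis using J F by (subst emeasure_distr[OF m])
     (auto simp: prod_emb_def space_PiM intro!: sets_PiM_I_finite)
  qed
  then show "emeasure (?d P) (prod_emb {0..T} (%_. borel) J (Pi\<^sub>E J F)) =
    emeasure (?d Q) (prod_emb {0..T} (%_. borel) J (Pi\<^sub>E J F))"
   using dd[OF J(2) P(2)] dd[OF J(2) Q(2)] eq[OF J] by simp
 next
  show "finite_measure (?d P)" using P.prob_space_distr[of "%x. x"] by (simp add: prob_space_def)
 qed simp_all
 show "P = Q"
 proof (rule measure_eqI)
  fix A assume A: "A \<in> sets P"
  then obtain B where B: "B \<in> sets (PiM {0..T} (%_. borel))" "A = B \<inter> paths T"
   using sets_path_space_eq_PiM[OF T] P(2) by metis
  have "emeasure R A = emeasure (?d R) B" if "sets R = sets (path_space T)" "space R = paths T" for R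
  proof -
   have [measurable_cong]: "sets R = sets (path_space T)" by fact
   show ?thesis using B that by (subst emeasure_distr) auto
  qed
  then show "emeasure P A = emeasure Q A" using \<open>?d P = ?d Q\<close> P(2) Q(2) sp by simp
 next
  show "sets P = sets Q" by (simp only: P(2) Q(2))
 qed
qed

text \<open>Countability matters for kernels: if two of them agree almost surely on each set of a
  countable intersection-stable generator, a single null set serves all these sets, and they agree
  almost surely as measures.\<close>

lemma path_space_countable_generator:
 assumes T: "0 < T"
 obtains G where "countable G" "Int_stable G" "G \<subseteq> Pow (paths T)"
  "sets (path_space T) = sigma_sets (paths T) G"
proof -
 define G where "G = (%l. paths T \<inter> \<Inter>(path_tube T ` set l)) ` (UNIV :: (rat list \<times> nat) list set)"
 have G: "G \<subseteq> Pow (paths T)" by (auto simp: G_def)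
 have st: "Int_stable G" unfolding Int_stable_def
 proof safe
  fix a b assume "a \<in> G" "b \<in> G"
  then obtain l l' where "a = paths T \<inter> \<Inter>(path_tube T ` set l)" "b = paths T \<inter> \<Inter>(path_tube T ` set l')"
   by (auto simp: G_def)
  then have "a \<inter> b = paths T \<inter> \<Inter>(path_tube T ` set (l @ l'))" by auto
  then show "a \<inter> b \<in> G" unfolding G_def by blast
 qed
 have tube: "path_tube T k \<in> sets (path_space T)" for k
  by (rule path_tube_in_sets[OF T space_path_space measurable_path_eval[OF T]])
 have 1: "sets (path_space T) \<subseteq> sets (sigma (paths T) G)"
 proof (rule sets_path_space_subset[OF T])
  show "space (sigma (paths T) G) = paths T" using G by simp
  show "path_tube T k \<in> sets (sigma (paths T) G)" for k
  proof -
   have "path_tube T k = paths T \<inter> \<Inter>(path_tube T ` set [k])" by (cases k) (auto simp: path_tube_def)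
   then have "path_tube T k \<in> G" unfolding G_def by blast
   then show ?thesis using G by (simp add: sigma_sets.Basic)
  qed
 qed
 have 2: "sigma_sets (space (path_space T)) G \<subseteq> sets (path_space T)"
 proof (rule sets.sigma_sets_subset, safe)
  fix a assume "a \<in> G"
  then obtain l where "a = space (path_space T) \<inter> \<Inter>(path_tube T ` set l)"
   by (auto simp: G_def space_path_space)
  moreover have "space (path_space T) \<inter> \<Inter>(path_tube T ` set l) \<in> sets (path_space T)"
   by (cases "l = []") (auto intro!: sets.Int sets.finite_INT tube)
  ultimately show "a \<in> sets (path_space T)" by simp
 qed
 show ?thesis by (rule that[of G]) (use 1 2 G st in \<open>auto simp: G_def space_path_space\<close>)
qed

section \<open>Relative entropy and disintegration\<close>

text \<open>The integrand u ln u - u + 1 replaces u ln u: for a probability density both have the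
  same integral, but the former is nonnegative and vanishes only at u = 1, so it can be integrated
  iteratively without integrability conditions. Sign and equality case come from ln v \<le> v - 1 at
  v = 1/u.\<close>

lemma entropy_integrand_nonneg:
 assumes "0 \<le> (u::real)" shows "0 \<le> u * ln u - u + 1"
proof (cases "u = 0")
 case False
 then have "ln (1 / u) \<le> 1 / u - 1" using assms by (intro ln_le_minus_one) auto
 then have "u * (- ln u) \<le> u * (1 / u - 1)" using assms False by (intro mult_left_mono) (auto simp: ln_div)
 then show ?thesis using False by (simp add: algebra_simps)
qed simp

lemma entropy_integrand_eq_0:
 assumes "0 \<le> (u::real)" "u * ln u - u + 1 = 0" shows "u = 1"
proof -
 have u: "u \<noteq> 0" using assms by auto
 then have "u * (ln (1 / u) - (1 / u - 1)) = 0" using assms by (simp add: ln_div algebra_simps)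
 then have "ln (1 / u) = 1 / u - 1" using u by simp
 then show ?thesis using ln_eq_minus_one[of "1 / u"] assms u by simp
qed

lemma relative_entropy_density:
 assumes "prob_space \<pi>" and h[measurable]: "h \<in> borel_measurable \<pi>" and h0: "!!x. 0 \<le> h x"
  and "prob_space (density \<pi> (%x. ennreal (h x)))"
 shows "relative_entropy (density \<pi> (%x. ennreal (h x))) \<pi> = (\<integral>\<^sup>+x. ennreal (h x * ln (h x) - h x + 1) \<partial>\<pi>)"
proof -
 interpret P: prob_space \<pi> by fact
 interpret N: prob_space "density \<pi> (%x. ennreal (h x))" by fact
 let ?N = "density \<pi> (%x. ennreal (h x))"
 have ac: "absolutely_continuous \<pi> ?N" by (auto intro: absolutely_continuousI_density)
 have "(\<integral>\<^sup>+x. ennreal (h x) \<partial>\<pi>) = 1"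
  using N.emeasure_space_1 by (simp add: emeasure_density cong: nn_integral_cong)
 then have ih: "integrable \<pi> h" "integral\<^sup>L \<pi> h = 1"
  using h0 by (auto intro!: integrableI_nonneg simp: integral_eq_nn_integral)
 have RN: "AE x in \<pi>. RN_deriv \<pi> ?N x = ennreal (h x)"
  by (rule AE_mp[OF P.RN_deriv_unique[of "%x. ennreal (h x)" ?N]]) auto
 have "integrable ?N (entropy_density (exp 1) \<pi> ?N) \<longleftrightarrow> integrable \<pi> (%x. h x *\<^sub>R entropy_density (exp 1) \<pi> ?N x)"
  by (rule integrable_density) (auto simp: h0 entropy_density_def comp_def)
 also have "\<dots> \<longleftrightarrow> integrable \<pi> (%x. h x * ln (h x))"
  using RN by (intro integrable_cong_AE) (auto simp: entropy_density_def log_def h0)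
 finally have int: "integrable ?N (entropy_density (exp 1) \<pi> ?N) \<longleftrightarrow> integrable \<pi> (%x. h x * ln (h x))" .
 have KL: "KL_divergence (exp 1) \<pi> ?N = (\<integral>x. h x * ln (h x) \<partial>\<pi>)"
  using P.KL_density[of "exp 1" h] h h0 by (simp add: log_def)
 show ?thesis
 proof (cases "integrable \<pi> (%x. h x * ln (h x))")
  case True
  have i: "integrable \<pi> (%x. h x * ln (h x) - h x + 1)"
   using True ih by (intro Bochner_Integration.integrable_add Bochner_Integration.integrable_diff) auto
  have "(\<integral>\<^sup>+x. ennreal (h x * ln (h x) - h x + 1) \<partial>\<pi>) = ennreal (\<integral>x. h x * ln (h x) - h x + 1 \<partial>\<pi>)"
   by (rule nn_integral_eq_integral[OF i]) (auto simp: entropy_integrand_nonneg h0)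
  also have "(\<integral>x. h x * ln (h x) - h x + 1 \<partial>\<pi>) = (\<integral>x. h x * ln (h x) \<partial>\<pi>)"
   using True ih by (simp add: P.prob_space)
  finally show ?thesis using ac int True KL by (simp add: relative_entropy_def)
 next
  case False
  have "(\<integral>\<^sup>+x. ennreal (h x * ln (h x) - h x + 1) \<partial>\<pi>) = \<infinity>"
  \<comment> \<open>Were it finite, adding the integrable \<open>h - 1\<close> would make
    \<open>h ln h\<close> integrable.\<close>
  proof (rule ccontr)
   assume "\<not> ?thesis"
   then have "integrable \<pi> (%x. h x * ln (h x) - h x + 1)"
    by (intro integrableI_nonneg) (auto simp: entropy_integrand_nonneg h0 less_top)
   then have "integrable \<pi> (%x. (h x * ln (h x) - h x + 1) + h x - 1)"
    by (rule Bochner_Integration.integrable_diff[OF Bochner_Integration.integrable_add[OF _ ih(1)]]) simp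
   moreover have "(%x. (h x * ln (h x) - h x + 1) + h x - 1) = (%x. h x * ln (h x))" by auto
   ultimately show False using False by simp
  qed
  then show ?thesis using int False by (simp add: relative_entropy_def)
 qed
qed

lemma absolutely_continuous_real_density:
 assumes "prob_space \<pi>" "prob_space \<nu>" "sets \<nu> = sets \<pi>" "absolutely_continuous \<pi> \<nu>"
 obtains h :: "'a => real" where "h \<in> borel_measurable \<pi>" "!!x. 0 \<le> h x" "\<nu> = density \<pi> (%x. ennreal (h x))"
proof -
 interpret P: prob_space \<pi> by fact
 interpret N: prob_space \<nu> by fact
 obtain D where D: "D \<in> borel_measurable \<pi>" "AE x in \<pi>. RN_deriv \<pi> \<nu> x = ennreal (D x)" "!!x. 0 \<le> D x"
  using P.real_RN_deriv[of \<nu>] assms N.finite_measure_axioms by metis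
 have "\<nu> = density \<pi> (RN_deriv \<pi> \<nu>)" using assms by (simp add: P.density_RN_deriv)
 also have "\<dots> = density \<pi> (%x. ennreal (D x))" using D by (intro density_cong) auto
 finally show ?thesis using that D by blast
qed

lemma relative_entropy_eq_0_iff:
 assumes "prob_space \<pi>" "prob_space \<nu>" "sets \<nu> = sets \<pi>"
 shows "relative_entropy \<nu> \<pi> = 0 \<longleftrightarrow> \<nu> = \<pi>"
proof
 assume 0: "relative_entropy \<nu> \<pi> = 0"
 then have "absolutely_continuous \<pi> \<nu>" by (auto simp: relative_entropy_def split: if_splits)
 then obtain h where h: "h \<in> borel_measurable \<pi>" "!!x. 0 \<le> h x" "\<nu> = density \<pi> (%x. ennreal (h x))"
  using absolutely_continuous_real_density assms by metis
 have "(\<integral>\<^sup>+x. ennreal (h x * ln (h x) - h x + 1) \<partial>\<pi>) = 0"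
  using relative_entropy_density[of \<pi> h] h assms 0 by simp
 then have "AE x in \<pi>. ennreal (h x * ln (h x) - h x + 1) = 0" using h by (subst (asm) nn_integral_0_iff_AE) auto
 then have "AE x in \<pi>. h x = 1"
 proof (rule AE_mp, intro AE_I2 impI)
  fix x assume "ennreal (h x * ln (h x) - h x + 1) = 0"
  then show "h x = 1"
   using h(2)[of x] entropy_integrand_nonneg[of "h x"] by (intro entropy_integrand_eq_0) (auto simp: ennreal_eq_0_iff)
 qed
 then have "density \<pi> (%x. ennreal (h x)) = density \<pi> (%x. 1)" using h by (intro density_cong) auto
 then show "\<nu> = \<pi>" using h by (simp add: density_1)
next
 assume "\<nu> = \<pi>"
 then show "relative_entropy \<nu> \<pi> = 0"
  using relative_entropy_density[of \<pi> "%_. 1"] assms by (simp add: density_1)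
qed

section \<open>Semidirect products and the chain rule for relative entropy\<close>

lemma measurable_semidirect_kernel:
 assumes \<kappa>[measurable]: "\<kappa> \<in> borel \<rightarrow>\<^sub>M prob_algebra S"
 shows "(%\<omega>. distr (\<kappa> \<omega>) (S \<Otimes>\<^sub>M borel) (%x. (x, \<omega>))) \<in> borel \<rightarrow>\<^sub>M prob_algebra (S \<Otimes>\<^sub>M (borel :: real measure))"
 by measurable

lemma prob_algebraD:
 assumes "\<mu> \<in> space (prob_algebra M)"
 shows "prob_space \<mu>" "sets \<mu> = sets M" "space \<mu> = space M"
 using assms by (auto simp: space_prob_algebra dest: sets_eq_imp_space_eq)

lemma measurable_prob_algebraD':
 assumes "\<kappa> \<in> M \<rightarrow>\<^sub>M prob_algebra S" "x \<in> space M"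
 shows "prob_space (\<kappa> x)" "sets (\<kappa> x) = sets S" "space (\<kappa> x) = space S"
 using prob_algebraD[OF measurable_space[OF assms]] by auto

lemma semidirect_in_space:
 assumes "\<mu> \<in> space (prob_algebra borel)" and \<kappa>: "\<kappa> \<in> borel \<rightarrow>\<^sub>M prob_algebra S"
 shows "semidirect S \<mu> \<kappa> \<in> space (prob_algebra (S \<Otimes>\<^sub>M borel))"
 unfolding semidirect_def space_prob_algebra
 using prob_space_bind'[OF assms(1) measurable_semidirect_kernel[OF \<kappa>]]
  sets_bind'[OF assms(1) measurable_semidirect_kernel[OF \<kappa>]] by simp

lemma nn_integral_semidirect:
 assumes \<mu>: "\<mu> \<in> space (prob_algebra borel)" and \<kappa>: "\<kappa> \<in> borel \<rightarrow>\<^sub>M prob_algebra S"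
  and F: "F \<in> borel_measurable (S \<Otimes>\<^sub>M borel)"
 shows "(\<integral>\<^sup>+z. F z \<partial>semidirect S \<mu> \<kappa>) = (\<integral>\<^sup>+\<omega>. \<integral>\<^sup>+x. F (x, \<omega>) \<partial>\<kappa> \<omega> \<partial>\<mu>)"
proof -
 have s: "sets \<mu> = sets borel" using prob_algebraD[OF \<mu>] by simp
 have "(\<integral>\<^sup>+z. F z \<partial>semidirect S \<mu> \<kappa>) =
   (\<integral>\<^sup>+\<omega>. \<integral>\<^sup>+z. F z \<partial>distr (\<kappa> \<omega>) (S \<Otimes>\<^sub>M borel) (%x. (x, \<omega>)) \<partial>\<mu>)"
  unfolding semidirect_def by (rule nn_integral_bind[OF F])
   (use measurable_prob_algebraD[OF measurable_semidirect_kernel[OF \<kappa>]] s in \<open>simp cong: measurable_cong_sets\<close>)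
 also have "\<dots> = (\<integral>\<^sup>+\<omega>. \<integral>\<^sup>+x. F (x, \<omega>) \<partial>\<kappa> \<omega> \<partial>\<mu>)"
 proof (rule nn_integral_cong)
  fix \<omega>
  have [measurable_cong]: "sets (\<kappa> \<omega>) = sets S" using measurable_prob_algebraD'[OF \<kappa>] by simp
  show "(\<integral>\<^sup>+z. F z \<partial>distr (\<kappa> \<omega>) (S \<Otimes>\<^sub>M borel) (%x. (x, \<omega>))) = (\<integral>\<^sup>+x. F (x, \<omega>) \<partial>\<kappa> \<omega>)"
   using F by (intro nn_integral_distr) auto
 qed
 finally show ?thesis .
qed

lemma emeasure_semidirect:
 assumes \<mu>: "\<mu> \<in> space (prob_algebra borel)" and \<kappa>: "\<kappa> \<in> borel \<rightarrow>\<^sub>M prob_algebra S"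
  and A: "A \<in> sets (S \<Otimes>\<^sub>M borel)"
 shows "emeasure (semidirect S \<mu> \<kappa>) A = (\<integral>\<^sup>+\<omega>. \<integral>\<^sup>+x. indicator A (x, \<omega>) \<partial>\<kappa> \<omega> \<partial>\<mu>)"
 using nn_integral_semidirect[OF \<mu> \<kappa>, of "indicator A"] A semidirect_in_space[OF \<mu> \<kappa>]
 by (simp add: space_prob_algebra)

lemma measurable_kernel_nn_integral:
 assumes \<kappa>: "\<kappa> \<in> borel \<rightarrow>\<^sub>M prob_algebra S" and F[measurable]: "F \<in> borel_measurable (S \<Otimes>\<^sub>M (borel :: real measure))"
 shows "(%\<omega>. \<integral>\<^sup>+x. F (x, \<omega>) \<partial>\<kappa> \<omega>) \<in> borel_measurable borel"
 by (rule nn_integral_measurable_subprob_algebra2[OF _ measurable_prob_algebraD[OF \<kappa>]]) measurable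

text \<open>For a fixed set A, testing the joint identity on rectangles A x B identifies two
  densities with respect to \<mu>, which therefore agree almost everywhere. The exceptional set
  depends on A; the countable generator merges these null sets into one.\<close>

lemma semidirect_density_AE:
 assumes \<mu>: "\<mu> \<in> space (prob_algebra borel)"
  and \<kappa>: "\<kappa> \<in> borel \<rightarrow>\<^sub>M prob_algebra S" and \<rho>: "\<rho> \<in> borel \<rightarrow>\<^sub>M prob_algebra S"
  and G: "countable G" "Int_stable G" "G \<subseteq> Pow (space S)" "sets S = sigma_sets (space S) G"
  and h[measurable]: "h \<in> borel_measurable (S \<Otimes>\<^sub>M borel)"
  and eq: "semidirect S \<mu> \<kappa> = density (semidirect S \<mu> \<rho>) h"
 shows "AE \<omega> in \<mu>. \<kappa> \<omega> = density (\<rho> \<omega>) (%x. h (x, \<omega>))"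
proof -
 interpret \<mu>: prob_space \<mu> using prob_algebraD[OF \<mu>] by simp
 have s\<mu>[measurable_cong]: "sets \<mu> = sets borel" and sp\<mu>: "space \<mu> = UNIV" using prob_algebraD[OF \<mu>] by auto
 note k = measurable_prob_algebraD'[OF \<kappa>] measurable_prob_algebraD'[OF \<rho>]
 have *: "AE \<omega> in \<mu>. emeasure (\<kappa> \<omega>) A = emeasure (density (\<rho> \<omega>) (%x. h (x, \<omega>))) A"
  if A[measurable]: "A \<in> sets S" for A
 proof -
  let ?f = "%\<omega>. \<integral>\<^sup>+x. indicator A x \<partial>\<kappa> \<omega>" and ?g = "%\<omega>. \<integral>\<^sup>+x. h (x, \<omega>) * indicator A x \<partial>\<rho> \<omega>"
  have mf: "?f \<in> borel_measurable borel"
   using measurable_kernel_nn_integral[OF \<kappa>, of "%z. indicator A (fst z)"] by simp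
  have mg: "?g \<in> borel_measurable borel"
   using measurable_kernel_nn_integral[OF \<rho>, of "%z. h z * indicator A (fst z)"] by simp
  have "density \<mu> ?f = density \<mu> ?g"
  proof (rule measure_eqI)
   fix B assume "B \<in> sets (density \<mu> ?f)"
   then have B[measurable]: "B \<in> sets borel" by (simp add: s\<mu>)
   have "emeasure (density \<mu> ?f) B = (\<integral>\<^sup>+\<omega>. ?f \<omega> * indicator B \<omega> \<partial>\<mu>)"
    using mf by (intro emeasure_density) (auto simp: s\<mu> cong: measurable_cong_sets)
   also have "\<dots> = (\<integral>\<^sup>+\<omega>. \<integral>\<^sup>+x. indicator (A \<times> B) (x, \<omega>) \<partial>\<kappa> \<omega> \<partial>\<mu>)"
   proof (rule nn_integral_cong)
    fix \<omega>
    have [measurable_cong]: "sets (\<kappa> \<omega>) = sets S" using k by simp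
    show "?f \<omega> * indicator B \<omega> = (\<integral>\<^sup>+x. indicator (A \<times> B) (x, \<omega>) \<partial>\<kappa> \<omega>)"
     by (subst nn_integral_multc[symmetric]) (auto simp: indicator_times)
   qed
   also have "\<dots> = emeasure (semidirect S \<mu> \<kappa>) (A \<times> B)"
    by (rule emeasure_semidirect[OF \<mu> \<kappa>, symmetric]) measurable
   also have "\<dots> = (\<integral>\<^sup>+z. h z * indicator (A \<times> B) z \<partial>semidirect S \<mu> \<rho>)"
    unfolding eq using semidirect_in_space[OF \<mu> \<rho>] h
    by (intro emeasure_density) (auto simp: space_prob_algebra cong: measurable_cong_sets)
   also have "\<dots> = (\<integral>\<^sup>+\<omega>. \<integral>\<^sup>+x. h (x, \<omega>) * indicator (A \<times> B) (x, \<omega>) \<partial>\<rho> \<omega> \<partial>\<mu>)"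
    by (rule nn_integral_semidirect[OF \<mu> \<rho>]) measurable
   also have "\<dots> = (\<integral>\<^sup>+\<omega>. ?g \<omega> * indicator B \<omega> \<partial>\<mu>)"
   proof (rule nn_integral_cong)
    fix \<omega>
    have [measurable_cong]: "sets (\<rho> \<omega>) = sets S" using k by simp
    show "(\<integral>\<^sup>+x. h (x, \<omega>) * indicator (A \<times> B) (x, \<omega>) \<partial>\<rho> \<omega>) = ?g \<omega> * indicator B \<omega>"
     by (subst nn_integral_multc[symmetric]) (auto simp: indicator_times ac_simps)
   qed
   also have "\<dots> = emeasure (density \<mu> ?g) B"
    using mg by (intro emeasure_density[symmetric]) (auto simp: s\<mu> cong: measurable_cong_sets)
   finally show "emeasure (density \<mu> ?f) B = emeasure (density \<mu> ?g) B" .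
  qed simp
  then have "AE \<omega> in \<mu>. ?f \<omega> = ?g \<omega>"
   using mf mg by (intro \<mu>.density_unique) (auto cong: measurable_cong_sets simp: s\<mu>)
  then show ?thesis
  proof (rule AE_mp, intro AE_I2 impI)
   fix \<omega> assume fg: "?f \<omega> = ?g \<omega>"
   have [measurable_cong]: "sets (\<rho> \<omega>) = sets S" "sets (\<kappa> \<omega>) = sets S" using k by auto
   have "emeasure (density (\<rho> \<omega>) (%x. h (x, \<omega>))) A = ?g \<omega>"
    by (rule emeasure_density) measurable
   with fg show "emeasure (\<kappa> \<omega>) A = emeasure (density (\<rho> \<omega>) (%x. h (x, \<omega>))) A" by simp
  qed
 qed
 \<comment> \<open>The whole space joins the generator to serve as the exhausting sequence of finite
   measure in the uniqueness theorem for measures.\<close>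
 have "AE \<omega> in \<mu>. \<forall>A\<in>insert (space S) G. emeasure (\<kappa> \<omega>) A = emeasure (density (\<rho> \<omega>) (%x. h (x, \<omega>))) A"
  using G * by (subst AE_ball_countable) (auto intro: sigma_sets.Basic)
 then show ?thesis
 proof (rule AE_mp, intro AE_I2 impI)
  fix \<omega> assume e: "\<forall>A\<in>insert (space S) G. emeasure (\<kappa> \<omega>) A = emeasure (density (\<rho> \<omega>) (%x. h (x, \<omega>))) A"
  interpret K: prob_space "\<kappa> \<omega>" using k by simp
  show "\<kappa> \<omega> = density (\<rho> \<omega>) (%x. h (x, \<omega>))"
  proof (rule measure_eqI_generator_eq[of "insert (space S) G" "space S" _ _ "%_. space S"])
   show "Int_stable (insert (space S) G)" using G(2,3) by (fastforce simp: Int_stable_def Int_absorb1 Int_absorb2)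
   have "sigma_sets (space S) (insert (space S) G) = sigma_sets (space S) G"
    by (rule sigma_sets_eqI) (auto intro: sigma_sets.Basic sigma_sets_top)
   then show "sets (\<kappa> \<omega>) = sigma_sets (space S) (insert (space S) G)"
    "sets (density (\<rho> \<omega>) (%x. h (x, \<omega>))) = sigma_sets (space S) (insert (space S) G)"
    using k G(4) by auto
  qed (use e G k in auto)
 qed
qed

lemma semidirect_eq_AE:
 assumes \<mu>: "\<mu> \<in> space (prob_algebra borel)"
  and \<kappa>: "\<kappa> \<in> borel \<rightarrow>\<^sub>M prob_algebra S" and \<rho>: "\<rho> \<in> borel \<rightarrow>\<^sub>M prob_algebra S"
  and G: "countable G" "Int_stable G" "G \<subseteq> Pow (space S)" "sets S = sigma_sets (space S) G"
  and eq: "semidirect S \<mu> \<kappa> = semidirect S \<mu> \<rho>"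
 shows "AE \<omega> in \<mu>. \<kappa> \<omega> = \<rho> \<omega>"
proof -
 have "semidirect S \<mu> \<kappa> = density (semidirect S \<mu> \<rho>) (%_. 1)" by (simp only: eq density_1)
 from semidirect_density_AE[OF \<mu> \<kappa> \<rho> G _ this] show ?thesis by (simp only: density_1 borel_measurable_const)
qed

text \<open>If the joint measures are absolutely continuous, the joint density restricted to the
  fibre over \<omega> is the density of the kernels, and the nonnegative integrand is integrated
  fibrewise. Otherwise both sides are infinite: a null set charged by the first measure has fibres
  that refute absolute continuity of the kernels for a set of \<omega> of positive
  \<mu>-measure.\<close>

lemma relative_entropy_semidirect:
 assumes \<mu>: "\<mu> \<in> space (prob_algebra borel)"
  and \<kappa>: "\<kappa> \<in> borel \<rightarrow>\<^sub>M prob_algebra S" and \<rho>: "\<rho> \<in> borel \<rightarrow>\<^sub>M prob_algebra S"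
  and G: "countable G" "Int_stable G" "G \<subseteq> Pow (space S)" "sets S = sigma_sets (space S) G"
 shows "relative_entropy (semidirect S \<mu> \<kappa>) (semidirect S \<mu> \<rho>) =
  (\<integral>\<^sup>+\<omega>. relative_entropy (\<kappa> \<omega>) (\<rho> \<omega>) \<partial>\<mu>)"
proof -
 let ?l = "semidirect S \<mu> \<kappa>" and ?p = "semidirect S \<mu> \<rho>"
 note l = prob_algebraD[OF semidirect_in_space[OF \<mu> \<kappa>]] and p = prob_algebraD[OF semidirect_in_space[OF \<mu> \<rho>]]
 have s\<mu>[measurable_cong]: "sets \<mu> = sets borel" and sp\<mu>: "space \<mu> = UNIV" using prob_algebraD[OF \<mu>] by auto
 note k = measurable_prob_algebraD'[OF \<kappa>] measurable_prob_algebraD'[OF \<rho>]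
 show ?thesis
 proof (cases "absolutely_continuous ?p ?l")
  case True
  then obtain h where h: "h \<in> borel_measurable ?p" "!!x. 0 \<le> h x" "?l = density ?p (%x. ennreal (h x))"
   using absolutely_continuous_real_density[OF p(1) l(1)] l p by metis
  have [measurable]: "h \<in> borel_measurable (S \<Otimes>\<^sub>M borel)" using h p by (simp cong: measurable_cong_sets)
  have ae: "AE \<omega> in \<mu>. \<kappa> \<omega> = density (\<rho> \<omega>) (%x. ennreal (h (x, \<omega>)))"
   by (rule semidirect_density_AE[OF \<mu> \<kappa> \<rho> G]) (use h in auto)
  have "relative_entropy ?l ?p = (\<integral>\<^sup>+x. ennreal (h x * ln (h x) - h x + 1) \<partial>?p)"
   using relative_entropy_density[OF p(1) h(1) h(2)] h(3) l(1) by simp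
  also have "\<dots> = (\<integral>\<^sup>+\<omega>. \<integral>\<^sup>+x. ennreal (h (x, \<omega>) * ln (h (x, \<omega>)) - h (x, \<omega>) + 1) \<partial>\<rho> \<omega> \<partial>\<mu>)"
   by (rule nn_integral_semidirect[OF \<mu> \<rho>]) measurable
  also have "\<dots> = (\<integral>\<^sup>+\<omega>. relative_entropy (\<kappa> \<omega>) (\<rho> \<omega>) \<partial>\<mu>)"
  proof (rule nn_integral_cong_AE, rule AE_mp[OF ae], intro AE_I2 impI)
   fix \<omega> assume e: "\<kappa> \<omega> = density (\<rho> \<omega>) (%x. ennreal (h (x, \<omega>)))"
   have [measurable_cong]: "sets (\<rho> \<omega>) = sets S" using k by auto
   show "(\<integral>\<^sup>+x. ennreal (h (x, \<omega>) * ln (h (x, \<omega>)) - h (x, \<omega>) + 1) \<partial>\<rho> \<omega>) = relative_entropy (\<kappa> \<omega>) (\<rho> \<omega>)"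
    using relative_entropy_density[of "\<rho> \<omega>" "%x. h (x, \<omega>)"] h(2) k(1)[of \<omega>] k(4)[of \<omega>] e by simp
  qed
  finally show ?thesis .
 next
  case False
  then obtain N where N: "N \<in> null_sets ?p" "N \<notin> null_sets ?l" by (auto simp: absolutely_continuous_def)
  then have [measurable]: "N \<in> sets (S \<Otimes>\<^sub>M borel)" using p by auto
  have l0: "emeasure ?l N \<noteq> 0" using N l p by (auto simp: null_sets_def)
  define f where "f \<omega> = (\<integral>\<^sup>+x. indicator N (x, \<omega>) \<partial>\<kappa> \<omega>)" for \<omega>
  have mf[measurable]: "f \<in> borel_measurable borel"
   unfolding f_def by (rule measurable_kernel_nn_integral[OF \<kappa>]) measurable
  have mg: "(%\<omega>. \<integral>\<^sup>+x. indicator N (x, \<omega>) \<partial>\<rho> \<omega>) \<in> borel_measurable borel"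
   by (rule measurable_kernel_nn_integral[OF \<rho>]) measurable
  have "(\<integral>\<^sup>+\<omega>. \<integral>\<^sup>+x. indicator N (x, \<omega>) \<partial>\<rho> \<omega> \<partial>\<mu>) = 0"
   using N emeasure_semidirect[OF \<mu> \<rho>, of N] by auto
  then have g0: "AE \<omega> in \<mu>. (\<integral>\<^sup>+x. indicator N (x, \<omega>) \<partial>\<rho> \<omega>) = 0"
   using mg by (subst (asm) nn_integral_0_iff_AE) (auto cong: measurable_cong_sets simp: s\<mu>)
  have "\<infinity> = (\<integral>\<^sup>+\<omega>. \<infinity> * indicator {\<omega>. f \<omega> \<noteq> 0} \<omega> \<partial>\<mu>)"
  proof -
   have B: "{\<omega>. f \<omega> \<noteq> 0} \<in> sets \<mu>" by (simp add: s\<mu>)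
   have "emeasure \<mu> {\<omega>. f \<omega> \<noteq> 0} \<noteq> 0"
   proof
    assume "emeasure \<mu> {\<omega>. f \<omega> \<noteq> 0} = 0"
    then have "AE \<omega> in \<mu>. f \<omega> = 0"
     using B by (intro AE_I[of _ _ "{\<omega>. f \<omega> \<noteq> 0}"]) auto
    then have "(\<integral>\<^sup>+\<omega>. f \<omega> \<partial>\<mu>) = 0" by (simp add: nn_integral_0_iff_AE)
    then show False using l0 emeasure_semidirect[OF \<mu> \<kappa>, of N] by (simp add: f_def)
   qed
   then show ?thesis using B unfolding infinity_ennreal_def
    by (subst nn_integral_cmult_indicator) (auto simp: ennreal_top_mult)
  qed
  also have "\<dots> \<le> (\<integral>\<^sup>+\<omega>. relative_entropy (\<kappa> \<omega>) (\<rho> \<omega>) \<partial>\<mu>)"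
  proof (rule nn_integral_mono_AE, rule AE_mp[OF g0], intro AE_I2 impI)
   fix \<omega> assume 0: "(\<integral>\<^sup>+x. indicator N (x, \<omega>) \<partial>\<rho> \<omega>) = 0"
   have [measurable_cong]: "sets (\<rho> \<omega>) = sets S" "sets (\<kappa> \<omega>) = sets S" using k by auto
   have sp: "space (\<rho> \<omega>) = space S" "space (\<kappa> \<omega>) = space S" using k by auto
   let ?N = "(%x. (x, \<omega>)) -` N \<inter> space S"
   have S: "?N \<in> sets S" by measurable
   have i: "(\<integral>\<^sup>+x. indicator N (x, \<omega>) \<partial>\<nu>) = emeasure \<nu> ?N" if "sets \<nu> = sets S" for \<nu>
   proof -
    have "(\<integral>\<^sup>+x. indicator N (x, \<omega>) \<partial>\<nu>) = (\<integral>\<^sup>+x. indicator ?N x \<partial>\<nu>)"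
     using sets_eq_imp_space_eq[OF that] by (intro nn_integral_cong) (auto simp: indicator_def)
    then show ?thesis using S that by simp
   qed
   have "relative_entropy (\<kappa> \<omega>) (\<rho> \<omega>) = \<infinity>" if f: "f \<omega> \<noteq> 0"
   proof -
    have "?N \<in> null_sets (\<rho> \<omega>)" using 0 S i[OF k(5)] k(5)[of \<omega>] by (simp add: null_sets_def)
    moreover have "?N \<notin> null_sets (\<kappa> \<omega>)" using f i[OF k(2)] by (simp add: f_def null_sets_def)
    ultimately have "\<not> absolutely_continuous (\<rho> \<omega>) (\<kappa> \<omega>)" by (auto simp: absolutely_continuous_def)
    then show ?thesis by (simp add: relative_entropy_def)
   qed
   then show "\<infinity> * indicator {\<omega>. f \<omega> \<noteq> 0} \<omega> \<le> relative_entropy (\<kappa> \<omega>) (\<rho> \<omega>)"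
    by (auto simp: indicator_def)
  qed
  finally show ?thesis using False by (simp add: relative_entropy_def top_unique)
 qed
qed

section \<open>Ordinary differential equations with additive driver\<close>

definition lip_drift :: "real => real => (real => real => real) => bool" where
 "lip_drift T L a \<longleftrightarrow> 0 \<le> L \<and> (\<forall>x. continuous_on {0..T} (%t. a t x)) \<and>
  (\<forall>t\<in>{0..T}. \<forall>x y. \<bar>a t x - a t y\<bar> \<le> L * \<bar>x - y\<bar>)"

lemma lip_driftD:
 assumes "lip_drift T L a"
 shows "0 \<le> L" "continuous_on {0..T} (%t. a t x)" "t \<in> {0..T} ==> \<bar>a t x - a t y\<bar> \<le> L * \<bar>x - y\<bar>"
 using assms by (auto simp: lip_drift_def)

lemma lip_drift_continuous_comp:
 assumes a: "lip_drift T L a" and x: "continuous_on {0..T} x"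
 shows "continuous_on {0..T} (%s. a s (x s))" unfolding continuous_on_def
proof
 fix t assume t: "t \<in> {0..T}"
 have "((%s. a s (x s) - a s (x t)) \<longlongrightarrow> 0) (at t within {0..T})"
 proof (rule Lim_null_comparison)
  show "\<forall>\<^sub>F s in at t within {0..T}. norm (a s (x s) - a s (x t)) \<le> L * \<bar>x s - x t\<bar>"
   using lip_driftD(3)[OF a] by (auto simp: eventually_at_filter)
  have "((%s. L * \<bar>x s - x t\<bar>) \<longlongrightarrow> L * \<bar>x t - x t\<bar>) (at t within {0..T})"
   using x t by (intro tendsto_intros) (auto simp: continuous_on_def)
  then show "((%s. L * \<bar>x s - x t\<bar>) \<longlongrightarrow> 0) (at t within {0..T})" by simp
 qed
 moreover have "((%s. a s (x t)) \<longlongrightarrow> a t (x t)) (at t within {0..T})"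
  using lip_driftD(2)[OF a] t by (auto simp: continuous_on_def)
 ultimately have "((%s. (a s (x s) - a s (x t)) + a s (x t)) \<longlongrightarrow> 0 + a t (x t)) (at t within {0..T})"
  by (rule tendsto_add)
 then show "((%s. a s (x s)) \<longlongrightarrow> a t (x t)) (at t within {0..T})" by simp
qed

text \<open>The basic estimate for exponentially weighted norms: integration costs a factor
  1/\<kappa>, so a large weight turns Lipschitz maps into contractions on all of [0,T] at
  once.\<close>

lemma integral_exp_le:
 fixes h :: "real => real"
 assumes \<kappa>: "\<kappa> > 0" and D: "0 \<le> D" and t: "0 \<le> t" and h: "continuous_on {0..t} h"
  and le: "!!s. s \<in> {0..t} ==> \<bar>h s\<bar> \<le> D * exp (\<kappa> * s)"
 shows "\<bar>integral {0..t} h\<bar> \<le> D / \<kappa> * exp (\<kappa> * t)"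
proof -
 have I: "((%s. D * exp (\<kappa> * s)) has_integral (D / \<kappa> * exp (\<kappa> * t) - D / \<kappa> * exp (\<kappa> * 0))) {0..t}"
  using \<kappa> t by (intro fundamental_theorem_of_calculus)
   (auto intro!: derivative_eq_intros simp: has_real_derivative_iff_has_vector_derivative[symmetric])
 have "norm (integral {0..t} h) \<le> integral {0..t} (%s. D * exp (\<kappa> * s))"
  using le by (intro integral_norm_bound_integral integrable_continuous_interval h continuous_intros) auto
 also have "\<dots> = D / \<kappa> * exp (\<kappa> * t) - D / \<kappa> * exp (\<kappa> * 0)" using I by (rule integral_unique)
 also have "\<dots> \<le> D / \<kappa> * exp (\<kappa> * t)" using \<kappa> D by simp
 finally show ?thesis by simp
qed

fun picard :: "(real => real => real) => (real => real) => nat => real => real" where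
 "picard a y 0 = y"
| "picard a y (Suc n) = (%t. y t + integral {0..t} (%s. a s (picard a y n s)))"

text \<open>With additive noise the equation x = y + int a(s, x_s) ds is solved separately for each
  continuous driver y. Being a limit of Picard iterates, the solution is an explicit functional
  whose measurability and adaptedness can be read off.\<close>

definition ode_sol :: "(real => real => real) => (real => real) => real => real" where
 "ode_sol a y t = lim (%n. picard a y n t)"

lemma continuous_on_picard:
 assumes a: "lip_drift T L a" and y: "continuous_on {0..T} y"
 shows "continuous_on {0..T} (picard a y n)"
proof (induction n)
 case (Suc n)
 show ?case by (simp, intro continuous_intros y indefinite_integral_continuous_1
    integrable_continuous_interval lip_drift_continuous_comp[OF a Suc])
qed (use y in simp)

lemma continuous_on_Icc_subset: "continuous_on {0..T} h ==> t \<le> T ==> continuous_on {0..t::real} h"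
 by (rule continuous_on_subset) auto

text \<open>With the weight exp(2(L+1)t), \<open>integral_exp_le\<close> yields the factor
  L/(2(L+1)), at most 1/2; using L + 1 covers L = 0. The constant C bounds the first step.\<close>

lemma picard_step:
 assumes a: "lip_drift T L a" and y: "continuous_on {0..T} y"
 obtains C where "0 \<le> C"
  "!!n t. t \<in> {0..T} ==> \<bar>picard a y (Suc n) t - picard a y n t\<bar> \<le> C * (1/2) ^ n * exp (2 * (L + 1) * t)"
proof -
 have L: "0 \<le> L" using lip_driftD[OF a] by simp
 have c: "continuous_on {0..T} (%t. picard a y 1 t - picard a y 0 t)"
  by (intro continuous_intros continuous_on_picard[OF a y])
 then have "compact ((%t. picard a y 1 t - picard a y 0 t) ` {0..T})" by (intro compact_continuous_image) auto
 then obtain C0 where C0: "!!t. t \<in> {0..T} ==> \<bar>picard a y 1 t - picard a y 0 t\<bar> \<le> C0"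
  by (fastforce dest!: compact_imp_bounded simp: bounded_iff)
 define C where "C = max 0 C0"
 have C: "0 \<le> C" "!!t. t \<in> {0..T} ==> \<bar>picard a y 1 t - picard a y 0 t\<bar> \<le> C"
  using C0 unfolding C_def by (metis max.cobounded1) (meson C0 max.coboundedI2)
 have "\<bar>picard a y (Suc n) t - picard a y n t\<bar> \<le> C * (1/2) ^ n * exp (2 * (L + 1) * t)"
  if "t \<in> {0..T}" for n t using that
 proof (induction n arbitrary: t)
  case 0
  have "C * 1 \<le> C * exp (2 * (L + 1) * t)" using 0 C(1) L by (intro mult_left_mono) auto
  then show ?case using C(2)[OF 0] by simp
 next
  case (Suc n)
  let ?h = "%n s. a s (picard a y n s)"
  have ch: "continuous_on {0..t} (?h n)" for n using Suc.prems
   by (intro continuous_on_Icc_subset[OF lip_drift_continuous_comp[OF a continuous_on_picard[OF a y]]]) auto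
  have "picard a y (Suc (Suc n)) t - picard a y (Suc n) t = integral {0..t} (?h (Suc n)) - integral {0..t} (?h n)"
   by simp
  also have "\<dots> = integral {0..t} (%s. ?h (Suc n) s - ?h n s)"
   by (intro integral_diff[symmetric] integrable_continuous_interval ch)
  also have "\<bar>\<dots>\<bar> \<le> (L * (C * (1/2) ^ n)) / (2 * (L + 1)) * exp (2 * (L + 1) * t)"
  proof (rule integral_exp_le)
   fix s assume s: "s \<in> {0..t}"
   then have s': "s \<in> {0..T}" using Suc.prems by auto
   have "\<bar>?h (Suc n) s - ?h n s\<bar> \<le> L * \<bar>picard a y (Suc n) s - picard a y n s\<bar>"
    by (rule lip_driftD(3)[OF a s'])
   also have "\<dots> \<le> L * (C * (1/2) ^ n * exp (2 * (L + 1) * s))" by (intro mult_left_mono Suc.IH[OF s'] L)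
   finally show "\<bar>?h (Suc n) s - ?h n s\<bar> \<le> L * (C * (1/2) ^ n) * exp (2 * (L + 1) * s)"
    by (simp add: mult.assoc)
  qed (use Suc.prems L C in \<open>auto intro!: continuous_on_diff ch simp del: picard.simps\<close>)
  also have "\<dots> \<le> (C * (1/2) ^ Suc n) * exp (2 * (L + 1) * t)"
  proof (rule mult_right_mono)
   have "L / (2 * (L + 1)) \<le> 1 / 2" using L by (simp add: field_simps)
   then have "C * (1/2) ^ n * (L / (2 * (L + 1))) \<le> C * (1/2) ^ n * (1 / 2)"
    using C by (intro mult_left_mono) auto
   then show "L * (C * (1/2) ^ n) / (2 * (L + 1)) \<le> C * (1/2) ^ Suc n" by (simp add: algebra_simps)
  qed simp
  finally show ?case .
 qed
 with C(1) that show ?thesis by blast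
qed

lemma picard_uniform_limit:
 assumes a: "lip_drift T L a" and y: "continuous_on {0..T} y"
 shows "uniform_limit {0..T} (picard a y) (ode_sol a y) sequentially"
proof -
 have L: "0 \<le> L" using lip_driftD[OF a] by simp
 obtain C where C: "0 \<le> C"
  "!!n t. t \<in> {0..T} ==> \<bar>picard a y (Suc n) t - picard a y n t\<bar> \<le> C * (1/2) ^ n * exp (2 * (L + 1) * t)"
  using picard_step[OF a y] by blast
 let ?d = "%n t. picard a y (Suc n) t - picard a y n t"
 have bd: "norm (?d n t) \<le> (C * exp (2 * (L + 1) * T)) * (1/2) ^ n" if "t \<in> {0..T}" for n t
 proof -
  have "norm (?d n t) \<le> C * (1/2) ^ n * exp (2 * (L + 1) * t)" using C(2)[OF that, of n] by (simp del: picard.simps)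
  also have "\<dots> \<le> C * (1/2) ^ n * exp (2 * (L + 1) * T)" using that C(1) L by (intro mult_left_mono) auto
  finally show ?thesis by (simp add: ac_simps)
 qed
 have sm: "summable (%n. (C * exp (2 * (L + 1) * T)) * (1/2::real) ^ n)"
  by (intro summable_mult summable_geometric) auto
 have "uniform_limit {0..T} (%n t. \<Sum>i<n. ?d i t) (%t. suminf (%i. ?d i t)) sequentially"
  by (rule Weierstrass_m_test[OF bd sm])
 then have "uniform_limit {0..T} (%n t. y t + (\<Sum>i<n. ?d i t)) (%t. y t + suminf (%i. ?d i t)) sequentially"
  by (intro uniform_limit_intros)
 moreover have "y t + (\<Sum>i<n. ?d i t) = picard a y n t" for n t
  using sum_lessThan_telescope[of "%n. picard a y n t" n] by simp
 ultimately have *: "uniform_limit {0..T} (picard a y) (%t. y t + suminf (%i. ?d i t)) sequentially"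
  by (simp only:)
 have "ode_sol a y t = y t + suminf (%i. ?d i t)" if "t \<in> {0..T}" for t
  unfolding ode_sol_def by (rule limI, rule tendsto_uniform_limitI[OF * that])
 then show ?thesis
  using * by (subst uniform_limit_cong'[where g = "picard a y" and i = "%t. y t + suminf (%i. ?d i t)"]) auto
qed

lemma continuous_on_ode_sol:
 assumes "lip_drift T L a" "continuous_on {0..T} y"
 shows "continuous_on {0..T} (ode_sol a y)" by (rule uniform_limit_theorem[OF _ picard_uniform_limit[OF assms]])
  (auto intro!: always_eventually continuous_on_picard[OF assms])

lemma ode_sol_eq:
 assumes a: "lip_drift T L a" and y: "continuous_on {0..T} y" and t: "t \<in> {0..T}"
 shows "ode_sol a y t = y t + integral {0..t} (%s. a s (ode_sol a y s))"
proof -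
 have L: "0 \<le> L" using lip_driftD[OF a] by simp
 have sub: "{0..t} \<subseteq> {0..T}" using t by auto
 have u: "uniform_limit {0..t} (picard a y) (ode_sol a y) sequentially"
  by (rule uniform_limit_on_subset[OF picard_uniform_limit[OF a y] sub])
 have "uniform_limit {0..t} (%n s. a s (picard a y n s)) (%s. a s (ode_sol a y s)) sequentially"
 proof (rule uniform_limitI)
  fix e :: real assume e: "0 < e"
  have "\<forall>\<^sub>F n in sequentially. \<forall>x\<in>{0..t}. dist (picard a y n x) (ode_sol a y x) < e / (L + 1)"
   using u e L by (intro uniform_limitD) auto
  then show "\<forall>\<^sub>F n in sequentially. \<forall>x\<in>{0..t}. dist (a x (picard a y n x)) (a x (ode_sol a y x)) < e"
  proof (rule eventually_mono, safe)
   fix n x assume *: "\<forall>x\<in>{0..t}. dist (picard a y n x) (ode_sol a y x) < e / (L + 1)" and x: "x \<in> {0..t}"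
   have "\<bar>a x (picard a y n x) - a x (ode_sol a y x)\<bar> \<le> L * \<bar>picard a y n x - ode_sol a y x\<bar>"
    using x sub by (intro lip_driftD[OF a]) auto
   also have "\<dots> \<le> L * (e / (L + 1))"
    using * x L by (intro mult_left_mono) (auto simp: dist_real_def less_imp_le)
   also have "\<dots> < e" using e L by (simp add: field_simps)
   finally show "dist (a x (picard a y n x)) (a x (ode_sol a y x)) < e" by (simp add: dist_real_def)
  qed
 qed
 moreover have "continuous_on {0..t} (%s. a s (picard a y n s))" for n
  using t by (intro continuous_on_Icc_subset[OF lip_drift_continuous_comp[OF a continuous_on_picard[OF a y]]]) auto
 ultimately obtain I J where IJ: "!!n. ((%s. a s (picard a y n s)) has_integral I n) {0..t}"
  "((%s. a s (ode_sol a y s)) has_integral J) {0..t}" "I \<longlonglongrightarrow> J"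
  by (rule uniform_limit_integral) auto
 have "(%n. integral {0..t} (%s. a s (picard a y n s))) \<longlonglongrightarrow> integral {0..t} (%s. a s (ode_sol a y s))"
  using IJ(3) integral_unique[OF IJ(1)] integral_unique[OF IJ(2)] by simp
 then have "(%n. picard a y (Suc n) t) \<longlonglongrightarrow> y t + integral {0..t} (%s. a s (ode_sol a y s))"
  by (auto intro!: tendsto_intros)
 moreover have "(%n. picard a y (Suc n) t) \<longlonglongrightarrow> ode_sol a y t"
  using tendsto_uniform_limitI[OF picard_uniform_limit[OF a y] t] by (rule LIMSEQ_Suc)
 ultimately show ?thesis using LIMSEQ_unique by blast
qed

text \<open>Gronwall in maximum form: at a maximum point of exp(-\<kappa> t) |x - x'| with value m,
  the equations give m \<le> (L m + D)/\<kappa>, hence m \<le> D/(\<kappa> - L). This explicit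
  constant is what later makes the mean-field map contract.\<close>

lemma ode_stability:
 assumes a: "lip_drift T L a" and a': "lip_drift T L a'" and T: "0 \<le> T" and \<kappa>: "L < \<kappa>" and D: "0 \<le> D"
  and x: "continuous_on {0..T} x" and x': "continuous_on {0..T} x'"
  and ex: "!!t. t \<in> {0..T} ==> x t = y t + integral {0..t} (%s. a s (x s))"
  and ex': "!!t. t \<in> {0..T} ==> x' t = y t + integral {0..t} (%s. a' s (x' s))"
  and d: "!!s z. s \<in> {0..T} ==> \<bar>a s z - a' s z\<bar> \<le> D * exp (\<kappa> * s)"
  and t: "t \<in> {0..T}"
 shows "\<bar>x t - x' t\<bar> \<le> D / (\<kappa> - L) * exp (\<kappa> * t)"
proof -
 have L: "0 \<le> L" using lip_driftD[OF a] by simp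
 have "continuous_on {0..T} (%t. exp (- \<kappa> * t) * \<bar>x t - x' t\<bar>)"
  by (intro continuous_intros x x')
 then obtain t0 where t0: "t0 \<in> {0..T}"
  "!!t. t \<in> {0..T} ==> exp (- \<kappa> * t) * \<bar>x t - x' t\<bar> \<le> exp (- \<kappa> * t0) * \<bar>x t0 - x' t0\<bar>"
  using continuous_attains_sup[of "{0..T}" "%t. exp (- \<kappa> * t) * \<bar>x t - x' t\<bar>"] T by auto
 define m where "m = exp (- \<kappa> * t0) * \<bar>x t0 - x' t0\<bar>"
 have m: "0 \<le> m" by (simp add: m_def)
 have le: "\<bar>x t - x' t\<bar> \<le> m * exp (\<kappa> * t)" if "t \<in> {0..T}" for t
 proof -
  have "exp (\<kappa> * t) * (exp (- \<kappa> * t) * \<bar>x t - x' t\<bar>) \<le> exp (\<kappa> * t) * m"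
   using t0(2)[OF that] unfolding m_def by (intro mult_left_mono) auto
  then show ?thesis by (simp add: mult.assoc[symmetric] exp_add[symmetric] mult.commute)
 qed
 have ch: "continuous_on {0..t0} (%s. a s (x s))" "continuous_on {0..t0} (%s. a' s (x' s))"
  using t0(1) by (auto intro!: continuous_on_Icc_subset[OF lip_drift_continuous_comp[OF a x]]
    continuous_on_Icc_subset[OF lip_drift_continuous_comp[OF a' x']])
 have "x t0 - x' t0 = integral {0..t0} (%s. a s (x s) - a' s (x' s))" unfolding ex[OF t0(1)] ex'[OF t0(1)]
  by (simp add: integral_diff integrable_continuous_interval ch)
 also have "\<bar>\<dots>\<bar> \<le> (L * m + D) / \<kappa> * exp (\<kappa> * t0)"
 proof (rule integral_exp_le)
  fix s assume s: "s \<in> {0..t0}"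
  then have s': "s \<in> {0..T}" using t0 by auto
  have "\<bar>a s (x s) - a' s (x' s)\<bar> \<le> \<bar>a s (x s) - a s (x' s)\<bar> + \<bar>a s (x' s) - a' s (x' s)\<bar>" by linarith
  also have "\<dots> \<le> L * \<bar>x s - x' s\<bar> + D * exp (\<kappa> * s)"
   by (intro add_mono lip_driftD(3)[OF a s'] d s')
  also have "\<dots> \<le> L * (m * exp (\<kappa> * s)) + D * exp (\<kappa> * s)"
   by (intro add_right_mono mult_left_mono le s' L)
  finally show "\<bar>a s (x s) - a' s (x' s)\<bar> \<le> (L * m + D) * exp (\<kappa> * s)" by (simp add: algebra_simps)
 qed (use \<kappa> L m D t0 in \<open>auto intro!: continuous_on_diff ch\<close>)
 finally have "m \<le> exp (- \<kappa> * t0) * ((L * m + D) / \<kappa> * exp (\<kappa> * t0))"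
  unfolding m_def by (intro mult_left_mono) auto
 also have "\<dots> = (exp (- \<kappa> * t0) * exp (\<kappa> * t0)) * ((L * m + D) / \<kappa>)" by (simp only: ac_simps)
 also have "\<dots> = (L * m + D) / \<kappa>" by (simp add: exp_add[symmetric])
 finally have "m * \<kappa> \<le> L * m + D" using \<kappa> L by (simp add: pos_le_divide_eq)
 then have "m \<le> D / (\<kappa> - L)" using \<kappa> by (simp add: pos_le_divide_eq algebra_simps)
 then have "m * exp (\<kappa> * t) \<le> D / (\<kappa> - L) * exp (\<kappa> * t)" by (rule mult_right_mono) simp
 with le[OF t] show ?thesis by linarith
qed

lemma ode_unique:
 assumes a: "lip_drift T L a" and T: "0 \<le> T" and y: "continuous_on {0..T} y"
  and x: "continuous_on {0..T} x"
  and ex: "!!t. t \<in> {0..T} ==> x t = y t + integral {0..t} (%s. a s (x s))"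
  and t: "t \<in> {0..T}"
 shows "x t = ode_sol a y t" using ode_stability[OF a a T, of "L+1" 0 x "ode_sol a y" y t] ex t x
  continuous_on_ode_sol[OF a y] ode_sol_eq[OF a y] by simp

text \<open>Each approximation evaluates h at the grid time floor(t(n+1))/(n+1), clamped to [0,T].
  It uses countably many times, so it is jointly measurable, and continuity in time gives the
  limit.\<close>

lemma caratheodory_measurable:
 fixes h :: "'a => real => real"
 assumes T: "0 \<le> T" and m: "!!t. t \<in> {0..T} ==> (%z. h z t) \<in> borel_measurable M"
  and c: "!!z. z \<in> space M ==> continuous_on {0..T} (h z)"
 shows "(%(z, t). indicator {0..T} t * h z t) \<in> borel_measurable (M \<Otimes>\<^sub>M borel)"
proof -
 define q where "q n i = max 0 (min T (real_of_int i / real (Suc n)))" for n :: nat and i :: int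
 have q: "q n i \<in> {0..T}" for n i using T by (auto simp: q_def)
 define g where "g n = (%(z, t). indicator {0..T} t * h z (q n \<lfloor>t * real (Suc n)\<rfloor>))" for n
 have g: "g n \<in> borel_measurable (M \<Otimes>\<^sub>M borel)" for n
 proof -
  have "(%x. h (fst x) (q n \<lfloor>snd x * real (Suc n)\<rfloor>)) \<in> borel_measurable (M \<Otimes>\<^sub>M (borel :: real measure))"
  proof (rule measurable_compose_countable[where g = "%x. \<lfloor>snd x * real (Suc n)\<rfloor>"])
   show "(%x. h (fst x) (q n i)) \<in> borel_measurable (M \<Otimes>\<^sub>M (borel :: real measure))" for i
    using m[OF q] by (rule measurable_compose[OF measurable_fst])
  qed measurable
  then show ?thesis unfolding g_def split_beta by measurable
 qed
 show ?thesis
 proof (rule borel_measurable_LIMSEQ_real[OF _ g])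
  fix x assume "x \<in> space (M \<Otimes>\<^sub>M (borel :: real measure))"
  then obtain z t where x: "x = (z, t)" "z \<in> space M" by (auto simp: space_pair_measure)
  show "(%n. g n x) \<longlonglongrightarrow> (case x of (z, t) => indicator {0..T} t * h z t)"
  proof (cases "t \<in> {0..T}")
   case True
   have "(%n. q n \<lfloor>t * real (Suc n)\<rfloor>) \<longlonglongrightarrow> max 0 (min T t)"
    unfolding q_def
   proof (intro tendsto_intros)
    have "(%n. real_of_int \<lfloor>t * real (Suc n)\<rfloor> / real (Suc n) - t) \<longlonglongrightarrow> 0"
    proof (rule Lim_null_comparison[OF always_eventually, rule_format])
     show "norm (real_of_int \<lfloor>t * real (Suc n)\<rfloor> / real (Suc n) - t) \<le> 1 / real (Suc n)" for n
     proof -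
      have "real_of_int \<lfloor>t * real (Suc n)\<rfloor> / real (Suc n) - t = (real_of_int \<lfloor>t * real (Suc n)\<rfloor> - t * real (Suc n)) / real (Suc n)"
       by (simp add: field_simps)
      moreover have "\<bar>real_of_int \<lfloor>t * real (Suc n)\<rfloor> - t * real (Suc n)\<bar> \<le> 1" by linarith
      ultimately show ?thesis by (simp add: divide_right_mono)
     qed
     show "(%n. 1 / real (Suc n)) \<longlonglongrightarrow> 0" using LIMSEQ_inverse_real_of_nat by (simp add: inverse_eq_divide)
    qed
    then show "(%n. real_of_int \<lfloor>t * real (Suc n)\<rfloor> / real (Suc n)) \<longlonglongrightarrow> t" by (simp add: LIM_zero_iff)
   qed
   then have "(%n. q n \<lfloor>t * real (Suc n)\<rfloor>) \<longlonglongrightarrow> t" using True by simp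
   then have "(%n. h z (q n \<lfloor>t * real (Suc n)\<rfloor>)) \<longlonglongrightarrow> h z t"
    by (rule continuous_on_tendsto_compose[OF c[OF x(2)] _ True]) (use q in auto)
   then show ?thesis using True by (simp add: x g_def)
  qed (simp add: x g_def)
 qed
qed

lemma integral_param_measurable:
 fixes h :: "'a => real => real"
 assumes t: "0 \<le> t" and m: "!!s. s \<in> {0..t} ==> (%z. h z s) \<in> borel_measurable M"
  and c: "!!z. z \<in> space M ==> continuous_on {0..t} (h z)"
 shows "(%z. integral {0..t} (h z)) \<in> borel_measurable M"
proof -
 have "(%(z, s). indicator {0..t} s * h z s) \<in> borel_measurable (M \<Otimes>\<^sub>M lborel)"
  using caratheodory_measurable[OF t m c] by simp
 then have "(%z. LINT s|lborel. indicator {0..t} s * h z s) \<in> borel_measurable M"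
  by (rule lborel.borel_measurable_lebesgue_integral)
 moreover have "integral {0..t} (h z) = (LINT s|lborel. indicator {0..t} s * h z s)" if "z \<in> space M" for z
  using set_borel_integral_eq_integral(2)[of "{0..t}" "h z"] borel_integrable_atLeastAtMost'[OF c[OF that]]
  by (simp add: set_lebesgue_integral_def)
 ultimately show ?thesis by (simp cong: measurable_cong)
qed

text \<open>Measurability of the data is required up to time t only. Applied to the sigma-algebra of
  the past, this is the adaptedness of the solution.\<close>

lemma ode_sol_measurable:
 fixes a :: "'a => real => real => real"
 assumes tT: "t \<in> {0..T}" and a: "!!z. z \<in> space M ==> lip_drift T L (a z)"
  and y: "!!z. z \<in> space M ==> continuous_on {0..T} (y z)"
  and ma: "!!s. s \<in> {0..t} ==> (%(z, x). a z s x) \<in> borel_measurable (M \<Otimes>\<^sub>M borel)"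
  and my: "!!s. s \<in> {0..t} ==> (%z. y z s) \<in> borel_measurable M"
 shows "(%z. ode_sol (a z) (y z) t) \<in> borel_measurable M"
proof -
 have p: "(%z. picard (a z) (y z) n s) \<in> borel_measurable M" if "s \<in> {0..t}" for n s using that
 proof (induction n arbitrary: s)
  case (Suc n)
  have "(%z. integral {0..s} (%r. a z r (picard (a z) (y z) n r))) \<in> borel_measurable M"
  proof (rule integral_param_measurable)
   fix r assume "r \<in> {0..s}"
   then have r: "r \<in> {0..t}" using Suc.prems by auto
   have "(%z. case (z, picard (a z) (y z) n r) of (z, x) => a z r x) \<in> borel_measurable M"
    by (rule measurable_compose[OF measurable_Pair[OF measurable_ident_sets[OF refl] Suc.IH[OF r]] ma[OF r]])
   then show "(%z. a z r (picard (a z) (y z) n r)) \<in> borel_measurable M" by simp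
  next
   fix z assume z: "z \<in> space M"
   show "continuous_on {0..s} (%r. a z r (picard (a z) (y z) n r))" using Suc.prems tT
    by (intro continuous_on_Icc_subset[OF lip_drift_continuous_comp[OF a[OF z] continuous_on_picard[OF a[OF z] y[OF z]]]]) auto
  qed (use Suc.prems in auto)
  then show ?case using my[OF Suc.prems] by simp
 qed (use my in simp)
 show ?thesis
 proof (rule borel_measurable_LIMSEQ_real)
  show "(%z. picard (a z) (y z) n t) \<in> borel_measurable M" for n by (rule p) (use tT in auto)
  show "(%n. picard (a z) (y z) n t) \<longlonglongrightarrow> ode_sol (a z) (y z) t" if "z \<in> space M" for z
   by (rule tendsto_uniform_limitI[OF picard_uniform_limit[OF a[OF that] y[OF that]] tT])
 qed
qed

section \<open>Brownian motion\<close>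

definition gauss :: "real => real measure" where
 "gauss v = density lborel (%x. ennreal (normal_density 0 (sqrt v) x))"

lemma prob_space_gauss: "0 < v ==> prob_space (gauss v)"
 unfolding gauss_def by (rule prob_space_normal_density) simp

lemma sets_gauss [simp, measurable_cong]: "sets (gauss v) = sets borel"
 and space_gauss [simp]: "space (gauss v) = UNIV" by (simp_all add: gauss_def)

lemma (in prob_space) distr_eq_gauss_iff:
 "X \<in> borel_measurable M ==> distr M borel X = gauss v \<longleftrightarrow> distributed M lborel X (normal_density 0 (sqrt v))"
 by (auto simp: distributed_def gauss_def distr_cong[of M M lborel borel, OF refl sets_lborel])

text \<open>The increments over the dyadic intervals of length \<open>2\<^sup>-\<^sup>n\<close>; summing neighbours maps level \<open>n + 1\<close> to level \<open>n\<close>, which makes the levels a projective family.\<close>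

definition dyadic_gauss :: "nat => (nat => real) measure" where
 "dyadic_gauss n = PiM UNIV (%_. gauss ((1/2) ^ n))"

definition pair_sum :: "(nat => real) => nat => real" where
 "pair_sum x k = x (2 * k) + x (Suc (2 * k))"

lemma sets_dyadic_gauss [simp, measurable_cong]: "sets (dyadic_gauss n) = sets (PiM UNIV (%_. borel))"
 unfolding dyadic_gauss_def by (rule sets_PiM_cong) auto

lemma prob_space_dyadic_gauss: "prob_space (dyadic_gauss n)"
 unfolding dyadic_gauss_def by (intro prob_space_PiM prob_space_gauss) simp

lemma measurable_pair_sum [measurable]: "pair_sum \<in> PiM UNIV (%_. borel) \<rightarrow>\<^sub>M PiM UNIV (%_. borel)"
 by (rule measurable_PiM_single') (auto simp: pair_sum_def)

lemma distr_dyadic_gauss_component: "distr (dyadic_gauss n) borel (%x. x i) = gauss ((1/2) ^ n)"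
 using distr_PiM_component[of UNIV "%_. gauss ((1/2) ^ n)" i] prob_space_gauss[of "(1/2)^n"]
 by (simp add: dyadic_gauss_def cong: distr_cong)

lemma indep_dyadic_gauss: "prob_space.indep_vars (dyadic_gauss n) (%_. borel) (%i x. x i) UNIV"
proof -
 interpret prob_space "dyadic_gauss n" by (rule prob_space_dyadic_gauss)
 have "distr (dyadic_gauss n) (PiM UNIV (%_. borel)) (%x. \<lambda>i\<in>UNIV. x i) = dyadic_gauss n"
  by (simp add: restrict_UNIV distr_id2)
 also have "\<dots> = PiM UNIV (%i. distr (dyadic_gauss n) borel (%x. x i))"
  by (simp add: distr_dyadic_gauss_component) (simp add: dyadic_gauss_def)
 finally show ?thesis by (subst indep_vars_iff_distr_eq_PiM') auto
qed

lemma distr_pair_sum: "distr (dyadic_gauss (Suc n)) (PiM UNIV (%_. borel)) pair_sum = dyadic_gauss n"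
proof -
 let ?M = "dyadic_gauss (Suc n)"
 interpret prob_space ?M by (rule prob_space_dyadic_gauss)
 have "indep_vars (%j. PiM {2 * j, Suc (2 * j)} (%_. borel)) (%j x. restrict (%i. x i) {2 * j, Suc (2 * j)}) UNIV"
  by (rule indep_vars_restrict[OF indep_dyadic_gauss]) (auto simp: disjoint_family_on_def double_not_eq_Suc_double Suc_double_not_eq_double)
 then have "indep_vars (%_. borel) (%j x. (%y. y (2 * j) + y (Suc (2 * j))) (restrict (%i. x i) {2 * j, Suc (2 * j)})) UNIV"
  by (rule indep_vars_compose2) simp
 then have iv: "indep_vars (%_. borel) (%j x. pair_sum x j) UNIV" by (simp add: pair_sum_def)
 have d: "distr ?M borel (%x. pair_sum x j) = gauss ((1/2) ^ n)" for j
 proof -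
  have n: "distributed ?M lborel (%x. x i) (normal_density 0 (sqrt ((1/2) ^ Suc n)))" for i
   using distr_dyadic_gauss_component[of "Suc n" i] by (subst distr_eq_gauss_iff[symmetric]) auto
  have "indep_var borel (%x. x (2 * j)) borel (%x. x (Suc (2 * j)))"
  proof -
   have "indep_var (PiM {2*j} (%_. borel)) (%x. restrict (%i. x i) {2*j}) (PiM {Suc (2*j)} (%_. borel)) (%x. restrict (%i. x i) {Suc (2*j)})"
    by (rule indep_var_restrict[OF indep_dyadic_gauss]) auto
   then have "indep_var borel ((%y. y (2*j)) \<circ> (%x. restrict (%i. x i) {2*j})) borel ((%y. y (Suc (2*j))) \<circ> (%x. restrict (%i. x i) {Suc (2*j)}))"
    by (rule indep_var_compose) auto
   then show ?thesis by (simp add: comp_def)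
  qed
  from add_indep_normal[OF this _ _ n n]
  have "distributed ?M lborel (%x. pair_sum x j) (normal_density 0 (sqrt ((1/2) ^ n)))"
   by (simp add: pair_sum_def)
  then show ?thesis by (subst distr_eq_gauss_iff) (auto simp: pair_sum_def)
 qed
 have "distr ?M (PiM UNIV (%_. borel)) (%x. \<lambda>j\<in>UNIV. pair_sum x j) = PiM UNIV (%j. distr ?M borel (%x. pair_sum x j))"
  by (rule indep_vars_iff_distr_eq_PiM'[THEN iffD1, OF _ _ iv]) (auto simp: pair_sum_def)
 then show ?thesis by (simp add: d restrict_UNIV) (simp add: dyadic_gauss_def)
qed

definition top_level :: "(nat \<times> nat) set => nat" where
 "top_level J = (if J = {} then 0 else Max (fst ` J))"

text \<open>An index (n,k) stands for the increment over [k/2^n, (k+1)/2^n]. It is a sum of 2^(N-n)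
  increments of a finer level N, so finitely many increments are functions of a single sufficiently
  fine level.\<close>

definition block_map :: "nat => (nat \<times> nat) set => (nat => real) => nat \<times> nat => real" where
 "block_map N J x = (\<lambda>i\<in>J. (pair_sum ^^ (N - fst i)) x (snd i))"

definition dyadic_marginal :: "(nat \<times> nat) set => (nat \<times> nat => real) measure" where
 "dyadic_marginal J = distr (dyadic_gauss (top_level J)) (PiM J (%_. borel)) (block_map (top_level J) J)"

lemma measurable_pair_sum_pow [measurable]:
 "(pair_sum ^^ d) \<in> PiM UNIV (%_. borel) \<rightarrow>\<^sub>M PiM UNIV (%_. borel)"
 by (induction d) (auto intro: measurable_comp)

lemma measurable_block_map [measurable]: "block_map N J \<in> PiM UNIV (%_. borel) \<rightarrow>\<^sub>M PiM J (%_. borel)"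
 unfolding block_map_def
 by (intro measurable_restrict measurable_compose[OF measurable_pair_sum_pow measurable_component_singleton]) auto

text \<open>Refining the level by one changes nothing, since pair sums at level m + 1 are
  distributed as level m. Independence of N gives projectivity: a set of indices and its subsets can
  be read off from the same level.\<close>

lemma dyadic_marginal_eq:
 assumes "finite J" and N: "!!i. i \<in> J ==> fst i \<le> N"
 shows "dyadic_marginal J = distr (dyadic_gauss N) (PiM J (%_. borel)) (block_map N J)"
proof -
 have le: "top_level J \<le> N" using assms by (auto simp: top_level_def)
 have le': "fst i \<le> top_level J" if "i \<in> J" for i using that assms(1) by (auto simp: top_level_def)
 show ?thesis using le
 proof (induction rule: dec_induct)
  case base
  show ?case by (simp add: dyadic_marginal_def)
 next
  case (step m)
  have *: "block_map (Suc m) J x = block_map m J (pair_sum x)" for x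
  proof -
   have "(pair_sum ^^ (Suc m - fst i)) x = (pair_sum ^^ (m - fst i)) (pair_sum x)" if "i \<in> J" for i
   proof -
    have "Suc m - fst i = Suc (m - fst i)" using le'[OF that] step by linarith
    then show ?thesis by (simp add: funpow_swap1)
   qed
   then show ?thesis unfolding block_map_def by (intro restrict_ext) simp
  qed
  have "dyadic_marginal J = distr (distr (dyadic_gauss (Suc m)) (PiM UNIV (%_. borel)) pair_sum) (PiM J (%_. borel)) (block_map m J)"
   unfolding distr_pair_sum by (rule step.IH)
  also have "\<dots> = distr (dyadic_gauss (Suc m)) (PiM J (%_. borel)) (block_map (Suc m) J)"
   by (subst distr_distr) (auto simp: comp_def *[symmetric])
  finally show ?case .
 qed
qed

text \<open>Kolmogorov extension over the countable set of all dyadic intervals; J is compared with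
  the larger set H at the top level of H.\<close>

interpretation BM: polish_projective UNIV dyadic_marginal
proof (intro polish_projective.intro projective_family.intro, goal_cases)
 case (1 J H)
 then have JH: "J \<subseteq> H" "finite H" by auto
 define N where "N = top_level H"
 have N: "fst i \<le> N" if "i \<in> H" for i using that JH by (auto simp: N_def top_level_def)
 have "dyadic_marginal J = distr (dyadic_gauss N) (PiM J (%_. borel)) (block_map N J)"
  using JH N by (intro dyadic_marginal_eq) (auto intro: finite_subset)
 also have "\<dots> = distr (distr (dyadic_gauss N) (PiM H (%_. borel)) (block_map N H)) (PiM J (%_. borel)) (%f. restrict f J)"
  using JH by (subst distr_distr) (auto simp: comp_def block_map_def[abs_def] Int_absorb1 intro: measurable_restrict_subset)
 also have "distr (dyadic_gauss N) (PiM H (%_. borel)) (block_map N H) = dyadic_marginal H"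
  using JH N by (intro dyadic_marginal_eq[symmetric]) auto
 finally show ?case .
next
 case (2 J)
 show ?case unfolding dyadic_marginal_def by (intro prob_space.prob_space_distr prob_space_dyadic_gauss) simp
qed

abbreviation "BML \<equiv> BM.lim"

lemma measurable_BML [simp]: "measurable BML N = measurable (PiM UNIV (%_. borel)) N"
 by (rule measurable_cong_sets) simp_all

lemma distr_BML:
 assumes J: "finite J" shows "distr BML (PiM J (%_. borel)) (%x. restrict x J) = dyadic_marginal J"
proof (rule measure_eqI)
 fix X assume "X \<in> sets (distr BML (PiM J (%_. borel)) (%x. restrict x J))"
 then have X: "X \<in> sets (PiM J (%_. borel))" by simp
 have "emeasure (distr BML (PiM J (%_. borel)) (%x. restrict x J)) X = emeasure BML (prod_emb UNIV (%_. borel) J X)"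
  using X by (subst emeasure_distr) (auto simp: prod_emb_def space_PiM intro!: measurable_restrict_subset)
 then show "emeasure (distr BML (PiM J (%_. borel)) (%x. restrict x J)) X = emeasure (dyadic_marginal J) X"
  using BM.emeasure_lim_emb[OF _ J X] by simp
qed (simp add: dyadic_marginal_def)

lemma BML_level:
 fixes m n :: nat
 shows "distr BML (PiM {..<m} (%_. borel)) (%x. \<lambda>k\<in>{..<m}. x (n, k)) = PiM {..<m} (%_. gauss ((1/2) ^ n))"
proof -
 define J where "J = {n} \<times> {..<m}"
 have J: "finite J" by (simp add: J_def)
 have re: "(%y. \<lambda>k\<in>{..<m}. y (n, k)) \<in> PiM J (%_. borel) \<rightarrow>\<^sub>M PiM {..<m} (%_. borel :: real measure)"
  by (intro measurable_restrict measurable_component_singleton) (auto simp: J_def)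
 have rJ: "(%x. restrict x J) \<in> BML \<rightarrow>\<^sub>M PiM J (%_. borel)"
  by (simp add: measurable_restrict_subset)
 have "distr BML (PiM {..<m} (%_. borel)) (%x. \<lambda>k\<in>{..<m}. x (n, k)) =
   distr (distr BML (PiM J (%_. borel)) (%x. restrict x J)) (PiM {..<m} (%_. borel)) (%y. \<lambda>k\<in>{..<m}. y (n, k))"
  by (subst distr_distr[OF re rJ], rule distr_cong) (auto simp: J_def)
 also have "\<dots> = distr (distr (dyadic_gauss n) (PiM J (%_. borel)) (block_map n J)) (PiM {..<m} (%_. borel)) (%y. \<lambda>k\<in>{..<m}. y (n, k))"
  unfolding distr_BML[OF J] using J by (subst dyadic_marginal_eq[of J n]) (auto simp: J_def)
 also have "\<dots> = distr (dyadic_gauss n) (PiM {..<m} (%_. borel)) (%x. restrict x {..<m})"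
  by (subst distr_distr[OF re], simp, rule distr_cong) (auto simp: J_def block_map_def)
 also have "\<dots> = PiM {..<m} (%_. gauss ((1/2) ^ n))"
 proof -
  interpret product_prob_space "%_. gauss ((1/2) ^ n)" "UNIV :: nat set"
   by (simp add: product_prob_space_def product_prob_space_axioms_def product_sigma_finite_def
     prob_space_gauss prob_space_imp_sigma_finite)
  have "distr (dyadic_gauss n) (PiM {..<m} (%_. borel)) (%x. restrict x {..<m}) =
    distr (PiM UNIV (%_. gauss ((1/2) ^ n))) (PiM {..<m} (%_. gauss ((1/2) ^ n))) (%x. restrict x {..<m})"
   unfolding dyadic_gauss_def by (rule distr_cong) (auto intro!: sets_PiM_cong)
  then show ?thesis using distr_PiM_restrict_finite[of "{..<m}"] by simp
 qed
 finally show ?thesis .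
qed

lemma BML_component: "distr BML borel (%x. x (n, k)) = gauss ((1/2) ^ n)"
proof -
 have "distr BML borel (%x. x (n, k)) = distr (distr BML (PiM {..<Suc k} (%_. borel)) (%x. \<lambda>k\<in>{..<Suc k}. x (n, k))) borel (%y. y k)"
  by (subst distr_distr) (auto simp: comp_def intro!: measurable_restrict)
 also have "\<dots> = gauss ((1/2) ^ n)"
  unfolding BML_level using distr_PiM_component[of "{..<Suc k}" "%_. gauss ((1/2) ^ n)" k] prob_space_gauss[of "(1/2)^n"]
  by (simp cong: distr_cong)
 finally show ?thesis .
qed

lemma BML_indep: "BM.P.indep_vars (%_. borel) (%k x. x (n, k)) {..<m}"
proof (cases "m = 0")
 case True
 then show ?thesis by (simp add: BM.P.indep_vars_def BM.P.indep_sets_def)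
next
 case False
 then show ?thesis by (subst BM.P.indep_vars_iff_distr_eq_PiM') (auto simp: BML_level BML_component)
qed

text \<open>Additivity over the two halves is exact on the image of \<open>block_map\<close>, but
  under the limit measure it holds only almost surely; the exceptional set is discarded in
  \<open>bm_good\<close>.\<close>

lemma BML_split: "AE x in BML. x (n, k) = x (Suc n, 2 * k) + x (Suc n, Suc (2 * k))"
proof -
 define J where "J = {(n, k), (Suc n, 2 * k), (Suc n, Suc (2 * k))}"
 have J: "finite J" by (simp add: J_def)
 let ?P = "%y :: nat \<times> nat => real. y (n, k) = y (Suc n, 2 * k) + y (Suc n, Suc (2 * k))"
 have rJ: "(%x. restrict x J) \<in> BML \<rightarrow>\<^sub>M PiM J (%_. borel)"
  by (simp add: measurable_restrict_subset)
 have eq: "distr BML (PiM J (%_. borel)) (%x. restrict x J) = distr (dyadic_gauss (Suc n)) (PiM J (%_. borel)) (block_map (Suc n) J)"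
  unfolding distr_BML[OF J] by (rule dyadic_marginal_eq) (auto simp: J_def)
 have c: "(%y. y i) \<in> borel_measurable (PiM J (%_. borel :: real measure))" if "i \<in> J" for i
  using that by simp
 have m: "{y \<in> space (PiM J (%_. borel)). ?P y} \<in> sets (PiM J (%_. borel))"
  by (intro borel_measurable_eq borel_measurable_add c) (auto simp: J_def)
 have "AE y in distr (dyadic_gauss (Suc n)) (PiM J (%_. borel)) (block_map (Suc n) J). ?P y"
  by (subst AE_distr_iff[OF _ m]) (auto simp: block_map_def J_def pair_sum_def)
 then have "AE y in distr BML (PiM J (%_. borel)) (%x. restrict x J). ?P y" unfolding eq .
 then show ?thesis by (subst (asm) AE_distr_iff[OF rJ m]) (simp add: J_def)
qed

section \<open>Polygonal paths and their uniform convergence\<close>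

definition clamp01 :: "real => real" where
 "clamp01 u = max 0 (min 1 u)"

text \<open>The polygonal path on [0,K] through the partial sums of the level-n increments: each
  increment is spread linearly over its interval.\<close>

definition interp :: "nat => nat => (nat \<times> nat => real) => real => real" where
 "interp K n x t = (\<Sum>k<K * 2 ^ n. x (n, k) * clamp01 (2 ^ n * t - real k))"

definition additive_increments :: "(nat \<times> nat => real) => bool" where
 "additive_increments x \<longleftrightarrow> (\<forall>n k. x (n, k) = x (Suc n, 2 * k) + x (Suc n, Suc (2 * k)))"

text \<open>The ratio 9/10 is below 1, so these bounds are summable, while its fourth power 0.6561
  exceeds 1/2: by the fourth-moment estimate the chance that one of the K 2^n increments reaches
  (9/10)^n is at most 3K (5000/6561)^n, which is summable too.\<close>

definition small_increments :: "nat => (nat \<times> nat => real) => bool" where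
 "small_increments K x \<longleftrightarrow> (\<exists>N. \<forall>n\<ge>N. \<forall>k<K * 2 ^ n. \<bar>x (n, k)\<bar> \<le> (9/10) ^ n)"

lemma sum_lessThan_double: "(\<Sum>j<2 * m. f j) = (\<Sum>k<m. f (2 * k) + f (Suc (2 * k)) :: real)"
 by (induction m) auto

lemma interp_diff:
 assumes "additive_increments x"
 shows "interp K (Suc n) x t - interp K n x t = (\<Sum>k<K * 2 ^ n.
  x (Suc n, 2 * k) * (clamp01 (2 * (2 ^ n * t - real k)) - clamp01 (2 ^ n * t - real k)) +
  x (Suc n, Suc (2 * k)) * (clamp01 (2 * (2 ^ n * t - real k) - 1) - clamp01 (2 ^ n * t - real k)))"
proof -
 have x: "x (n, k) = x (Suc n, 2 * k) + x (Suc n, Suc (2 * k))" for k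
  using assms unfolding additive_increments_def by blast
 have "interp K (Suc n) x t = (\<Sum>j<2 * (K * 2 ^ n). x (Suc n, j) * clamp01 (2 ^ Suc n * t - real j))"
  unfolding interp_def by (rule sum.cong) simp_all
 also have "\<dots> = (\<Sum>k<K * 2 ^ n. x (Suc n, 2 * k) * clamp01 (2 * (2 ^ n * t - real k)) +
   x (Suc n, Suc (2 * k)) * clamp01 (2 * (2 ^ n * t - real k) - 1))"
  unfolding sum_lessThan_double by (intro sum.cong refl) (simp add: algebra_simps)
 finally have 1: "interp K (Suc n) x t = \<dots>" .
 show ?thesis unfolding 1 unfolding interp_def x sum_subtractf[symmetric]
  by (intro sum.cong refl) (simp only: algebra_simps)
qed

lemma clamp01_double_diff:
 "\<bar>clamp01 (2 * v) - clamp01 v\<bar> \<le> 1" "\<bar>clamp01 (2 * v - 1) - clamp01 v\<bar> \<le> 1"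
 "v \<le> 0 \<or> 1 \<le> v ==> clamp01 (2 * v) = clamp01 v" "v \<le> 0 \<or> 1 \<le> v ==> clamp01 (2 * v - 1) = clamp01 v"
 by (auto simp: clamp01_def)

text \<open>Refinement alters the polygon only inside coarse intervals. For given t at most the
  index floor(2^n t) contributes, with two fine increments of size at most c each.\<close>

lemma interp_diff_le:
 assumes "additive_increments x" and c: "0 \<le> c" "!!k. k < K * 2 ^ Suc n ==> \<bar>x (Suc n, k)\<bar> \<le> c"
 shows "\<bar>interp K (Suc n) x t - interp K n x t\<bar> \<le> 2 * c"
proof -
 let ?u = "2 ^ n * t"
 have "\<bar>interp K (Suc n) x t - interp K n x t\<bar> \<le> (\<Sum>k<K * 2 ^ n. if k = nat \<lfloor>?u\<rfloor> then 2 * c else 0)"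
  unfolding interp_diff[OF assms(1)]
 proof (rule order_trans[OF sum_abs], rule sum_mono)
  fix k assume k: "k \<in> {..<K * 2 ^ n}"
  let ?v = "?u - real k"
  have a: "\<bar>x (Suc n, 2 * k)\<bar> \<le> c" "\<bar>x (Suc n, Suc (2 * k))\<bar> \<le> c" using k by (auto intro!: c)
  show "\<bar>x (Suc n, 2 * k) * (clamp01 (2 * ?v) - clamp01 ?v) +
    x (Suc n, Suc (2 * k)) * (clamp01 (2 * ?v - 1) - clamp01 ?v)\<bar> \<le> (if k = nat \<lfloor>?u\<rfloor> then 2 * c else 0)"
  proof (cases "k = nat \<lfloor>?u\<rfloor>")
   case True
   have "\<bar>x (Suc n, 2 * k) * (clamp01 (2 * ?v) - clamp01 ?v)\<bar> \<le> c * 1"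
    unfolding abs_mult using a clamp01_double_diff(1)[of ?v] c(1) by (intro mult_mono) auto
   moreover have "\<bar>x (Suc n, Suc (2 * k)) * (clamp01 (2 * ?v - 1) - clamp01 ?v)\<bar> \<le> c * 1"
    unfolding abs_mult using a clamp01_double_diff(2)[of ?v] c(1) by (intro mult_mono) auto
   ultimately show ?thesis unfolding if_P[OF True] by linarith
  next
   case False
   have "?v \<le> 0 \<or> 1 \<le> ?v"
   proof (rule ccontr)
    assume "\<not> ?thesis"
    then have "\<lfloor>?u\<rfloor> = int k" by (intro floor_unique) auto
    then show False using False by simp
   qed
   from clamp01_double_diff(3,4)[OF this] show ?thesis
    by (simp only: if_not_P[OF False] diff_self mult_zero_right add_0_right abs_zero order_refl)
  qed
 qed
 also have "\<dots> \<le> 2 * c" using c(1) by (simp add: sum.delta)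
 finally show ?thesis .
qed

lemma interp_grid:
 assumes "j \<le> K * 2 ^ n" shows "interp K n x (real j / 2 ^ n) = (\<Sum>k<j. x (n, k))"
proof -
 have "interp K n x (real j / 2 ^ n) = (\<Sum>k<K * 2 ^ n. if k < j then x (n, k) else 0)"
  unfolding interp_def by (intro sum.cong refl) (auto simp: clamp01_def)
 also have "\<dots> = (\<Sum>k\<in>{..<K * 2 ^ n} \<inter> {k. k < j}. x (n, k))" by (simp add: sum.If_cases)
 also have "{..<K * 2 ^ n} \<inter> {k. k < j} = {..<j}" using assms by auto
 finally show ?thesis .
qed

text \<open>Grid points of level n are vertices of all finer polygons: there 2^m t is an integer,
  and the clamp differences in \<open>interp_diff\<close> vanish.\<close>

lemma interp_grid_stable:
 assumes "additive_increments x" "n \<le> m"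
 shows "interp K m x (real j / 2 ^ n) = interp K n x (real j / 2 ^ n)" using assms(2)
proof (induction rule: dec_induct)
 case (step m)
 define i where "i = j * 2 ^ (m - n)"
 have "(2::real) ^ m = 2 ^ (m - n) * 2 ^ n" using step by (simp flip: power_add)
 then have i: "2 ^ m * (real j / 2 ^ n) = real i" by (simp add: i_def)
 have "interp K (Suc m) x (real j / 2 ^ n) - interp K m x (real j / 2 ^ n) = 0" unfolding interp_diff[OF assms(1)] i
 proof (rule sum.neutral, rule ballI)
  fix k
  have "real i - real k \<le> 0 \<or> 1 \<le> real i - real k" by (cases "i \<le> k") auto
  from clamp01_double_diff(3,4)[OF this]
  show "x (Suc m, 2 * k) * (clamp01 (2 * (real i - real k)) - clamp01 (real i - real k)) +
    x (Suc m, Suc (2 * k)) * (clamp01 (2 * (real i - real k) - 1) - clamp01 (real i - real k)) = 0"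
   by (simp only: diff_self mult_zero_right add_0_right)
 qed
 then show ?case using step by simp
qed simp

definition bm_path :: "nat => (nat \<times> nat => real) => real => real" where
 "bm_path K x t = lim (%n. interp K n x t)"

lemma continuous_on_interp: "continuous_on A (interp K n x)"
 unfolding interp_def clamp01_def by (intro continuous_intros)

lemma interp_uniform_limit:
 assumes a: "additive_increments x" and s: "small_increments K x"
 shows "uniform_limit UNIV (%n. interp K n x) (bm_path K x) sequentially"
proof -
 obtain N where N: "!!n k. n \<ge> N ==> k < K * 2 ^ n ==> \<bar>x (n, k)\<bar> \<le> (9/10) ^ n"
  using s by (auto simp: small_increments_def)
 \<comment> \<open>The series starts at level N, from where on the increments obey the geometric
   bound.\<close>
 let ?d = "%i t. interp K (Suc (i + N)) x t - interp K (i + N) x t"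
 have "uniform_limit UNIV (%n t. \<Sum>i<n. ?d i t) (%t. suminf (%i. ?d i t)) sequentially"
 proof (rule Weierstrass_m_test)
  show "norm (?d i t) \<le> 2 * (9/10) ^ Suc (i + N)" for i t
   using interp_diff_le[OF a, of "(9/10) ^ Suc (i + N)" K "i + N" t] N[of "Suc (i + N)"] by simp
  have "summable (%i. (2 * (9/10) ^ Suc N) * (9/10::real) ^ i)"
   by (intro summable_mult summable_geometric) auto
  then show "summable (%i. 2 * (9/10::real) ^ Suc (i + N))" by (simp add: power_add ac_simps)
 qed
 then have "uniform_limit UNIV (%n t. interp K N x t + (\<Sum>i<n. ?d i t)) (%t. interp K N x t + suminf (%i. ?d i t)) sequentially"
  by (intro uniform_limit_intros)
 moreover have "interp K N x t + (\<Sum>i<n. ?d i t) = interp K (n + N) x t" for n t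
  using sum_lessThan_telescope[of "%n. interp K (n + N) x t" n] by simp
 ultimately have *: "uniform_limit UNIV (%n. interp K (n + N) x) (%t. interp K N x t + suminf (%i. ?d i t)) sequentially"
  by (simp only:)
 have lim: "bm_path K x t = interp K N x t + suminf (%i. ?d i t)" for t
  unfolding bm_path_def using tendsto_uniform_limitI[OF *, of t] by (intro limI) (simp add: LIMSEQ_offset)
 then have "uniform_limit UNIV (%n. interp K (n + N) x) (bm_path K x) sequentially" using * by presburger
 then show ?thesis unfolding uniform_limit_iff eventually_sequentially
  by (metis (no_types, opaque_lifting) le_add_diff_inverse2 nat_le_iff_add add_leD2 le_diff_conv2)
qed

lemma continuous_on_bm_path:
 assumes "additive_increments x" "small_increments K x"
 shows "continuous_on UNIV (bm_path K x)" by (rule uniform_limit_theorem[OF _ interp_uniform_limit[OF assms]])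
  (auto intro!: always_eventually continuous_on_interp)

lemma bm_path_grid:
 assumes a: "additive_increments x" and j: "j \<le> K * 2 ^ n"
 shows "bm_path K x (real j / 2 ^ n) = (\<Sum>k<j. x (n, k))" unfolding bm_path_def
proof (rule limI, rule tendsto_eventually)
 show "\<forall>\<^sub>F m in sequentially. interp K m x (real j / 2 ^ n) = (\<Sum>k<j. x (n, k))"
  using interp_grid_stable[OF a] interp_grid[OF j] by (intro eventually_sequentiallyI[of n]) simp
qed

lemma measurable_coord_BML: "(%x. x i) \<in> borel_measurable BML" by simp

lemma gauss_fourth_moment:
 assumes v: "0 < v"
 shows "integrable (gauss v) (%x. x ^ 4)" "(\<integral>x. x ^ 4 \<partial>gauss v) = 3 * v\<^sup>2"
proof -
 have eq: "fact (2 * 2) / ((2 / (sqrt v)\<^sup>2)\<^sup>2 * fact 2) = 3 * v\<^sup>2"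
  using v by (simp add: fact_numeral power_divide)
 have "has_bochner_integral lborel (%x. normal_density 0 (sqrt v) x *\<^sub>R x ^ 4) (3 * v\<^sup>2)"
  using normal_moment_even[of "sqrt v" 0 2] v unfolding eq by simp
 then have "has_bochner_integral (gauss v) (%x. x ^ 4) (3 * v\<^sup>2)"
  unfolding gauss_def by (intro has_bochner_integral_density) auto
 then show "integrable (gauss v) (%x. x ^ 4)" "(\<integral>x. x ^ 4 \<partial>gauss v) = 3 * v\<^sup>2"
  by (auto simp: has_bochner_integral_iff)
qed

text \<open>Markov's inequality for the fourth moment 3/4^n against ((9/10)^n)^4 =
  (6561/10000)^n.\<close>

lemma BML_large_prob: "measure BML {x \<in> space BML. (9/10) ^ n \<le> \<bar>x (n, k)\<bar>} \<le> 3 * (10000 / (4 * 6561)) ^ n"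
proof -
 have i: "integrable BML (%x. x (n, k) ^ 4)" "(\<integral>x. x (n, k) ^ 4 \<partial>BML) = 3 * ((1/2) ^ n)\<^sup>2"
  using gauss_fourth_moment[of "(1/2)^n"] integrable_distr_eq[of "%x. x (n, k)" BML borel "%x. x ^ 4"]
   integral_distr[of "%x. x (n, k)" BML borel "%x. x ^ 4"] by (simp_all add: BML_component)
 have "{x \<in> space BML. (9/10) ^ n \<le> \<bar>x (n, k)\<bar>} \<subseteq> {x \<in> space BML. ((9/10) ^ n) ^ 4 \<le> x (n, k) ^ 4}"
 proof safe
  fix x :: "nat \<times> nat => real" assume "(9/10) ^ n \<le> \<bar>x (n, k)\<bar>"
  then have "((9/10) ^ n) ^ 4 \<le> \<bar>x (n, k)\<bar> ^ 4" by (rule power_mono) simp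
  then show "((9/10) ^ n) ^ 4 \<le> x (n, k) ^ 4" by simp
 qed
 then have "measure BML {x \<in> space BML. (9/10) ^ n \<le> \<bar>x (n, k)\<bar>} \<le> measure BML {x \<in> space BML. ((9/10) ^ n) ^ 4 \<le> x (n, k) ^ 4}"
  by (intro BM.P.finite_measure_mono borel_measurable_le borel_measurable_power borel_measurable_const measurable_coord_BML)
 also have "\<dots> \<le> (\<integral>x. x (n, k) ^ 4 \<partial>BML) / ((9/10) ^ n) ^ 4"
  using i by (intro integral_Markov_inequality_measure[where A = "{}"]) auto
 also have "\<dots> = 3 * (10000 / (4 * 6561)) ^ n"
 proof -
  have "((1/2::real) ^ n)\<^sup>2 = (1/4) ^ n" by (simp add: power2_eq_square flip: power_mult_distrib)
  moreover have "((9/10::real) ^ n) ^ 4 = (6561/10000) ^ n"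
  proof -
   have "((9/10::real) ^ n) ^ 4 = ((9/10) ^ 4) ^ n" by (simp only: power_mult[symmetric] mult.commute)
   also have "(9/10::real) ^ 4 = 6561/10000" by (simp add: power_divide)
   finally show ?thesis .
  qed
  moreover have "3 * (1/4) ^ n / (6561/10000) ^ n = 3 * ((1/4) / (6561/10000) :: real) ^ n"
   by (simp only: power_divide times_divide_eq_right)
  ultimately show ?thesis unfolding i(2) by simp
 qed
 finally show ?thesis .
qed

lemma AE_small_increments: "AE x in BML. small_increments K x"
proof -
 define A where "A n = {x \<in> space BML. \<exists>k\<in>{..<K * 2 ^ n}. (9/10) ^ n \<le> \<bar>x (n, k)\<bar>}" for n
 have A: "A n = (\<Union>k\<in>{..<K * 2 ^ n}. {x \<in> space BML. (9/10) ^ n \<le> \<bar>x (n, k)\<bar>})" for n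
  by (auto simp: A_def)
 have s: "{x \<in> space BML. (9/10) ^ n \<le> \<bar>x (n, k)\<bar>} \<in> sets BML" for n k :: nat
  by (intro borel_measurable_le borel_measurable_abs borel_measurable_const measurable_coord_BML)
 have "AE x in BML. eventually (%n. x \<in> space BML - A n) sequentially"
 proof (rule borel_cantelli_AE1)
  show "A n \<in> sets BML" for n unfolding A by (intro sets.finite_UN s) auto
  show "summable (%n. measure BML (A n))"
  proof (rule summable_comparison_test', rule summable_mult[OF summable_geometric])
   show "norm (5000 / 6561 :: real) < 1" by simp
   fix n :: nat
   have "measure BML (A n) \<le> (\<Sum>k<K * 2 ^ n. measure BML {x \<in> space BML. (9/10) ^ n \<le> \<bar>x (n, k)\<bar>})"
    unfolding A by (rule BM.P.finite_measure_subadditive_finite) (use s in auto)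
   also have "\<dots> \<le> (\<Sum>k<K * 2 ^ n. 3 * (10000 / (4 * 6561)) ^ n)" by (intro sum_mono BML_large_prob)
   also have "\<dots> = 3 * real K * (2 ^ n * (10000 / (4 * 6561)) ^ n)" by simp
   also have "2 ^ n * (10000 / (4 * 6561)) ^ n = (5000 / 6561 :: real) ^ n"
    by (subst power_mult_distrib[symmetric]) simp
   finally show "norm (measure BML (A n)) \<le> 3 * real K * (5000 / 6561) ^ n" by simp
  qed
 qed (simp add: less_top[symmetric])
 then show ?thesis
 proof (rule AE_mp, intro AE_I2 impI)
  fix x assume "x \<in> space BML" "eventually (%n. x \<in> space BML - A n) sequentially"
  then obtain N where "!!n. n \<ge> N ==> x \<in> space BML - A n" by (auto simp: eventually_sequentially)
  then show "small_increments K x"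
   unfolding small_increments_def A_def by (intro exI[of _ N]) (auto simp: not_le intro: less_imp_le)
 qed
qed

lemma AE_additive_increments: "AE x in BML. additive_increments x"
 unfolding additive_increments_def by (intro AE_all_countable[THEN iffD2] allI BML_split)

definition bm_good :: "nat => (nat \<times> nat => real) set" where
 "bm_good K = {x \<in> space BML. additive_increments x \<and> small_increments K x}"

lemma bm_good_sets [measurable]: "bm_good K \<in> sets BML"
 unfolding bm_good_def additive_increments_def small_increments_def
 by (intro sets.sets_Collect_conj sets.sets_Collect_countable_All sets.sets_Collect_countable_Ex
   sets.sets_Collect_imp sets.sets_Collect_const borel_measurable_eq borel_measurable_le
   borel_measurable_add borel_measurable_abs borel_measurable_const measurable_coord_BML)

lemma AE_bm_good: "AE x in BML. x \<in> bm_good K"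
 using AE_small_increments[of K] AE_additive_increments by eventually_elim (simp add: bm_good_def space_PiM PiE_UNIV_domain)

text \<open>Set to zero on the exceptional null set, because \<open>brownian_motion\<close> demands
  a continuous path starting at 0 for every sample point.\<close>

definition bm :: "nat => real => (nat \<times> nat => real) => real" where
 "bm K t x = (if x \<in> bm_good K then bm_path K x t else 0)"

lemma measurable_bm [measurable]: "bm K t \<in> borel_measurable BML"
proof -
 have "(%x. if x \<in> bm_good K then interp K n x t else 0) \<in> borel_measurable BML" for n
  unfolding interp_def
  by (intro measurable_If_set borel_measurable_sum borel_measurable_times measurable_coord_BML borel_measurable_const)
   (simp add: Int_absorb2 sets.sets_into_space bm_good_sets del: BM.sets_lim BM.space_lim)
 moreover have "(%n. if x \<in> bm_good K then interp K n x t else 0) \<longlonglongrightarrow> bm K t x" for x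
  using tendsto_uniform_limitI[OF interp_uniform_limit, of x K t] by (auto simp: bm_def bm_good_def)
 ultimately show ?thesis by (rule borel_measurable_LIMSEQ_real[rotated])
qed

lemma continuous_bm: "continuous_on A (%t. bm K t x)"
 using continuous_on_bm_path[of x K] by (cases "x \<in> bm_good K") (auto simp: bm_def bm_good_def intro: continuous_on_subset)

lemma bm_0: "bm K 0 x = 0" using bm_path_grid[of x 0 K 0] by (auto simp: bm_def bm_good_def)

lemma bm_grid: "x \<in> bm_good K ==> j \<le> K * 2 ^ n ==> bm K (real j / 2 ^ n) x = (\<Sum>k<j. x (n, k))"
 using bm_path_grid by (auto simp: bm_def bm_good_def)

section \<open>Law and independence of the increments by passage to the limit\<close>

lemma atMost_continuous_approx:
 fixes a :: real
 obtains f :: "nat => real => real" where "!!m. continuous_on UNIV (f m)" "!!m x. 0 \<le> f m x \<and> f m x \<le> 1"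
  "!!x. (%m. f m x) \<longlonglongrightarrow> indicator {..a} x"
proof (rule that[of "%m x. max 0 (min 1 (1 - real m * (x - a)))"])
 show "continuous_on UNIV (%x. max 0 (min 1 (1 - real m * (x - a))))" for m by (intro continuous_intros)
 show "(%m. max 0 (min 1 (1 - real m * (x - a)))) \<longlonglongrightarrow> indicator {..a} x" for x
 proof (cases "x \<le> a")
  case True
  then have "max 0 (min 1 (1 - real m * (x - a))) = 1" for m by (simp add: mult_nonneg_nonpos)
  then show ?thesis using True by simp
 next
  case False
  obtain N where N: "1 / (x - a) < real N" using reals_Archimedean2 by blast
  have "max 0 (min 1 (1 - real m * (x - a))) = 0" if "m \<ge> N" for m
  proof -
   have "1 < real N * (x - a)" using N False by (simp add: divide_less_eq)
   also have "\<dots> \<le> real m * (x - a)" using that False by (intro mult_right_mono) auto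
   finally show ?thesis by simp
  qed
  then have "\<forall>\<^sub>F m in sequentially. max 0 (min 1 (1 - real m * (x - a))) = 0"
   by (auto simp: eventually_sequentially)
  then show ?thesis using False by (simp add: tendsto_eventually)
 qed
qed auto

text \<open>The product formula passes to the limit by dominated convergence for continuous
  functions with values in [0,1]. A second limit, towards indicators of half-lines, gives
  independence on a generator of the Borel sets.\<close>

lemma (in prob_space) indep_vars_lim:
 fixes X :: "nat => 'i => 'a => real"
 assumes I: "finite I" and ind: "!!r. indep_vars (%_. borel) (X r) I"
  and Y: "!!i. i \<in> I ==> Y i \<in> borel_measurable M"
  and lim: "AE z in M. \<forall>i\<in>I. (%r. X r i z) \<longlonglongrightarrow> Y i z"
 shows "indep_vars (%_. borel) Y I"
proof (cases "I = {}")
 case True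
 then show ?thesis by (simp add: indep_vars_def indep_sets_def)
next
 case False
 have X: "X r i \<in> borel_measurable M" if "i \<in> I" for r i using ind[of r] that by (auto simp: indep_vars_def)
 have cont: "(\<integral>z. (\<Prod>i\<in>I. \<phi> i (Y i z)) \<partial>M) = (\<Prod>i\<in>I. \<integral>z. \<phi> i (Y i z) \<partial>M)"
  if \<phi>: "!!i. i \<in> I ==> continuous_on UNIV (\<phi> i)" "!!i x. 0 \<le> \<phi> i x \<and> \<phi> i x \<le> (1::real)" for \<phi> :: "'i => real => real"
 proof -
  have m\<phi>: "\<phi> i \<in> borel_measurable borel" if "i \<in> I" for i
   using \<phi>(1)[OF that] by (rule borel_measurable_continuous_onI)
  have mc: "(%z. \<phi> i (Z z)) \<in> borel_measurable M" if "i \<in> I" "Z \<in> borel_measurable M" for i Z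
   using that(2) m\<phi>[OF that(1)] by (rule measurable_compose)
  have p1: "norm (\<Prod>i\<in>I. \<phi> i (Z i)) \<le> 1" for Z
   using \<phi>(2) by (auto simp: abs_prod intro!: prod_le_1)
  have eq: "(\<integral>z. (\<Prod>i\<in>I. \<phi> i (X r i z)) \<partial>M) = (\<Prod>i\<in>I. \<integral>z. \<phi> i (X r i z) \<partial>M)" for r
  proof (rule indep_vars_lebesgue_integral[OF I])
   show "indep_vars (%_. borel) (%i z. \<phi> i (X r i z)) I"
    by (rule indep_vars_compose2[OF ind m\<phi>])
   show "integrable M (%z. \<phi> i (X r i z))" if "i \<in> I" for i
    using \<phi>(2) by (intro integrable_const_bound[of _ 1] mc X that) auto
  qed
  have "(%r. \<integral>z. (\<Prod>i\<in>I. \<phi> i (X r i z)) \<partial>M) \<longlonglongrightarrow> (\<integral>z. (\<Prod>i\<in>I. \<phi> i (Y i z)) \<partial>M)"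
  proof (rule integral_dominated_convergence[where w = "%_. 1"])
   show "AE z in M. (%r. \<Prod>i\<in>I. \<phi> i (X r i z)) \<longlonglongrightarrow> (\<Prod>i\<in>I. \<phi> i (Y i z))"
    using lim by eventually_elim
     (intro tendsto_prod continuous_on_tendsto_compose[OF \<phi>(1)], auto)
  qed (use p1 in \<open>auto intro!: borel_measurable_prod mc X Y\<close>)
  moreover have "(%r. \<Prod>i\<in>I. \<integral>z. \<phi> i (X r i z) \<partial>M) \<longlonglongrightarrow> (\<Prod>i\<in>I. \<integral>z. \<phi> i (Y i z) \<partial>M)"
  proof (rule tendsto_prod)
   fix i assume i: "i \<in> I"
   show "(%r. \<integral>z. \<phi> i (X r i z) \<partial>M) \<longlonglongrightarrow> (\<integral>z. \<phi> i (Y i z) \<partial>M)"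
   proof (rule integral_dominated_convergence[where w = "%_. 1"])
    show "AE z in M. (%r. \<phi> i (X r i z)) \<longlonglongrightarrow> \<phi> i (Y i z)"
     using lim by eventually_elim (intro continuous_on_tendsto_compose[OF \<phi>(1)], use i in auto)
   qed (use \<phi>(2) i in \<open>auto intro!: mc X Y\<close>)
  qed
  ultimately show ?thesis unfolding eq using LIMSEQ_unique by blast
 qed
 \<comment> \<open>The criterion for independence on generators asks that the generator contain the
   whole line.\<close>
 define E where "E = insert UNIV (range (atMost :: real => real set))"
 have "sigma_sets UNIV E = sigma_sets UNIV (range (atMost :: real => real set))"
  unfolding E_def by (rule sigma_sets_eqI) (auto intro: sigma_sets.Basic sigma_sets_top)
 then have sE: "sets borel = sigma_sets UNIV E" unfolding borel_eq_atMost by simp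
 show ?thesis
 proof (subst indep_vars_finite[where E = "%_. E"])
  show "\<forall>A\<in>I \<rightarrow> E. prob (\<Inter>j\<in>I. Y j -` A j \<inter> space M) = (\<Prod>j\<in>I. prob (Y j -` A j \<inter> space M))"
  proof
   fix A assume A: "A \<in> I \<rightarrow> E"
   have "\<exists>f :: nat => real => real. (\<forall>m. continuous_on UNIV (f m)) \<and> (\<forall>m x. 0 \<le> f m x \<and> f m x \<le> 1) \<and>
     (\<forall>x. (%m. f m x) \<longlonglongrightarrow> indicator B x)" if "B \<in> E" for B
   proof (cases "B = UNIV")
    case True
    then show ?thesis by (intro exI[of _ "%_ _. 1"]) auto
   next
    case False
    with that have "B \<in> range atMost" unfolding E_def by blast
    then obtain a where B: "B = {..a}" by (rule rangeE)
    show ?thesis unfolding B by (rule atMost_continuous_approx[of a]) blast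
   qed
   then obtain f :: "real set => nat => real => real" where f: "!!B m. B \<in> E ==> continuous_on UNIV (f B m)"
    "!!B m x. B \<in> E ==> 0 \<le> f B m x \<and> f B m x \<le> 1" "!!B x. B \<in> E ==> (%m. f B m x) \<longlonglongrightarrow> indicator B x"
    by metis
   define \<phi> where "\<phi> m i x = (if i \<in> I then f (A i) m x else 0)" for m i x
   have AE: "A i \<in> E" if "i \<in> I" for i using A that by auto
   have Ab: "A i \<in> sets borel" if "i \<in> I" for i using AE[OF that] unfolding sE by (rule sigma_sets.Basic)
   have \<phi>: "!!i. i \<in> I ==> continuous_on UNIV (\<phi> m i)" "!!i x. 0 \<le> \<phi> m i x \<and> \<phi> m i x \<le> 1"
    "!!i x. i \<in> I ==> (%m. \<phi> m i x) \<longlonglongrightarrow> indicator (A i) x" for m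
    using f AE by (auto simp: \<phi>_def)
   have m\<phi>: "(%z. \<phi> m i (Y i z)) \<in> borel_measurable M" if "i \<in> I" for i m
    by (rule measurable_compose[OF Y[OF that] borel_measurable_continuous_onI[OF \<phi>(1)[OF that]]])
   have p1: "norm (\<Prod>i\<in>I. \<phi> m i (Z i)) \<le> 1" for Z m
    using \<phi>(2) by (auto simp: abs_prod intro!: prod_le_1)
   have mi: "(%z. indicator (A i) (Y i z) :: real) \<in> borel_measurable M" if "i \<in> I" for i
    by (rule measurable_compose[OF Y[OF that] borel_measurable_indicator[OF Ab[OF that]]])
   have l1: "(%m. \<integral>z. (\<Prod>i\<in>I. \<phi> m i (Y i z)) \<partial>M) \<longlonglongrightarrow> (\<integral>z. (\<Prod>i\<in>I. indicator (A i) (Y i z)) \<partial>M)"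
    by (rule integral_dominated_convergence[where w = "%_. 1"])
     (use p1 \<phi>(3) in \<open>auto intro!: borel_measurable_prod m\<phi> mi tendsto_prod\<close>)
   have l2: "(%m. \<Prod>i\<in>I. \<integral>z. \<phi> m i (Y i z) \<partial>M) \<longlonglongrightarrow> (\<Prod>i\<in>I. \<integral>z. indicator (A i) (Y i z) \<partial>M)"
    by (intro tendsto_prod integral_dominated_convergence[where w = "%_. 1"])
     (use \<phi>(2,3) in \<open>auto intro!: m\<phi> mi\<close>)
   have e: "(\<integral>z. (\<Prod>i\<in>I. \<phi> m i (Y i z)) \<partial>M) = (\<Prod>i\<in>I. \<integral>z. \<phi> m i (Y i z) \<partial>M)" for m
    by (rule cont[OF \<phi>(1,2)])
   have *: "(\<integral>z. (\<Prod>i\<in>I. indicat_real (A i) (Y i z)) \<partial>M) = (\<Prod>i\<in>I. \<integral>z. indicator (A i) (Y i z) \<partial>M)"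
    by (rule LIMSEQ_unique[OF l1[unfolded e] l2])
   have s: "Y i -` A i \<inter> space M \<in> events" if "i \<in> I" for i
    using Y[OF that] Ab[OF that] by (rule measurable_sets)
   have "(\<integral>z. indicat_real (A i) (Y i z) \<partial>M) = prob (Y i -` A i \<inter> space M)" if "i \<in> I" for i
   proof -
    have "(\<integral>z. indicat_real (A i) (Y i z) \<partial>M) = (\<integral>z. indicat_real (Y i -` A i \<inter> space M) z \<partial>M)"
     by (intro Bochner_Integration.integral_cong) (auto simp: indicator_def)
    then show ?thesis using s[OF that] by simp
   qed
   moreover have "(\<integral>z. (\<Prod>i\<in>I. indicat_real (A i) (Y i z)) \<partial>M) = prob (\<Inter>j\<in>I. Y j -` A j \<inter> space M)"
   proof -
    have "(\<Prod>i\<in>I. indicat_real (A i) (Y i z)) = indicat_real (\<Inter>j\<in>I. Y j -` A j \<inter> space M) z" if "z \<in> space M" for z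
     using that I False by (auto simp: indicator_def prod_zero_iff)
    then have "(\<integral>z. (\<Prod>i\<in>I. indicat_real (A i) (Y i z)) \<partial>M) = (\<integral>z. indicat_real (\<Inter>j\<in>I. Y j -` A j \<inter> space M) z \<partial>M)"
     by (intro Bochner_Integration.integral_cong) auto
    moreover have "(\<Inter>j\<in>I. Y j -` A j \<inter> space M) \<in> events"
     using I False s by (intro sets.finite_INT) auto
    ultimately show ?thesis by simp
   qed
   ultimately show "prob (\<Inter>j\<in>I. Y j -` A j \<inter> space M) = (\<Prod>j\<in>I. prob (Y j -` A j \<inter> space M))"
    using * by simp
  qed
  show "Int_stable E" for i :: 'i unfolding Int_stable_def E_def by (auto simp: Int_atMost)
 qed (use False I Y sE in \<open>auto simp: E_def\<close>)
qed

lemma char_gauss: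
 assumes v: "0 < v" shows "char (gauss v) u = complex_of_real (exp (- (v * u\<^sup>2) / 2))"
proof -
 interpret N: prob_space std_normal_distribution using real_distribution.axioms(1)[OF real_dist_normal_dist] .
 have "distributed std_normal_distribution lborel (%x. x) std_normal_density"
  unfolding distributed_def by (auto simp: distr_id2)
 then have "distributed std_normal_distribution lborel (%x. 0 + sqrt v * x) (normal_density (0 + sqrt v * 0) (\<bar>sqrt v\<bar> * 1))"
  by (rule N.normal_density_affine) (use v in auto)
 then have "distr std_normal_distribution borel (%x. sqrt v * x) = gauss v"
  using v by (subst N.distr_eq_gauss_iff) auto
 then have "char (gauss v) u = char (distr std_normal_distribution borel (%x. sqrt v * x)) u" by simp
 also have "\<dots> = char std_normal_distribution (sqrt v * u)"
  unfolding char_def by (subst integral_distr) (auto simp: ac_simps)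
 also have "\<dots> = complex_of_real (exp (- (v * u\<^sup>2) / 2))"
  using v by (simp add: char_std_normal_distribution power_mult_distrib)
 finally show ?thesis .
qed

text \<open>The approximants are described by characteristic functions rather than by
  \<open>gauss\<close>, because their variances may vanish; only the limit variance is
  positive.\<close>

lemma (in prob_space) distr_gauss_lim:
 fixes X :: "nat => 'a => real"
 assumes X: "!!r. X r \<in> borel_measurable M" and Y: "Y \<in> borel_measurable M"
  and lim: "AE z in M. (%r. X r z) \<longlonglongrightarrow> Y z"
  and ch: "!!r u. char (distr M borel (X r)) u = complex_of_real (exp (- (v r * u\<^sup>2) / 2))"
  and v: "v \<longlonglongrightarrow> w" "0 < w"
 shows "distr M borel Y = gauss w"
proof (rule Levy_uniqueness)
 show "real_distribution (distr M borel Y)" using Y by (rule real_distribution_distr)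
 show "real_distribution (gauss w)"
  using v prob_space_gauss by (auto simp: real_distribution_def real_distribution_axioms_def)
 show "char (distr M borel Y) = char (gauss w)"
 proof
  fix u
  have c: "char (distr M borel Z) u = (\<integral>z. iexp (u * Z z) \<partial>M)" if "Z \<in> borel_measurable M" for Z
   unfolding char_def using that by (subst integral_distr) auto
  have "(%r. \<integral>z. iexp (u * X r z) \<partial>M) \<longlonglongrightarrow> (\<integral>z. iexp (u * Y z) \<partial>M)"
  proof (rule integral_dominated_convergence[where w = "%_. 1"])
   show "AE z in M. (%r. iexp (u * X r z)) \<longlonglongrightarrow> iexp (u * Y z)"
    using lim by eventually_elim (intro tendsto_intros)
  qed (use X Y in auto)
  then have "(%r. char (distr M borel (X r)) u) \<longlonglongrightarrow> char (distr M borel Y) u"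
   unfolding c[OF X] c[OF Y] .
  moreover have "(%r. complex_of_real (exp (- (v r * u\<^sup>2) / 2))) \<longlonglongrightarrow> complex_of_real (exp (- (w * u\<^sup>2) / 2))"
   by (intro tendsto_intros v) simp
  ultimately show "char (distr M borel Y) u = char (gauss w) u"
   unfolding ch char_gauss[OF v(2)] using LIMSEQ_unique by blast
 qed
qed

definition grid :: "nat => real => nat" where
 "grid r t = nat \<lfloor>2 ^ r * t\<rfloor>"

lemma grid_mono: "s \<le> t ==> grid r s \<le> grid r t"
 unfolding grid_def by (intro nat_mono floor_mono) simp

lemma grid_le: "0 \<le> t ==> t \<le> real K ==> grid r t \<le> K * 2 ^ r"
proof -
 assume t: "0 \<le> t" "t \<le> real K"
 have "grid r t \<le> grid r (real K)" by (rule grid_mono[OF t(2)])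
 also have "2 ^ r * real K = real_of_int (int (K * 2 ^ r))" by simp
 then have "grid r (real K) = K * 2 ^ r" unfolding grid_def by (metis floor_of_int nat_int)
 finally show ?thesis .
qed

lemma grid_lim:
 assumes "0 \<le> t" shows "(%r. real (grid r t) / 2 ^ r) \<longlonglongrightarrow> t"
proof -
 have "(%r. real (grid r t) / 2 ^ r - t) \<longlonglongrightarrow> 0"
 proof (rule Lim_null_comparison[OF always_eventually, rule_format])
  fix r
  have g: "real (grid r t) = real_of_int \<lfloor>2 ^ r * t\<rfloor>" using assms by (simp add: grid_def)
  have "\<bar>real_of_int \<lfloor>2 ^ r * t\<rfloor> - 2 ^ r * t\<bar> \<le> 1" by linarith
  then have "\<bar>real_of_int \<lfloor>2 ^ r * t\<rfloor> - 2 ^ r * t\<bar> / 2 ^ r \<le> 1 / 2 ^ r" by (rule divide_right_mono) simp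
  moreover have "real_of_int \<lfloor>2 ^ r * t\<rfloor> / 2 ^ r - t = (real_of_int \<lfloor>2 ^ r * t\<rfloor> - 2 ^ r * t) / 2 ^ r"
   by (simp add: field_simps)
  ultimately show "norm (real (grid r t) / 2 ^ r - t) \<le> (1/2) ^ r"
   unfolding g real_norm_def by (simp only: abs_divide power_one_over abs_of_pos zero_less_power zero_less_numeral)
 qed (auto intro: LIMSEQ_power_zero)
 then show ?thesis by (simp add: LIM_zero_iff)
qed

definition grid_inc :: "nat => real => real => (nat \<times> nat => real) => real" where
 "grid_inc r s t x = (\<Sum>k\<in>{grid r s..<grid r t}. x (r, k))"

text \<open>At grid points the path is a partial sum of increments; the grid times converge, and
  path continuity does the rest.\<close>

lemma grid_inc_lim:
 assumes st: "0 \<le> s" "s \<le> t" "t \<le> real K"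
 shows "AE x in BML. (%r. grid_inc r s t x) \<longlonglongrightarrow> bm K t x - bm K s x"
 using AE_bm_good[of K]
proof eventually_elim
 fix x assume x: "x \<in> bm_good K"
 have "grid_inc r s t x = bm K (real (grid r t) / 2 ^ r) x - bm K (real (grid r s) / 2 ^ r) x" for r
 proof -
  have g: "grid r s \<le> K * 2 ^ r" "grid r t \<le> K * 2 ^ r" using st by (auto intro!: grid_le)
  have "grid_inc r s t x = (\<Sum>k<grid r t. x (r, k)) - (\<Sum>k<grid r s. x (r, k))"
   using sum_diff_nat_ivl[of 0 "grid r s" "grid r t" "%k. x (r, k)"] grid_mono[OF st(2), of r]
   by (simp add: grid_inc_def lessThan_atLeast0)
  then show ?thesis by (simp only: bm_grid[OF x g(1)] bm_grid[OF x g(2)])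
 qed
 moreover have "(%r. bm K (real (grid r u) / 2 ^ r) x) \<longlonglongrightarrow> bm K u x" if "0 \<le> u" for u
  by (rule continuous_on_tendsto_compose[OF continuous_bm[of UNIV] grid_lim[OF that]]) auto
 ultimately show "(%r. grid_inc r s t x) \<longlonglongrightarrow> bm K t x - bm K s x"
  using st by (auto intro!: tendsto_diff)
qed

lemma measurable_grid_inc: "grid_inc r s t \<in> borel_measurable BML"
 unfolding grid_inc_def by (intro borel_measurable_sum measurable_coord_BML)

lemma char_grid_inc:
 assumes "s \<le> t"
 shows "char (distr BML borel (grid_inc r s t)) u =
  complex_of_real (exp (- ((real (grid r t) / 2 ^ r - real (grid r s) / 2 ^ r) * u\<^sup>2) / 2))"
proof -
 have "char (distr BML borel (grid_inc r s t)) u = (\<Prod>k\<in>{grid r s..<grid r t}. char (distr BML borel (%x. x (r, k))) u)"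
  unfolding grid_inc_def
  by (rule BM.P.char_distr_sum) (rule BM.P.indep_vars_subset[OF BML_indep[of r "grid r t"]], auto)
 also have "\<dots> = complex_of_real (exp (- ((1/2) ^ r * u\<^sup>2) / 2)) ^ (grid r t - grid r s)"
  by (simp add: BML_component char_gauss)
 also have "\<dots> = complex_of_real (exp (real (grid r t - grid r s) * (- ((1/2) ^ r * u\<^sup>2) / 2)))"
  by (subst exp_of_nat_mult) simp
 also have "real (grid r t - grid r s) * (- ((1/2) ^ r * u\<^sup>2) / 2) = - ((real (grid r t) / 2 ^ r - real (grid r s) / 2 ^ r) * u\<^sup>2) / 2"
  using grid_mono[OF assms, of r] by (simp add: of_nat_diff power_divide field_simps)
 finally show ?thesis .
qed

lemma bm_increment_gauss:
 assumes "0 \<le> s" "s < t" "t \<le> real K"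
 shows "distr BML borel (%x. bm K t x - bm K s x) = gauss (t - s)"
proof (rule BM.P.distr_gauss_lim)
 show "AE x in BML. (%r. grid_inc r s t x) \<longlonglongrightarrow> bm K t x - bm K s x"
  using assms by (intro grid_inc_lim) auto
 show "(%r. real (grid r t) / 2 ^ r - real (grid r s) / 2 ^ r) \<longlonglongrightarrow> t - s"
  using assms by (intro tendsto_diff grid_lim) auto
 show "char (distr BML borel (grid_inc r s t)) u =
  complex_of_real (exp (- ((real (grid r t) / 2 ^ r - real (grid r s) / 2 ^ r) * u\<^sup>2) / 2))" for r u
  using assms by (intro char_grid_inc) auto
qed (use assms in \<open>auto intro!: measurable_grid_inc borel_measurable_diff measurable_bm simp del: measurable_BML\<close>)

text \<open>Grid increments between successive times sum over disjoint blocks of independent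
  coordinates, and independence survives the limit.\<close>

lemma bm_increments_indep:
 fixes \<theta> :: "nat => real"
 assumes \<theta>: "mono \<theta>" "range \<theta> \<subseteq> {0..real K}"
 shows "BM.P.indep_vars (%_. borel) (%i x. bm K (\<theta> (Suc i)) x - bm K (\<theta> i) x) {..<n}"
proof (rule BM.P.indep_vars_lim[where X = "%r i. grid_inc r (\<theta> i) (\<theta> (Suc i))"])
 have t: "0 \<le> \<theta> i" "\<theta> i \<le> real K" "\<theta> i \<le> \<theta> (Suc i)" for i
  using \<theta> by (auto simp: mono_def image_subset_iff)
 show "BM.P.indep_vars (%_. borel) (%i. grid_inc r (\<theta> i) (\<theta> (Suc i))) {..<n}" for r
 proof -
  let ?K = "%i. {grid r (\<theta> i)..<grid r (\<theta> (Suc i))}"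
  have disj: "?K i \<inter> ?K j = {}" if "i < j" for i j
  proof -
   have "grid r (\<theta> (Suc i)) \<le> grid r (\<theta> j)" using that \<theta>(1) by (intro grid_mono) (auto simp: mono_def)
   then show ?thesis by auto
  qed
  have "BM.P.indep_vars (%i. PiM (?K i) (%_. borel)) (%i x. restrict (%k. x (r, k)) (?K i)) {..<n}"
  proof (rule BM.P.indep_vars_restrict[OF BML_indep[of r "K * 2 ^ r"]])
   show "?K i \<subseteq> {..<K * 2 ^ r}" for i using grid_le[of "\<theta> (Suc i)" K r] t by auto
   show "disjoint_family_on ?K {..<n}"
    unfolding disjoint_family_on_def using disj by (metis Int_commute linorder_neqE_nat)
  qed
  then have "BM.P.indep_vars (%_. borel) (%i x. (%y. \<Sum>k\<in>?K i. y k) (restrict (%k. x (r, k)) (?K i))) {..<n}"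
   by (rule BM.P.indep_vars_compose2) simp
  then show ?thesis by (simp add: grid_inc_def[abs_def])
 qed
 have "\<forall>i\<in>{..<n}. AE x in BML. (%r. grid_inc r (\<theta> i) (\<theta> (Suc i)) x) \<longlonglongrightarrow> bm K (\<theta> (Suc i)) x - bm K (\<theta> i) x"
  using t by (auto intro!: grid_inc_lim simp del: measurable_BML)
 then show "AE x in BML. \<forall>i\<in>{..<n}. (%r. grid_inc r (\<theta> i) (\<theta> (Suc i)) x) \<longlonglongrightarrow> bm K (\<theta> (Suc i)) x - bm K (\<theta> i) x"
  by (intro AE_finite_allI) auto
qed (auto intro!: borel_measurable_diff measurable_bm simp del: measurable_BML)

section \<open>Uniqueness of the law and Wiener measure\<close>

lemma (in prob_space) indep_vars_distr:
 assumes f: "f \<in> M \<rightarrow>\<^sub>M N" and X: "!!i. i \<in> I ==> X i \<in> N \<rightarrow>\<^sub>M M' i"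
 shows "prob_space.indep_vars (distr M N f) M' X I \<longleftrightarrow> indep_vars M' (%i z. X i (f z)) I"
proof (cases "I = {}")
 case True
 interpret D: prob_space "distr M N f" by (rule prob_space_distr[OF f])
 show ?thesis using True by (simp add: indep_vars_def indep_sets_def D.indep_vars_def D.indep_sets_def)
next
 case False
 interpret D: prob_space "distr M N f" by (rule prob_space_distr[OF f])
 have Xf: "(%z. X i (f z)) \<in> M \<rightarrow>\<^sub>M M' i" if "i \<in> I" for i
  using measurable_compose[OF f X[OF that]] .
 have "PiM I (%i. distr (distr M N f) (M' i) (X i)) = PiM I (%i. distr M (M' i) (%z. X i (f z)))"
  by (intro PiM_cong refl) (simp add: distr_distr f X comp_def)
 moreover have "distr (distr M N f) (PiM I M') (%x. \<lambda>i\<in>I. X i x) = distr M (PiM I M') (%x. \<lambda>i\<in>I. X i (f x))"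
  by (subst distr_distr) (auto simp: comp_def intro!: f X measurable_restrict)
 ultimately show ?thesis
  using D.indep_vars_iff_distr_eq_PiM'[of I X M'] indep_vars_iff_distr_eq_PiM'[of I "%i z. X i (f z)" M'] False X Xf
  by simp
qed

text \<open>The point mass covers increments of length zero: the time sequences below may repeat a
  time, and \<open>gauss 0\<close> is the zero measure.\<close>

definition inc_law :: "real => real measure" where
 "inc_law v = (if v > 0 then gauss v else return borel 0)"

lemma brownian_motionD:
 assumes "brownian_motion T M b"
 shows "prob_space M" "t \<in> {0..T} ==> b t \<in> borel_measurable M"
  "z \<in> space M ==> b 0 z = 0" "z \<in> space M ==> continuous_on {0..T} (%t. b t z)"
  "0 \<le> s ==> s < t ==> t \<le> T ==> distributed M lborel (%z. b t z - b s z) (normal_density 0 (sqrt (t - s)))"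
  "mono \<theta> ==> range \<theta> \<subseteq> {0..T} ==>
   prob_space.indep_vars M (%_. borel) (%i z. b (\<theta> (Suc i)) z - b (\<theta> i) z) {..<n::nat}"
 using assms unfolding brownian_motion_def by blast+

lemma brownian_increment_law:
 assumes b: "brownian_motion T M b" and st: "0 \<le> s" "s \<le> t" "t \<le> T"
 shows "distr M borel (%z. b t z - b s z) = inc_law (t - s)"
proof -
 interpret prob_space M using brownian_motionD[OF b] by simp
 show ?thesis
 proof (cases "s < t")
  case True
  have "(%z. b t z - b s z) \<in> borel_measurable M"
   using st by (intro borel_measurable_diff brownian_motionD(2)[OF b]) auto
  then have "distr M borel (%z. b t z - b s z) = gauss (t - s)"
   using brownian_motionD(5)[OF b st(1) True st(3)] by (simp only: distr_eq_gauss_iff)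
  then show ?thesis using True by (simp add: inc_law_def)
 next
  case False
  then show ?thesis using st by (simp add: inc_law_def)
 qed
qed

lemma brownian_increments_joint:
 assumes b: "brownian_motion T M b" and \<theta>: "mono \<theta>" "range \<theta> \<subseteq> {0..T}" and n: "0 < (n::nat)"
 shows "distr M (PiM {..<n} (%_. borel)) (%z. \<lambda>i\<in>{..<n}. b (\<theta> (Suc i)) z - b (\<theta> i) z) =
  PiM {..<n} (%i. inc_law (\<theta> (Suc i) - \<theta> i))"
proof -
 interpret prob_space M using brownian_motionD[OF b] by simp
 have t: "\<theta> i \<in> {0..T}" "\<theta> i \<le> \<theta> (Suc i)" for i using \<theta> by (auto simp: mono_def image_subset_iff)
 have m: "(%z. b (\<theta> (Suc i)) z - b (\<theta> i) z) \<in> borel_measurable M" for i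
  by (intro borel_measurable_diff brownian_motionD(2)[OF b] t)
 have "distr M (PiM {..<n} (%_. borel)) (%z. \<lambda>i\<in>{..<n}. b (\<theta> (Suc i)) z - b (\<theta> i) z) =
   PiM {..<n} (%i. distr M borel (%z. b (\<theta> (Suc i)) z - b (\<theta> i) z))"
  using brownian_motionD(6)[OF b \<theta>, of n] n by (subst (asm) indep_vars_iff_distr_eq_PiM') (auto intro: m)
 also have "\<dots> = PiM {..<n} (%i. inc_law (\<theta> (Suc i) - \<theta> i))"
  using t by (intro PiM_cong refl brownian_increment_law[OF b]) auto
 finally show ?thesis .
qed

text \<open>Independence of increments is formulated for monotone sequences on all natural numbers.
  So a finite set of times, with 0 added, is listed in increasing order and then continued
  constantly.\<close>

lemma finite_times_enumeration:
 assumes J: "finite J" "J \<subseteq> {0..T}" and T: "0 \<le> (T::real)"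
 obtains \<theta> :: "nat => real" and n where "mono \<theta>" "range \<theta> \<subseteq> {0..T}" "\<theta> 0 = 0" "J \<subseteq> \<theta> ` {..n}"
proof -
 define J0 where "J0 = insert 0 J"
 define l where "l = sorted_list_of_set J0"
 have "finite J0" using J by (simp add: J0_def)
 then have l: "sorted l" "set l = insert 0 J"
  unfolding l_def by (simp_all only: sorted_sorted_list_of_set set_sorted_list_of_set) (rule J0_def)
 then have l3: "l \<noteq> []" by auto
 define \<theta> where "\<theta> i = l ! min i (length l - 1)" for i
 have idx: "min i (length l - 1) < length l" for i using l3 by (cases l) auto
 have in_l: "\<theta> i \<in> set l" for i unfolding \<theta>_def by (rule nth_mem[OF idx])
 have m: "mono \<theta>" unfolding \<theta>_def by (intro monoI sorted_nth_mono[OF l(1) _ idx]) auto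
 have "\<theta> i \<in> {0..T}" for i using in_l[of i] J(2) T unfolding l(2) by auto
 then have r: "range \<theta> \<subseteq> {0..T}" by blast
 have img: "insert 0 J \<subseteq> \<theta> ` {..length l}"
 proof
  fix t assume "t \<in> insert 0 J"
  then obtain i where i: "i < length l" "l ! i = t" unfolding l(2)[symmetric] in_set_conv_nth by auto
  then have "\<theta> i = t" by (auto simp: \<theta>_def min_def)
  then show "t \<in> \<theta> ` {..length l}" using i by (auto intro!: image_eqI[of _ _ i])
 qed
 then obtain i where "\<theta> i = 0" by auto
 then have "\<theta> 0 \<le> 0" using monoD[OF m, of 0 i] by simp
 moreover have "0 \<le> \<theta> 0" using r by (auto simp: image_subset_iff)
 ultimately show ?thesis using that[OF m r, of "length l"] img by auto
qed

definition cumulative :: "(real => nat) => real set => (nat => real) => real => real" where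
 "cumulative k J y = (\<lambda>t\<in>J. \<Sum>i<k t. y i)"

lemma measurable_cumulative:
 assumes "!!t. t \<in> J ==> k t \<le> n"
 shows "cumulative k J \<in> PiM {..<n} (%_. borel) \<rightarrow>\<^sub>M PiM J (%_. borel)"
 unfolding cumulative_def
 by (intro measurable_restrict borel_measurable_sum measurable_component_singleton) (use assms in force)

lemma cumulative_increments:
 assumes b: "brownian_motion T M b" and z: "z \<in> space M" and \<theta>0: "\<theta> 0 = 0"
  and k: "!!t. t \<in> J ==> k t \<le> n \<and> \<theta> (k t) = t"
 shows "cumulative k J (\<lambda>i\<in>{..<n}. b (\<theta> (Suc i)) z - b (\<theta> i) z) = (\<lambda>t\<in>J. b t z)"
 unfolding cumulative_def
proof (rule restrict_ext)
 fix t assume t: "t \<in> J"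
 have "(\<Sum>i<k t. (\<lambda>i\<in>{..<n}. b (\<theta> (Suc i)) z - b (\<theta> i) z) i) = (\<Sum>i<k t. b (\<theta> (Suc i)) z - b (\<theta> i) z)"
  using k[OF t] by (intro sum.cong) auto
 also have "\<dots> = b (\<theta> (k t)) z - b (\<theta> 0) z" by (rule sum_lessThan_telescope)
 finally show "(\<Sum>i<k t. (\<lambda>i\<in>{..<n}. b (\<theta> (Suc i)) z - b (\<theta> i) z) i) = b t z"
  using k[OF t] brownian_motionD(3)[OF b z] \<theta>0 by simp
qed

definition fdd_law :: "(nat => real) => nat => (real => nat) => real set => (real => real) measure" where
 "fdd_law \<theta> n k J = distr (PiM {..<n} (%i. inc_law (\<theta> (Suc i) - \<theta> i))) (PiM J (%_. borel)) (cumulative k J)"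

text \<open>The right-hand side mentions neither M nor b, hence any two Brownian motions have the
  same finite-dimensional laws.\<close>

lemma brownian_fdd_law:
 assumes b: "brownian_motion T M b" and \<theta>: "mono \<theta>" "range \<theta> \<subseteq> {0..T}" "\<theta> 0 = 0" and n: "0 < n"
  and k: "!!t. t \<in> J ==> k t \<le> n \<and> \<theta> (k t) = t"
 shows "distr M (PiM J (%_. borel)) (%z. \<lambda>t\<in>J. b t z) = fdd_law \<theta> n k J"
proof -
 have t: "\<theta> i \<in> {0..T}" for i using \<theta> by (auto simp: image_subset_iff)
 have m: "(%z. \<lambda>i\<in>{..<n}. b (\<theta> (Suc i)) z - b (\<theta> i) z) \<in> M \<rightarrow>\<^sub>M PiM {..<n} (%_. borel)"
  by (intro measurable_restrict borel_measurable_diff brownian_motionD(2)[OF b] t)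
 have "fdd_law \<theta> n k J = distr (distr M (PiM {..<n} (%_. borel)) (%z. \<lambda>i\<in>{..<n}. b (\<theta> (Suc i)) z - b (\<theta> i) z))
   (PiM J (%_. borel)) (cumulative k J)"
  unfolding fdd_law_def brownian_increments_joint[OF b \<theta>(1,2) n] ..
 also have "\<dots> = distr M (PiM J (%_. borel)) (%z. cumulative k J (\<lambda>i\<in>{..<n}. b (\<theta> (Suc i)) z - b (\<theta> i) z))"
  by (subst distr_distr[OF measurable_cumulative m]) (use k in \<open>auto simp: comp_def\<close>)
 also have "\<dots> = distr M (PiM J (%_. borel)) (%z. \<lambda>t\<in>J. b t z)"
  by (intro distr_cong refl cumulative_increments[OF b _ \<theta>(3) k]) auto
 finally show ?thesis by simp
qed

lemma brownian_paths:
 assumes b: "brownian_motion T M b" and T: "0 < T"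
 shows "(%z. \<lambda>t\<in>{0..T}. b t z) \<in> M \<rightarrow>\<^sub>M path_space T"
proof (rule measurable_path_spaceI[OF T])
 fix z assume "z \<in> space M"
 then have "continuous_on {0..T} (%t. b t z)" by (rule brownian_motionD(4)[OF b])
 then have "continuous_on {0..T} (\<lambda>t\<in>{0..T}. b t z)" by (rule continuous_on_eq) simp
 then show "(\<lambda>t\<in>{0..T}. b t z) \<in> paths T" by (simp add: paths_def)
next
 fix t assume "t \<in> {0..T}"
 then show "(%z. (\<lambda>t\<in>{0..T}. b t z) t) \<in> borel_measurable M" using brownian_motionD(2)[OF b] by simp
qed

lemma brownian_law_unique:
 assumes b: "brownian_motion T M b" and b': "brownian_motion T M' b'" and T: "0 < T"
 shows "distr M (path_space T) (%z. \<lambda>t\<in>{0..T}. b t z) = distr M' (path_space T) (%z. \<lambda>t\<in>{0..T}. b' t z)"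
proof (rule path_measure_eqI[OF T])
 note p = brownian_paths[OF b T] and p' = brownian_paths[OF b' T]
 show "prob_space (distr M (path_space T) (%z. \<lambda>t\<in>{0..T}. b t z))"
  by (rule prob_space.prob_space_distr[OF brownian_motionD(1)[OF b] p])
 show "prob_space (distr M' (path_space T) (%z. \<lambda>t\<in>{0..T}. b' t z))"
  by (rule prob_space.prob_space_distr[OF brownian_motionD(1)[OF b'] p'])
 fix J :: "real set" assume J: "finite J" "J \<subseteq> {0..T}"
 obtain \<theta> :: "nat => real" and n where \<theta>: "mono \<theta>" "range \<theta> \<subseteq> {0..T}" "\<theta> 0 = 0" "J \<subseteq> \<theta> ` {..n}"
  using finite_times_enumeration[OF J] T by auto
 \<comment> \<open>The bound \<open>Suc n\<close> guarantees at least one increment, as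
   \<open>brownian_fdd_law\<close> requires.\<close>
 have "\<forall>t\<in>J. \<exists>i. i \<le> Suc n \<and> \<theta> i = t"
 proof
  fix t assume "t \<in> J"
  then obtain i where "i \<in> {..n}" "t = \<theta> i" using \<theta>(4) by blast
  then show "\<exists>i. i \<le> Suc n \<and> \<theta> i = t" by (intro exI[of _ i]) auto
 qed
 then obtain k where k: "!!t. t \<in> J ==> k t \<le> Suc n \<and> \<theta> (k t) = t" by metis
 have rJ: "(%x. restrict x J) \<in> path_space T \<rightarrow>\<^sub>M PiM J (%_. borel)"
  by (intro measurable_restrict measurable_path_eval T)
 have r: "restrict (\<lambda>t\<in>{0..T}. h t) J = (\<lambda>t\<in>J. h t)" for h :: "real => real"
  using J(2) by (auto simp: fun_eq_iff)
 show "distr (distr M (path_space T) (%z. \<lambda>t\<in>{0..T}. b t z)) (PiM J (%_. borel)) (%x. restrict x J) =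
   distr (distr M' (path_space T) (%z. \<lambda>t\<in>{0..T}. b' t z)) (PiM J (%_. borel)) (%x. restrict x J)"
  unfolding distr_distr[OF rJ p] distr_distr[OF rJ p'] comp_def r
  using brownian_fdd_law[OF b \<theta>(1-3) _ k] brownian_fdd_law[OF b' \<theta>(1-3) _ k] by simp
qed simp_all

text \<open>A path in \<open>paths T\<close> need not start at 0, so the coordinate process is
  normalised by subtracting its initial value.\<close>

lemma brownian_motion_path_law:
 assumes b: "brownian_motion T M b" and T: "0 < T"
 shows "brownian_motion T (distr M (path_space T) (%z. \<lambda>t\<in>{0..T}. b t z)) (%t x. x t - x 0)"
proof -
 let ?p = "%z. \<lambda>t\<in>{0..T}. b t z"
 interpret prob_space M by (rule brownian_motionD(1)[OF b])
 note p = brownian_paths[OF b T]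
 interpret D: prob_space "distr M (path_space T) ?p" by (rule prob_space_distr[OF p])
 have e: "(%x. x t - x s) \<in> borel_measurable (path_space T)" for s t :: real
  by (intro borel_measurable_diff measurable_path_eval T)
 show ?thesis unfolding brownian_motion_def
 proof (intro conjI allI ballI impI D.prob_space_axioms)
  fix t show "(%x. x t - x 0) \<in> borel_measurable (distr M (path_space T) ?p)" using e by simp
 next
  fix z assume "z \<in> space (distr M (path_space T) ?p)"
  then show "z 0 - z 0 = 0" "continuous_on {0..T} (%t. z t - z 0)"
   by (auto simp: space_path_space paths_def intro!: continuous_intros)
 next
  fix s t assume st: "0 \<le> s \<and> s < t \<and> t \<le> T"
  then have d: "distr M borel (%z. b t z - b s z) = gauss (t - s)"
   using brownian_increment_law[OF b, of s t] by (simp add: inc_law_def)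
  have "distr (distr M (path_space T) ?p) borel (%x. x t - x s) = gauss (t - s)"
   unfolding distr_distr[OF e p] comp_def using st d by simp
  then have "distributed (distr M (path_space T) ?p) lborel (%x. x t - x s) (normal_density 0 (sqrt (t - s)))"
   using e by (subst D.distr_eq_gauss_iff[symmetric]) auto
  then show "distributed (distr M (path_space T) ?p) lborel (%x. x t - x 0 - (x s - x 0)) (normal_density 0 (sqrt (t - s)))"
   by simp
 next
  fix n :: nat and \<theta> :: "nat => real" assume \<theta>: "mono \<theta> \<and> range \<theta> \<subseteq> {0..T}"
  have "indep_vars (%_. borel) (%i z. (%x. x (\<theta> (Suc i)) - x (\<theta> i)) (?p z)) {..<n}"
   using brownian_motionD(6)[OF b, of \<theta> n] \<theta> by (simp add: image_subset_iff)
  then have "D.indep_vars (%_. borel) (%i x. x (\<theta> (Suc i)) - x (\<theta> i)) {..<n}"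
   by (subst indep_vars_distr[OF p]) (auto intro: e)
  then show "D.indep_vars (%_. borel) (%i z. z (\<theta> (Suc i)) - z 0 - (z (\<theta> i) - z 0)) {..<n}"
   by simp
 qed
qed

lemma brownian_motion_bm: "brownian_motion (real K) BML (bm K)" unfolding brownian_motion_def
proof (intro conjI allI ballI impI BM.P.prob_space_axioms)
 fix s t assume st: "0 \<le> s \<and> s < t \<and> t \<le> real K"
 show "distributed BML lborel (%z. bm K t z - bm K s z) (normal_density 0 (sqrt (t - s)))"
  using bm_increment_gauss[of s t K] st
  by (subst BM.P.distr_eq_gauss_iff[symmetric]) (auto intro!: borel_measurable_diff measurable_bm simp del: measurable_BML)
qed (auto simp: bm_0 intro: continuous_bm measurable_bm bm_increments_indep simp del: measurable_BML)

lemma brownian_motion_mono_time: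
 assumes "brownian_motion T M b" "T' \<le> T" shows "brownian_motion T' M b"
proof -
 have "{0..T'} \<subseteq> {0..T}" using assms by auto
 then have r: "range \<theta> \<subseteq> {0..T}" if "range \<theta> \<subseteq> {0..T'}" for \<theta> :: "nat => real"
  using that by (rule subset_trans[rotated])
 show ?thesis unfolding brownian_motion_def
 proof (intro conjI allI impI ballI)
  fix n :: nat and \<theta> :: "nat => real" assume "mono \<theta> \<and> range \<theta> \<subseteq> {0..T'}"
  then show "prob_space.indep_vars M (%_. borel) (%i z. b (\<theta> (Suc i)) z - b (\<theta> i) z) {..<n}"
   using r by (intro brownian_motionD(6)[OF assms(1)]) auto
 next
  fix z assume "z \<in> space M"
  then show "continuous_on {0..T'} (%t. b t z)"
   using assms(2) by (intro continuous_on_subset[OF brownian_motionD(4)[OF assms(1)]]) auto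
 qed (use assms brownian_motionD[OF assms(1)] in auto)
qed

text \<open>The construction lives on [0,K] for natural K; here K is T rounded up, and the path is
  cut down to [0,T].\<close>

definition wiener :: "real => (real => real) measure" where
 "wiener T = distr BML (path_space T) (%z. \<lambda>t\<in>{0..T}. bm (nat \<lceil>T\<rceil>) t z)"

lemma brownian_motion_bm': "brownian_motion T BML (bm (nat \<lceil>T\<rceil>))"
 by (rule brownian_motion_mono_time[OF brownian_motion_bm]) linarith

lemma brownian_law_wiener:
 assumes "brownian_motion T M b" "0 < T"
 shows "distr M (path_space T) (%z. \<lambda>t\<in>{0..T}. b t z) = wiener T"
 unfolding wiener_def by (rule brownian_law_unique[OF assms(1) brownian_motion_bm' assms(2)])

lemma brownian_motion_wiener: "0 < T ==> brownian_motion T (wiener T) (%t x. x t - x 0)"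
 unfolding wiener_def by (rule brownian_motion_path_law[OF brownian_motion_bm'])

lemma prob_space_wiener: "0 < T ==> prob_space (wiener T)"
 by (rule brownian_motionD(1)[OF brownian_motion_wiener])

lemma sets_wiener [simp, measurable_cong]: "sets (wiener T) = sets (path_space T)"
 and space_wiener: "space (wiener T) = paths T" by (simp_all add: wiener_def space_path_space)

text \<open>A cylinder set of the past depends on finitely many increments before s, which are
  independent of the increment from s to t. Cylinder sets are stable under intersection and generate
  the past.\<close>

lemma brownian_indep_past:
 assumes b: "brownian_motion T M b" and st: "0 \<le> s" "s < t" "t \<le> T"
  and G: "G \<in> borel_measurable (vimage_algebra (space M) (%z. \<lambda>r\<in>{0..s}. b r z) (PiM {0..s} (%_. borel)))"
 shows "prob_space.indep_var M borel G borel (%z. b t z - b s z)"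
proof -
 interpret prob_space M by (rule brownian_motionD(1)[OF b])
 let ?X = "%z. \<lambda>r\<in>{0..s}. b r z" and ?P = "PiM {0..s} (%_. borel :: real measure)"
 let ?Y = "%z. b t z - b s z"
 let ?V = "vimage_algebra (space M) ?X ?P"
 have X: "?X \<in> M \<rightarrow>\<^sub>M ?P" using st by (intro measurable_restrict brownian_motionD(2)[OF b]) auto
 have Y: "?Y \<in> borel_measurable M" using st by (intro borel_measurable_diff brownian_motionD(2)[OF b]) auto
 have VM: "sets ?V \<subseteq> sets M" using X by (subst sets_vimage_algebra2) (auto dest: measurable_space)
 have Gm: "G \<in> borel_measurable M" using G VM unfolding measurable_def by auto
 let ?A = "{?X -` A \<inter> space M |A. A \<in> prod_algebra {0..s} (%_. borel :: real measure)}"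
 let ?B = "{?Y -` A \<inter> space M |A. A \<in> sets (borel :: real measure)}"
 have pa: "prod_algebra {0..s} (%_. borel :: real measure) \<subseteq> sets ?P"
  unfolding sets_PiM by (rule sigma_sets_superset_generator)
 have "indep_set ?A ?B"
 proof (rule indep_setI)
  show "?A \<subseteq> events" using pa measurable_sets[OF X] by auto
  show "?B \<subseteq> events" using measurable_sets[OF Y] by auto
  fix a b' assume "a \<in> ?A" "b' \<in> ?B"
  then obtain A B where A: "a = ?X -` A \<inter> space M" "A \<in> prod_algebra {0..s} (%_. borel :: real measure)"
   and B: "b' = ?Y -` B \<inter> space M" "B \<in> sets borel" by auto
  from A(2) obtain J E where J: "A = prod_emb {0..s} (%_. borel) J (Pi\<^sub>E J E)" "finite J" "J \<subseteq> {0..s}"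
   "!!i. i \<in> J ==> E i \<in> sets borel" by (rule prod_algebraE) auto
  obtain \<theta> :: "nat => real" and n where \<theta>: "mono \<theta>" "range \<theta> \<subseteq> {0..s}" "\<theta> 0 = 0" "insert s J \<subseteq> \<theta> ` {..n}"
   using finite_times_enumeration[of "insert s J" s] J st by auto
  have "\<forall>t\<in>J. \<exists>i. i \<le> n \<and> \<theta> i = t"
  proof
   fix t assume "t \<in> J"
   then obtain i where "i \<in> {..n}" "t = \<theta> i" using \<theta>(4) by blast
   then show "\<exists>i. i \<le> n \<and> \<theta> i = t" by (intro exI[of _ i]) auto
  qed
  then obtain k where k: "!!t. t \<in> J ==> k t \<le> n \<and> \<theta> (k t) = t" by metis
  obtain i where "i \<le> n" "\<theta> i = s" using \<theta>(4) by auto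
  then have "s \<le> \<theta> n" using monoD[OF \<theta>(1), of i n] by simp
  then have \<theta>n: "\<theta> n = s" using \<theta>(2) by (auto simp: image_subset_iff antisym)
  \<comment> \<open>After the n increments that exhaust [0,s] comes a single jump from s to t, so
    the increment with index n is exactly \<open>b t - b s\<close>.\<close>
  define \<theta>' where "\<theta>' i = (if i \<le> n then \<theta> i else t)" for i
  have le: "0 \<le> \<theta> i" "\<theta> i \<le> s" for i using \<theta>(2) by (auto simp: image_subset_iff)
  have \<theta>': "mono \<theta>'" "range \<theta>' \<subseteq> {0..T}" "\<theta>' 0 = 0"
  proof -
   show "mono \<theta>'"
   proof (rule monoI)
    fix i j :: nat assume "i \<le> j"
    then show "\<theta>' i \<le> \<theta>' j" using monoD[OF \<theta>(1), of i j] le[of i] st by (auto simp: \<theta>'_def)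
   qed
   show "range \<theta>' \<subseteq> {0..T}"
   proof safe
    fix i show "\<theta>' i \<in> {0..T}" using le[of i] st by (auto simp: \<theta>'_def)
   qed
   show "\<theta>' 0 = 0" using \<theta>(3) by (simp add: \<theta>'_def)
  qed
  have k': "k t \<le> n \<and> \<theta>' (k t) = t" if "t \<in> J" for t using k[OF that] by (simp add: \<theta>'_def)
  let ?Z = "%i z. b (\<theta>' (Suc i)) z - b (\<theta>' i) z"
  have iv: "indep_var (PiM {..<n} (%_. borel)) (%z. restrict (%i. ?Z i z) {..<n}) (PiM {n} (%_. borel)) (%z. restrict (%i. ?Z i z) {n})"
   by (rule indep_var_restrict[OF brownian_motionD(6)[OF b \<theta>'(1,2), of "Suc n"]]) auto
  let ?E = "cumulative k J -` (Pi\<^sub>E J E) \<inter> space (PiM {..<n} (%_. borel))"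
  let ?F = "(%y. y n) -` B \<inter> space (PiM {n} (%_. borel :: real measure))"
  have PE: "Pi\<^sub>E J E \<in> sets (PiM J (%_. borel))" using J by (intro sets_PiM_I_finite) auto
  have E: "?E \<in> sets (PiM {..<n} (%_. borel))"
   by (rule measurable_sets[OF measurable_cumulative PE]) (use k in auto)
  have F: "?F \<in> sets (PiM {n} (%_. borel))" by (rule measurable_sets[OF _ B(2)]) simp
  have Z: "restrict (%i. ?Z i z) K \<in> space (PiM K (%_. borel))" for z K by (simp add: space_PiM)
  have cj: "cumulative k J (restrict (%i. ?Z i z) {..<n}) = (\<lambda>t\<in>J. b t z)" if "z \<in> space M" for z
   by (rule cumulative_increments[OF b that \<theta>'(3) k'])
  have a_eq: "a = (%z. restrict (%i. ?Z i z) {..<n}) -` ?E \<inter> space M"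
   using cj J(3) Z unfolding A(1) J(1) by (auto simp: prod_emb_def space_PiM PiE_iff Int_absorb2 subset_iff)
  have b_eq: "b' = (%z. restrict (%i. ?Z i z) {n}) -` ?F \<inter> space M"
   using Z unfolding B(1) by (auto simp: \<theta>'_def \<theta>n)
  have ab: "a \<inter> b' = (%z. (restrict (%i. ?Z i z) {..<n}, restrict (%i. ?Z i z) {n})) -` (?E \<times> ?F) \<inter> space M"
   unfolding a_eq b_eq by auto
  show "prob (a \<inter> b') = prob a * prob b'" unfolding ab indep_varD[OF iv E F] unfolding a_eq b_eq ..
 qed
 moreover have "Int_stable ?A"
 proof (rule Int_stableI)
  fix a b assume "a \<in> ?A" "b \<in> ?A"
  then obtain A B where "a = ?X -` A \<inter> space M" "b = ?X -` B \<inter> space M"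
   "A \<in> prod_algebra {0..s} (%_. borel :: real measure)" "B \<in> prod_algebra {0..s} (%_. borel :: real measure)" by auto
  moreover then have "A \<inter> B \<in> prod_algebra {0..s} (%_. borel :: real measure)"
   using Int_stableD[OF Int_stable_prod_algebra] by blast
  ultimately show "a \<inter> b \<in> ?A" by (intro CollectI exI[of _ "A \<inter> B"]) auto
 qed
 moreover have "Int_stable ?B"
 proof (rule Int_stableI)
  fix a b assume "a \<in> ?B" "b \<in> ?B"
  then obtain A B where "a = ?Y -` A \<inter> space M" "b = ?Y -` B \<inter> space M" "A \<in> sets borel" "B \<in> sets borel" by auto
  then show "a \<inter> b \<in> ?B" by (intro CollectI exI[of _ "A \<inter> B"]) auto
 qed
 ultimately have ind: "indep_set (sigma_sets (space M) ?A) (sigma_sets (space M) ?B)" by (rule indep_set_sigma_sets)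
 have sV: "sets ?V = sigma_sets (space M) ?A"
 proof -
  have Xsp: "?X \<in> space M \<rightarrow> (\<Pi>\<^sub>E i\<in>{0..s}. space borel)" by auto
  have "sets ?V = {?X -` A \<inter> space M |A. A \<in> sets ?P}"
   by (rule sets_vimage_algebra2) (auto simp: space_PiM)
  also have "\<dots> = sigma_sets (space M) ?A" unfolding sets_PiM by (rule sigma_sets_vimage_commute[OF Xsp])
  finally show ?thesis .
 qed
 have "sigma_sets (space M) {G -` A \<inter> space M |A. A \<in> sets borel} \<subseteq> sets ?V"
 proof -
  have "{G -` A \<inter> space ?V |A. A \<in> sets borel} \<subseteq> sets ?V" using G by (auto dest: measurable_sets)
  then have "sigma_sets (space ?V) {G -` A \<inter> space ?V |A. A \<in> sets borel} \<subseteq> sets ?V"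
   by (rule sets.sigma_sets_subset)
  then show ?thesis by simp
 qed
 then have "indep_set (sigma_sets (space M) {G -` A \<inter> space M |A. A \<in> sets borel}) (sigma_sets (space M) ?B)"
  using ind unfolding sV indep_set_def by (elim indep_sets_mono_sets) (auto split: bool.split)
 then show ?thesis unfolding indep_var_eq using Gm Y by simp
qed

section \<open>Strong solutions\<close>

lemma LBINT_eq_integral:
 fixes h :: "real => real"
 assumes "continuous_on {0..t} h"
 shows "set_integrable lborel {0..t} h" "(LBINT s:{0..t}. h s) = integral {0..t} h"
 using borel_integrable_atLeastAtMost'[OF assms] set_borel_integral_eq_integral(2)[of "{0..t}" h] by auto

lemma ode_sol_cong:
 assumes a: "lip_drift T L a" and a': "lip_drift T L a'" and T: "0 \<le> T"
  and y: "continuous_on {0..T} y" and y': "continuous_on {0..T} y'"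
  and aa: "!!s x. s \<in> {0..T} ==> a s x = a' s x" and yy: "!!s. s \<in> {0..T} ==> y s = y' s" and t: "t \<in> {0..T}"
 shows "ode_sol a y t = ode_sol a' y' t"
proof (rule ode_unique[OF a' T y' continuous_on_ode_sol[OF a y] _ t])
 fix t assume t: "t \<in> {0..T}"
 have "integral {0..t} (%s. a s (ode_sol a y s)) = integral {0..t} (%s. a' s (ode_sol a y s))"
  using t by (intro integral_cong aa) auto
 then show "ode_sol a y t = y' t + integral {0..t} (%s. a' s (ode_sol a y s))"
  using ode_sol_eq[OF a y t] yy[OF t] by simp
qed

text \<open>Subtracting \<open>w 0\<close> makes the driver start at \<xi> for every w, in
  accordance with the canonical Brownian motion on path space.\<close>

definition driver :: "real => (real => real) => real => real" where
 "driver \<xi> w t = \<xi> + (w t - w 0)"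

definition sde_path :: "real => (real => real => real) => real => (real => real) => real => real" where
 "sde_path T a \<xi> w = (\<lambda>t\<in>{0..T}. ode_sol a (driver \<xi> w) t)"

lemma continuous_on_driver: "continuous_on A w ==> continuous_on A (driver \<xi> w)"
 unfolding driver_def by (intro continuous_intros)

lemma sde_path_in_paths:
 assumes "lip_drift T L a" "continuous_on {0..T} w"
 shows "sde_path T a \<xi> w \<in> paths T"
proof -
 have "continuous_on {0..T} (sde_path T a \<xi> w)"
  by (rule continuous_on_eq[OF continuous_on_ode_sol[OF assms(1) continuous_on_driver[OF assms(2)]]])
   (simp add: sde_path_def)
 then show ?thesis by (simp add: paths_def sde_path_def)
qed

lemma sde_path_eq:
 assumes a: "lip_drift T L a" and w: "continuous_on {0..T} w" and t: "t \<in> {0..T}"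
 shows "sde_path T a \<xi> w t = driver \<xi> w t + integral {0..t} (%s. a s (sde_path T a \<xi> w s))"
proof -
 have "integral {0..t} (%s. a s (sde_path T a \<xi> w s)) = integral {0..t} (%s. a s (ode_sol a (driver \<xi> w) s))"
  using t by (intro integral_cong) (auto simp: sde_path_def)
 then show ?thesis using ode_sol_eq[OF a continuous_on_driver[OF w] t] t by (simp add: sde_path_def)
qed

text \<open>With the disorder as parameter, this joint measurability makes the path laws a kernel;
  with a one-point parameter space it serves a single equation.\<close>

lemma measurable_sde_path:
 assumes T: "0 < T" and a: "!!\<omega>. \<omega> \<in> space N ==> lip_drift T L (a \<omega>)"
  and ma: "!!s. s \<in> {0..T} ==> (%(\<omega>, x). a \<omega> s x) \<in> borel_measurable (N \<Otimes>\<^sub>M borel)"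
 shows "(%(\<omega>, \<xi>, w). sde_path T (a \<omega>) \<xi> w) \<in> N \<Otimes>\<^sub>M (borel \<Otimes>\<^sub>M path_space T) \<rightarrow>\<^sub>M path_space T"
proof (rule measurable_path_spaceI[OF T])
 fix z :: "'a \<times> real \<times> (real => real)" assume "z \<in> space (N \<Otimes>\<^sub>M (borel \<Otimes>\<^sub>M path_space T))"
 then show "(case z of (\<omega>, \<xi>, w) => sde_path T (a \<omega>) \<xi> w) \<in> paths T"
  using sde_path_in_paths[OF a] by (auto simp: space_pair_measure space_path_space paths_def split: prod.split)
next
 fix t assume t: "t \<in> {0..T}"
 let ?M = "N \<Otimes>\<^sub>M (borel \<Otimes>\<^sub>M path_space T)"
 have e: "(%z. snd (snd z) s) \<in> borel_measurable ?M" for s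
  by (rule measurable_compose[OF _ measurable_path_eval[OF T]]) measurable
 have "(%z. ode_sol (a (fst z)) (driver (fst (snd z)) (snd (snd z))) t) \<in> borel_measurable ?M"
 proof (rule ode_sol_measurable[OF t])
  show "lip_drift T L (a (fst z))" if "z \<in> space ?M" for z using that a by (auto simp: space_pair_measure)
  show "continuous_on {0..T} (driver (fst (snd z)) (snd (snd z)))" if "z \<in> space ?M" for z
   using that by (intro continuous_on_driver) (auto simp: space_pair_measure space_path_space paths_def)
  show "(%(z, x). a (fst z) s x) \<in> borel_measurable (?M \<Otimes>\<^sub>M borel)" if "s \<in> {0..t}" for s
  proof -
   have s: "s \<in> {0..T}" using that t by auto
   have "(%y. (fst (fst y), snd y)) \<in> ?M \<Otimes>\<^sub>M borel \<rightarrow>\<^sub>M N \<Otimes>\<^sub>M (borel :: real measure)" by measurable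
   from measurable_compose[OF this ma[OF s]] show ?thesis by (simp add: case_prod_unfold)
  qed
  show "(%z. driver (fst (snd z)) (snd (snd z)) s) \<in> borel_measurable ?M" if "s \<in> {0..t}" for s
   unfolding driver_def by (intro borel_measurable_add borel_measurable_diff e) measurable
 qed
 then show "(%z. (case z of (\<omega>, \<xi>, w) => sde_path T (a \<omega>) \<xi> w) t) \<in> borel_measurable ?M"
  using t by (simp add: split_beta sde_path_def)
qed

lemma lip_drift_measurable:
 assumes a: "lip_drift T L a" and s: "s \<in> {0..T}"
 shows "(%x. a s x) \<in> borel_measurable borel"
proof (rule borel_measurable_continuous_onI)
 have "L-lipschitz_on UNIV (a s)" using lip_driftD[OF a] s by (intro lipschitz_onI) (auto simp: dist_real_def)
 then show "continuous_on UNIV (a s)" by (rule lipschitz_on_continuous_on)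
qed

lemma measurable_sde_path':
 assumes T: "0 < T" and a: "lip_drift T L a"
 shows "(%(\<xi>, w). sde_path T a \<xi> w) \<in> borel \<Otimes>\<^sub>M path_space T \<rightarrow>\<^sub>M path_space T"
proof -
 have m: "(%(\<omega> :: unit, \<xi>, w). sde_path T a \<xi> w) \<in> count_space UNIV \<Otimes>\<^sub>M (borel \<Otimes>\<^sub>M path_space T) \<rightarrow>\<^sub>M path_space T"
 proof (rule measurable_sde_path[OF T, where a = "%_. a"])
  show "(%(\<omega> :: unit, x). a s x) \<in> borel_measurable (count_space UNIV \<Otimes>\<^sub>M borel)" if "s \<in> {0..T}" for s
   unfolding split_beta by (rule measurable_compose[OF measurable_snd lip_drift_measurable[OF a that]])
 qed (use a in auto)
 have "(%z. ((), z)) \<in> borel \<Otimes>\<^sub>M path_space T \<rightarrow>\<^sub>M count_space UNIV \<Otimes>\<^sub>M (borel \<Otimes>\<^sub>M path_space T)" by measurable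
 from measurable_compose[OF this m] show ?thesis by (simp add: split_beta)
qed

lemma brownian_motion_comp:
 assumes "prob_space M" and f: "f \<in> M \<rightarrow>\<^sub>M N" and b: "brownian_motion T (distr M N f) b"
 shows "brownian_motion T M (%t z. b t (f z))"
proof -
 interpret prob_space M by fact
 interpret D: prob_space "distr M N f" by (rule prob_space_distr[OF f])
 have m: "b t \<in> borel_measurable N" if "t \<in> {0..T}" for t using brownian_motionD(2)[OF b that] by simp
 have bd: "(%z. b t z - b s z) \<in> borel_measurable N" if "t \<in> {0..T}" "s \<in> {0..T}" for s t
  using that by (intro borel_measurable_diff m)
 show ?thesis unfolding brownian_motion_def
 proof (intro conjI ballI allI impI prob_space_axioms)
  fix t assume "t \<in> {0..T}"
  then show "(%z. b t (f z)) \<in> borel_measurable M" using measurable_compose[OF f m] by simp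
 next
  fix z assume "z \<in> space M"
  then have "f z \<in> space (distr M N f)" using measurable_space[OF f] by simp
  then show "b 0 (f z) = 0" "continuous_on {0..T} (%t. b t (f z))" using brownian_motionD(3,4)[OF b] by auto
 next
  fix s t assume st: "0 \<le> s \<and> s < t \<and> t \<le> T"
  have "distr (distr M N f) borel (%z. b t z - b s z) = gauss (t - s)"
   using brownian_increment_law[OF b, of s t] st by (simp add: inc_law_def)
  then have "distr M borel (%z. b t (f z) - b s (f z)) = gauss (t - s)"
   using st by (simp add: distr_distr[OF bd f] comp_def)
  then show "distributed M lborel (%z. b t (f z) - b s (f z)) (normal_density 0 (sqrt (t - s)))"
   using st measurable_compose[OF f bd, of t s] by (subst distr_eq_gauss_iff[symmetric]) auto
 next
  fix n :: nat and \<theta> :: "nat => real" assume \<theta>: "mono \<theta> \<and> range \<theta> \<subseteq> {0..T}"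
  then have t: "\<theta> i \<in> {0..T}" for i by (auto simp: image_subset_iff)
  have "D.indep_vars (%_. borel) (%i z. b (\<theta> (Suc i)) z - b (\<theta> i) z) {..<n}"
   using brownian_motionD(6)[OF b] \<theta> by blast
  then show "indep_vars (%_. borel) (%i z. b (\<theta> (Suc i)) (f z) - b (\<theta> i) (f z)) {..<n}"
   using bd[OF t t] by (subst (asm) indep_vars_distr[OF f]) auto
 qed
qed

lemma sets_augmented_filtration:
 assumes b: "brownian_motion T M b" and \<xi>: "\<xi> \<in> borel_measurable M" and t: "t \<le> T"
 shows "sets (augmented_filtration M \<xi> b t) \<subseteq> sets M" "space (augmented_filtration M \<xi> b t) = space M"
  "\<xi> \<in> borel_measurable (augmented_filtration M \<xi> b t)"
  "!!s. s \<in> {0..t} ==> b s \<in> borel_measurable (augmented_filtration M \<xi> b t)"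
proof -
 let ?G = "{\<xi> -` A \<inter> space M | A. A \<in> sets borel} \<union>
   {b s -` A \<inter> space M | s A. s \<in> {0..t} \<and> A \<in> sets borel} \<union> null_sets M"
 have G: "?G \<subseteq> sets M"
 proof -
  have "b s -` A \<inter> space M \<in> sets M" if "s \<in> {0..t}" "A \<in> sets borel" for s A
   using that t by (intro measurable_sets[OF brownian_motionD(2)[OF b]]) auto
  then show ?thesis using measurable_sets[OF \<xi>] by auto
 qed
 then have P: "?G \<subseteq> Pow (space M)" using sets.space_closed by blast
 show sp: "space (augmented_filtration M \<xi> b t) = space M"
  unfolding augmented_filtration_def using P by (rule space_measure_of)
 have s: "sets (augmented_filtration M \<xi> b t) = sigma_sets (space M) ?G"
  unfolding augmented_filtration_def using P by (rule sets_measure_of)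
 show "sets (augmented_filtration M \<xi> b t) \<subseteq> sets M" unfolding s by (rule sets.sigma_sets_subset[OF G])
 show "\<xi> \<in> borel_measurable (augmented_filtration M \<xi> b t)"
  by (rule measurableI) (auto simp: s sp intro!: sigma_sets.Basic)
 show "b r \<in> borel_measurable (augmented_filtration M \<xi> b t)" if "r \<in> {0..t}" for r
  by (rule measurableI) (use that in \<open>auto simp: s sp intro!: sigma_sets.Basic\<close>)
qed

text \<open>By independence, start and noise have a product law whose second factor is Wiener
  measure on whatever probability space the solution lives. This is what makes the law of a solution
  unique.\<close>

lemma strong_solution_joint_law:
 assumes sol: "strong_solution T a \<rho> M \<xi> b x" and T: "0 < T"
 shows "distr M (borel \<Otimes>\<^sub>M path_space T) (%z. (\<xi> z, \<lambda>t\<in>{0..T}. b t z)) = \<rho> \<Otimes>\<^sub>M wiener T"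
proof -
 have b: "brownian_motion T M b" and \<xi>: "\<xi> \<in> borel_measurable M" and \<rho>: "distr M borel \<xi> = \<rho>"
  and ind: "prob_space.indep_set M {\<xi> -` A \<inter> space M | A. A \<in> sets borel}
   {(%z. \<lambda>t\<in>{0..T}. b t z) -` A \<inter> space M | A. A \<in> sets (PiM {0..T} (%_. borel))}"
  using sol by (auto simp: strong_solution_def)
 interpret prob_space M by (rule brownian_motionD(1)[OF b])
 interpret R: prob_space \<rho> unfolding \<rho>[symmetric] by (rule prob_space_distr[OF \<xi>])
 interpret W: prob_space "wiener T" by (rule prob_space_wiener[OF T])
 have s\<rho>: "sets \<rho> = sets borel" using \<rho> by auto
 note p = brownian_paths[OF b T]
 have pair: "(%z. (\<xi> z, \<lambda>t\<in>{0..T}. b t z)) \<in> M \<rightarrow>\<^sub>M borel \<Otimes>\<^sub>M path_space T"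
  using \<xi> p by (rule measurable_Pair)
 show ?thesis
 proof (rule pair_measure_eqI[symmetric])
  show "sets (\<rho> \<Otimes>\<^sub>M wiener T) = sets (distr M (borel \<Otimes>\<^sub>M path_space T) (%z. (\<xi> z, \<lambda>t\<in>{0..T}. b t z)))"
   by (simp add: s\<rho> cong: sets_pair_measure_cong)
  fix A B assume A: "A \<in> sets \<rho>" and B: "B \<in> sets (wiener T)"
  then have B': "B \<in> sets (path_space T)" and A': "A \<in> sets borel" by (auto simp: s\<rho>)
  obtain C where C: "C \<in> sets (PiM {0..T} (%_. borel :: real measure))" "B = C \<inter> paths T"
   using sets_path_space_eq_PiM[OF T B'] by blast
  let ?p = "%z. \<lambda>t\<in>{0..T}. b t z"
  have BC: "?p -` B \<inter> space M = ?p -` C \<inter> space M"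
   unfolding C(2) using measurable_space[OF p] by (auto simp: space_path_space)
  have "prob ((\<xi> -` A \<inter> space M) \<inter> (?p -` B \<inter> space M)) = prob (\<xi> -` A \<inter> space M) * prob (?p -` B \<inter> space M)"
   unfolding BC by (rule indep_setD[OF ind]) (use A' C in auto)
  moreover have "(%z. (\<xi> z, ?p z)) -` (A \<times> B) \<inter> space M = (\<xi> -` A \<inter> space M) \<inter> (?p -` B \<inter> space M)" by auto
  moreover have "emeasure \<rho> A = prob (\<xi> -` A \<inter> space M)"
   unfolding \<rho>[symmetric] using A' \<xi> by (simp add: emeasure_distr emeasure_eq_measure)
  moreover have "emeasure (wiener T) B = prob (?p -` B \<inter> space M)"
   unfolding brownian_law_wiener[OF b T, symmetric] using B' p by (simp add: emeasure_distr emeasure_eq_measure)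
  ultimately show "emeasure \<rho> A * emeasure (wiener T) B = emeasure (distr M (borel \<Otimes>\<^sub>M path_space T) (%z. (\<xi> z, ?p z))) (A \<times> B)"
   using A' B' pair by (simp add: emeasure_distr emeasure_eq_measure ennreal_mult)
 qed (unfold_locales)
qed

definition sde_dist :: "real => (real => real => real) => real measure => (real => real) measure" where
 "sde_dist T a \<rho> = distr (\<rho> \<Otimes>\<^sub>M wiener T) (path_space T) (%(\<xi>, w). sde_path T a \<xi> w)"

text \<open>Almost every path of a strong solution solves the integral equation driven by \<xi> + b,
  and that equation has a single continuous solution, the functional
  \<open>sde_path\<close>.\<close>

lemma strong_solution_law:
 assumes sol: "strong_solution T a \<rho> M \<xi> b x" and T: "0 < T" and a: "lip_drift T L a"
 shows "distr M (path_space T) (%z. \<lambda>t\<in>{0..T}. x t z) = sde_dist T a \<rho>"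
proof -
 have b: "brownian_motion T M b" and \<xi>: "\<xi> \<in> borel_measurable M"
  and xm: "!!t. t \<in> {0..T} ==> x t \<in> borel_measurable (augmented_filtration M \<xi> b t)"
  and xc: "!!z. z \<in> space M ==> continuous_on {0..T} (%t. x t z)"
  and xe: "AE z in M. set_integrable lborel {0..T} (%s. a s (x s z)) \<and>
    (\<forall>t\<in>{0..T}. x t z = \<xi> z + (LBINT s:{0..t}. a s (x s z)) + b t z)"
  using sol by (auto simp: strong_solution_def)
 let ?p = "%z. \<lambda>t\<in>{0..T}. b t z"
 note p = brownian_paths[OF b T]
 have pair: "(%z. (\<xi> z, ?p z)) \<in> M \<rightarrow>\<^sub>M borel \<Otimes>\<^sub>M path_space T"
  using \<xi> p by (rule measurable_Pair)
 have xM: "x t \<in> borel_measurable M" if "t \<in> {0..T}" for t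
 proof -
  have "t \<le> T" using that by simp
  note af = sets_augmented_filtration(1,2)[OF b \<xi> this]
  show ?thesis using xm[OF that] af unfolding measurable_def by auto
 qed
 have mx: "(%z. \<lambda>t\<in>{0..T}. x t z) \<in> M \<rightarrow>\<^sub>M path_space T"
 proof (rule measurable_path_spaceI[OF T])
  fix z assume "z \<in> space M"
  then have "continuous_on {0..T} (\<lambda>t\<in>{0..T}. x t z)" by (intro continuous_on_eq[OF xc]) auto
  then show "(\<lambda>t\<in>{0..T}. x t z) \<in> paths T" by (simp add: paths_def)
 qed (use xM in simp)
 note ms = measurable_sde_path'[OF T a]
 have "distr M (path_space T) (%z. \<lambda>t\<in>{0..T}. x t z) = distr M (path_space T) (%z. (%(\<xi>, w). sde_path T a \<xi> w) (\<xi> z, ?p z))"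
 proof (rule distr_cong_AE[OF refl refl])
  show "AE z in M. (\<lambda>t\<in>{0..T}. x t z) = (%(\<xi>, w). sde_path T a \<xi> w) (\<xi> z, ?p z)"
   using xe AE_space
  proof eventually_elim
   fix z assume *: "set_integrable lborel {0..T} (%s. a s (x s z)) \<and>
    (\<forall>t\<in>{0..T}. x t z = \<xi> z + (LBINT s:{0..t}. a s (x s z)) + b t z)" and z: "z \<in> space M"
   have pc: "continuous_on {0..T} (?p z)" using measurable_space[OF p z] by (simp add: space_path_space paths_def)
   have "x t z = ode_sol a (driver (\<xi> z) (?p z)) t" if t: "t \<in> {0..T}" for t
   proof (rule ode_unique[OF a _ continuous_on_driver[OF pc] xc[OF z] _ t])
    fix t assume t: "t \<in> {0..T}"
    have "(LBINT s:{0..t}. a s (x s z)) = integral {0..t} (%s. a s (x s z))"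
     using t by (intro LBINT_eq_integral(2) continuous_on_Icc_subset[OF lip_drift_continuous_comp[OF a xc[OF z]]]) auto
    then show "x t z = driver (\<xi> z) (?p z) t + integral {0..t} (%s. a s (x s z))"
     using * t T brownian_motionD(3)[OF b z] by (simp add: driver_def)
   qed (use T in simp)
   then show "(\<lambda>t\<in>{0..T}. x t z) = (%(\<xi>, w). sde_path T a \<xi> w) (\<xi> z, ?p z)"
    unfolding sde_path_def prod.case by (intro restrict_ext)
  qed
 qed (use mx measurable_compose[OF pair ms] in auto)
 also have "\<dots> = distr (distr M (borel \<Otimes>\<^sub>M path_space T) (%z. (\<xi> z, ?p z))) (path_space T) (%(\<xi>, w). sde_path T a \<xi> w)"
  by (subst distr_distr[OF ms pair]) (simp add: comp_def)
 finally show ?thesis unfolding strong_solution_joint_law[OF sol T] sde_dist_def .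
qed

text \<open>The canonical space \<open>\<rho> \<Otimes>\<^sub>M wiener T\<close> has the sample type
  over which \<open>sde_law\<close> ranges. Adaptedness holds because the Picard iterates at time t
  use the driver up to t only.\<close>

lemma strong_solution_exists:
 assumes T: "0 < T" and a: "lip_drift T L a" and \<rho>: "\<rho> \<in> space (prob_algebra borel)"
 shows "strong_solution T a \<rho> (\<rho> \<Otimes>\<^sub>M wiener T) fst (%t z. snd z t - snd z 0) (%t z. sde_path T a (fst z) (snd z) t)"
proof -
 let ?M = "\<rho> \<Otimes>\<^sub>M wiener T" and ?b = "%t (z :: real \<times> (real => real)). snd z t - snd z 0"
 have s\<rho>[measurable_cong]: "sets \<rho> = sets borel" and sp\<rho>: "space \<rho> = UNIV" and p\<rho>: "prob_space \<rho>"
  using \<rho> by (auto simp: space_prob_algebra dest: sets_eq_imp_space_eq)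
 interpret R: prob_space \<rho> by fact
 interpret W: prob_space "wiener T" by (rule prob_space_wiener[OF T])
 interpret M: pair_prob_space \<rho> "wiener T" ..
 have ds: "distr ?M (wiener T) snd = wiener T"
 proof (rule measure_eqI)
  fix A assume "A \<in> sets (distr ?M (wiener T) snd)"
  then have A: "A \<in> sets (wiener T)" by simp
  have "snd -` A \<inter> space ?M = space \<rho> \<times> A" using sets.sets_into_space[OF A] by (auto simp: space_pair_measure)
  moreover have "emeasure ?M (space \<rho> \<times> A) = emeasure \<rho> (space \<rho>) * emeasure (wiener T) A"
   by (rule W.emeasure_pair_measure_Times[OF sets.top A])
  ultimately show "emeasure (distr ?M (wiener T) snd) A = emeasure (wiener T) A"
   using A by (simp add: emeasure_distr R.emeasure_space_1)
 qed simp
 have b: "brownian_motion T ?M ?b"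
  by (rule brownian_motion_comp[OF _ measurable_snd, of _ _ _ "%t x. x t - x 0"])
   (use brownian_motion_wiener[OF T] ds M.prob_space_axioms in auto)
 have fst: "fst \<in> borel_measurable ?M" by measurable
 have cont: "continuous_on {0..T} (snd z)" if "z \<in> space ?M" for z
  using that by (auto simp: space_pair_measure space_wiener paths_def)
 have "distr ?M borel fst = distr ?M \<rho> fst" by (intro distr_cong refl) (simp add: s\<rho>)
 also have "\<dots> = \<rho>" by (rule W.distr_pair_fst)
 finally have df: "distr ?M borel fst = \<rho>" .
 let ?p = "%w. \<lambda>t\<in>{0..T}. w t - w 0"
 have ind: "M.indep_set {fst -` A \<inter> space ?M | A. A \<in> sets borel}
   {(%z. \<lambda>t\<in>{0..T}. ?b t z) -` A \<inter> space ?M | A. A \<in> sets (PiM {0..T} (%_. borel))}"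
 proof (rule M.indep_setI)
  have 2: "(%z. \<lambda>t\<in>{0..T}. ?b t z) \<in> ?M \<rightarrow>\<^sub>M PiM {0..T} (%_. borel)"
   by (intro measurable_restrict brownian_motionD(2)[OF b])
  show "{fst -` A \<inter> space ?M | A. A \<in> sets borel} \<subseteq> M.events" using measurable_sets[OF fst] by auto
  show "{(%z. \<lambda>t\<in>{0..T}. ?b t z) -` A \<inter> space ?M | A. A \<in> sets (PiM {0..T} (%_. borel))} \<subseteq> M.events"
   using measurable_sets[OF 2] by auto
  have p: "?p \<in> wiener T \<rightarrow>\<^sub>M PiM {0..T} (%_. borel)"
   by (intro measurable_restrict brownian_motionD(2)[OF brownian_motion_wiener[OF T]])
  fix u v assume "u \<in> {fst -` A \<inter> space ?M | A. A \<in> sets borel}"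
   "v \<in> {(%z. \<lambda>t\<in>{0..T}. ?b t z) -` A \<inter> space ?M | A. A \<in> sets (PiM {0..T} (%_. borel))}"
  then obtain A B where A: "u = fst -` A \<inter> space ?M" "A \<in> sets borel"
   and B: "v = (%z. \<lambda>t\<in>{0..T}. ?b t z) -` B \<inter> space ?M" "B \<in> sets (PiM {0..T} (%_. borel :: real measure))" by auto
  let ?B = "?p -` B \<inter> space (wiener T)"
  have B': "?B \<in> sets (wiener T)" by (rule measurable_sets[OF p B(2)])
  have A': "A \<in> sets \<rho>" using A s\<rho> by simp
  have u: "u = A \<times> space (wiener T)" using A by (auto simp: space_pair_measure sp\<rho>)
  have v: "v = space \<rho> \<times> ?B" using B by (auto simp: space_pair_measure sp\<rho>)
  have uv: "u \<inter> v = A \<times> ?B" unfolding u v by (auto simp: sp\<rho>)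
  have m: "measure ?M (X \<times> Y) = measure \<rho> X * measure (wiener T) Y" if "X \<in> sets \<rho>" "Y \<in> sets (wiener T)" for X Y
   using W.emeasure_pair_measure_Times[OF that] by (simp add: measure_def enn2real_mult)
  show "measure ?M (u \<inter> v) = measure ?M u * measure ?M v"
   unfolding uv unfolding u v m[OF A' B'] m[OF A' sets.top] m[OF sets.top B'] by (simp add: R.prob_space W.prob_space)
 qed
 show ?thesis unfolding strong_solution_def
 proof (intro conjI ballI)
  fix t assume t: "t \<in> {0..T}"
  then have "t \<le> T" by simp
  note af = sets_augmented_filtration[OF b fst this]
  have "(%z. ode_sol a (driver (fst z) (snd z)) t) \<in> borel_measurable (augmented_filtration ?M fst ?b t)"
  proof (rule ode_sol_measurable[OF t])
   show "continuous_on {0..T} (driver (fst z) (snd z))" if "z \<in> space (augmented_filtration ?M fst ?b t)" for z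
    by (rule continuous_on_driver[OF cont]) (use that in \<open>simp only: af(2)\<close>)
   show "(%(z, x). a s x) \<in> borel_measurable (augmented_filtration ?M fst ?b t \<Otimes>\<^sub>M borel)" if "s \<in> {0..t}" for s
    unfolding split_beta by (rule measurable_compose[OF measurable_snd lip_drift_measurable[OF a]]) (use that t in auto)
   show "(%z. driver (fst z) (snd z) s) \<in> borel_measurable (augmented_filtration ?M fst ?b t)" if "s \<in> {0..t}" for s
    unfolding driver_def by (intro borel_measurable_add af that)
  qed (rule a)
  then show "(%z. sde_path T a (fst z) (snd z) t) \<in> borel_measurable (augmented_filtration ?M fst ?b t)"
   using t by (simp add: sde_path_def)
 next
  fix z assume "z \<in> space ?M"
  then show "continuous_on {0..T} (%t. sde_path T a (fst z) (snd z) t)"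
   using sde_path_in_paths[OF a cont] by (simp add: paths_def)
 next
  show "AE z in ?M. set_integrable lborel {0..T} (%s. a s (sde_path T a (fst z) (snd z) s)) \<and>
    (\<forall>t\<in>{0..T}. sde_path T a (fst z) (snd z) t = fst z + (LBINT s:{0..t}. a s (sde_path T a (fst z) (snd z) s)) + (snd z t - snd z 0))"
  proof (intro AE_I2 conjI ballI)
   fix z assume z: "z \<in> space ?M"
   have c: "continuous_on {0..T} (%s. a s (sde_path T a (fst z) (snd z) s))"
    using sde_path_in_paths[OF a cont[OF z]] by (intro lip_drift_continuous_comp[OF a]) (simp add: paths_def)
   then show "set_integrable lborel {0..T} (%s. a s (sde_path T a (fst z) (snd z) s))" by (rule LBINT_eq_integral)
   fix t assume t: "t \<in> {0..T}"
   then have "continuous_on {0..t} (%s. a s (sde_path T a (fst z) (snd z) s))"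
    by (intro continuous_on_Icc_subset[OF c]) auto
   then show "sde_path T a (fst z) (snd z) t = fst z + (LBINT s:{0..t}. a s (sde_path T a (fst z) (snd z) s)) + (snd z t - snd z 0)"
    unfolding sde_path_eq[OF a cont[OF z] t] LBINT_eq_integral(2) by (simp add: driver_def LBINT_eq_integral(2))
  qed
 qed (fact b fst df ind)+
qed

theorem sde_law_eq:
 assumes T: "0 < T" and a: "lip_drift T L a" and \<rho>: "\<rho> \<in> space (prob_algebra borel)"
 shows "sde_law T a \<rho> = sde_dist T a \<rho>" unfolding sde_law_def
proof (rule the_equality)
 note sol = strong_solution_exists[OF T a \<rho>]
 show "\<exists>(M :: (real \<times> (real => real)) measure) \<xi> b x. strong_solution T a \<rho> M \<xi> b x \<and>
   sde_dist T a \<rho> = distr M (path_space T) (%z. \<lambda>t\<in>{0..T}. x t z)"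
  by (intro exI conjI, rule sol, rule strong_solution_law[OF sol T a, symmetric])
qed (use strong_solution_law[OF _ T a] in blast)

lemma sde_dist_kernel:
 assumes T: "0 < T" and a: "!!\<omega>. lip_drift T L (a \<omega>)"
  and ma: "!!s. s \<in> {0..T} ==> (%(\<omega>, x). a \<omega> s x) \<in> borel_measurable (borel \<Otimes>\<^sub>M borel)"
  and \<gamma>[measurable]: "\<gamma> \<in> borel \<rightarrow>\<^sub>M prob_algebra borel"
 shows "(%\<omega> :: real. sde_dist T (a \<omega>) (\<gamma> \<omega>)) \<in> borel \<rightarrow>\<^sub>M prob_algebra (path_space T)"
 unfolding sde_dist_def
proof (rule measurable_distr_prob_space2[where M = "borel \<Otimes>\<^sub>M path_space T"])
 have W: "(%_. wiener T) \<in> borel \<rightarrow>\<^sub>M prob_algebra (path_space T)"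
  by (rule measurable_const) (simp add: space_prob_algebra prob_space_wiener[OF T])
 show "(%\<omega>. \<gamma> \<omega> \<Otimes>\<^sub>M wiener T) \<in> borel \<rightarrow>\<^sub>M prob_algebra (borel \<Otimes>\<^sub>M path_space T)"
  by (rule measurable_pair_prob[OF \<gamma> W])
 show "(%(\<omega>, y). case y of (\<xi>, w) => sde_path T (a \<omega>) \<xi> w) \<in> borel \<Otimes>\<^sub>M (borel \<Otimes>\<^sub>M path_space T) \<rightarrow>\<^sub>M path_space T"
  by (rule measurable_sde_path[OF T a ma])
qed

section \<open>The weak formulation\<close>

lemma mvt_bound:
 fixes g :: "real => real"
 assumes d: "!!u. (g has_real_derivative g' u) (at u)" and b: "!!u. \<bar>u\<bar> \<le> \<bar>d\<bar> ==> \<bar>g' u\<bar> \<le> C" and 0: "g 0 = 0"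
 shows "\<bar>g d\<bar> \<le> C * \<bar>d\<bar>"
proof -
 have "norm (g d - g 0) \<le> C * norm (d - 0)"
 proof (rule field_differentiable_bound[of "cball 0 \<bar>d\<bar>"])
  show "(g has_field_derivative g' z) (at z within cball 0 \<bar>d\<bar>)" for z
   using d by (rule has_field_derivative_at_within)
 qed (use b in auto)
 then show ?thesis by (simp add: 0)
qed

lemma lipschitz_from_deriv:
 fixes g :: "real => real"
 assumes d: "!!u. (g has_real_derivative g' u) (at u)" and b: "!!u. \<bar>g' u\<bar> \<le> C"
 shows "\<bar>g x - g y\<bar> \<le> C * \<bar>x - y\<bar>"
 using field_differentiable_bound[of UNIV g g' C y x] d b by (auto simp: abs_minus_commute)

lemma taylor3_bound:
 fixes \<phi> :: "real => real"
 assumes d: "!!x. (\<phi> has_real_derivative \<phi>1 x) (at x)" "!!x. (\<phi>1 has_real_derivative \<phi>2 x) (at x)"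
  "!!x. (\<phi>2 has_real_derivative \<phi>3 x) (at x)" and K: "!!x. \<bar>\<phi>3 x\<bar> \<le> K"
 shows "\<bar>\<phi> (x + u) - \<phi> x - \<phi>1 x * u - \<phi>2 x * u\<^sup>2 / 2\<bar> \<le> K * \<bar>u\<bar> ^ 3"
proof -
 have K0: "0 \<le> K" using K[of 0] by linarith
 have 2: "\<bar>\<phi>2 (x + v) - \<phi>2 x\<bar> \<le> K * \<bar>v\<bar>" for v
  using lipschitz_from_deriv[OF d(3) K, of "x + v" x] by simp
 have 1: "\<bar>\<phi>1 (x + v) - \<phi>1 x - \<phi>2 x * v\<bar> \<le> K * \<bar>v\<bar> * \<bar>v\<bar>" for v
 proof (rule mvt_bound[where g' = "%v. \<phi>2 (x + v) - \<phi>2 x"])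
  show "((%v. \<phi>1 (x + v) - \<phi>1 x - \<phi>2 x * v) has_real_derivative \<phi>2 (x + w) - \<phi>2 x) (at w)" for w
   by (auto intro!: derivative_eq_intros DERIV_chain2[OF d(2)])
  show "\<bar>\<phi>2 (x + w) - \<phi>2 x\<bar> \<le> K * \<bar>v\<bar>" if "\<bar>w\<bar> \<le> \<bar>v\<bar>" for w
   using 2[of w] mult_left_mono[OF that K0] by linarith
 qed simp
 have "\<bar>\<phi> (x + u) - \<phi> x - \<phi>1 x * u - \<phi>2 x * u\<^sup>2 / 2\<bar> \<le> (K * \<bar>u\<bar> * \<bar>u\<bar>) * \<bar>u\<bar>"
 proof (rule mvt_bound[where g' = "%v. \<phi>1 (x + v) - \<phi>1 x - \<phi>2 x * v"])
  show "((%v. \<phi> (x + v) - \<phi> x - \<phi>1 x * v - \<phi>2 x * v\<^sup>2 / 2) has_real_derivative \<phi>1 (x + w) - \<phi>1 x - \<phi>2 x * w) (at w)" for w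
   by (auto intro!: derivative_eq_intros DERIV_chain2[OF d(1)])
  show "\<bar>\<phi>1 (x + w) - \<phi>1 x - \<phi>2 x * w\<bar> \<le> K * \<bar>u\<bar> * \<bar>u\<bar>" if "\<bar>w\<bar> \<le> \<bar>u\<bar>" for w
  proof -
   have "K * \<bar>w\<bar> * \<bar>w\<bar> \<le> K * \<bar>u\<bar> * \<bar>u\<bar>" using that K0 by (intro mult_mono) auto
   with 1[of w] show ?thesis by linarith
  qed
 qed simp
 then show ?thesis by (simp add: power3_eq_cube mult.assoc)
qed

text \<open>The derivative is frozen at x, the state at the start of a step, although the drift
  displacement v acts after the noise displacement u; hence the factor |u| + |v|.\<close>

lemma taylor_drift_bound:
 fixes \<phi> :: "real => real"
 assumes d: "!!x. (\<phi> has_real_derivative \<phi>1 x) (at x)" "!!x. (\<phi>1 has_real_derivative \<phi>2 x) (at x)"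
  and K: "!!x. \<bar>\<phi>2 x\<bar> \<le> K"
 shows "\<bar>\<phi> (x + u + v) - \<phi> (x + u) - \<phi>1 x * v\<bar> \<le> K * (\<bar>u\<bar> + \<bar>v\<bar>) * \<bar>v\<bar>"
proof (rule mvt_bound[where g' = "%w. \<phi>1 (x + u + w) - \<phi>1 x"])
 have K0: "0 \<le> K" using K[of 0] by linarith
 show "((%w. \<phi> (x + u + w) - \<phi> (x + u) - \<phi>1 x * w) has_real_derivative \<phi>1 (x + u + w) - \<phi>1 x) (at w)" for w
  by (auto intro!: derivative_eq_intros DERIV_chain2[OF d(1)])
 show "\<bar>\<phi>1 (x + u + w) - \<phi>1 x\<bar> \<le> K * (\<bar>u\<bar> + \<bar>v\<bar>)" if "\<bar>w\<bar> \<le> \<bar>v\<bar>" for w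
 proof -
  have "\<bar>\<phi>1 (x + u + w) - \<phi>1 x\<bar> \<le> K * \<bar>x + u + w - x\<bar>" by (rule lipschitz_from_deriv[OF d(2) K])
  also have "\<dots> \<le> K * (\<bar>u\<bar> + \<bar>v\<bar>)" using that K0 by (intro mult_left_mono) auto
  finally show ?thesis .
 qed
qed simp

text \<open>Replaces Ito's formula: an \<open>O(h\<^sup>3\<^sup>/\<^sup>2)\<close> Taylor error over each time step suffices.\<close>

lemma zero_growth_constant:
 fixes J :: "real => real"
 assumes J: "!!s t. 0 \<le> s ==> s \<le> t ==> t \<le> T ==> \<bar>J t - J s\<bar> \<le> C * (t - s) * sqrt (t - s)"
  and t: "t \<in> {0..T}"
 shows "J t = J 0"
proof (cases "T = 0")
 case True
 then show ?thesis using t by simp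
next
 case False
 define C' where "C' = max C 0"
 have J': "\<bar>J t - J s\<bar> \<le> C' * \<bar>t - s\<bar> * sqrt \<bar>t - s\<bar>" if "s \<in> {0..T}" "t \<in> {0..T}" for s t
 proof -
  have "\<bar>J t - J s\<bar> \<le> C * \<bar>t - s\<bar> * sqrt \<bar>t - s\<bar>"
  proof (cases "s \<le> t")
   case True
   then show ?thesis using J[of s t] that by simp
  next
   case False
   then show ?thesis using J[of t s] that by (simp add: abs_minus_commute)
  qed
  also have "\<dots> \<le> C' * \<bar>t - s\<bar> * sqrt \<bar>t - s\<bar>" unfolding C'_def by (intro mult_right_mono) auto
  finally show ?thesis .
 qed
 have der: "(J has_field_derivative 0) (at s within {0..T})" if s: "s \<in> {0..T}" for s
  unfolding has_field_derivative_iff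
 proof (rule Lim_null_comparison)
  show "\<forall>\<^sub>F r in at s within {0..T}. norm ((J r - J s) / (r - s)) \<le> C' * sqrt \<bar>r - s\<bar>"
   unfolding eventually_at_filter
  proof (rule always_eventually, intro allI impI)
   fix r assume "r \<noteq> s" "r \<in> {0..T}"
   then have "\<bar>J r - J s\<bar> / \<bar>r - s\<bar> \<le> C' * sqrt \<bar>r - s\<bar>"
    using J'[OF s, of r] by (simp add: divide_le_eq ac_simps)
   then show "norm ((J r - J s) / (r - s)) \<le> C' * sqrt \<bar>r - s\<bar>" by (simp add: abs_divide)
  qed
  have "((%r. C' * sqrt \<bar>r - s\<bar>) \<longlongrightarrow> C' * sqrt \<bar>s - s\<bar>) (at s within {0..T})"
   by (intro tendsto_intros)
  then show "((%r. C' * sqrt \<bar>r - s\<bar>) \<longlongrightarrow> 0) (at s within {0..T})" by simp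
 qed
 have "\<exists>c. \<forall>x\<in>{0..T}. J x = c" by (rule has_field_derivative_zero_constant[OF _ der]) auto
 then show ?thesis using t by auto
qed

text \<open>A non-integrable integrand has integral 0, which the bound covers because K is
  nonnegative on a nonempty space.\<close>

lemma (in prob_space) expectation_abs_bound:
 fixes f :: "'a => real"
 assumes K: "!!z. z \<in> space M ==> \<bar>f z\<bar> \<le> K"
 shows "\<bar>expectation f\<bar> \<le> K"
proof -
 have K0: "0 \<le> K" using K not_empty by (meson abs_ge_zero all_not_in_conv order_trans)
 have "\<bar>expectation f\<bar> \<le> expectation (%z. \<bar>f z\<bar>)" by (rule integral_abs_bound)
 moreover have "expectation (%z. \<bar>f z\<bar>) \<le> expectation (%_. K)"
  by (rule integral_mono_AE') (use K K0 in auto)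
 ultimately show ?thesis by (rule order_trans[OF order_trans]) (simp add: prob_space)
qed

lemma (in prob_space) expectation_difference_bound:
 assumes "integrable M f" "integrable M g" and c: "!!z. z \<in> space M ==> \<bar>f z - g z\<bar> \<le> (c :: real)"
 shows "\<bar>expectation f - expectation g\<bar> \<le> c"
 unfolding Bochner_Integration.integral_diff[OF assms(1,2), symmetric] by (rule expectation_abs_bound[OF c])

lemma (in prob_space) expectation_continuous:
 fixes h :: "'a => real => real"
 assumes m: "!!t. t \<in> {0..T} ==> (%z. h z t) \<in> borel_measurable M"
  and c: "!!z. z \<in> space M ==> continuous_on {0..T} (h z)"
  and K: "!!z t. z \<in> space M ==> t \<in> {0..T} ==> \<bar>h z t\<bar> \<le> K"
 shows "continuous_on {0..T} (%t. expectation (%z. h z t))"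
 unfolding continuous_on_sequentially comp_def
proof (intro allI ballI impI)
 fix x a assume a: "a \<in> {0..T}" "(\<forall>n. x n \<in> {0..T}) \<and> x \<longlonglongrightarrow> a"
 show "(%n. expectation (%z. h z (x n))) \<longlonglongrightarrow> expectation (%z. h z a)"
 proof (rule integral_dominated_convergence[where w = "%_. K"])
  show "AE z in M. (%n. h z (x n)) \<longlonglongrightarrow> h z a"
   using a by (intro AE_I2 continuous_on_tendsto_compose[OF c]) auto
  show "AE z in M. norm (h z (x n)) \<le> K" for n using a K by (intro AE_I2) auto
 qed (use a m in auto)
qed

lemma (in prob_space) expectation_integral_swap:
 fixes h :: "'a => real => real"
 assumes m: "!!t. t \<in> {0..T} ==> (%z. h z t) \<in> borel_measurable M"
  and c: "!!z. z \<in> space M ==> continuous_on {0..T} (h z)"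
  and K: "!!z t. z \<in> space M ==> t \<in> {0..T} ==> \<bar>h z t\<bar> \<le> K"
  and uv: "0 \<le> u" "u \<le> v" "v \<le> T"
 shows "expectation (%z. integral {u..v} (h z)) = integral {u..v} (%t. expectation (%z. h z t))"
  "(%z. integral {u..v} (h z)) \<in> borel_measurable M"
proof -
 interpret P: pair_sigma_finite M lborel ..
 let ?f = "%z t. indicator {u..v} t * h z t"
 have T: "0 \<le> T" using uv by simp
 have sub: "{u..v} \<subseteq> {0..T}" using uv by auto
 have eqI: "integral {u..v} g = (LINT t|lborel. indicator {u..v} t * g t)" if "continuous_on {0..T} g" for g :: "real => real"
  using set_borel_integral_eq_integral(2)[of "{u..v}" g] borel_integrable_atLeastAtMost'[OF continuous_on_subset[OF that sub]]
  by (simp add: set_lebesgue_integral_def)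
 have "(%(z, t). indicator {0..T} t * h z t) \<in> borel_measurable (M \<Otimes>\<^sub>M lborel)"
  using caratheodory_measurable[OF T m c] by simp
 then have "(%x. indicator {u..v} (snd x) * (case x of (z, t) => indicator {0..T} t * h z t)) \<in> borel_measurable (M \<Otimes>\<^sub>M lborel)"
  by measurable
 moreover have "indicator {u..v} (snd x) * (case x of (z, t) => indicator {0..T} t * h z t) = case_prod ?f x" for x
  using sub by (auto simp: indicator_def split: prod.split)
 ultimately have mf: "case_prod ?f \<in> borel_measurable (M \<Otimes>\<^sub>M lborel)" by simp
 have int: "integrable (M \<Otimes>\<^sub>M lborel) (case_prod ?f)"
 proof (rule P.Fubini_integrable[OF mf])
  have "(\<integral>z. \<integral>t. norm (case_prod ?f (z, t)) \<partial>lborel \<partial>M) = (\<integral>z. \<integral>t. indicator {u..v} t * \<bar>h z t\<bar> \<partial>lborel \<partial>M)"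
   by (simp add: abs_mult)
  show "integrable M (%z. \<integral>t. norm (case_prod ?f (z, t)) \<partial>lborel)"
  proof (rule integrable_const_bound[of _ "K * (v - u)"])
   have "(%(z, t). norm (?f z t)) \<in> borel_measurable (M \<Otimes>\<^sub>M lborel)" using mf by (simp add: case_prod_unfold)
   from lborel.borel_measurable_lebesgue_integral[OF this]
   show "(%z. \<integral>t. norm (case_prod ?f (z, t)) \<partial>lborel) \<in> borel_measurable M" by simp
   show "AE z in M. norm (\<integral>t. norm (case_prod ?f (z, t)) \<partial>lborel) \<le> K * (v - u)"
   proof (rule AE_I2)
    fix z assume z: "z \<in> space M"
    have "(\<integral>t. norm (case_prod ?f (z, t)) \<partial>lborel) \<le> (\<integral>t. K * indicator {u..v} t \<partial>lborel)"
    proof (rule integral_mono_AE')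
     show "integrable lborel (%t. K * indicator {u..v} t)"
      by (intro integrable_mult_right integrable_real_indicator) (use uv in auto)
     show "AE t in lborel. norm (case_prod ?f (z, t)) \<le> K * indicator {u..v} t"
      using K[OF z] sub by (intro AE_I2) (auto simp: indicator_def)
     have "0 \<le> K" using K[OF z, of u] uv by auto
     then show "AE t in lborel. 0 \<le> K * indicat_real {u..v} t" by (intro AE_I2) simp
    qed
    also have "\<dots> = K * (v - u)" using uv by simp
    finally show "norm (\<integral>t. norm (case_prod ?f (z, t)) \<partial>lborel) \<le> K * (v - u)" by simp
   qed
  qed
  show "AE z in M. integrable lborel (%t. case_prod ?f (z, t))"
  proof (rule AE_I2)
   fix z assume z: "z \<in> space M"
   show "integrable lborel (%t. case_prod ?f (z, t))"
    using borel_integrable_atLeastAtMost'[OF continuous_on_subset[OF c[OF z] sub]] by (simp add: set_integrable_def)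
  qed
 qed
 have 1: "integral {u..v} (h z) = (LINT t|lborel. ?f z t)" if "z \<in> space M" for z by (rule eqI[OF c[OF that]])
 have "expectation (%z. integral {u..v} (h z)) = (\<integral>z. \<integral>t. ?f z t \<partial>lborel \<partial>M)"
  using 1 by (intro Bochner_Integration.integral_cong) auto
 also have "\<dots> = (\<integral>t. \<integral>z. ?f z t \<partial>M \<partial>lborel)" by (rule P.Fubini_integral[OF int, symmetric])
 also have "\<dots> = integral {u..v} (%t. expectation (%z. h z t))"
  using eqI[OF expectation_continuous[OF m c K]] by simp
 finally show "expectation (%z. integral {u..v} (h z)) = integral {u..v} (%t. expectation (%z. h z t))" .
 have "(%z. LINT t|lborel. ?f z t) \<in> borel_measurable M"
  using lborel.borel_measurable_lebesgue_integral[OF mf] .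
 then show "(%z. integral {u..v} (h z)) \<in> borel_measurable M" using 1 by (simp cong: measurable_cong)
qed

section \<open>The weak equation from one-step estimates\<close>

lemma gauss_moments:
 assumes v: "0 < v"
 shows "integrable (gauss v) (%x. x)" "(\<integral>x. x \<partial>gauss v) = 0"
  "integrable (gauss v) (%x. x\<^sup>2)" "(\<integral>x. x\<^sup>2 \<partial>gauss v) = v"
proof -
 have s: "0 < sqrt v" using v by simp
 have "has_bochner_integral lborel (%x. normal_density 0 (sqrt v) x *\<^sub>R x) 0"
  using normal_moment_odd[OF s, of 0 0] by simp
 then have "has_bochner_integral (gauss v) (%x. x) 0"
  unfolding gauss_def by (intro has_bochner_integral_density) auto
 then show "integrable (gauss v) (%x. x)" "(\<integral>x. x \<partial>gauss v) = 0" by (auto simp: has_bochner_integral_iff)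
 have "fact (2 * 1) / ((2 / (sqrt v)\<^sup>2) ^ 1 * fact 1) = v" using v by simp
 then have "has_bochner_integral lborel (%x. normal_density 0 (sqrt v) x *\<^sub>R x\<^sup>2) v"
  using normal_moment_even[OF s, of 0 1] by simp
 then have "has_bochner_integral (gauss v) (%x. x\<^sup>2) v"
  unfolding gauss_def by (intro has_bochner_integral_density) auto
 then show "integrable (gauss v) (%x. x\<^sup>2)" "(\<integral>x. x\<^sup>2 \<partial>gauss v) = v" by (auto simp: has_bochner_integral_iff)
qed

text \<open>Odd absolute moments are reached from even ones: with q the square root of t - s, 2|x|
  \<le> q + x^2/q, and multiplication by x^2 handles the third moment, giving (q^3 + 3 q^3)/2. Only
  the order in t - s matters later.\<close>

lemma brownian_increment_moments:
 assumes b: "brownian_motion T M b" and st: "0 \<le> s" "s < t" "t \<le> T"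
 defines "\<Delta> \<equiv> %z. b t z - b s z"
 shows "integrable M \<Delta>" "(\<integral>z. \<Delta> z \<partial>M) = 0" "integrable M (%z. (\<Delta> z)\<^sup>2)" "(\<integral>z. (\<Delta> z)\<^sup>2 \<partial>M) = t - s"
  "integrable M (%z. \<bar>\<Delta> z\<bar> ^ 3)" "(\<integral>z. \<bar>\<Delta> z\<bar> ^ 3 \<partial>M) \<le> 2 * (t - s) * sqrt (t - s)"
  "integrable M (%z. \<bar>\<Delta> z\<bar>)" "(\<integral>z. \<bar>\<Delta> z\<bar> \<partial>M) \<le> sqrt (t - s)"
proof -
 interpret prob_space M by (rule brownian_motionD(1)[OF b])
 have m[measurable]: "\<Delta> \<in> borel_measurable M"
  unfolding \<Delta>_def using st by (intro borel_measurable_diff brownian_motionD(2)[OF b]) auto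
 have d: "distr M borel \<Delta> = gauss (t - s)"
  unfolding \<Delta>_def using brownian_increment_law[OF b, of s t] st by (simp add: inc_law_def)
 have v: "0 < t - s" using st by simp
 have I: "integrable M (%z. f (\<Delta> z)) \<longleftrightarrow> integrable (gauss (t - s)) f"
  and E: "(\<integral>z. f (\<Delta> z) \<partial>M) = (\<integral>x. f x \<partial>gauss (t - s))" if "f \<in> borel_measurable borel" for f :: "real => real"
  unfolding d[symmetric] using that by (simp_all add: integrable_distr_eq integral_distr)
 have 11: "integrable M \<Delta>" by (rule I[of "%x. x", THEN iffD2, OF _ gauss_moments(1)[OF v]]) measurable
 have 12: "(\<integral>z. \<Delta> z \<partial>M) = 0"
  by (rule trans[OF E[of "%x. x"] gauss_moments(2)[OF v]]) measurable
 have 21: "integrable M (%z. (\<Delta> z)\<^sup>2)"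
  by (rule I[of "%x. x\<^sup>2", THEN iffD2, OF _ gauss_moments(3)[OF v]]) measurable
 have 22: "(\<integral>z. (\<Delta> z)\<^sup>2 \<partial>M) = t - s"
  by (rule trans[OF E[of "%x. x\<^sup>2"] gauss_moments(4)[OF v]]) measurable
 have 41: "integrable M (%z. (\<Delta> z) ^ 4)"
  by (rule I[of "%x. x ^ 4", THEN iffD2, OF _ gauss_fourth_moment(1)[OF v]]) measurable
 have 42: "(\<integral>z. (\<Delta> z) ^ 4 \<partial>M) = 3 * (t - s)\<^sup>2"
  by (rule trans[OF E[of "%x. x ^ 4"] gauss_fourth_moment(2)[OF v]]) measurable
 note 1 = 11 12 and 2 = 21 22 and 4 = 41 42
 show "integrable M \<Delta>" "(\<integral>z. \<Delta> z \<partial>M) = 0" "integrable M (%z. (\<Delta> z)\<^sup>2)" "(\<integral>z. (\<Delta> z)\<^sup>2 \<partial>M) = t - s"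
  by (fact 1 2)+
 define q where "q = sqrt (t - s)"
 have q: "0 < q" "q\<^sup>2 = t - s" "q * q = t - s" using v by (auto simp: q_def)
 have am: "\<bar>x\<bar> \<le> (q + x\<^sup>2 / q) / 2" for x :: real
 proof -
  have "0 \<le> (q - \<bar>x\<bar>)\<^sup>2" by simp
  then have "2 * q * \<bar>x\<bar> \<le> q\<^sup>2 + x\<^sup>2" by (simp add: power2_diff)
  then show ?thesis using q by (simp add: field_simps power2_eq_square)
 qed
 have am3: "\<bar>x\<bar> ^ 3 \<le> (q * x\<^sup>2 + x ^ 4 / q) / 2" for x :: real
 proof -
  have "\<bar>x\<bar> * x\<^sup>2 \<le> (q + x\<^sup>2 / q) / 2 * x\<^sup>2" by (rule mult_right_mono[OF am]) simp
  moreover have "\<bar>x\<bar> * x\<^sup>2 = \<bar>x\<bar> ^ 3" by (simp add: power3_eq_cube power2_eq_square)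
  moreover have "(q + x\<^sup>2 / q) / 2 * x\<^sup>2 = (q * x\<^sup>2 + x ^ 4 / q) / 2"
   by (simp add: power4_eq_xxxx power2_eq_square algebra_simps)
  ultimately show ?thesis by simp
 qed
 show i1: "integrable M (%z. \<bar>\<Delta> z\<bar>)" using 1 by simp
 show i3: "integrable M (%z. \<bar>\<Delta> z\<bar> ^ 3)"
 proof (rule Bochner_Integration.integrable_bound[of _ "%z. (q * (\<Delta> z)\<^sup>2 + (\<Delta> z) ^ 4 / q) / 2"])
  show "integrable M (%z. (q * (\<Delta> z)\<^sup>2 + (\<Delta> z) ^ 4 / q) / 2)" using 2 4 by simp
  show "AE z in M. norm (\<bar>\<Delta> z\<bar> ^ 3) \<le> norm ((q * (\<Delta> z)\<^sup>2 + (\<Delta> z) ^ 4 / q) / 2)"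
  proof (rule AE_I2)
   fix z show "norm (\<bar>\<Delta> z\<bar> ^ 3) \<le> norm ((q * (\<Delta> z)\<^sup>2 + (\<Delta> z) ^ 4 / q) / 2)"
    unfolding real_norm_def power_abs abs_abs using am3[of "\<Delta> z"] by (rule order_trans[OF _ abs_ge_self])
  qed
 qed simp
 have "(\<integral>z. \<bar>\<Delta> z\<bar> ^ 3 \<partial>M) \<le> (\<integral>z. (q * (\<Delta> z)\<^sup>2 + (\<Delta> z) ^ 4 / q) / 2 \<partial>M)"
  using i3 2 4 am3 by (intro integral_mono) auto
 also have "\<dots> = (q * (t - s) + 3 * (t - s)\<^sup>2 / q) / 2" using 2 4 by simp
 also have "\<dots> = 2 * (t - s) * q" unfolding q(3)[symmetric] using q(1) by (simp add: field_simps power2_eq_square)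
 finally show "(\<integral>z. \<bar>\<Delta> z\<bar> ^ 3 \<partial>M) \<le> 2 * (t - s) * sqrt (t - s)" by (simp add: q_def)
 have "(\<integral>z. \<bar>\<Delta> z\<bar> \<partial>M) \<le> (\<integral>z. (q + (\<Delta> z)\<^sup>2 / q) / 2 \<partial>M)"
  using i1 2 am by (intro integral_mono) auto
 also have "\<dots> = (q + (t - s) / q) / 2" using 2 by (simp add: prob_space)
 also have "\<dots> = q" unfolding q(3)[symmetric] using q(1) by (simp add: field_simps)
 finally show "(\<integral>z. \<bar>\<Delta> z\<bar> \<partial>M) \<le> sqrt (t - s)" by (simp add: q_def)
qed

lemma (in prob_space) diffusion_step_error:
 fixes X X' \<Delta> D :: "'a => real" and \<phi> \<phi>1 \<phi>2 \<phi>3 :: "real => real"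
 assumes d: "!!x. (\<phi> has_real_derivative \<phi>1 x) (at x)" "!!x. (\<phi>1 has_real_derivative \<phi>2 x) (at x)"
  "!!x. (\<phi>2 has_real_derivative \<phi>3 x) (at x)"
  and K: "!!x. \<bar>\<phi> x\<bar> \<le> K" "!!x. \<bar>\<phi>1 x\<bar> \<le> K" "!!x. \<bar>\<phi>2 x\<bar> \<le> K" "!!x. \<bar>\<phi>3 x\<bar> \<le> K"
  and m: "X \<in> borel_measurable M" "D \<in> borel_measurable M"
  and X': "!!z. z \<in> space M ==> X' z = X z + \<Delta> z + D z"
  and D: "!!z. z \<in> space M ==> \<bar>D z\<bar> \<le> B * h" and h: "0 < h" "0 \<le> B"
  and ind: "indep_var borel X borel \<Delta>"
  and \<Delta>: "integrable M \<Delta>" "expectation \<Delta> = 0" "integrable M (%z. (\<Delta> z)\<^sup>2)" "expectation (%z. (\<Delta> z)\<^sup>2) = h"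
  "integrable M (%z. \<bar>\<Delta> z\<bar> ^ 3)" "expectation (%z. \<bar>\<Delta> z\<bar> ^ 3) \<le> 2 * h * sqrt h"
  "integrable M (%z. \<bar>\<Delta> z\<bar>)" "expectation (%z. \<bar>\<Delta> z\<bar>) \<le> sqrt h"
 shows "\<bar>expectation (%z. \<phi> (X' z)) - expectation (%z. \<phi> (X z)) - expectation (%z. \<phi>1 (X z) * D z)
   - h / 2 * expectation (%z. \<phi>2 (X z))\<bar> \<le> K * (2 * h * sqrt h + (sqrt h + B * h) * (B * h))"
proof -
 have K0: "0 \<le> K" using K(1)[of 0] by linarith
 have m\<phi>: "\<phi> \<in> borel_measurable borel" "\<phi>1 \<in> borel_measurable borel" "\<phi>2 \<in> borel_measurable borel"
  using d by (auto intro!: borel_measurable_continuous_onI continuous_at_imp_continuous_on DERIV_isCont)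
 have m\<Delta>: "\<Delta> \<in> borel_measurable M" using \<Delta>(1) by simp
 have mX': "(%z. X z + \<Delta> z + D z) \<in> borel_measurable M" using m m\<Delta> by simp
 have mc: "(%z. f (Y z)) \<in> borel_measurable M" if "f \<in> borel_measurable borel" "Y \<in> borel_measurable M" for f :: "real => real" and Y
  using measurable_compose[OF that(2,1)] .
 have ib: "integrable M (%z. f (Y z))" if "f \<in> borel_measurable borel" "Y \<in> borel_measurable M" "!!x. \<bar>f x\<bar> \<le> K" for f :: "real => real" and Y
  by (rule integrable_const_bound[of _ K, OF AE_I2 mc[OF that(1,2)]]) (simp add: that(3))
 have i1: "integrable M (%z. \<phi>1 (X z) * \<Delta> z)" and e1: "expectation (%z. \<phi>1 (X z) * \<Delta> z) = 0"
 proof -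
  have iv: "indep_var borel (%z. \<phi>1 (X z)) borel \<Delta>"
   using indep_var_compose[OF ind m\<phi>(2), of "%x. x" borel] by (simp add: comp_def)
  show "integrable M (%z. \<phi>1 (X z) * \<Delta> z)" by (rule indep_var_integrable[OF iv ib[OF m\<phi>(2) m(1) K(2)] \<Delta>(1)])
  show "expectation (%z. \<phi>1 (X z) * \<Delta> z) = 0"
   using indep_var_lebesgue_integral[OF iv ib[OF m\<phi>(2) m(1) K(2)] \<Delta>(1)] \<Delta>(2) by simp
 qed
 have i2: "integrable M (%z. \<phi>2 (X z) * (\<Delta> z)\<^sup>2)" and e2: "expectation (%z. \<phi>2 (X z) * (\<Delta> z)\<^sup>2) = expectation (%z. \<phi>2 (X z)) * h"
 proof -
  have iv: "indep_var borel (%z. \<phi>2 (X z)) borel (%z. (\<Delta> z)\<^sup>2)"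
   using indep_var_compose[OF ind m\<phi>(3), of "%x. x\<^sup>2" borel] by (simp add: comp_def)
  show "integrable M (%z. \<phi>2 (X z) * (\<Delta> z)\<^sup>2)" by (rule indep_var_integrable[OF iv ib[OF m\<phi>(3) m(1) K(3)] \<Delta>(3)])
  show "expectation (%z. \<phi>2 (X z) * (\<Delta> z)\<^sup>2) = expectation (%z. \<phi>2 (X z)) * h"
   using indep_var_lebesgue_integral[OF iv ib[OF m\<phi>(3) m(1) K(3)] \<Delta>(3)] \<Delta>(4) by simp
 qed
 have iD: "integrable M (%z. \<phi>1 (X z) * D z)"
 proof (rule integrable_const_bound[of _ "K * (B * h)"])
  show "AE z in M. norm (\<phi>1 (X z) * D z) \<le> K * (B * h)"
   using K(2) D K0 by (intro AE_I2) (auto simp: abs_mult intro!: mult_mono)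
 qed (rule borel_measurable_times[OF mc[OF m\<phi>(2) m(1)] m(2)])
 let ?R = "%z. \<phi> (X z + \<Delta> z + D z) - \<phi> (X z) - \<phi>1 (X z) * D z - \<phi>1 (X z) * \<Delta> z - \<phi>2 (X z) * (\<Delta> z)\<^sup>2 / 2"
 have R: "\<bar>?R z\<bar> \<le> K * \<bar>\<Delta> z\<bar> ^ 3 + K * (\<bar>\<Delta> z\<bar> + B * h) * (B * h)" if z: "z \<in> space M" for z
 proof -
  have "?R z = (\<phi> (X z + \<Delta> z) - \<phi> (X z) - \<phi>1 (X z) * \<Delta> z - \<phi>2 (X z) * (\<Delta> z)\<^sup>2 / 2)
    + (\<phi> (X z + \<Delta> z + D z) - \<phi> (X z + \<Delta> z) - \<phi>1 (X z) * D z)" by simp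
  also have "\<bar>\<dots>\<bar> \<le> K * \<bar>\<Delta> z\<bar> ^ 3 + K * (\<bar>\<Delta> z\<bar> + \<bar>D z\<bar>) * \<bar>D z\<bar>"
   by (rule order_trans[OF abs_triangle_ineq add_mono[OF taylor3_bound[OF d K(4)] taylor_drift_bound[OF d(1,2) K(3)]]])
  also have "\<dots> \<le> K * \<bar>\<Delta> z\<bar> ^ 3 + K * (\<bar>\<Delta> z\<bar> + B * h) * (B * h)"
   using D[OF z] K0 by (intro add_left_mono mult_mono add_mono) auto
  finally show ?thesis .
 qed
 have iR: "integrable M ?R" using ib[OF m\<phi>(1) mX' K(1)] ib[OF m\<phi>(1) m(1) K(1)] iD i1 i2
  by (intro Bochner_Integration.integrable_diff) auto
 have eR: "expectation ?R = expectation (%z. \<phi> (X' z)) - expectation (%z. \<phi> (X z)) - expectation (%z. \<phi>1 (X z) * D z)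
   - h / 2 * expectation (%z. \<phi>2 (X z))"
 proof -
  have "expectation (%z. \<phi> (X' z)) = expectation (%z. \<phi> (X z + \<Delta> z + D z))"
   using X' by (intro Bochner_Integration.integral_cong) auto
  moreover have "expectation ?R = expectation (%z. \<phi> (X z + \<Delta> z + D z)) - expectation (%z. \<phi> (X z))
    - expectation (%z. \<phi>1 (X z) * D z) - expectation (%z. \<phi>1 (X z) * \<Delta> z) - expectation (%z. \<phi>2 (X z) * (\<Delta> z)\<^sup>2) / 2"
   using ib[OF m\<phi>(1) mX' K(1)] ib[OF m\<phi>(1) m(1) K(1)] iD i1 i2 by simp
  ultimately show ?thesis by (simp add: e1 e2)
 qed
 have "\<bar>expectation ?R\<bar> \<le> expectation (%z. \<bar>?R z\<bar>)" by (rule integral_abs_bound)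
 also have "\<dots> \<le> expectation (%z. K * \<bar>\<Delta> z\<bar> ^ 3 + K * (\<bar>\<Delta> z\<bar> + B * h) * (B * h))"
  using R iR \<Delta>(5,7) by (intro integral_mono) (auto simp: algebra_simps)
 also have "\<dots> = K * (expectation (%z. \<bar>\<Delta> z\<bar> ^ 3) + (expectation (%z. \<bar>\<Delta> z\<bar>) + B * h) * (B * h))"
  using \<Delta>(5,7) by (simp add: prob_space algebra_simps)
 also have "\<dots> \<le> K * (2 * h * sqrt h + (sqrt h + B * h) * (B * h))"
  using K0 h \<Delta>(6,8) by (intro mult_left_mono add_mono mult_right_mono) auto
 finally show ?thesis unfolding eR .
qed

lemma generator_oscillation:
 fixes A :: real
 assumes "\<bar>A\<bar> \<le> B" and p: "\<bar>p - p'\<bar> \<le> K * e" and q: "\<bar>q - q'\<bar> \<le> K * e"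
 shows "\<bar>p * A + q / 2 - (q' / 2 + A * p')\<bar> \<le> (K * B + K / 2) * e"
proof -
 have "p * A + q / 2 - (q' / 2 + A * p') = A * (p - p') + (q - q') / 2" by (simp add: field_simps)
 moreover have "\<bar>A * (p - p')\<bar> \<le> B * (K * e)" unfolding abs_mult using assms by (intro mult_mono) auto
 moreover have "(K * B + K / 2) * e = B * (K * e) + K * e / 2" by (simp add: algebra_simps)
 moreover have "\<bar>(q - q') / 2\<bar> \<le> K * e / 2" using q by simp
 ultimately show ?thesis using abs_triangle_ineq[of "A * (p - p')" "(q - q') / 2"] by linarith
qed

text \<open>The expectation minus the time integral of the generator changes by O(h^(3/2)) over
  steps of length h, hence is constant. For a deterministic start the solution is a functional of b
  alone, so its value at s is independent of the next increment.\<close>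

lemma weak_formulation_deterministic_start:
 fixes \<xi> :: real
 assumes b: "brownian_motion T M b" and T: "0 \<le> T" and a: "lip_drift T L a"
  and B: "!!s x. s \<in> {0..T} ==> \<bar>a s x\<bar> \<le> B"
  and d: "!!x. (\<phi> has_real_derivative \<phi>1 x) (at x)" "!!x. (\<phi>1 has_real_derivative \<phi>2 x) (at x)"
  "!!x. (\<phi>2 has_real_derivative \<phi>3 x) (at x)"
  and K: "!!x. \<bar>\<phi> x\<bar> \<le> K" "!!x. \<bar>\<phi>1 x\<bar> \<le> K" "!!x. \<bar>\<phi>2 x\<bar> \<le> K" "!!x. \<bar>\<phi>3 x\<bar> \<le> K"
  and t: "t \<in> {0..T}"
 defines "X \<equiv> %z. ode_sol a (%t. \<xi> + b t z)"
 shows "(\<integral>z. \<phi> (X z t) \<partial>M) = \<phi> \<xi> + integral {0..t} (%s. \<integral>z. \<phi>2 (X z s) / 2 + a s (X z s) * \<phi>1 (X z s) \<partial>M)"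
proof -
 interpret prob_space M by (rule brownian_motionD(1)[OF b])
 have K0: "0 \<le> K" using K(1)[of 0] by linarith
 have B0: "0 \<le> B" using B[of 0 0] T by (auto intro: order_trans[OF abs_ge_zero])
 have cy: "continuous_on {0..T} (%t. \<xi> + b t z)" if "z \<in> space M" for z
  by (intro continuous_intros brownian_motionD(4)[OF b that])
 have cX: "continuous_on {0..T} (X z)" if "z \<in> space M" for z
  unfolding X_def by (rule continuous_on_ode_sol[OF a cy[OF that]])
 let ?V = "%t. vimage_algebra (space M) (%z. \<lambda>r\<in>{0..t}. b r z) (PiM {0..t} (%_. borel :: real measure))"
 have VX: "(%z. X z t) \<in> borel_measurable (?V t)" if t: "t \<in> {0..T}" for t unfolding X_def
 proof (rule ode_sol_measurable[OF t])
  show "continuous_on {0..T} (%t. \<xi> + b t z)" if "z \<in> space (?V t)" for z using that cy by simp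
  show "(%(z, x). a s x) \<in> borel_measurable (?V t \<Otimes>\<^sub>M borel)" if "s \<in> {0..t}" for s
   unfolding split_beta by (rule measurable_compose[OF measurable_snd lip_drift_measurable[OF a]]) (use that t in auto)
  show "(%z. \<xi> + b s z) \<in> borel_measurable (?V t)" if s: "s \<in> {0..t}" for s
  proof -
   have f: "(%z. \<lambda>r\<in>{0..t}. b r z) \<in> space M \<rightarrow> space (PiM {0..t} (%_. borel :: real measure))"
    by (auto simp: space_PiM)
   have "(%z. (\<lambda>r\<in>{0..t}. b r z) s) \<in> borel_measurable (?V t)"
    by (rule measurable_compose[OF measurable_vimage_algebra1[OF f] measurable_component_singleton[OF s]])
   then show ?thesis using s by simp
  qed
 qed (rule a)
 have mX: "(%z. X z t) \<in> borel_measurable M" if t: "t \<in> {0..T}" for t unfolding X_def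
 proof (rule ode_sol_measurable[OF t])
  show "(%(z, x). a s x) \<in> borel_measurable (M \<Otimes>\<^sub>M borel)" if "s \<in> {0..t}" for s
   unfolding split_beta by (rule measurable_compose[OF measurable_snd lip_drift_measurable[OF a]]) (use that t in auto)
  show "(%z. \<xi> + b s z) \<in> borel_measurable M" if "s \<in> {0..t}" for s
   using that t by (intro borel_measurable_add borel_measurable_const brownian_motionD(2)[OF b]) auto
 qed (use a cy in auto)
 have c\<phi>: "continuous_on UNIV \<phi>" "continuous_on UNIV \<phi>1" "continuous_on UNIV \<phi>2"
  using d by (auto intro!: continuous_at_imp_continuous_on DERIV_isCont)
 note m\<phi> = c\<phi>[THEN borel_measurable_continuous_onI]
 have mc: "(%z. f (X z s)) \<in> borel_measurable M" if "f \<in> borel_measurable borel" "s \<in> {0..T}" for f :: "real => real" and s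
  using measurable_compose[OF mX[OF that(2)] that(1)] .
 note mcs = mc[OF m\<phi>(1)] mc[OF m\<phi>(2)] mc[OF m\<phi>(3)]
 have cc: "continuous_on {0..T} (%s. f (X z s))" if "continuous_on UNIV f" "z \<in> space M" for f :: "real => real" and z
  by (rule continuous_on_compose2[OF that(1) cX[OF that(2)]]) simp
 have ca: "continuous_on {0..T} (%s. a s (X z s))" if "z \<in> space M" for z
  by (rule lip_drift_continuous_comp[OF a cX[OF that]])
 have ma: "(%z. a s (X z s)) \<in> borel_measurable M" if "s \<in> {0..T}" for s
  by (rule mc[OF lip_drift_measurable[OF a that] that])
 let ?r = "%z s. \<phi>2 (X z s) / 2 + a s (X z s) * \<phi>1 (X z s)"
 have mr: "(%z. ?r z s) \<in> borel_measurable M" if "s \<in> {0..T}" for s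
  using that by (intro borel_measurable_add borel_measurable_times borel_measurable_divide borel_measurable_const mcs ma)
 have cr: "continuous_on {0..T} (?r z)" if "z \<in> space M" for z
  using that by (intro continuous_intros cc c\<phi> ca) auto
 have Kr: "\<bar>?r z s\<bar> \<le> K / 2 + B * K" if "z \<in> space M" "s \<in> {0..T}" for z s
 proof -
  have "\<bar>a s (X z s) * \<phi>1 (X z s)\<bar> \<le> B * K" unfolding abs_mult using B[OF that(2)] K(2) B0 by (intro mult_mono) auto
  moreover have "\<bar>\<phi>2 (X z s) / 2\<bar> \<le> K / 2" using K(3)[of "X z s"] by simp
  ultimately show ?thesis using abs_triangle_ineq[of "\<phi>2 (X z s) / 2" "a s (X z s) * \<phi>1 (X z s)"] by linarith
 qed
 define R where "R s = expectation (%z. ?r z s)" for s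
 have cR: "continuous_on {0..T} R" unfolding R_def by (rule expectation_continuous[OF mr cr Kr])
 define J where "J t = expectation (%z. \<phi> (X z t)) - integral {0..t} R" for t
 define S where "S = sqrt T"
 \<comment> \<open>Collects the coefficients of h q, where q = sqrt h, after h is replaced by the
   larger S q in the factors q + B h.\<close>
 define C where "C = K * (2 + (1 + B * S) * B) + (K * B + K / 2) * (1 + B * S)"
 have "J t = J 0"
 proof (rule zero_growth_constant[OF _ t, of J C])
  fix s t assume st: "0 \<le> s" "s \<le> t" "t \<le> T"
  show "\<bar>J t - J s\<bar> \<le> C * (t - s) * sqrt (t - s)"
  proof (cases "s = t")
   case True
   then show ?thesis by simp
  next
   case False
   then have st': "s < t" using st by simp
   have sT: "s \<in> {0..T}" and tT: "t \<in> {0..T}" using st by auto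
   define h where "h = t - s"
   define q where "q = sqrt h"
   have h: "0 < h" and q: "0 < q" "q * q = h" "q \<le> S" using st st' by (auto simp: h_def q_def S_def)
   have hS: "h \<le> S * q" unfolding q(2)[symmetric] using q by (intro mult_right_mono) auto
   define D where "D z = integral {s..t} (%r. a r (X z r))" for z
   let ?\<Delta> = "%z. b t z - b s z"
   note mom = brownian_increment_moments[OF b st(1) st' st(3)]
   have X': "X z t = X z s + ?\<Delta> z + D z" if z: "z \<in> space M" for z
   proof -
    have I: "(%r. a r (X z r)) integrable_on {0..t}"
     by (rule integrable_continuous_interval[OF continuous_on_Icc_subset[OF ca[OF z] st(3)]])
    have "integral {0..s} (%r. a r (X z r)) + D z = integral {0..t} (%r. a r (X z r))"
     unfolding D_def by (rule Henstock_Kurzweil_Integration.integral_combine[OF st(1,2) I])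
    then show ?thesis using ode_sol_eq[OF a cy[OF z] sT] ode_sol_eq[OF a cy[OF z] tT] unfolding X_def by linarith
   qed
   have Db: "\<bar>integral {s..r} (%r. a r (X z r))\<bar> \<le> B * (r - s)" if z: "z \<in> space M" and r: "s \<le> r" "r \<le> t" for z r
   proof -
    have "continuous_on {s..r} (%r. a r (X z r))" by (rule continuous_on_subset[OF ca[OF z]]) (use st r in auto)
    then have "norm (integral {s..r} (%r. a r (X z r))) \<le> integral {s..r} (%_. B)"
     using st r B by (intro integral_norm_bound_integral integrable_continuous_interval) auto
    then show ?thesis using r by (simp add: mult.commute)
   qed
   have mD: "D \<in> borel_measurable M"
    unfolding D_def by (rule expectation_integral_swap(2)[OF ma ca _ st]) (use B in auto)
   have ind: "indep_var borel (%z. X z s) borel ?\<Delta>"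
    by (rule brownian_indep_past[OF b st(1) st' st(3) VX[OF sT]])
   have step: "\<bar>expectation (%z. \<phi> (X z t)) - expectation (%z. \<phi> (X z s)) - expectation (%z. \<phi>1 (X z s) * D z)
     - h / 2 * expectation (%z. \<phi>2 (X z s))\<bar> \<le> K * (2 * h * sqrt h + (sqrt h + B * h) * (B * h))"
    unfolding h_def by (rule diffusion_step_error[OF d K mX[OF sT] mD X' _ _ B0 ind mom])
     (use Db st' st in \<open>auto simp: D_def\<close>)
   \<comment> \<open>The noise contributes at most q and the drift at most B h; this mean
     displacement pays for freezing the derivatives of \<phi> below.\<close>
   have osc: "expectation (%z. \<bar>X z r - X z s\<bar>) \<le> q + B * h" "integrable M (%z. \<bar>X z r - X z s\<bar>)" if r: "r \<in> {s..t}" for r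
   proof -
    have rT: "r \<in> {0..T}" using r st by auto
    have i: "integrable M (%z. \<bar>b r z - b s z\<bar>)" and e: "expectation (%z. \<bar>b r z - b s z\<bar>) \<le> q"
    proof -
     show "integrable M (%z. \<bar>b r z - b s z\<bar>)"
      using brownian_increment_moments(7)[OF b st(1), of r] r st by (cases "r = s") auto
     have "expectation (%z. \<bar>b r z - b s z\<bar>) \<le> sqrt (r - s)"
      using brownian_increment_moments(8)[OF b st(1), of r] r st by (cases "r = s") auto
     also have "\<dots> \<le> q" using r by (simp add: q_def h_def)
     finally show "expectation (%z. \<bar>b r z - b s z\<bar>) \<le> q" .
    qed
    have le: "\<bar>X z r - X z s\<bar> \<le> \<bar>b r z - b s z\<bar> + B * h" if z: "z \<in> space M" for z
    proof -
     have I: "(%r. a r (X z r)) integrable_on {0..r}"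
      by (rule integrable_continuous_interval[OF continuous_on_Icc_subset[OF ca[OF z]]]) (use rT in auto)
     have "integral {0..s} (%r. a r (X z r)) + integral {s..r} (%r. a r (X z r)) = integral {0..r} (%r. a r (X z r))"
      by (rule Henstock_Kurzweil_Integration.integral_combine[OF st(1) _ I]) (use r in auto)
     then have "X z r - X z s = (b r z - b s z) + integral {s..r} (%r. a r (X z r))"
      using ode_sol_eq[OF a cy[OF z] sT] ode_sol_eq[OF a cy[OF z] rT] unfolding X_def by linarith
     moreover have "\<bar>integral {s..r} (%r. a r (X z r))\<bar> \<le> B * (r - s)" using Db[OF z, of r] r by auto
     moreover have "B * (r - s) \<le> B * h" using r B0 by (intro mult_left_mono) (auto simp: h_def)
     ultimately show ?thesis by linarith
    qed
    show ig: "integrable M (%z. \<bar>X z r - X z s\<bar>)"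
    proof (rule Bochner_Integration.integrable_bound[of _ "%z. \<bar>b r z - b s z\<bar> + B * h"])
     show "AE z in M. norm \<bar>X z r - X z s\<bar> \<le> norm (\<bar>b r z - b s z\<bar> + B * h)"
      using le by (intro AE_I2) (force intro: order_trans[OF _ abs_ge_self])
    qed (use i in \<open>auto intro!: borel_measurable_abs borel_measurable_diff mX rT sT\<close>)
    have "expectation (%z. \<bar>X z r - X z s\<bar>) \<le> expectation (%z. \<bar>b r z - b s z\<bar> + B * h)"
     using ig i le by (intro integral_mono) auto
    also have "\<dots> \<le> q + B * h" using i e by (simp add: prob_space)
    finally show "expectation (%z. \<bar>X z r - X z s\<bar>) \<le> q + B * h" .
   qed
   \<comment> \<open>The derivatives of \<phi> are frozen at time s while the drift keeps running.
     The time integral of \<open>?g\<close> is exactly the main part of the Taylor step, and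
     \<open>?g\<close> differs from the true integrand \<open>?r\<close> only through the
     displacement of X.\<close>
   let ?g = "%z r. \<phi>1 (X z s) * a r (X z r) + \<phi>2 (X z s) / 2"
   have mg: "(%z. ?g z r) \<in> borel_measurable M" if "r \<in> {0..T}" for r
    using that sT by (intro borel_measurable_add borel_measurable_times borel_measurable_divide borel_measurable_const mcs ma)
   have cg: "continuous_on {0..T} (?g z)" if "z \<in> space M" for z using that by (intro continuous_intros ca) auto
   have Kg: "\<bar>?g z r\<bar> \<le> K * B + K / 2" if "z \<in> space M" "r \<in> {0..T}" for z r
   proof -
    have "\<bar>\<phi>1 (X z s) * a r (X z r)\<bar> \<le> K * B" unfolding abs_mult using B[OF that(2)] K(2) K0 by (intro mult_mono) auto
    moreover have "\<bar>\<phi>2 (X z s) / 2\<bar> \<le> K / 2" using K(3)[of "X z s"] by simp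
    ultimately show ?thesis using abs_triangle_ineq[of "\<phi>1 (X z s) * a r (X z r)" "\<phi>2 (X z s) / 2"] by linarith
   qed
   have ig: "integrable M (%z. ?g z r)" if "r \<in> {0..T}" for r
    using Kg that by (intro integrable_const_bound[of _ "K * B + K / 2"] mg) auto
   have ir: "integrable M (%z. ?r z r)" if "r \<in> {0..T}" for r
    using Kr that by (intro integrable_const_bound[of _ "K / 2 + B * K"] mr) auto
   have gz: "integral {s..t} (?g z) = \<phi>1 (X z s) * D z + \<phi>2 (X z s) / 2 * h" if z: "z \<in> space M" for z
   proof -
    have "(%r. a r (X z r)) integrable_on {s..t}"
     by (rule integrable_continuous_interval, rule continuous_on_subset[OF ca[OF z]]) (use st in auto)
    then have "((%r. a r (X z r)) has_integral D z) {s..t}" unfolding D_def by (rule integrable_integral)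
    from has_integral_add[OF has_integral_mult_right[OF this, of "\<phi>1 (X z s)"] has_integral_const_real[of "\<phi>2 (X z s) / 2" s t]]
    show ?thesis using st by (simp add: integral_unique h_def mult.commute)
   qed
   have iD: "integrable M (%z. \<phi>1 (X z s) * D z)"
   proof (rule integrable_const_bound[of _ "K * (B * h)"])
    show "AE z in M. norm (\<phi>1 (X z s) * D z) \<le> K * (B * h)"
     using K(2) Db[of _ t] st K0 by (intro AE_I2) (auto simp: abs_mult D_def h_def intro!: mult_mono)
   qed (use sT in \<open>intro borel_measurable_times mcs mD\<close>)
   have i\<phi>2: "integrable M (%z. \<phi>2 (X z s))"
    using K(3) sT by (intro integrable_const_bound[of _ K] mcs) auto
   have "expectation (%z. \<phi>1 (X z s) * D z) + h / 2 * expectation (%z. \<phi>2 (X z s)) = expectation (%z. integral {s..t} (?g z))"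
   proof -
    have "expectation (%z. integral {s..t} (?g z)) = expectation (%z. \<phi>1 (X z s) * D z + \<phi>2 (X z s) / 2 * h)"
     by (intro Bochner_Integration.integral_cong refl gz)
    also have "\<dots> = expectation (%z. \<phi>1 (X z s) * D z) + expectation (%z. \<phi>2 (X z s) / 2 * h)"
     using iD i\<phi>2 by (intro Bochner_Integration.integral_add) auto
    finally show ?thesis by simp
   qed
   also have "\<dots> = integral {s..t} (%r. expectation (%z. ?g z r))"
    by (rule expectation_integral_swap(1)[OF mg cg Kg st])
   finally have eg: "expectation (%z. \<phi>1 (X z s) * D z) + h / 2 * expectation (%z. \<phi>2 (X z s)) = \<dots>" .
   have cG: "continuous_on {0..T} (%r. expectation (%z. ?g z r))" by (rule expectation_continuous[OF mg cg Kg])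
   have IG: "(%r. expectation (%z. ?g z r)) integrable_on {s..t}" and IR: "R integrable_on {s..t}"
    by (rule integrable_continuous_interval, rule continuous_on_subset[OF cG], use st in auto)
     (rule integrable_continuous_interval, rule continuous_on_subset[OF cR], use st in auto)
   have pw: "\<bar>expectation (%z. ?g z r) - R r\<bar> \<le> (K * B + K / 2) * (q + B * h)" if r: "r \<in> {s..t}" for r
   proof -
    have rT: "r \<in> {0..T}" using r st by auto
    have e1: "expectation (%z. ?g z r) - R r = expectation (%z. ?g z r - ?r z r)"
     unfolding R_def by (rule Bochner_Integration.integral_diff[OF ig[OF rT] ir[OF rT], symmetric])
    have "\<bar>expectation (%z. ?g z r) - R r\<bar> \<le> expectation (%z. \<bar>?g z r - ?r z r\<bar>)"
     unfolding e1 by (rule integral_abs_bound)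
    also have "\<dots> \<le> expectation (%z. (K * B + K / 2) * \<bar>X z r - X z s\<bar>)"
    proof (rule Bochner_Integration.integral_mono[OF integrable_abs[OF Bochner_Integration.integrable_diff[OF ig[OF rT] ir[OF rT]]]
       integrable_mult_right[OF osc(2)[OF r]]])
     fix z
     have 1: "\<bar>\<phi>1 (X z s) - \<phi>1 (X z r)\<bar> \<le> K * \<bar>X z r - X z s\<bar>"
      unfolding abs_minus_commute[of "X z r" "X z s"] by (rule lipschitz_from_deriv[OF d(2) K(3)])
     have 2: "\<bar>\<phi>2 (X z s) - \<phi>2 (X z r)\<bar> \<le> K * \<bar>X z r - X z s\<bar>"
      unfolding abs_minus_commute[of "X z r" "X z s"] by (rule lipschitz_from_deriv[OF d(3) K(4)])
     show "\<bar>?g z r - ?r z r\<bar> \<le> (K * B + K / 2) * \<bar>X z r - X z s\<bar>"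
      by (rule generator_oscillation[OF B[OF rT] 1 2])
    qed
    also have "\<dots> \<le> (K * B + K / 2) * (q + B * h)" using osc[OF r] K0 B0 by (simp add: mult_left_mono)
    finally show ?thesis .
   qed
   have e2: "integral {s..t} (%r. expectation (%z. ?g z r)) - integral {s..t} R = integral {s..t} (%r. expectation (%z. ?g z r) - R r)"
    by (rule Henstock_Kurzweil_Integration.integral_diff[OF IG IR, symmetric])
   have "norm (integral {s..t} (%r. expectation (%z. ?g z r)) - integral {s..t} R) \<le> integral {s..t} (%r. (K * B + K / 2) * (q + B * h))"
    unfolding e2 using pw by (intro integral_norm_bound_integral Henstock_Kurzweil_Integration.integrable_diff IG IR) auto
   also have "\<dots> = h * ((K * B + K / 2) * (q + B * h))" using st by (simp add: h_def)
   finally have err: "\<bar>integral {s..t} (%r. expectation (%z. ?g z r)) - integral {s..t} R\<bar> \<le> h * ((K * B + K / 2) * (q + B * h))"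
    by simp
   have "integral {0..s} R + integral {s..t} R = integral {0..t} R"
    by (rule Henstock_Kurzweil_Integration.integral_combine[OF st(1,2)
      integrable_continuous_interval[OF continuous_on_Icc_subset[OF cR st(3)]]])
   then have "J t - J s = (expectation (%z. \<phi> (X z t)) - expectation (%z. \<phi> (X z s)) - expectation (%z. \<phi>1 (X z s) * D z)
     - h / 2 * expectation (%z. \<phi>2 (X z s))) + (integral {s..t} (%r. expectation (%z. ?g z r)) - integral {s..t} R)"
    unfolding J_def using eg by linarith
   then have "\<bar>J t - J s\<bar> \<le> K * (2 * h * q + (q + B * h) * (B * h)) + h * ((K * B + K / 2) * (q + B * h))"
    using step err unfolding q_def by linarith
   also have "\<dots> \<le> K * (2 * h * q + (q + B * (S * q)) * (B * h)) + h * ((K * B + K / 2) * (q + B * (S * q)))"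
    using K0 B0 h hS by (intro add_mono mult_left_mono mult_right_mono) auto
   also have "\<dots> = C * h * q" by (simp add: C_def field_simps)
   finally show ?thesis by (simp add: h_def q_def)
  qed
 qed
 moreover have "expectation (%z. \<phi> (X z 0)) = \<phi> \<xi>"
 proof -
  have "X z 0 = \<xi>" if "z \<in> space M" for z
   using ode_sol_eq[OF a cy[OF that], of 0] T brownian_motionD(3)[OF b that] by (simp add: X_def)
  then have "expectation (%z. \<phi> (X z 0)) = expectation (%z. \<phi> \<xi>)" by (intro Bochner_Integration.integral_cong) auto
  then show ?thesis by (simp add: prob_space)
 qed
 moreover have "R = (%s. expectation (%z. ?r z s))" by (simp add: R_def fun_eq_iff)
 ultimately show ?thesis by (simp add: J_def)
qed

lemma sde_dist_integral:
 fixes F :: "(real => real) => real"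
 assumes T: "0 < T" and a: "lip_drift T L a" and \<rho>: "\<rho> \<in> space (prob_algebra borel)"
  and F: "F \<in> borel_measurable (path_space T)" and K: "!!x. x \<in> paths T ==> \<bar>F x\<bar> \<le> K"
 shows "(\<integral>x. F x \<partial>sde_dist T a \<rho>) = (\<integral>\<xi>. \<integral>w. F (sde_path T a \<xi> w) \<partial>wiener T \<partial>\<rho>)"
  "(%\<xi>. \<integral>w. F (sde_path T a \<xi> w) \<partial>wiener T) \<in> borel_measurable borel"
  "(%w. F (sde_path T a \<xi> w)) \<in> borel_measurable (wiener T)"
proof -
 have s\<rho>[measurable_cong]: "sets \<rho> = sets borel" and p\<rho>: "prob_space \<rho>"
  using \<rho> by (auto simp: space_prob_algebra)
 interpret R: prob_space \<rho> by fact
 interpret W: prob_space "wiener T" by (rule prob_space_wiener[OF T])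
 interpret P: pair_prob_space \<rho> "wiener T" ..
 have eqs: "sets (\<rho> \<Otimes>\<^sub>M wiener T) = sets (borel \<Otimes>\<^sub>M path_space T)" by (intro sets_pair_measure_cong s\<rho> sets_wiener)
 have ms0: "(%(\<xi>, w). sde_path T a \<xi> w) \<in> borel \<Otimes>\<^sub>M wiener T \<rightarrow>\<^sub>M path_space T"
  using measurable_sde_path'[OF T a] by (subst measurable_cong_sets[OF sets_pair_measure_cong[OF refl sets_wiener] refl])
 have ms: "(%(\<xi>, w). sde_path T a \<xi> w) \<in> \<rho> \<Otimes>\<^sub>M wiener T \<rightarrow>\<^sub>M path_space T"
  using measurable_sde_path'[OF T a] by (subst measurable_cong_sets[OF eqs refl])
 have mF0: "(%(\<xi>, w). F (sde_path T a \<xi> w)) \<in> borel_measurable (borel \<Otimes>\<^sub>M wiener T)"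
  using measurable_compose[OF ms0 F] by (simp add: case_prod_unfold)
 have mF: "(%(\<xi>, w). F (sde_path T a \<xi> w)) \<in> borel_measurable (\<rho> \<Otimes>\<^sub>M wiener T)"
  using measurable_compose[OF ms F] by (simp add: case_prod_unfold)
 have "integrable (\<rho> \<Otimes>\<^sub>M wiener T) (%(\<xi>, w). F (sde_path T a \<xi> w))"
 proof (rule P.integrable_const_bound[OF _ mF])
  show "AE z in \<rho> \<Otimes>\<^sub>M wiener T. norm (case z of (\<xi>, w) => F (sde_path T a \<xi> w)) \<le> K"
   using K sde_path_in_paths[OF a] by (intro AE_I2) (auto simp: space_pair_measure space_wiener paths_def[of T] split: prod.split)
 qed
 from P.integral_fst'[OF this]
 show "(\<integral>x. F x \<partial>sde_dist T a \<rho>) = (\<integral>\<xi>. \<integral>w. F (sde_path T a \<xi> w) \<partial>wiener T \<partial>\<rho>)"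
  unfolding sde_dist_def by (subst integral_distr[OF ms F]) (simp add: case_prod_unfold)
 show "(%\<xi>. \<integral>w. F (sde_path T a \<xi> w) \<partial>wiener T) \<in> borel_measurable borel"
  using W.borel_measurable_lebesgue_integral[OF mF0] .
 show "(%w. F (sde_path T a \<xi> w)) \<in> borel_measurable (wiener T)"
  using measurable_compose[OF measurable_Pair1'[of \<xi> borel "wiener T"] mF0] by simp
qed

lemma sde_dist_in_space:
 assumes T: "0 < T" and a: "lip_drift T L a" and \<rho>: "\<rho> \<in> space (prob_algebra borel)"
 shows "sde_dist T a \<rho> \<in> space (prob_algebra (path_space T))"
proof -
 have "(%_ :: real. sde_dist T a \<rho>) \<in> borel \<rightarrow>\<^sub>M prob_algebra (path_space T)"
  using \<rho> lip_drift_measurable[OF a]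
  by (intro sde_dist_kernel[OF T a]) (auto simp: case_prod_unfold intro: measurable_compose[OF measurable_snd])
 from measurable_space[OF this, of 0] show ?thesis by simp
qed

lemma sde_dist_initial:
 assumes T: "0 < T" and a: "lip_drift T L a" and \<rho>: "\<rho> \<in> space (prob_algebra borel)"
 shows "distr (sde_dist T a \<rho>) borel (%x. x 0) = \<rho>"
proof -
 have s\<rho>[measurable_cong]: "sets \<rho> = sets borel" and p\<rho>: "prob_space \<rho>"
  using \<rho> by (auto simp: space_prob_algebra)
 interpret R: prob_space \<rho> by fact
 interpret W: prob_space "wiener T" by (rule prob_space_wiener[OF T])
 have eqs: "sets (\<rho> \<Otimes>\<^sub>M wiener T) = sets (borel \<Otimes>\<^sub>M path_space T)" by (intro sets_pair_measure_cong s\<rho> sets_wiener)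
 have ms: "(%(\<xi>, w). sde_path T a \<xi> w) \<in> \<rho> \<Otimes>\<^sub>M wiener T \<rightarrow>\<^sub>M path_space T"
  using measurable_sde_path'[OF T a] by (subst measurable_cong_sets[OF eqs refl])
 have "distr (sde_dist T a \<rho>) borel (%x. x 0) = distr (\<rho> \<Otimes>\<^sub>M wiener T) borel (%z. (case z of (\<xi>, w) => sde_path T a \<xi> w) 0)"
  unfolding sde_dist_def by (subst distr_distr[OF measurable_path_eval[OF T] ms]) (simp add: comp_def)
 also have "\<dots> = distr (\<rho> \<Otimes>\<^sub>M wiener T) \<rho> fst"
 proof (intro distr_cong refl)
  fix z assume "z \<in> space (\<rho> \<Otimes>\<^sub>M wiener T)"
  then have "continuous_on {0..T} (snd z)" by (auto simp: space_pair_measure space_wiener paths_def)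
  from sde_path_eq[OF a this, of 0 "fst z"] T
  show "(case z of (\<xi>, w) => sde_path T a \<xi> w) 0 = fst z" by (simp add: case_prod_unfold driver_def)
 qed (simp add: s\<rho>)
 also have "\<dots> = \<rho>" by (rule W.distr_pair_fst)
 finally show ?thesis .
qed

text \<open>The law disintegrates over the initial value, so the formula for deterministic starts is
  averaged over \<rho>; boundedness permits exchanging this average with the time integral.\<close>

lemma sde_dist_weak_formulation:
 assumes T: "0 < T" and a: "lip_drift T L a" and \<rho>: "\<rho> \<in> space (prob_algebra borel)"
  and B: "!!s x. s \<in> {0..T} ==> \<bar>a s x\<bar> \<le> B"
  and d: "!!x. (\<phi> has_real_derivative \<phi>1 x) (at x)" "!!x. (\<phi>1 has_real_derivative \<phi>2 x) (at x)"
  "!!x. (\<phi>2 has_real_derivative \<phi>3 x) (at x)"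
  and K: "!!x. \<bar>\<phi> x\<bar> \<le> K" "!!x. \<bar>\<phi>1 x\<bar> \<le> K" "!!x. \<bar>\<phi>2 x\<bar> \<le> K" "!!x. \<bar>\<phi>3 x\<bar> \<le> K"
  and t: "t \<in> {0..T}"
 shows "(\<integral>x. \<phi> (x t) \<partial>sde_dist T a \<rho>) = (\<integral>x. \<phi> x \<partial>\<rho>) +
  integral {0..t} (%s. \<integral>x. \<phi>2 (x s) / 2 + a s (x s) * \<phi>1 (x s) \<partial>sde_dist T a \<rho>)"
proof -
 have s\<rho>: "sets \<rho> = sets borel" and p\<rho>: "prob_space \<rho>"
  using \<rho> by (auto simp: space_prob_algebra)
 have m\<rho>: "f \<in> borel_measurable borel ==> f \<in> borel_measurable \<rho>" for f :: "real => real"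
  by (subst measurable_cong_sets[OF s\<rho> refl])
 interpret R: prob_space \<rho> by fact
 interpret W: prob_space "wiener T" by (rule prob_space_wiener[OF T])
 have B0: "0 \<le> B" using B[of 0 0] T by (auto intro: order_trans[OF abs_ge_zero])
 have c\<phi>: "continuous_on UNIV \<phi>" "continuous_on UNIV \<phi>1" "continuous_on UNIV \<phi>2"
  using d by (auto intro!: continuous_at_imp_continuous_on DERIV_isCont)
 note m\<phi> = c\<phi>[THEN borel_measurable_continuous_onI]
 define F where "F s x = \<phi>2 (x s) / 2 + a s (x s) * \<phi>1 (x s)" for s and x :: "real => real"
 have me: "(%x. f (x s)) \<in> borel_measurable (path_space T)" if "f \<in> borel_measurable borel" for f :: "real => real" and s
  using measurable_compose[OF measurable_path_eval[OF T] that] .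
 have mF: "F s \<in> borel_measurable (path_space T)" if "s \<in> {0..T}" for s unfolding F_def
  by (intro borel_measurable_add borel_measurable_times borel_measurable_divide borel_measurable_const
    me[OF m\<phi>(3)] me[OF m\<phi>(2)] me[OF lip_drift_measurable[OF a that]])
 have KF: "\<bar>F s x\<bar> \<le> K / 2 + B * K" if "s \<in> {0..T}" for s x
 proof -
  have "\<bar>a s (x s) * \<phi>1 (x s)\<bar> \<le> B * K" unfolding abs_mult using B[OF that] K(2) B0 by (intro mult_mono) auto
  moreover have "\<bar>\<phi>2 (x s) / 2\<bar> \<le> K / 2" using K(3)[of "x s"] by simp
  ultimately show ?thesis unfolding F_def using abs_triangle_ineq[of "\<phi>2 (x s) / 2" "a s (x s) * \<phi>1 (x s)"] by linarith
 qed
 have SF: "(\<integral>x. F s x \<partial>sde_dist T a \<rho>) = (\<integral>\<xi>. \<integral>w. F s (sde_path T a \<xi> w) \<partial>wiener T \<partial>\<rho>)"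
  "(%\<xi>. \<integral>w. F s (sde_path T a \<xi> w) \<partial>wiener T) \<in> borel_measurable borel"
  "(%w. F s (sde_path T a \<xi> w)) \<in> borel_measurable (wiener T)" if s: "s \<in> {0..T}" for s \<xi>
  by (rule sde_dist_integral[where F = "F s", OF T a \<rho> mF[OF s] KF[OF s]])+
 have cF: "continuous_on {0..T} (%s. F s x)" if x: "continuous_on {0..T} x" for x
 proof -
  have "continuous_on {0..T} (%s. \<phi>2 (x s))" "continuous_on {0..T} (%s. \<phi>1 (x s))"
   by (rule continuous_on_compose2[OF c\<phi>(3) x] continuous_on_compose2[OF c\<phi>(2) x], simp)+
  then show ?thesis unfolding F_def by (intro continuous_intros lip_drift_continuous_comp[OF a x]) auto
 qed
 define e where "e \<xi> s = (\<integral>w. F s (sde_path T a \<xi> w) \<partial>wiener T)" for \<xi> s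
 have me': "(%\<xi>. e \<xi> s) \<in> borel_measurable \<rho>" if "s \<in> {0..T}" for s
  unfolding e_def by (rule m\<rho>[OF SF(2)[OF that]])
 have Ke: "\<bar>e \<xi> s\<bar> \<le> K / 2 + B * K" if s: "s \<in> {0..T}" for \<xi> s
  unfolding e_def by (rule W.expectation_abs_bound[OF KF[OF s]])
 have ce: "continuous_on {0..T} (e \<xi>)" for \<xi> unfolding e_def
 proof (rule W.expectation_continuous)
  show "(%w. F s (sde_path T a \<xi> w)) \<in> borel_measurable (wiener T)" if "s \<in> {0..T}" for s
   by (rule SF(3)[OF that])
  show "continuous_on {0..T} (%s. F s (sde_path T a \<xi> w))" if "w \<in> space (wiener T)" for w
   by (rule cF) (use sde_path_in_paths[OF a, of w \<xi>] that in \<open>auto simp: space_wiener paths_def[of T]\<close>)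
 qed (rule KF)
 have det: "(\<integral>w. \<phi> (sde_path T a \<xi> w t) \<partial>wiener T) = \<phi> \<xi> + integral {0..t} (e \<xi>)" for \<xi>
 proof -
  have sp: "sde_path T a \<xi> w s = ode_sol a (%t. \<xi> + (w t - w 0)) s" if "s \<in> {0..T}" for w s
   using that by (simp add: sde_path_def driver_def[abs_def])
  have "(\<integral>w. \<phi> (ode_sol a (%t. \<xi> + (w t - w 0)) t) \<partial>wiener T) = \<phi> \<xi> + integral {0..t} (%s. \<integral>w.
    \<phi>2 (ode_sol a (%t. \<xi> + (w t - w 0)) s) / 2 +
    a s (ode_sol a (%t. \<xi> + (w t - w 0)) s) * \<phi>1 (ode_sol a (%t. \<xi> + (w t - w 0)) s) \<partial>wiener T)"
   by (rule weak_formulation_deterministic_start[OF brownian_motion_wiener[OF T] less_imp_le[OF T] a B d K t])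
  moreover have "integral {0..t} (e \<xi>) = integral {0..t} (%s. \<integral>w.
    \<phi>2 (ode_sol a (%t. \<xi> + (w t - w 0)) s) / 2 +
    a s (ode_sol a (%t. \<xi> + (w t - w 0)) s) * \<phi>1 (ode_sol a (%t. \<xi> + (w t - w 0)) s) \<partial>wiener T)"
   unfolding e_def F_def by (rule Henstock_Kurzweil_Integration.integral_cong) (use t sp in simp)
  ultimately show ?thesis using sp[OF t] by simp
 qed
 have i\<phi>: "integrable \<rho> \<phi>" using K(1) by (intro R.integrable_const_bound[of _ K] m\<rho> m\<phi>) auto
 note swap = R.expectation_integral_swap[of T "%\<xi>. e \<xi>", OF me' ce Ke, of 0 t]
 have ie: "integrable \<rho> (%\<xi>. integral {0..t} (e \<xi>))"
 proof (rule R.integrable_const_bound[of _ "(K / 2 + B * K) * t"])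
  show "(%\<xi>. integral {0..t} (e \<xi>)) \<in> borel_measurable \<rho>" by (rule swap(2)) (use t in auto)
  show "AE \<xi> in \<rho>. norm (integral {0..t} (e \<xi>)) \<le> (K / 2 + B * K) * t"
  proof (rule AE_I2)
   fix \<xi>
   have "norm (integral {0..t} (e \<xi>)) \<le> integral {0..t} (%_. K / 2 + B * K)"
    using t Ke by (intro integral_norm_bound_integral integrable_continuous_interval continuous_on_Icc_subset[OF ce]) auto
   then show "norm (integral {0..t} (e \<xi>)) \<le> (K / 2 + B * K) * t" using t by (simp add: mult.commute)
  qed
 qed
 have "(\<integral>x. \<phi> (x t) \<partial>sde_dist T a \<rho>) = (\<integral>\<xi>. \<phi> \<xi> + integral {0..t} (e \<xi>) \<partial>\<rho>)"
  unfolding det[symmetric] by (rule sde_dist_integral(1)[OF T a \<rho> me[OF m\<phi>(1)] K(1)])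
 also have "\<dots> = (\<integral>x. \<phi> x \<partial>\<rho>) + (\<integral>\<xi>. integral {0..t} (e \<xi>) \<partial>\<rho>)" by (rule Bochner_Integration.integral_add[OF i\<phi> ie])
 also have "(\<integral>\<xi>. integral {0..t} (e \<xi>) \<partial>\<rho>) = integral {0..t} (%s. \<integral>\<xi>. e \<xi> s \<partial>\<rho>)"
  by (rule swap(1)) (use t in auto)
 also have "\<dots> = integral {0..t} (%s. \<integral>x. F s x \<partial>sde_dist T a \<rho>)"
 proof (rule Henstock_Kurzweil_Integration.integral_cong)
  fix s assume "s \<in> {0..t}"
  then have s: "s \<in> {0..T}" using t by auto
  show "(\<integral>\<xi>. e \<xi> s \<partial>\<rho>) = (\<integral>x. F s x \<partial>sde_dist T a \<rho>)" unfolding e_def by (rule SF(1)[OF s, symmetric])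
 qed
 finally show ?thesis unfolding F_def .
qed

section \<open>Uniqueness for the Fokker--Planck equation\<close>

primrec n_diff :: "nat => (real => real) => bool" where
 "n_diff 0 f \<longleftrightarrow> True"
| "n_diff (Suc n) f \<longleftrightarrow> (\<forall>x. f field_differentiable (at x)) \<and> n_diff n (deriv f)"

definition smooth :: "(real => real) => bool" where
 "smooth f \<longleftrightarrow> (\<forall>n. n_diff n f)"

lemma smooth_iff_funpow: "smooth f \<longleftrightarrow> (\<forall>n x. (deriv ^^ n) f field_differentiable (at x))"
proof
 assume "smooth f"
 then have "\<forall>n. n_diff n f" by (simp add: smooth_def)
 then have "(deriv ^^ n) f field_differentiable (at x)" for n x
 proof (induction n arbitrary: f)
  case 0
  then show ?case using n_diff.simps(2)[of 0 f] by simp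
 next
  case (Suc n)
  then have "n_diff n (deriv f)" for n using n_diff.simps(2)[of n f] by blast
  then show ?case using Suc.IH[of "deriv f"] by (simp add: funpow_swap1)
 qed
 then show "\<forall>n x. (deriv ^^ n) f field_differentiable (at x)" by blast
next
 assume "\<forall>n x. (deriv ^^ n) f field_differentiable (at x)"
 then have "n_diff n f" for n
 proof (induction n arbitrary: f)
  case (Suc n)
  have "f field_differentiable (at x)" for x using Suc.prems[rule_format, of 0 x] by simp
  moreover have "\<forall>n x. (deriv ^^ n) (deriv f) field_differentiable (at x)"
  proof (intro allI)
   fix n x show "(deriv ^^ n) (deriv f) field_differentiable (at x)"
    using Suc.prems[rule_format, of "Suc n" x] by (simp add: funpow_swap1)
  qed
  ultimately show ?case using Suc.IH by simp
 qed simp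
 then show "smooth f" by (simp add: smooth_def)
qed

lemma smoothD: "smooth f ==> (f has_real_derivative deriv f x) (at x)"
 and smooth_deriv: "smooth f ==> smooth (deriv f)"
proof -
 assume f: "smooth f"
 then have "n_diff (Suc 0) f" unfolding smooth_def by blast
 then show "(f has_real_derivative deriv f x) (at x)" by (simp add: field_differentiable_derivI)
 show "smooth (deriv f)" unfolding smooth_def
 proof
  fix n have "n_diff (Suc n) f" using f unfolding smooth_def by blast
  then show "n_diff n (deriv f)" by simp
 qed
qed

text \<open>Smoothness of a whole family at once: as long as derivatives stay in the family, the
  induction over the order needs no formula for higher derivatives.\<close>

lemma smooth_closed_set:
 assumes S: "!!f. f \<in> S ==> \<exists>f'\<in>S. \<forall>x. (f has_real_derivative f' x) (at x)" and f: "f \<in> S"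
 shows "smooth f"
proof -
 have "n_diff n f" for n using f
 proof (induction n arbitrary: f)
  case (Suc n)
  obtain f' where f': "f' \<in> S" "!!x. (f has_real_derivative f' x) (at x)" using S[OF Suc.prems] by blast
  then have "deriv f = f'" using DERIV_imp_deriv by blast
  then show ?case using f' Suc.IH by (auto simp: field_differentiable_def)
 qed simp
 then show ?thesis by (simp add: smooth_def)
qed

lemma n_diff_add: "n_diff n f ==> n_diff n g ==> n_diff n (%x. f x + g x)"
proof (induction n arbitrary: f g)
 case (Suc n)
 have "deriv (%x. f x + g x) = (%x. deriv f x + deriv g x)"
  using Suc.prems by (intro ext deriv_add) auto
 then show ?case using Suc by (auto intro: field_differentiable_add)
qed simp

lemma smooth_mult:
 assumes "smooth f" "smooth g" shows "smooth (%x. f x * g x)"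
proof -
 have "n_diff n (%x. f x * g x)" for n using assms
 proof (induction n arbitrary: f g)
  case (Suc n)
  have d: "((%x. f x * g x) has_real_derivative (f x * deriv g x + deriv f x * g x)) (at x)" for x
   using DERIV_mult[OF smoothD[OF Suc.prems(1)] smoothD[OF Suc.prems(2)], of x] by (simp add: algebra_simps)
  then have "deriv (%x. f x * g x) = (%x. f x * deriv g x + deriv f x * g x)"
   by (intro ext DERIV_imp_deriv)
  moreover have "n_diff n (%x. f x * deriv g x + deriv f x * g x)"
   by (intro n_diff_add Suc.IH Suc.prems smooth_deriv)
  ultimately show ?case using d by (auto simp: field_differentiable_def)
 qed simp
 then show ?thesis by (simp add: smooth_def)
qed

lemma smooth_affine:
 assumes "smooth f" shows "smooth (%x. c * f (k * x + d))"
proof (rule smooth_closed_set[where S = "{%x. c * f (k * x + d) | f c. smooth f}"])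
 fix h assume "h \<in> {%x. c * f (k * x + d) | f c. smooth f}"
 then obtain f c where h: "h = (%x. c * f (k * x + d))" and f: "smooth f" by auto
 have "((%x. c * f (k * x + d)) has_real_derivative (c * k) * deriv f (k * x + d)) (at x)" for x
  by (auto intro!: derivative_eq_intros DERIV_chain2[OF smoothD[OF f]])
 then show "\<exists>h'\<in>{%x. c * f (k * x + d) | f c. smooth f}. \<forall>x. (h has_real_derivative h' x) (at x)"
  unfolding h using smooth_deriv[OF f] by (intro bexI[of _ "%x. (c * k) * deriv f (k * x + d)"]) auto
qed (use assms in auto)

lemma smooth_poly: "smooth (poly p)"
proof (rule smooth_closed_set[where S = "range poly"])
 fix f assume "f \<in> range (poly :: real poly => _)"
 then obtain p where "f = poly p" by auto
 then show "\<exists>f'\<in>range poly. \<forall>x. (f has_real_derivative f' x) (at x)"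
  by (intro bexI[of _ "poly (pderiv p)"]) auto
qed simp

text \<open>The classical flat function exp(-1/x) times a polynomial in 1/x. These functions are
  closed under differentiation, p becoming X^2 (p - p'), also at 0, where the exponential decay
  wins.\<close>

definition flat :: "real poly => real => real" where
 "flat p x = (if x > 0 then poly p (1 / x) * exp (- 1 / x) else 0)"

lemma poly_exp_lim: "((%u. poly p u * exp (- u)) \<longlongrightarrow> 0) (at_top :: real filter)"
proof -
 have "((%u. \<Sum>i\<le>degree p. coeff p i * (u ^ i / exp u)) \<longlongrightarrow> (\<Sum>i\<le>degree p. coeff p i * 0)) at_top"
  by (intro tendsto_sum tendsto_mult tendsto_const tendsto_power_div_exp_0)
 then show ?thesis by (simp add: poly_altdef exp_minus divide_inverse sum_distrib_right mult.assoc)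
qed

lemma flat_derivative: "(flat p has_real_derivative flat ((p - pderiv p) * [:0, 0, 1:]) x) (at x)"
proof (cases x "0 :: real" rule: linorder_cases)
 case less
 have "((%_. 0) has_real_derivative 0) (at x)" by simp
 then have "(flat p has_real_derivative 0) (at x)"
  by (rule has_field_derivative_transform_within_open[of _ _ _ "{..<0}"]) (use less in \<open>auto simp: flat_def\<close>)
 then show ?thesis using less by (simp add: flat_def)
next
 case greater
 have "((%x. poly p (1 / x) * exp (- 1 / x)) has_real_derivative
   poly p (1 / x) * (exp (- 1 / x) * (1 / x\<^sup>2)) + (poly (pderiv p) (1 / x) * (- 1 / x\<^sup>2)) * exp (- 1 / x)) (at x)"
  using greater by (auto intro!: derivative_eq_intros DERIV_chain2[OF poly_DERIV] simp: power2_eq_square)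
 then have "(flat p has_real_derivative
   poly p (1 / x) * (exp (- 1 / x) * (1 / x\<^sup>2)) + (poly (pderiv p) (1 / x) * (- 1 / x\<^sup>2)) * exp (- 1 / x)) (at x)"
  by (rule has_field_derivative_transform_within_open[of _ _ _ "{0<..}"]) (use greater in \<open>auto simp: flat_def\<close>)
 moreover have "poly p (1 / x) * (exp (- 1 / x) * (1 / x\<^sup>2)) + (poly (pderiv p) (1 / x) * (- 1 / x\<^sup>2)) * exp (- 1 / x) =
   flat ((p - pderiv p) * [:0, 0, 1:]) x" using greater by (simp add: flat_def power2_eq_square algebra_simps)
 ultimately show ?thesis by simp
next
 case equal
 have "((%h. flat p h / h) \<longlongrightarrow> 0) (at_right 0)"
 proof -
  have "((%u. poly (p * [:0, 1:]) u * exp (- u)) \<longlongrightarrow> 0) at_top" by (rule poly_exp_lim)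
  then have "((%h. poly (p * [:0, 1:]) (inverse h) * exp (- inverse h)) \<longlongrightarrow> 0) (at_right 0)"
   by (rule filterlim_compose[OF _ filterlim_inverse_at_top_right])
  then show ?thesis
  proof (rule Lim_transform_eventually)
   show "\<forall>\<^sub>F h in at_right 0. poly (p * [:0, 1:]) (inverse h) * exp (- inverse h) = flat p h / h"
    unfolding eventually_at_filter by (auto simp: flat_def divide_inverse intro!: always_eventually)
  qed
 qed
 moreover have "((%h. flat p h / h) \<longlongrightarrow> 0) (at_left 0)"
 proof (rule tendsto_eventually)
  show "\<forall>\<^sub>F h in at_left 0. flat p h / h = 0"
   unfolding eventually_at_filter by (auto simp: flat_def intro!: always_eventually)
 qed
 ultimately have "((%h. flat p h / h) \<longlongrightarrow> 0) (at 0)" by (rule filterlim_split_at[rotated])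
 then show ?thesis unfolding has_field_derivative_iff equal by (simp add: flat_def)
qed

lemma smooth_flat: "smooth (flat p)"
proof (rule smooth_closed_set[where S = "range flat"])
 fix f assume "f \<in> range flat"
 then obtain p where "f = flat p" by auto
 then show "\<exists>f'\<in>range flat. \<forall>x. (f has_real_derivative f' x) (at x)"
  using flat_derivative[of p] by (intro bexI[of _ "flat ((p - pderiv p) * [:0, 0, 1:])"]) auto
qed simp

text \<open>On (-1,1) this is exp(2 - 1/(1+x) - 1/(1-x)); the factor \<open>exp 2\<close> normalises
  the value at 0 to 1. The spelling of the arguments matches \<open>smooth_affine\<close>.\<close>

definition bump :: "real => real" where
 "bump x = exp 2 * (flat 1 (1 * x + 1) * flat 1 ((- 1) * x + 1))"

lemma smooth_bump: "smooth bump"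
proof -
 have "smooth (%x. flat 1 (1 * x + 1) * flat 1 ((- 1) * x + 1))"
  using smooth_affine[OF smooth_flat[of 1], of 1 1 1] smooth_affine[OF smooth_flat[of 1], of 1 "- 1" 1]
  by (intro smooth_mult) simp_all
 from smooth_affine[OF this, of "exp 2" 1 0] show ?thesis by (simp add: bump_def[abs_def])
qed

lemma bump_props: "bump 0 = 1" "0 \<le> bump x" "bump x \<le> 1" "1 \<le> \<bar>x\<bar> ==> bump x = 0"
proof -
 show "bump 0 = 1" by (simp add: bump_def flat_def flip: exp_add)
 show "0 \<le> bump x" by (auto simp: bump_def flat_def)
 show 0: "bump x = 0" if "1 \<le> \<bar>x\<bar>" for x using that by (auto simp: bump_def flat_def)
 show "bump x \<le> 1"
 proof (cases "\<bar>x\<bar> < 1")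
  case True
  then have p: "0 < 1 + x" "0 < 1 - x" by auto
  have "bump x = exp (2 + (- 1 / (1 + x) + - 1 / (1 - x)))"
   unfolding exp_add using p by (simp add: bump_def flat_def add.commute)
  also have "2 + (- 1 / (1 + x) + - 1 / (1 - x)) = - (2 * x\<^sup>2) / ((1 + x) * (1 - x))"
  proof -
   have "2 + (- 1 / A + - 1 / C) = (2 * A * C - C - A) / (A * C)" if "A \<noteq> 0" "C \<noteq> 0" for A C :: real
    using that by (simp add: field_simps)
   from this[of "1 + x" "1 - x"] have "2 + (- 1 / (1 + x) + - 1 / (1 - x)) = (2 * (1 + x) * (1 - x) - (1 - x) - (1 + x)) / ((1 + x) * (1 - x))"
    using p by linarith
   also have "2 * (1 + x) * (1 - x) - (1 - x) - (1 + x) = - (2 * x\<^sup>2)" by (simp add: power2_eq_square algebra_simps)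
   finally show ?thesis .
  qed
  also have "exp \<dots> \<le> 1" using p by (simp add: divide_nonpos_pos)
  finally show ?thesis .
 qed (use 0[of x] in simp)
qed

definition cutoff :: "nat => real => real" where
 "cutoff n x = bump (x / Suc n)"

lemma smooth_cutoff: "smooth (cutoff n)"
 using smooth_affine[OF smooth_bump, of 1 "1 / Suc n" 0] by (simp add: cutoff_def[abs_def])

lemma test_function_iff: "test_function \<phi> \<longleftrightarrow> smooth \<phi> \<and> (\<exists>R. \<forall>x. \<bar>x\<bar> > R --> \<phi> x = 0)"
 by (simp add: test_function_def smooth_iff_funpow)

lemma test_function_mult_cutoff: "smooth \<psi> ==> test_function (%x. \<psi> x * cutoff n x)"
 unfolding test_function_iff
proof (intro conjI exI[of _ "real (Suc n)"] allI impI)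
 fix x assume "real (Suc n) < \<bar>x\<bar>"
 then have "1 \<le> \<bar>x / real (Suc n)\<bar>" by (simp add: abs_divide le_divide_eq)
 then show "\<psi> x * cutoff n x = 0" using bump_props(4) by (simp add: cutoff_def)
qed (intro smooth_mult smooth_cutoff)

lemma smooth_continuous: "smooth f ==> continuous_on A f"
 by (meson DERIV_isCont continuous_at_imp_continuous_on smoothD)

lemma test_function_deriv: assumes "test_function \<phi>" shows "test_function (deriv \<phi>)"
proof -
 obtain R where R: "!!x. \<bar>x\<bar> > R ==> \<phi> x = 0" and s: "smooth \<phi>" using assms by (auto simp: test_function_iff)
 have "deriv \<phi> x = 0" if "\<bar>x\<bar> > R" for x
 proof -
  have "((%_. 0) has_real_derivative 0) (at x)" by simp
  then have "(\<phi> has_real_derivative 0) (at x)"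
  proof (rule has_field_derivative_transform_within_open)
   show "open {x. \<bar>x\<bar> > R}" by (intro open_Collect_less continuous_intros)
  qed (use that R in auto)
  then show ?thesis by (rule DERIV_imp_deriv)
 qed
 then show ?thesis using smooth_deriv[OF s] by (auto simp: test_function_iff)
qed

lemma test_function_bounded: assumes "test_function \<phi>" obtains K where "!!x. \<bar>\<phi> x\<bar> \<le> K"
proof -
 obtain R where R: "!!x. \<bar>x\<bar> > R ==> \<phi> x = 0" and s: "smooth \<phi>" using assms by (auto simp: test_function_iff)
 have "compact (\<phi> ` {- \<bar>R\<bar>..\<bar>R\<bar>})" by (intro compact_continuous_image smooth_continuous s) auto
 then obtain K where K: "!!y. y \<in> \<phi> ` {- \<bar>R\<bar>..\<bar>R\<bar>} ==> \<bar>y\<bar> \<le> K"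
  by (metis compact_imp_bounded bounded_iff real_norm_def)
 have "\<bar>\<phi> x\<bar> \<le> max K 0" for x
 proof (cases "\<bar>x\<bar> \<le> \<bar>R\<bar>")
  case True
  then have "\<phi> x \<in> \<phi> ` {- \<bar>R\<bar>..\<bar>R\<bar>}" by (intro imageI) auto
  then show ?thesis using K by (simp add: le_max_iff_disj)
 next
  case False
  then show ?thesis using R[of x] by simp
 qed
 then show ?thesis using that by blast
qed

lemma deriv_bump_bounded: obtains K where "!!x. \<bar>bump x\<bar> \<le> K" "!!x. \<bar>deriv bump x\<bar> \<le> K" "!!x. \<bar>deriv (deriv bump) x\<bar> \<le> K"
proof -
 have t: "test_function bump"
  unfolding test_function_iff using smooth_bump bump_props(4) by (intro conjI exI[of _ 1]) auto
 obtain K1 where "!!x. \<bar>bump x\<bar> \<le> K1" using test_function_bounded[OF t] by blast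
 moreover obtain K2 where "!!x. \<bar>deriv bump x\<bar> \<le> K2" using test_function_bounded[OF test_function_deriv[OF t]] by blast
 moreover obtain K3 where "!!x. \<bar>deriv (deriv bump) x\<bar> \<le> K3"
  using test_function_bounded[OF test_function_deriv[OF test_function_deriv[OF t]]] by blast
 ultimately show ?thesis using that[of "max K1 (max K2 K3)"] by (meson max.coboundedI1 max.coboundedI2)
qed

lemma cutoff_derivs:
 "(cutoff n has_real_derivative deriv bump (x / Suc n) / Suc n) (at x)"
 "((%x. deriv bump (x / Suc n) / Suc n) has_real_derivative deriv (deriv bump) (x / Suc n) / (real (Suc n))\<^sup>2) (at x)"
proof -
 show "(cutoff n has_real_derivative deriv bump (x / Suc n) / Suc n) (at x)" unfolding cutoff_def
  by (rule DERIV_chain2[OF smoothD[OF smooth_bump], THEN DERIV_cong]) (auto intro!: derivative_eq_intros)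
 have "((%x. deriv bump (x / Suc n)) has_real_derivative deriv (deriv bump) (x / Suc n) * (1 / Suc n)) (at x)"
  by (rule DERIV_chain2[OF smoothD[OF smooth_deriv[OF smooth_bump]]]) (auto intro!: derivative_eq_intros)
 from DERIV_cdivide[OF this, of "Suc n"]
 show "((%x. deriv bump (x / Suc n) / Suc n) has_real_derivative deriv (deriv bump) (x / Suc n) / (real (Suc n))\<^sup>2) (at x)"
  by (simp add: power2_eq_square del: of_nat_Suc)
qed

lemma cutoff_lim: "(%n. cutoff n x) \<longlonglongrightarrow> 1"
proof -
 have "(%n. x * inverse (real (Suc n))) \<longlonglongrightarrow> x * 0" by (intro tendsto_intros LIMSEQ_inverse_real_of_nat)
 then have "(%n. x / real (Suc n)) \<longlonglongrightarrow> 0" by (simp add: divide_inverse)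
 then have "(%n. bump (x / real (Suc n))) \<longlonglongrightarrow> bump 0"
  by (rule continuous_on_tendsto_compose[OF smooth_continuous[OF smooth_bump, of UNIV]]) auto
 then show ?thesis by (simp add: cutoff_def bump_props)
qed

text \<open>Weierstrass polynomials on growing intervals, multiplied by cutoffs with values in
  [0,1]. The bound c + 1/(n+1), asymptotically sharp, lets estimates on test functions pass to
  continuous functions without loss of constants.\<close>

lemma continuous_test_function_approx:
 fixes f :: "real => real"
 assumes f: "continuous_on UNIV f" and c: "!!x. \<bar>f x\<bar> \<le> c"
 obtains \<phi> where "!!n. test_function (\<phi> n)" "!!n x. \<bar>\<phi> n x\<bar> \<le> c + 1 / Suc n" "!!x. (%n. \<phi> n x) \<longlonglongrightarrow> f x"
proof -
 have c0: "0 \<le> c" using c[of 0] by linarith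
 have "\<exists>p. \<forall>x\<in>{- real (Suc n)..real (Suc n)}. \<bar>f x - poly p x\<bar> < 1 / Suc n" for n
 proof -
  obtain g where g: "real_polynomial_function g" "!!x. x \<in> {- real (Suc n)..real (Suc n)} ==> \<bar>f x - g x\<bar> < 1 / Suc n"
   using Stone_Weierstrass_real_polynomial_function[of "{- real (Suc n)..real (Suc n)}" f "1 / Suc n"]
    continuous_on_subset[OF f] by auto
  then obtain a m where ga: "g = (%x. \<Sum>i\<le>m. a i * x ^ i)" using real_polynomial_function_iff_sum by metis
  have eq: "g = poly (\<Sum>i\<le>m. monom (a i) i)" by (simp add: ga poly_sum poly_monom fun_eq_iff)
  show ?thesis using g(2) unfolding eq by blast
 qed
 then obtain p where p: "!!n x. x \<in> {- real (Suc n)..real (Suc n)} ==> \<bar>f x - poly (p n) x\<bar> < 1 / Suc n" by metis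
 define \<phi> where "\<phi> n x = poly (p n) x * cutoff n x" for n x
 have cut: "0 \<le> cutoff n x" "cutoff n x \<le> 1" for n x by (auto simp: cutoff_def bump_props)
 have near: "\<bar>\<phi> n x - f x * cutoff n x\<bar> \<le> 1 / Suc n" for n x
 proof (cases "x \<in> {- real (Suc n)..real (Suc n)}")
  case True
  have "\<bar>\<phi> n x - f x * cutoff n x\<bar> = \<bar>f x - poly (p n) x\<bar> * cutoff n x"
   using cut[of n x] by (simp add: \<phi>_def abs_mult abs_minus_commute flip: left_diff_distrib)
  also have "\<dots> \<le> 1 / Suc n * 1" using p[OF True] cut[of n x] by (intro mult_mono) auto
  finally show ?thesis by simp
 next
  case False
  then have "1 \<le> \<bar>x / real (Suc n)\<bar>" by (auto simp: abs_divide le_divide_eq)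
  then show ?thesis using bump_props(4) by (simp add: \<phi>_def cutoff_def)
 qed
 show ?thesis
 proof (rule that[of \<phi>])
  show "test_function (\<phi> n)" for n unfolding \<phi>_def by (rule test_function_mult_cutoff[OF smooth_poly])
  show "\<bar>\<phi> n x\<bar> \<le> c + 1 / Suc n" for n x
  proof -
   have "\<bar>f x * cutoff n x\<bar> \<le> c * 1" unfolding abs_mult using c cut[of n x] c0 by (intro mult_mono) auto
   then show ?thesis using near[of n x] by linarith
  qed
  show "(%n. \<phi> n x) \<longlonglongrightarrow> f x" for x
  proof -
   have "(%n. \<phi> n x - f x * cutoff n x) \<longlonglongrightarrow> 0"
    by (rule Lim_null_comparison[OF always_eventually, rule_format, of _ "%n. 1 / Suc n"])
     (use near LIMSEQ_inverse_real_of_nat in \<open>auto simp: inverse_eq_divide\<close>)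
   moreover have "(%n. f x * cutoff n x) \<longlonglongrightarrow> f x * 1" by (intro tendsto_intros cutoff_lim)
   ultimately have "(%n. (\<phi> n x - f x * cutoff n x) + f x * cutoff n x) \<longlonglongrightarrow> 0 + f x * 1" by (rule tendsto_add)
   then show ?thesis by simp
  qed
 qed
qed

section \<open>The linear equation and its admissible test functions\<close>

definition generator :: "(real => real => real) => (real => real) => real => real => real" where
 "generator a \<phi> s x = deriv (deriv \<phi>) x / 2 + a s x * deriv \<phi> x"

definition weakly_continuous :: "real => (real => real measure) => bool" where
 "weakly_continuous T \<nu> \<longleftrightarrow> (\<forall>t\<in>{0..T}. \<nu> t \<in> space (prob_algebra borel)) \<and>
  (\<forall>\<phi> :: real => real. continuous_on UNIV \<phi> --> bounded (range \<phi>) --> continuous_on {0..T} (%t. \<integral>x. \<phi> x \<partial>\<nu> t))"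

definition fokker_planck :: "real => (real => real => real) => (real => real measure) => bool" where
 "fokker_planck T a \<nu> \<longleftrightarrow> weakly_continuous T \<nu> \<and>
  (\<forall>\<phi>. test_function \<phi> --> (\<forall>t\<in>{0..T}. (\<integral>x. \<phi> x \<partial>\<nu> t) = (\<integral>x. \<phi> x \<partial>\<nu> 0) +
    integral {0..t} (%s. \<integral>x. generator a \<phi> s x \<partial>\<nu> s)))"

lemma weakly_continuousD:
 assumes "weakly_continuous T \<nu>"
 shows "t \<in> {0..T} ==> prob_space (\<nu> t)" "t \<in> {0..T} ==> sets (\<nu> t) = sets borel"
  "continuous_on UNIV \<phi> ==> (!!x. \<bar>\<phi> x\<bar> \<le> K) ==> continuous_on {0..T} (%t. \<integral>x. (\<phi> x :: real) \<partial>\<nu> t)"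
proof -
 show "t \<in> {0..T} ==> prob_space (\<nu> t)" "t \<in> {0..T} ==> sets (\<nu> t) = sets borel"
  using assms by (auto simp: weakly_continuous_def space_prob_algebra)
 assume "continuous_on UNIV \<phi>" and K: "!!x. \<bar>\<phi> x\<bar> \<le> K"
 moreover have "bounded (range \<phi>)" using K by (intro boundedI[of _ K]) auto
 ultimately show "continuous_on {0..T} (%t. \<integral>x. \<phi> x \<partial>\<nu> t)" using assms unfolding weakly_continuous_def by blast
qed

lemma weakly_continuous_integrable:
 assumes "weakly_continuous T \<nu>" "t \<in> {0..T}" "continuous_on UNIV f" "!!x. \<bar>f x\<bar> \<le> (K::real)"
 shows "integrable (\<nu> t) f"
proof -
 interpret prob_space "\<nu> t" using weakly_continuousD(1)[OF assms(1,2)] .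
 have "f \<in> borel_measurable (\<nu> t)"
  using borel_measurable_continuous_onI[OF assms(3)] by (subst measurable_cong_sets[OF weakly_continuousD(2)[OF assms(1,2)] refl])
 then show ?thesis using assms(4) by (intro integrable_const_bound[of _ K]) auto
qed

lemma lipschitz_continuous_real:
 fixes f :: "real => real"
 assumes "0 \<le> L" "!!x y. \<bar>f x - f y\<bar> \<le> L * \<bar>x - y\<bar>" shows "continuous_on A f"
proof -
 have "L-lipschitz_on A f" using assms by (intro lipschitz_onI) (auto simp: dist_real_def)
 then show ?thesis by (rule lipschitz_on_continuous_on)
qed

text \<open>Measure and integrand vary together. A cutoff that carries almost all mass of the limit
  measure, hence by weak convergence of the nearby ones, reduces matters to a compact interval;
  there a finite net suffices, because the integrands are equi-Lipschitz.\<close>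

lemma weakly_continuous_param:
 fixes f :: "real => real => real"
 assumes \<nu>: "weakly_continuous T \<nu>" and L: "0 \<le> L"
  and lip: "!!s x y. s \<in> {0..T} ==> \<bar>f s x - f s y\<bar> \<le> L * \<bar>x - y\<bar>"
  and C: "!!s x. s \<in> {0..T} ==> \<bar>f s x\<bar> \<le> C"
  and c: "!!x. continuous_on {0..T} (%s. f s x)"
 shows "continuous_on {0..T} (%s. \<integral>x. f s x \<partial>\<nu> s)"
 unfolding continuous_on_sequentially comp_def
proof (intro allI ballI impI)
 fix r s assume s: "s \<in> {0..T}" and "(\<forall>n. r n \<in> {0..T}) \<and> r \<longlonglongrightarrow> s"
 then have r: "!!n. r n \<in> {0..T}" "r \<longlonglongrightarrow> s" by auto
 have C0: "0 \<le> C" using C[OF s, of 0] by linarith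
 have cf: "continuous_on UNIV (f u)" if "u \<in> {0..T}" for u by (rule lipschitz_continuous_real[OF L lip[OF that]])
 have cc: "continuous_on UNIV (cutoff N)" for N by (rule smooth_continuous[OF smooth_cutoff])
 have cut: "0 \<le> cutoff N x" "cutoff N x \<le> 1" "\<bar>cutoff N x\<bar> \<le> 1" for N x
  using bump_props(2,3)[of "x / Suc N"] by (auto simp: cutoff_def)
 interpret S: prob_space "\<nu> s" using weakly_continuousD(1)[OF \<nu> s] .
 have bound: "\<forall>\<^sub>F n in sequentially. \<bar>(\<integral>x. f (r n) x \<partial>\<nu> (r n)) - (\<integral>x. f s x \<partial>\<nu> s)\<bar> \<le> (2 + 2 * C) * e" if e: "0 < e" for e
 proof -
  have "(%N. \<integral>x. cutoff N x \<partial>\<nu> s) \<longlonglongrightarrow> (\<integral>x. 1 \<partial>\<nu> s)"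
  proof (rule integral_dominated_convergence[where w = "%_. 1"])
   show "cutoff N \<in> borel_measurable (\<nu> s)" for N
    using weakly_continuous_integrable[OF \<nu> s cc cut(3)] by auto
  qed (use cut cutoff_lim in auto)
  then have "\<forall>\<^sub>F N in sequentially. 1 - e < (\<integral>x. cutoff N x \<partial>\<nu> s)"
   using e by (intro order_tendstoD) (auto simp: S.prob_space)
  then obtain N where N: "1 - e < (\<integral>x. cutoff N x \<partial>\<nu> s)"
   unfolding eventually_sequentially by blast
  have "(%n. \<integral>x. cutoff N x \<partial>\<nu> (r n)) \<longlonglongrightarrow> (\<integral>x. cutoff N x \<partial>\<nu> s)"
   by (rule continuous_on_tendsto_compose[OF weakly_continuousD(3)[OF \<nu> cc cut(3)] r(2) s]) (use r in auto)
  then have ev1: "\<forall>\<^sub>F n in sequentially. 1 - e < (\<integral>x. cutoff N x \<partial>\<nu> (r n))"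
   using N by (rule order_tendstoD)
  have "(%n. \<integral>x. f s x \<partial>\<nu> (r n)) \<longlonglongrightarrow> (\<integral>x. f s x \<partial>\<nu> s)"
   by (rule continuous_on_tendsto_compose[OF weakly_continuousD(3)[OF \<nu> cf[OF s] C[OF s]] r(2) s]) (use r in auto)
  then have ev2: "\<forall>\<^sub>F n in sequentially. dist (\<integral>x. f s x \<partial>\<nu> (r n)) (\<integral>x. f s x \<partial>\<nu> s) < e"
   using e by (rule tendstoD)
  define M where "M = real (Suc N)"
  \<comment> \<open>Two Lipschitz errors of at most L d \<le> e/4 each and an error below e/2 at the
    net point add up to at most e.\<close>
  define d where "d = e / (4 * (L + 1))"
  have d: "0 < d" using e L by (simp add: d_def)
  obtain F where F: "finite F" "{- M..M} \<subseteq> (\<Union>x\<in>F. ball x d)"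
   using compact_Icc[of "- M" M] d unfolding compact_eq_totally_bounded by blast
  have "\<forall>x\<in>F. \<forall>\<^sub>F n in sequentially. dist (f (r n) x) (f s x) < e / 2"
  proof
   fix x show "\<forall>\<^sub>F n in sequentially. dist (f (r n) x) (f s x) < e / 2"
    by (rule tendstoD[OF continuous_on_tendsto_compose[OF c r(2) s]]) (use r e in auto)
  qed
  then have ev3: "\<forall>\<^sub>F n in sequentially. \<forall>x\<in>F. dist (f (r n) x) (f s x) < e / 2"
   using F(1) by (simp add: eventually_ball_finite)
  show ?thesis using ev1 ev2 ev3
  proof eventually_elim
   fix n assume n: "1 - e < (\<integral>x. cutoff N x \<partial>\<nu> (r n))"
    "dist (\<integral>x. f s x \<partial>\<nu> (r n)) (\<integral>x. f s x \<partial>\<nu> s) < e" "\<forall>x\<in>F. dist (f (r n) x) (f s x) < e / 2"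
   interpret R: prob_space "\<nu> (r n)" using weakly_continuousD(1)[OF \<nu> r(1)] .
   have pw: "\<bar>f (r n) x - f s x\<bar> \<le> e + 2 * C * (1 - cutoff N x)" for x
   proof (cases "x \<in> {- M..M}")
    case True
    then obtain y where y: "y \<in> F" "\<bar>y - x\<bar> < d" using F(2) by (auto simp: dist_real_def)
    have "\<bar>f (r n) x - f (r n) y\<bar> \<le> L * d" "\<bar>f s x - f s y\<bar> \<le> L * d"
     using y L by (auto intro!: order_trans[OF lip[OF r(1)]] order_trans[OF lip[OF s]] mult_left_mono simp: abs_minus_commute)
    moreover have "L * d \<le> e / 4"
    proof -
     have "L / (L + 1) \<le> 1" using L by simp
     then have "e / 4 * (L / (L + 1)) \<le> e / 4 * 1" using e by (intro mult_left_mono) auto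
     then show ?thesis by (simp add: d_def field_simps)
    qed
    moreover have "\<bar>f (r n) y - f s y\<bar> < e / 2" using n(3) y by (auto simp: dist_real_def)
    ultimately have "\<bar>f (r n) x - f s x\<bar> \<le> e" by linarith
    moreover have "0 \<le> 2 * C * (1 - cutoff N x)" using C0 cut by simp
    ultimately show ?thesis by linarith
   next
    case False
    then have "1 \<le> \<bar>x / real (Suc N)\<bar>" by (auto simp: abs_divide le_divide_eq M_def)
    then have "cutoff N x = 0" using bump_props(4) by (simp add: cutoff_def)
    moreover have "\<bar>f (r n) x - f s x\<bar> \<le> 2 * C" using C[OF r(1), of n x] C[OF s, of x] by linarith
    ultimately show ?thesis using e by simp
   qed
   have i1: "integrable (\<nu> (r n)) (f (r n))" by (rule weakly_continuous_integrable[OF \<nu> r(1) cf[OF r(1)] C[OF r(1)]])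
   have i2: "integrable (\<nu> (r n)) (f s)" by (rule weakly_continuous_integrable[OF \<nu> r(1) cf[OF s] C[OF s]])
   have i3: "integrable (\<nu> (r n)) (cutoff N)" by (rule weakly_continuous_integrable[OF \<nu> r(1) cc cut(3)])
   have "\<bar>(\<integral>x. f (r n) x \<partial>\<nu> (r n)) - (\<integral>x. f s x \<partial>\<nu> (r n))\<bar> = \<bar>\<integral>x. f (r n) x - f s x \<partial>\<nu> (r n)\<bar>"
    using i1 i2 by simp
   also have "\<dots> \<le> (\<integral>x. \<bar>f (r n) x - f s x\<bar> \<partial>\<nu> (r n))" by (rule integral_abs_bound)
   also have "\<dots> \<le> (\<integral>x. e + 2 * C * (1 - cutoff N x) \<partial>\<nu> (r n))"
    using i1 i2 i3 pw by (intro integral_mono) auto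
   also have "\<dots> = e + 2 * C * (1 - (\<integral>x. cutoff N x \<partial>\<nu> (r n)))" using i3 by (simp add: R.prob_space)
   also have "\<dots> \<le> e + 2 * C * e" using n(1) C0 by (intro add_left_mono mult_left_mono) auto
   finally have "\<bar>(\<integral>x. f (r n) x \<partial>\<nu> (r n)) - (\<integral>x. f s x \<partial>\<nu> (r n))\<bar> \<le> e + 2 * C * e" .
   then show "\<bar>(\<integral>x. f (r n) x \<partial>\<nu> (r n)) - (\<integral>x. f s x \<partial>\<nu> s)\<bar> \<le> (2 + 2 * C) * e"
    using n(2) by (simp add: dist_real_def algebra_simps)
  qed
 qed
 show "(%n. \<integral>x. f (r n) x \<partial>\<nu> (r n)) \<longlonglongrightarrow> (\<integral>x. f s x \<partial>\<nu> s)"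
 proof (rule tendstoI)
  fix e :: real assume e: "0 < e"
  have "0 < e / (2 * (2 + 2 * C))" using e C0 by simp
  from bound[OF this] show "\<forall>\<^sub>F n in sequentially. dist (\<integral>x. f (r n) x \<partial>\<nu> (r n)) (\<integral>x. f s x \<partial>\<nu> s) < e"
  proof eventually_elim
   case (elim n)
   have "(2 + 2 * C) * (e / (2 * (2 + 2 * C))) = e / 2" using C0 by (simp add: field_simps)
   then show ?case using elim e by (simp add: dist_real_def)
  qed
 qed
qed

locale bounded_drift =
 fixes T L B :: real and a :: "real => real => real"
 assumes T: "0 < T" and a: "lip_drift T L a" and B: "!!s x. s \<in> {0..T} ==> \<bar>a s x\<bar> \<le> B"
begin

lemma B0: "0 \<le> B" using B[of 0 0] T by (auto intro: order_trans[OF abs_ge_zero])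

lemma drift_product:
 assumes g: "!!s x y. s \<in> {0..T} ==> \<bar>g s x - g s y\<bar> \<le> K * \<bar>x - y\<bar>" "!!s x. s \<in> {0..T} ==> \<bar>g s x\<bar> \<le> K"
  "!!x. continuous_on {0..T} (%s. g s x)" and s: "s \<in> {0..T}"
 shows "\<bar>a s x * g s x - a s y * g s y\<bar> \<le> (L * K + B * K) * \<bar>x - y\<bar>" "\<bar>a s x * g s x\<bar> \<le> B * K"
  "continuous_on {0..T} (%s. a s x * g s x)"
proof -
 have "a s x * g s x - a s y * g s y = (a s x - a s y) * g s x + a s y * (g s x - g s y)" by (simp add: algebra_simps)
 moreover have "\<bar>(a s x - a s y) * g s x\<bar> \<le> (L * \<bar>x - y\<bar>) * K"
  unfolding abs_mult using lip_driftD[OF a] g(2)[OF s] s by (intro mult_mono) auto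
 moreover have "\<bar>a s y * (g s x - g s y)\<bar> \<le> B * (K * \<bar>x - y\<bar>)"
  unfolding abs_mult using B[OF s] g(1)[OF s] B0 by (intro mult_mono) auto
 ultimately have "\<bar>a s x * g s x - a s y * g s y\<bar> \<le> (L * \<bar>x - y\<bar>) * K + B * (K * \<bar>x - y\<bar>)"
  using abs_triangle_ineq[of "(a s x - a s y) * g s x" "a s y * (g s x - g s y)"] by linarith
 then show "\<bar>a s x * g s x - a s y * g s y\<bar> \<le> (L * K + B * K) * \<bar>x - y\<bar>" by (simp add: algebra_simps)
 show "\<bar>a s x * g s x\<bar> \<le> B * K" unfolding abs_mult using B[OF s] g(2)[OF s] B0 by (intro mult_mono) auto
 show "continuous_on {0..T} (%s. a s x * g s x)" by (intro continuous_intros lip_driftD(2)[OF a] g(3))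
qed

lemma generator_props:
 assumes s\<phi>: "smooth \<phi>" and K: "!!x. \<bar>deriv \<phi> x\<bar> \<le> K" "!!x. \<bar>deriv (deriv \<phi>) x\<bar> \<le> K" "!!x. \<bar>deriv (deriv (deriv \<phi>)) x\<bar> \<le> K"
  and s: "s \<in> {0..T}"
 shows "\<bar>generator a \<phi> s x - generator a \<phi> s y\<bar> \<le> (K + (L * K + B * K)) * \<bar>x - y\<bar>" "\<bar>generator a \<phi> s x\<bar> \<le> K + B * K"
  "continuous_on {0..T} (%s. generator a \<phi> s x)"
proof -
 note s1 = smooth_deriv[OF s\<phi>] note s2 = smooth_deriv[OF s1]
 have l1: "\<bar>deriv \<phi> x - deriv \<phi> y\<bar> \<le> K * \<bar>x - y\<bar>" for x y by (rule lipschitz_from_deriv[OF smoothD[OF s1] K(2)])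
 have l2: "\<bar>deriv (deriv \<phi>) x - deriv (deriv \<phi>) y\<bar> \<le> K * \<bar>x - y\<bar>" for x y by (rule lipschitz_from_deriv[OF smoothD[OF s2] K(3)])
 note p = drift_product[of "%_. deriv \<phi>" K, OF l1 K(1) continuous_on_const s]
 show "\<bar>generator a \<phi> s x - generator a \<phi> s y\<bar> \<le> (K + (L * K + B * K)) * \<bar>x - y\<bar>"
  unfolding generator_def using p(1)[of x y] l2[of x y] by (simp add: distrib_right abs_if split: if_splits)
 show "\<bar>generator a \<phi> s x\<bar> \<le> K + B * K"
  unfolding generator_def using p(2)[of x] K(2)[of x] abs_triangle_ineq[of "deriv (deriv \<phi>) x / 2" "a s x * deriv \<phi> x"] by simp
 show "continuous_on {0..T} (%s. generator a \<phi> s x)"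
  unfolding generator_def by (intro continuous_intros lip_driftD(2)[OF a])
qed

lemma generator_integral_continuous:
 assumes \<nu>: "weakly_continuous T \<nu>" and s\<phi>: "smooth \<phi>"
  and K: "!!x. \<bar>deriv \<phi> x\<bar> \<le> K" "!!x. \<bar>deriv (deriv \<phi>) x\<bar> \<le> K" "!!x. \<bar>deriv (deriv (deriv \<phi>)) x\<bar> \<le> K"
 shows "continuous_on {0..T} (%s. \<integral>x. generator a \<phi> s x \<partial>\<nu> s)"
proof (rule weakly_continuous_param[OF \<nu>, of "K + (L * K + B * K)" _ "K + B * K"])
 have "0 \<le> K" using K(1)[of 0] by linarith
 then show "0 \<le> K + (L * K + B * K)" using lip_driftD(1)[OF a] B0 by simp
 show "continuous_on {0..T} (%s. generator a \<phi> s x)" for x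
  by (rule generator_props(3)[OF s\<phi> K, of 0]) (use T in simp)
qed (rule generator_props[OF s\<phi> K], assumption)+

text \<open>The heat flow of a test function loses compact support, so the equation must be extended
  to bounded smooth functions with bounded derivatives. Cutoffs whose derivatives tend to 0 and
  dominated convergence achieve this.\<close>

lemma fokker_planck_bounded_smooth:
 assumes \<nu>: "fokker_planck T a \<nu>" and s\<psi>: "smooth \<psi>"
  and K: "!!x. \<bar>\<psi> x\<bar> \<le> K" "!!x. \<bar>deriv \<psi> x\<bar> \<le> K" "!!x. \<bar>deriv (deriv \<psi>) x\<bar> \<le> K" "!!x. \<bar>deriv (deriv (deriv \<psi>)) x\<bar> \<le> K"
  and t: "t \<in> {0..T}"
 shows "(\<integral>x. \<psi> x \<partial>\<nu> t) = (\<integral>x. \<psi> x \<partial>\<nu> 0) + integral {0..t} (%s. \<integral>x. generator a \<psi> s x \<partial>\<nu> s)"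
proof -
 have w: "weakly_continuous T \<nu>" using \<nu> by (simp add: fokker_planck_def)
 obtain Kb where Kb: "!!x. \<bar>bump x\<bar> \<le> Kb" "!!x. \<bar>deriv bump x\<bar> \<le> Kb" "!!x. \<bar>deriv (deriv bump) x\<bar> \<le> Kb"
  using deriv_bump_bounded by blast
 have K0: "0 \<le> K" using K(1)[of 0] by linarith
 have Kb0: "0 \<le> Kb" using Kb(1)[of 0] by linarith
 let ?\<chi> = cutoff and ?\<chi>1 = "%n x. deriv bump (x / Suc n) / Suc n" and ?\<chi>2 = "%n x. deriv (deriv bump) (x / Suc n) / (real (Suc n))\<^sup>2"
 define \<phi> where "\<phi> n x = \<psi> x * cutoff n x" for n x
 note s1 = smooth_deriv[OF s\<psi>]
 have test: "test_function (\<phi> n)" for n unfolding \<phi>_def by (rule test_function_mult_cutoff[OF s\<psi>])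
 have d1: "deriv (\<phi> n) = (%x. deriv \<psi> x * ?\<chi> n x + \<psi> x * ?\<chi>1 n x)" for n
 proof (rule ext, rule DERIV_imp_deriv)
  fix x show "(\<phi> n has_real_derivative deriv \<psi> x * ?\<chi> n x + \<psi> x * ?\<chi>1 n x) (at x)"
   unfolding \<phi>_def using DERIV_mult[OF smoothD[OF s\<psi>] cutoff_derivs(1)[of n], of x] by (simp add: algebra_simps)
 qed
 have d2: "deriv (deriv (\<phi> n)) = (%x. deriv (deriv \<psi>) x * ?\<chi> n x + 2 * (deriv \<psi> x * ?\<chi>1 n x) + \<psi> x * ?\<chi>2 n x)" for n
 proof (rule ext, rule DERIV_imp_deriv)
  fix x show "(deriv (\<phi> n) has_real_derivative deriv (deriv \<psi>) x * ?\<chi> n x + 2 * (deriv \<psi> x * ?\<chi>1 n x) + \<psi> x * ?\<chi>2 n x) (at x)"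
   unfolding d1 by (rule DERIV_cong[OF DERIV_add[OF DERIV_mult[OF smoothD[OF s1] cutoff_derivs(1)[of n]] DERIV_mult[OF smoothD[OF s\<psi>] cutoff_derivs(2)[of n]]]])
    (simp add: algebra_simps)
 qed
 have cut: "0 \<le> cutoff n x" "cutoff n x \<le> 1" "\<bar>cutoff n x\<bar> \<le> 1" for n x
  using bump_props(2,3)[of "x / Suc n"] by (auto simp: cutoff_def)
 have x1: "\<bar>?\<chi>1 n x\<bar> \<le> Kb * inverse (real (Suc n))" for n x
  unfolding divide_inverse abs_mult using Kb(2)[of "x * inverse (real (Suc n))"]
  by (simp add: mult_right_mono del: of_nat_Suc)
 have x2: "\<bar>?\<chi>2 n x\<bar> \<le> Kb * inverse (real (Suc n))" for n x
 proof -
  have "\<bar>?\<chi>2 n x\<bar> = \<bar>deriv (deriv bump) (x / Suc n)\<bar> * (inverse (real (Suc n)) * inverse (real (Suc n)))"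
   by (simp add: abs_divide divide_inverse power2_eq_square abs_mult del: of_nat_Suc)
  also have "\<dots> \<le> Kb * (inverse (real (Suc n)) * 1)"
   using Kb(3) Kb0 by (intro mult_mono) (auto simp: inverse_le_1_iff)
  finally show ?thesis by simp
 qed
 have inv1: "inverse (real (Suc n)) \<le> 1" for n by (simp add: inverse_le_1_iff)
 have x1': "\<bar>?\<chi>1 n x\<bar> \<le> Kb" and x2': "\<bar>?\<chi>2 n x\<bar> \<le> Kb" for n x
  using x1[of x n] x2[of x n] mult_left_mono[OF inv1[of n] Kb0] by linarith+
 have lz: "(%n. Kb * inverse (real (Suc n))) \<longlonglongrightarrow> 0"
  using tendsto_mult_right_zero[OF LIMSEQ_inverse_real_of_nat] by simp
 have l1: "(%n. ?\<chi>1 n x) \<longlonglongrightarrow> 0" and l2: "(%n. ?\<chi>2 n x) \<longlonglongrightarrow> 0" for x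
  by (rule Lim_null_comparison[OF always_eventually lz], use x1 in simp)
   (rule Lim_null_comparison[OF always_eventually lz], use x2 in simp)
 have b0: "\<bar>\<phi> n x\<bar> \<le> K" for n x
  unfolding \<phi>_def abs_mult using mult_mono[OF K(1)[of x] cut(3)[of n x] K0] by simp
 \<comment> \<open>By the product rule, the second derivative of the cut-off function has one term
   bounded by K and three, counted with multiplicity, bounded by \<open>K * Kb\<close>.\<close>
 define C where "C = K + 3 * K * Kb"
 have b1: "\<bar>deriv (\<phi> n) x\<bar> \<le> C" and b2: "\<bar>deriv (deriv (\<phi> n)) x\<bar> \<le> C" for n x
 proof -
  have 1: "\<bar>deriv \<psi> x * ?\<chi> n x\<bar> \<le> K * 1" "\<bar>\<psi> x * ?\<chi>1 n x\<bar> \<le> K * Kb" "\<bar>deriv (deriv \<psi>) x * ?\<chi> n x\<bar> \<le> K * 1"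
   "\<bar>deriv \<psi> x * ?\<chi>1 n x\<bar> \<le> K * Kb" "\<bar>\<psi> x * ?\<chi>2 n x\<bar> \<le> K * Kb"
   unfolding abs_mult by (intro mult_mono K cut x1' x2' K0 abs_ge_zero)+
  have "0 \<le> K * Kb" using K0 Kb0 by simp
  then show "\<bar>deriv (\<phi> n) x\<bar> \<le> C" unfolding d1 C_def using 1(1,2) by linarith
  show "\<bar>deriv (deriv (\<phi> n)) x\<bar> \<le> C" unfolding d2 C_def using 1(3-5) by linarith
 qed
 have p0: "(%n. \<phi> n x) \<longlonglongrightarrow> \<psi> x" for x
  unfolding \<phi>_def using tendsto_mult[OF tendsto_const[of "\<psi> x"] cutoff_lim[of x]] by simp
 have p1: "(%n. deriv (\<phi> n) x) \<longlonglongrightarrow> deriv \<psi> x" for x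
  unfolding d1 using tendsto_add[OF tendsto_mult[OF tendsto_const[of "deriv \<psi> x"] cutoff_lim[of x]] tendsto_mult[OF tendsto_const[of "\<psi> x"] l1[of x]]] by simp
 have p2: "(%n. deriv (deriv (\<phi> n)) x) \<longlonglongrightarrow> deriv (deriv \<psi>) x" for x
  unfolding d2
  using tendsto_add[OF tendsto_add[OF tendsto_mult[OF tendsto_const[of "deriv (deriv \<psi>) x"] cutoff_lim[of x]]
    tendsto_mult[OF tendsto_const[of 2] tendsto_mult[OF tendsto_const[of "deriv \<psi> x"] l1[of x]]]] tendsto_mult[OF tendsto_const[of "\<psi> x"] l2[of x]]] by simp
 have pg: "(%n. generator a (\<phi> n) s x) \<longlonglongrightarrow> generator a \<psi> s x" for s x
  unfolding generator_def by (intro tendsto_intros p1 p2) simp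
 have s\<phi>: "smooth (\<phi> n)" for n using test by (simp add: test_function_iff)
 have bg: "\<bar>generator a (\<phi> n) s x\<bar> \<le> C + B * C" if s: "s \<in> {0..T}" for n s x
 proof -
  have "\<bar>a s x * deriv (\<phi> n) x\<bar> \<le> B * C" unfolding abs_mult by (intro mult_mono B s b1 B0 abs_ge_zero)
  moreover have "\<bar>deriv (deriv (\<phi> n)) x / 2\<bar> \<le> C" using b2[of n x] by simp
  ultimately show ?thesis unfolding generator_def using abs_triangle_ineq[of "deriv (deriv (\<phi> n)) x / 2" "a s x * deriv (\<phi> n) x"] by linarith
 qed
 have cont_g: "continuous_on UNIV (generator a f s)" if "smooth f" "s \<in> {0..T}" for f s
 proof -
  have "continuous_on UNIV (a s)" by (rule lipschitz_continuous_real[OF lip_driftD(1)[OF a] lip_driftD(3)[OF a that(2)]])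
  moreover have "continuous_on UNIV (deriv f)" "continuous_on UNIV (deriv (deriv f))"
   using that by (auto intro: smooth_continuous smooth_deriv)
  ultimately show ?thesis unfolding generator_def by (intro continuous_intros) auto
 qed
 have int_g: "generator a f s \<in> borel_measurable (\<nu> s)" if "smooth f" "s \<in> {0..T}" for f s
  using borel_measurable_continuous_onI[OF cont_g[OF that]] by (subst measurable_cong_sets[OF weakly_continuousD(2)[OF w that(2)] refl])
 have lim_g: "(%n. \<integral>x. generator a (\<phi> n) s x \<partial>\<nu> s) \<longlonglongrightarrow> (\<integral>x. generator a \<psi> s x \<partial>\<nu> s)" if s: "s \<in> {0..T}" for s
 proof -
  interpret prob_space "\<nu> s" using weakly_continuousD(1)[OF w s] .
  show ?thesis by (rule integral_dominated_convergence[where w = "%_. C + B * C"])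
    (use pg bg[OF s] int_g[OF s\<phi> s] int_g[OF s\<psi> s] in auto)
 qed
 have lim_f: "(%n. \<integral>x. \<phi> n x \<partial>\<nu> s) \<longlonglongrightarrow> (\<integral>x. \<psi> x \<partial>\<nu> s)" if s: "s \<in> {0..T}" for s
 proof -
  interpret prob_space "\<nu> s" using weakly_continuousD(1)[OF w s] .
  have m: "f \<in> borel_measurable (\<nu> s)" if "smooth f" for f
   using borel_measurable_continuous_onI[OF smooth_continuous[OF that]] by (subst measurable_cong_sets[OF weakly_continuousD(2)[OF w s] refl])
  show ?thesis by (rule integral_dominated_convergence[where w = "%_. K"])
    (use p0 b0 m[OF s\<phi>] m[OF s\<psi>] in auto)
 qed
 have eq: "(\<integral>x. \<phi> n x \<partial>\<nu> t) = (\<integral>x. \<phi> n x \<partial>\<nu> 0) + integral {0..t} (%s. \<integral>x. generator a (\<phi> n) s x \<partial>\<nu> s)" for n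
  using \<nu> test[of n] t unfolding fokker_planck_def by blast
 have sub: "s \<in> {0..T}" if "s \<in> {0..t}" for s using that t by auto
 have lim_i: "(%n. integral {0..t} (%s. \<integral>x. generator a (\<phi> n) s x \<partial>\<nu> s)) \<longlonglongrightarrow> integral {0..t} (%s. \<integral>x. generator a \<psi> s x \<partial>\<nu> s)"
 proof (rule dominated_convergence(2)[where h = "%_. C + B * C"])
  show "(%s. \<integral>x. generator a (\<phi> n) s x \<partial>\<nu> s) integrable_on {0..t}" for n
  proof -
   note t1 = test_function_deriv[OF test[of n]] note t2 = test_function_deriv[OF t1] note t3 = test_function_deriv[OF t2]
   obtain K1 where K1: "!!x. \<bar>deriv (\<phi> n) x\<bar> \<le> K1" using test_function_bounded[OF t1] by blast
   obtain K2 where K2: "!!x. \<bar>deriv (deriv (\<phi> n)) x\<bar> \<le> K2" using test_function_bounded[OF t2] by blast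
   obtain K3 where K3: "!!x. \<bar>deriv (deriv (deriv (\<phi> n))) x\<bar> \<le> K3" using test_function_bounded[OF t3] by blast
   have "continuous_on {0..T} (%s. \<integral>x. generator a (\<phi> n) s x \<partial>\<nu> s)"
    by (rule generator_integral_continuous[OF w s\<phi>, of _ "max K1 (max K2 K3)"])
     (rule K1[THEN order_trans] K2[THEN order_trans] K3[THEN order_trans], simp)+
   from continuous_on_subset[OF this] show ?thesis using t by (intro integrable_continuous_interval) simp
  qed
  show "norm (\<integral>x. generator a (\<phi> n) s x \<partial>\<nu> s) \<le> C + B * C" if "s \<in> {0..t}" for n s
  proof -
   interpret prob_space "\<nu> s" using weakly_continuousD(1)[OF w sub[OF that]] .
   show ?thesis unfolding real_norm_def by (rule expectation_abs_bound[OF bg[OF sub[OF that]]])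
  qed
 qed (use lim_g sub in auto)
 have "0 \<in> {0..T}" using T by simp
 from tendsto_add[OF lim_f[OF this] lim_i] have "(%n. \<integral>x. \<phi> n x \<partial>\<nu> t) \<longlonglongrightarrow> (\<integral>x. \<psi> x \<partial>\<nu> 0) + integral {0..t} (%s. \<integral>x. generator a \<psi> s x \<partial>\<nu> s)"
  by (simp add: eq)
 then show ?thesis using lim_f[OF t] LIMSEQ_unique by blast
qed

end

lemma test_function_funpow: "test_function \<phi> ==> test_function ((deriv ^^ k) \<phi>)"
 by (induction k) (auto intro: test_function_deriv)

lemma test_function_smooth: "test_function \<phi> ==> smooth \<phi>" by (simp add: test_function_iff)

lemma test_function_derivs_bounded:
 assumes "test_function \<phi>" obtains K where "!!k x. k \<le> n ==> \<bar>(deriv ^^ k) \<phi> x\<bar> \<le> K"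
proof -
 have "\<forall>k. \<exists>K. \<forall>x. \<bar>(deriv ^^ k) \<phi> x\<bar> \<le> K"
  using test_function_bounded[OF test_function_funpow[OF assms]] by metis
 then obtain K where K: "!!k x. \<bar>(deriv ^^ k) \<phi> x\<bar> \<le> K k" by metis
 have "\<bar>(deriv ^^ k) \<phi> x\<bar> \<le> Max (K ` {..n})" if "k \<le> n" for k x
 proof -
  have "K k \<le> Max (K ` {..n})" using that by (intro Max_ge) auto
  then show ?thesis using K[of k x] by linarith
 qed
 then show ?thesis using that by blast
qed

section \<open>The heat semigroup\<close>

lemma derivative_of_quadratic_error:
 fixes f :: "real => real"
 assumes K: "!!h. \<bar>f (x + h) - f x - h * d\<bar> \<le> K * h\<^sup>2"
 shows "(f has_real_derivative d) (at x)"
proof -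
 have "((%h. (f (x + h) - f x) / h - d) \<longlongrightarrow> 0) (at 0)"
 proof (rule Lim_null_comparison)
  show "\<forall>\<^sub>F h in at 0. norm ((f (x + h) - f x) / h - d) \<le> K * \<bar>h\<bar>"
   unfolding eventually_at_filter
  proof (intro always_eventually allI impI)
   fix h :: real assume h: "h \<noteq> 0"
   have "\<bar>(f (x + h) - f x) / h - d\<bar> = \<bar>f (x + h) - f x - h * d\<bar> / \<bar>h\<bar>"
    using h by (simp add: field_simps flip: abs_divide)
   also have "\<dots> \<le> K * h\<^sup>2 / \<bar>h\<bar>" by (intro divide_right_mono K) simp
   also have "K * h\<^sup>2 / \<bar>h\<bar> = K * \<bar>h\<bar>" using h by (simp add: power2_eq_square field_simps flip: abs_mult)
   finally show "norm ((f (x + h) - f x) / h - d) \<le> K * \<bar>h\<bar>" by simp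
  qed
  have "((%h::real. K * \<bar>h\<bar>) \<longlongrightarrow> K * \<bar>0\<bar>) (at 0)" by (intro tendsto_intros)
  then show "((%h::real. K * \<bar>h\<bar>) \<longlongrightarrow> 0) (at 0)" by simp
 qed
 then have "((%h. (f (x + h) - f x) / h) \<longlongrightarrow> d) (at 0)" by (simp add: LIM_zero_iff)
 then show ?thesis by (simp add: DERIV_def)
qed

text \<open>Together with its converse above, this differentiates under an expectation: a quadratic
  error bound with a uniform constant survives averaging.\<close>

lemma quadratic_error_of_derivative:
 fixes f :: "real => real"
 assumes d: "!!x. (f has_real_derivative f1 x) (at x)" "!!x. (f1 has_real_derivative f2 x) (at x)"
  and K: "!!x. \<bar>f2 x\<bar> \<le> K"
 shows "\<bar>f (x + h) - f x - h * f1 x\<bar> \<le> K * h\<^sup>2"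
proof -
 let ?g = "%u. f (x + u) - f x - u * f1 x"
 have "\<bar>?g h\<bar> \<le> (K * \<bar>h\<bar>) * \<bar>h\<bar>"
 proof (rule mvt_bound)
  show "(?g has_real_derivative f1 (x + u) - f1 x) (at u)" for u
   by (auto intro!: derivative_eq_intros DERIV_chain2[OF d(1)])
  fix u :: real assume "\<bar>u\<bar> \<le> \<bar>h\<bar>"
  moreover have "0 \<le> K" using K[of 0] by linarith
  ultimately have "K * \<bar>u\<bar> \<le> K * \<bar>h\<bar>" by (intro mult_left_mono)
  then show "\<bar>f1 (x + u) - f1 x\<bar> \<le> K * \<bar>h\<bar>"
   using lipschitz_from_deriv[OF d(2) K, of "x + u" x] by simp
 qed simp
 then show ?thesis by (simp add: power2_eq_square mult.assoc flip: abs_mult)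
qed

text \<open>The heat semigroup as a Wiener expectation instead of a convolution: the heat equation
  becomes the zero-drift case of the weak formulation, and the Gaussian density enters only in the
  gradient bound.\<close>

definition heat :: "real => (real => real) => real => real => real" where
 "heat T \<phi> r x = (\<integral>w. \<phi> (x + (w r - w 0)) \<partial>wiener T)"

context
 fixes T :: real assumes T: "0 < T"
begin

interpretation W: prob_space "wiener T" by (rule prob_space_wiener[OF T])

lemma heat_integrand_measurable:
 assumes r: "r \<in> {0..T}" and \<phi>: "continuous_on UNIV \<phi>"
 shows "(%w. \<phi> (x + (w r - w 0)) :: real) \<in> borel_measurable (wiener T)"
proof -
 have "(%w. w r - w 0) \<in> borel_measurable (wiener T)" by (rule brownian_motionD(2)[OF brownian_motion_wiener[OF T] r])
 then have "(%w. x + (w r - w 0)) \<in> borel_measurable (wiener T)" by (intro borel_measurable_add borel_measurable_const)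
 then show ?thesis by (rule measurable_compose[OF _ borel_measurable_continuous_onI[OF \<phi>]])
qed

lemma heat_integrable:
 assumes r: "r \<in> {0..T}" and \<phi>: "continuous_on UNIV \<phi>" and K: "!!x. \<bar>\<phi> x\<bar> \<le> (K :: real)"
 shows "integrable (wiener T) (%w. \<phi> (x + (w r - w 0)))"
 using heat_integrand_measurable[OF r \<phi>] K by (intro W.integrable_const_bound[of _ K]) auto

lemma heat_bound:
 assumes r: "r \<in> {0..T}" and \<phi>: "continuous_on UNIV \<phi>" and K: "!!x. \<bar>\<phi> x\<bar> \<le> (K :: real)"
 shows "\<bar>heat T \<phi> r x\<bar> \<le> K" unfolding heat_def by (rule W.expectation_abs_bound[OF K])

lemma heat_0: "heat T \<phi> 0 x = \<phi> x" by (simp add: heat_def W.prob_space)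

lemma heat_derivative:
 assumes r: "r \<in> {0..T}" and \<psi>: "smooth \<psi>"
  and K: "!!x. \<bar>\<psi> x\<bar> \<le> K" "!!x. \<bar>deriv \<psi> x\<bar> \<le> K" "!!x. \<bar>deriv (deriv \<psi>) x\<bar> \<le> K"
 shows "(heat T \<psi> r has_real_derivative heat T (deriv \<psi>) r x) (at x)"
proof (rule derivative_of_quadratic_error)
 fix h
 note i0 = heat_integrable[OF r smooth_continuous[OF \<psi>] K(1)]
 note i1 = heat_integrable[OF r smooth_continuous[OF smooth_deriv[OF \<psi>]] K(2)]
 let ?e = "%w. \<psi> (x + (w r - w 0) + h) - \<psi> (x + (w r - w 0)) - h * deriv \<psi> (x + (w r - w 0))"
 have i: "integrable (wiener T) (%w. \<psi> (x + (w r - w 0) + h))" using i0[of "x + h"] by (simp add: algebra_simps)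
 have eq: "heat T \<psi> r (x + h) - heat T \<psi> r x - h * heat T (deriv \<psi>) r x = (\<integral>w. ?e w \<partial>wiener T)"
  unfolding heat_def using i0[of x] i1[of x] i by (simp add: algebra_simps)
 show "\<bar>heat T \<psi> r (x + h) - heat T \<psi> r x - h * heat T (deriv \<psi>) r x\<bar> \<le> K * h\<^sup>2"
  unfolding eq by (rule W.expectation_abs_bound[OF quadratic_error_of_derivative[OF smoothD[OF \<psi>] smoothD[OF smooth_deriv[OF \<psi>]] K(3)]])
qed

lemma heat_test_function:
 assumes r: "r \<in> {0..T}" and \<phi>: "test_function \<phi>"
 shows "(heat T \<phi> r has_real_derivative heat T (deriv \<phi>) r x) (at x)" "smooth (heat T \<phi> r)"
  "deriv (heat T \<phi> r) = heat T (deriv \<phi>) r"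
proof -
 have d: "(heat T \<psi> r has_real_derivative heat T (deriv \<psi>) r x) (at x)" if t: "test_function \<psi>" for \<psi> x
 proof -
  obtain K where K: "!!k x. k \<le> 2 ==> \<bar>(deriv ^^ k) \<psi> x\<bar> \<le> K" using test_function_derivs_bounded[OF t] by blast
  show ?thesis by (rule heat_derivative[OF r test_function_smooth[OF t], of K])
    (use K[of 0] K[of 1] K[of 2] in \<open>simp_all add: numeral_2_eq_2\<close>)
 qed
 show "(heat T \<phi> r has_real_derivative heat T (deriv \<phi>) r x) (at x)" by (rule d[OF \<phi>])
 show "deriv (heat T \<phi> r) = heat T (deriv \<phi>) r" by (intro ext DERIV_imp_deriv d \<phi>)
 show "smooth (heat T \<phi> r)"
 proof (rule smooth_closed_set[where S = "{heat T \<psi> r | \<psi>. test_function \<psi>}"])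
  fix f assume "f \<in> {heat T \<psi> r | \<psi>. test_function \<psi>}"
  then obtain \<psi> where "f = heat T \<psi> r" "test_function \<psi>" by blast
  then show "\<exists>f'\<in>{heat T \<psi> r | \<psi>. test_function \<psi>}. \<forall>x. (f has_real_derivative f' x) (at x)"
   using d test_function_deriv by blast
 qed (use \<phi> in blast)
qed

lemma heat_equation:
 assumes r: "r \<in> {0..T}" and \<phi>: "test_function \<phi>"
 shows "heat T \<phi> r x = \<phi> x + integral {0..r} (%s. heat T (deriv (deriv \<phi>)) s x / 2)"
  "continuous_on {0..T} (%s. heat T \<phi> s x)"
proof -
 obtain K where K: "!!k x. k \<le> 3 ==> \<bar>(deriv ^^ k) \<phi> x\<bar> \<le> K" using test_function_derivs_bounded[OF \<phi>] by blast
 note s0 = test_function_smooth[OF \<phi>] note s1 = smooth_deriv[OF s0] note s2 = smooth_deriv[OF s1]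
 have a: "lip_drift T 0 (%_ _. 0)" by (simp add: lip_drift_def)
 have o: "ode_sol (%_ _. 0) (%t. x + (w t - w 0)) s = x + (w s - w 0)" if "w \<in> space (wiener T)" "s \<in> {0..T}" for w s
 proof -
  have "continuous_on {0..T} (%t. x + (w t - w 0))"
   by (rule continuous_on_add[OF continuous_on_const brownian_motionD(4)[OF brownian_motion_wiener[OF T] that(1)]])
  from ode_sol_eq[OF a this that(2)] show ?thesis by simp
 qed
 have B: "\<bar>(%_ _. 0 :: real) s y\<bar> \<le> (0::real)" if "s \<in> {0..T}" for s y :: real by simp
 have "(\<integral>w. \<phi> (ode_sol (%_ _. 0) (%t. x + (w t - w 0)) r) \<partial>wiener T) = \<phi> x + integral {0..r} (%s. \<integral>w.
    deriv (deriv \<phi>) (ode_sol (%_ _. 0) (%t. x + (w t - w 0)) s) / 2 +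
    0 * deriv \<phi> (ode_sol (%_ _. 0) (%t. x + (w t - w 0)) s) \<partial>wiener T)"
  by (rule weak_formulation_deterministic_start[OF brownian_motion_wiener[OF T] less_imp_le[OF T] a B smoothD[OF s0] smoothD[OF s1] smoothD[OF s2], of _ K])
   (use K[of 0] K[of 1] K[of 2] K[of 3] r in \<open>simp_all add: numeral_2_eq_2 numeral_3_eq_3\<close>)
 moreover have "(\<integral>w. \<phi> (ode_sol (%_ _. 0) (%t. x + (w t - w 0)) r) \<partial>wiener T) = heat T \<phi> r x"
  unfolding heat_def by (intro Bochner_Integration.integral_cong refl) (simp add: o r del: atLeastAtMost_iff)
 moreover have "integral {0..r} (%s. \<integral>w.
    deriv (deriv \<phi>) (ode_sol (%_ _. 0) (%t. x + (w t - w 0)) s) / 2 +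
    0 * deriv \<phi> (ode_sol (%_ _. 0) (%t. x + (w t - w 0)) s) \<partial>wiener T) =
   integral {0..r} (%s. heat T (deriv (deriv \<phi>)) s x / 2)"
 proof (rule Henstock_Kurzweil_Integration.integral_cong)
  fix s assume "s \<in> {0..r}" then have s: "s \<in> {0..T}" using r by auto
  have "(\<integral>w. deriv (deriv \<phi>) (ode_sol (%_ _. 0) (%t. x + (w t - w 0)) s) / 2 +
    0 * deriv \<phi> (ode_sol (%_ _. 0) (%t. x + (w t - w 0)) s) \<partial>wiener T) = (\<integral>w. deriv (deriv \<phi>) (x + (w s - w 0)) / 2 \<partial>wiener T)"
   by (intro Bochner_Integration.integral_cong refl) (simp add: o s del: atLeastAtMost_iff)
  then show "(\<integral>w. deriv (deriv \<phi>) (ode_sol (%_ _. 0) (%t. x + (w t - w 0)) s) / 2 +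
    0 * deriv \<phi> (ode_sol (%_ _. 0) (%t. x + (w t - w 0)) s) \<partial>wiener T) = heat T (deriv (deriv \<phi>)) s x / 2"
   by (simp add: heat_def)
 qed
 ultimately show "heat T \<phi> r x = \<phi> x + integral {0..r} (%s. heat T (deriv (deriv \<phi>)) s x / 2)" by simp
 show "continuous_on {0..T} (%s. heat T \<phi> s x)" unfolding heat_def
 proof (rule W.expectation_continuous[where K = K])
  fix w assume "w \<in> space (wiener T)"
  then have "continuous_on {0..T} (%t. w t - w 0)" by (rule brownian_motionD(4)[OF brownian_motion_wiener[OF T]])
  then have "continuous_on {0..T} (%t. x + (w t - w 0))" by (rule continuous_on_add[OF continuous_on_const])
  then show "continuous_on {0..T} (%s. \<phi> (x + (w s - w 0)))"
   by (rule continuous_on_compose2[OF smooth_continuous[OF s0, of UNIV]]) simp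
 qed (use K[of 0] heat_integrand_measurable[OF _ smooth_continuous[OF s0]] in auto)
qed

lemma heat_time_difference:
 assumes \<phi>: "test_function \<phi>" and rs: "0 \<le> r" "r \<le> s" "s \<le> T"
 shows "heat T \<phi> s x - heat T \<phi> r x = integral {r..s} (%u. heat T (deriv (deriv \<phi>)) u x / 2)"
proof -
 have r: "r \<in> {0..T}" and s: "s \<in> {0..T}" using rs by auto
 have "continuous_on {0..T} (%u. heat T (deriv (deriv \<phi>)) u x / 2)"
  using heat_equation(2)[OF r test_function_deriv[OF test_function_deriv[OF \<phi>]]] by (intro continuous_intros) auto
 from continuous_on_subset[OF this] have "(%u. heat T (deriv (deriv \<phi>)) u x / 2) integrable_on {0..s}"
  using rs by (intro integrable_continuous_interval) simp
 then have "integral {0..r} (%u. heat T (deriv (deriv \<phi>)) u x / 2) + integral {r..s} (%u. heat T (deriv (deriv \<phi>)) u x / 2) =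
   integral {0..s} (%u. heat T (deriv (deriv \<phi>)) u x / 2)"
  using rs by (intro Henstock_Kurzweil_Integration.integral_combine) auto
 then show ?thesis unfolding heat_equation(1)[OF r \<phi>] heat_equation(1)[OF s \<phi>] by simp
qed

lemma heat_time_lipschitz:
 assumes \<phi>: "test_function \<phi>" and K: "!!x. \<bar>deriv (deriv \<phi>) x\<bar> \<le> K" and rs: "0 \<le> r" "r \<le> s" "s \<le> T"
 shows "\<bar>heat T \<phi> s x - heat T \<phi> r x\<bar> \<le> K * (s - r)"
proof -
 note t2 = test_function_deriv[OF test_function_deriv[OF \<phi>]]
 have "continuous_on {0..T} (%u. heat T (deriv (deriv \<phi>)) u x / 2)"
  using heat_equation(2)[of 0, OF _ t2] T by (intro continuous_intros) auto
 from continuous_on_subset[OF this] have "norm (integral {r..s} (%u. heat T (deriv (deriv \<phi>)) u x / 2)) \<le> integral {r..s} (%_. K)"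
 proof (intro integral_norm_bound_integral integrable_continuous_interval)
  fix u assume "u \<in> {r..s}"
  then have "\<bar>heat T (deriv (deriv \<phi>)) u x\<bar> \<le> K"
   using rs by (intro heat_bound smooth_continuous test_function_smooth t2 K) auto
  then show "norm (heat T (deriv (deriv \<phi>)) u x / 2) \<le> K" by simp
 qed (use rs in auto)
 then show ?thesis unfolding heat_time_difference[OF \<phi> rs] using rs by (simp add: mult.commute)
qed

text \<open>The time derivative is half the semigroup applied to the second derivative, and the
  fourth derivative makes it Lipschitz in time. It is taken at the later time s, which in the
  reversed variable T - t is the beginning of a step.\<close>

lemma heat_time_expansion:
 assumes \<phi>: "test_function \<phi>" and K: "!!x. \<bar>(deriv ^^ 4) \<phi> x\<bar> \<le> K" and rs: "0 \<le> r" "r \<le> s" "s \<le> T"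
 shows "\<bar>heat T \<phi> s x - heat T \<phi> r x - (s - r) * (heat T (deriv (deriv \<phi>)) s x / 2)\<bar> \<le> K * (s - r)\<^sup>2"
proof -
 note t2 = test_function_deriv[OF test_function_deriv[OF \<phi>]]
 let ?v = "%u. heat T (deriv (deriv \<phi>)) u x / 2"
 have K4: "\<bar>deriv (deriv (deriv (deriv \<phi>))) x\<bar> \<le> K" for x using K[of x] by (simp add: eval_nat_numeral)
 have K0: "0 \<le> K" using K[of 0] by linarith
 have c: "continuous_on {0..T} ?v" using heat_equation(2)[of 0, OF _ t2] T by (intro continuous_intros) auto
 have i: "?v integrable_on {r..s}" using rs by (intro integrable_continuous_interval continuous_on_subset[OF c]) simp
 have "integral {r..s} ?v - (s - r) * ?v s = integral {r..s} ?v - integral {r..s} (%_. ?v s)" using rs by simp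
 also have "\<dots> = integral {r..s} (%u. ?v u - ?v s)"
  by (rule Henstock_Kurzweil_Integration.integral_diff[OF i integrable_const_ivl, symmetric])
 finally have "integral {r..s} ?v - (s - r) * ?v s = integral {r..s} (%u. ?v u - ?v s)" .
 moreover have "norm (integral {r..s} (%u. ?v u - ?v s)) \<le> integral {r..s} (%_. K * (s - r))"
 proof (intro integral_norm_bound_integral Henstock_Kurzweil_Integration.integrable_diff i integrable_const_ivl)
  fix u assume u: "u \<in> {r..s}"
  have "\<bar>heat T (deriv (deriv \<phi>)) s x - heat T (deriv (deriv \<phi>)) u x\<bar> \<le> K * (s - u)"
   using u rs by (intro heat_time_lipschitz t2 K4) auto
  also have "\<dots> \<le> K * (s - r)" using u K0 by (intro mult_left_mono) auto
  finally show "norm (?v u - ?v s) \<le> K * (s - r)" by (simp add: abs_minus_commute flip: diff_divide_distrib)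
 qed
 ultimately show ?thesis unfolding heat_time_difference[OF \<phi> rs] using rs by (simp add: power2_eq_square mult_ac)
qed

text \<open>Integration by parts against the Gaussian density.\<close>

lemma heat_gradient_bound:
 assumes \<phi>: "test_function \<phi>" and M: "!!x. \<bar>\<phi> x\<bar> \<le> K" and r: "0 < r" "r \<le> T"
 shows "\<bar>heat T (deriv \<phi>) r x\<bar> \<le> K / sqrt r"
proof -
 note b = brownian_motion_wiener[OF T]
 note s0 = test_function_smooth[OF \<phi>] note s1 = smooth_deriv[OF s0]
 define \<Delta> where "\<Delta> w = w r - w 0" for w :: "real => real"
 let ?n = "normal_density 0 (sqrt r)"
 have D: "distributed (wiener T) lborel \<Delta> ?n"
  using brownian_motionD(5)[OF b, of 0 r] r by (simp add: \<Delta>_def[abs_def])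
 have m: "integrable (wiener T) (%w. \<bar>\<Delta> w\<bar>)" "(\<integral>w. \<bar>\<Delta> w\<bar> \<partial>wiener T) \<le> sqrt r"
  using brownian_increment_moments(7,8)[OF b, of 0 r] r by (simp_all add: \<Delta>_def[abs_def])
 have K0: "0 \<le> K" using M[of 0] by linarith
 obtain R where R: "!!x. \<bar>x\<bar> > R ==> \<phi> x = 0" using \<phi> by (auto simp: test_function_iff)
 obtain R1 where R1: "!!x. \<bar>x\<bar> > R1 ==> deriv \<phi> x = 0" using test_function_deriv[OF \<phi>] by (auto simp: test_function_iff)
 \<comment> \<open>For |y| \<ge> c both \<phi> and its derivative vanish at x + y, so the
   integration by parts runs over a compact interval with zero boundary terms.\<close>
 define c where "c = \<bar>R\<bar> + \<bar>R1\<bar> + \<bar>x\<bar> + 1"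
 have out: "\<phi> (x + y) = 0" "deriv \<phi> (x + y) = 0" if "y \<notin> {- c<..<c}" for y
  using that by (auto simp: c_def intro!: R R1)
 define p where "p y = ?n y * deriv \<phi> (x + y)" for y
 define q where "q y = ?n y * (y / r * \<phi> (x + y))" for y
 have cm: "continuous_on UNIV (%y. \<phi> (x + y))" "continuous_on UNIV (%y. deriv \<phi> (x + y))"
  by (rule continuous_on_compose2[OF smooth_continuous[OF s0, of UNIV]] continuous_on_compose2[OF smooth_continuous[OF s1, of UNIV]];
    auto intro!: continuous_intros)+
 have cn: "continuous_on UNIV ?n" unfolding normal_density_def by (intro continuous_intros) (use r in auto)
 have cp: "isCont p y" and cq: "isCont q y" for y
 proof -
  have "continuous_on UNIV p" unfolding p_def by (intro continuous_intros cn cm)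
  then show "isCont p y" by (simp add: continuous_on_eq_continuous_at)
  have "continuous_on UNIV q" unfolding q_def by (intro continuous_intros cn cm) (use r in auto)
  then show "isCont q y" by (simp add: continuous_on_eq_continuous_at)
 qed
 have off: "p y = 0" "q y = 0" if "y \<notin> {- c..c}" for y using that out[of y] by (auto simp: p_def q_def)
 have ip: "p = (%y. p y * indicator {- c..c} y)" and iq: "q = (%y. q y * indicator {- c..c} y)"
  by (auto simp: fun_eq_iff indicator_def intro: off)
 have int: "integrable lborel p" "integrable lborel q"
  by (subst ip iq, rule borel_integrable_atLeastAtMost, rule cp cq)+
 have dn: "(?n has_real_derivative - (y / r) * ?n y) (at y)" for y
  unfolding normal_density_def using r by (auto intro!: derivative_eq_intros simp: field_simps power2_eq_square)
 have "(\<integral>y. (p y - q y) * indicator {- c..c} y \<partial>lborel) = ?n c * \<phi> (x + c) - ?n (- c) * \<phi> (x + (- c))"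
 proof (rule integral_FTC_Icc_real)
  show "DERIV (%y. ?n y * \<phi> (x + y)) y :> p y - q y" for y
   by (rule DERIV_cong[OF DERIV_mult[OF dn DERIV_chain2[OF smoothD[OF s0]]]])
    (auto intro!: derivative_eq_intros simp: p_def q_def algebra_simps)
  show "isCont (%y. p y - q y) y" for y by (intro continuous_intros cp cq)
 qed (auto simp: c_def)
 also have "\<dots> = 0" using out(1)[of c] out(1)[of "- c"] by simp
 also have "(%y. (p y - q y) * indicator {- c..c} y) = (%y. p y - q y)"
  by (rule ext) (use off in \<open>auto simp: indicator_def simp del: atLeastAtMost_iff\<close>)
 finally have "(\<integral>y. p y \<partial>lborel) = (\<integral>y. q y \<partial>lborel)" using int by simp
 moreover have "(\<integral>y. p y \<partial>lborel) = heat T (deriv \<phi>) r x"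
  unfolding p_def heat_def using distributed_integral[OF D, of "%y. deriv \<phi> (x + y)"] borel_measurable_continuous_onI[OF cm(2)]
  by (simp add: \<Delta>_def)
 moreover have mq: "(%y. y / r * \<phi> (x + y)) \<in> borel_measurable borel"
  by (intro borel_measurable_continuous_onI continuous_intros cm) (use r in auto)
 have "(\<integral>y. q y \<partial>lborel) = (\<integral>w. \<Delta> w / r * \<phi> (x + \<Delta> w) \<partial>wiener T)"
  unfolding q_def using distributed_integral[OF D, of "%y. y / r * \<phi> (x + y)"] mq by simp
 moreover have "\<bar>\<integral>w. \<Delta> w / r * \<phi> (x + \<Delta> w) \<partial>wiener T\<bar> \<le> (\<integral>w. \<bar>\<Delta> w / r * \<phi> (x + \<Delta> w)\<bar> \<partial>wiener T)"
  by (rule integral_abs_bound)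
 moreover have "(\<integral>w. \<bar>\<Delta> w / r * \<phi> (x + \<Delta> w)\<bar> \<partial>wiener T) \<le> (\<integral>w. \<bar>\<Delta> w\<bar> * (K / r) \<partial>wiener T)"
 proof (rule integral_mono_AE')
  show "integrable (wiener T) (%w. \<bar>\<Delta> w\<bar> * (K / r))" using m(1) by simp
  show "AE w in wiener T. \<bar>\<Delta> w / r * \<phi> (x + \<Delta> w)\<bar> \<le> \<bar>\<Delta> w\<bar> * (K / r)"
  proof (rule AE_I2)
   fix w
   have "\<bar>\<Delta> w / r * \<phi> (x + \<Delta> w)\<bar> = \<bar>\<Delta> w\<bar> / r * \<bar>\<phi> (x + \<Delta> w)\<bar>" using r by (simp add: abs_mult)
   also have "\<dots> \<le> \<bar>\<Delta> w\<bar> / r * K" using r M by (intro mult_left_mono) auto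
   finally show "\<bar>\<Delta> w / r * \<phi> (x + \<Delta> w)\<bar> \<le> \<bar>\<Delta> w\<bar> * (K / r)" by simp
  qed
  show "AE w in wiener T. 0 \<le> \<bar>\<Delta> w\<bar> * (K / r)" using K0 r by auto
 qed
 moreover have "(\<integral>w. \<bar>\<Delta> w\<bar> * (K / r) \<partial>wiener T) = (\<integral>w. \<bar>\<Delta> w\<bar> \<partial>wiener T) * (K / r)" by simp
 moreover have "\<dots> \<le> sqrt r * (K / r)" using m(2) K0 r by (intro mult_right_mono) auto
 moreover have "sqrt r * (K / r) = K / sqrt r" using r by (simp add: field_simps)
 ultimately show ?thesis by linarith
qed

end

section \<open>The difference of two solutions\<close>

definition bounded_continuous :: "(real => real) => bool" where
 "bounded_continuous f \<longleftrightarrow> continuous_on UNIV f \<and> (\<exists>C. \<forall>x. \<bar>f x\<bar> \<le> C)"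

lemma bounded_continuousI: "continuous_on UNIV f ==> (!!x. \<bar>f x\<bar> \<le> C) ==> bounded_continuous f"
 by (auto simp: bounded_continuous_def)

lemma bounded_continuousD: "bounded_continuous f ==> continuous_on UNIV f" by (simp add: bounded_continuous_def)

lemma weakly_continuous_bc_integrable:
 "weakly_continuous T \<nu> ==> s \<in> {0..T} ==> bounded_continuous f ==> integrable (\<nu> s) f"
 unfolding bounded_continuous_def using weakly_continuous_integrable by blast

lemma test_function_bounded_continuous: assumes "test_function \<phi>" shows "bounded_continuous \<phi>"
proof -
 obtain K where "!!x. \<bar>\<phi> x\<bar> \<le> K" using test_function_bounded[OF assms] by blast
 then show ?thesis by (rule bounded_continuousI[OF smooth_continuous[OF test_function_smooth[OF assms]]])
qed

lemma weakly_continuous_mono: "weakly_continuous T \<nu> ==> t \<le> T ==> weakly_continuous t \<nu>"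
 unfolding weakly_continuous_def by (auto intro: continuous_on_Icc_subset)

lemma fokker_planck_mono: "fokker_planck T a \<nu> ==> t \<le> T ==> fokker_planck t a \<nu>"
proof -
 assume fp: "fokker_planck T a \<nu>" and t: "t \<le> T"
 have "{0..t} \<subseteq> {0..T}" using t by auto
 moreover have "weakly_continuous t \<nu>" using fp t weakly_continuous_mono unfolding fokker_planck_def by blast
 ultimately show ?thesis using fp unfolding fokker_planck_def by blast
qed

lemma half_difference_bound:
 fixes X :: real
 assumes "\<bar>Y - X\<bar> \<le> 2 * b" "\<bar>W\<bar> \<le> c" shows "\<bar>(X - Y) / 2 + W\<bar> \<le> b + c"
proof -
 have "\<bar>(X - Y) / 2\<bar> \<le> b" using assms(1) by (simp add: abs_minus_commute)
 then show ?thesis using abs_triangle_ineq[of "(X - Y) / 2" W] assms(2) by linarith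
qed

locale two_solutions = bounded_drift +
 fixes \<nu> \<nu>' :: "real => real measure"
 assumes fp: "fokker_planck T a \<nu>" "fokker_planck T a \<nu>'" and eq0: "\<nu> 0 = \<nu>' 0"
begin

text \<open>The signed measure \<nu>(s) - \<nu>'(s) as a functional; uniqueness means that it
  vanishes on bounded continuous functions.\<close>

definition D :: "real => (real => real) => real" where
 "D s f = (\<integral>x. f x \<partial>\<nu> s) - (\<integral>x. f x \<partial>\<nu>' s)"

lemma wc: "weakly_continuous T \<nu>" "weakly_continuous T \<nu>'" using fp by (auto simp: fokker_planck_def)

lemma D_0: "D 0 f = 0" by (simp add: D_def eq0)

lemma D_add: "s \<in> {0..T} ==> bounded_continuous f ==> bounded_continuous g ==> D s (%x. f x + g x) = D s f + D s g"
 unfolding D_def using weakly_continuous_bc_integrable[OF wc(1)] weakly_continuous_bc_integrable[OF wc(2)] by simp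

lemma D_scale: "D s (%x. c * f x) = c * D s f" by (simp add: D_def right_diff_distrib)

lemma D_diff: "s \<in> {0..T} ==> bounded_continuous f ==> bounded_continuous g ==> D s (%x. f x - g x) = D s f - D s g"
 unfolding D_def using weakly_continuous_bc_integrable[OF wc(1)] weakly_continuous_bc_integrable[OF wc(2)] by simp

lemma D_bound:
 assumes s: "s \<in> {0..T}" and f: "continuous_on UNIV f" and C: "!!x. \<bar>f x\<bar> \<le> C" shows "\<bar>D s f\<bar> \<le> 2 * C"
proof -
 have "\<bar>\<integral>x. f x \<partial>\<eta> s\<bar> \<le> C" if w: "weakly_continuous T \<eta>" for \<eta>
 proof -
  interpret prob_space "\<eta> s" using weakly_continuousD(1)[OF w s] .
  show ?thesis by (rule expectation_abs_bound[OF C])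
 qed
 from this[OF wc(1)] this[OF wc(2)] show ?thesis unfolding D_def by linarith
qed

lemma D_generator:
 assumes s\<psi>: "smooth \<psi>"
  and K: "!!x. \<bar>\<psi> x\<bar> \<le> K" "!!x. \<bar>deriv \<psi> x\<bar> \<le> K" "!!x. \<bar>deriv (deriv \<psi>) x\<bar> \<le> K" "!!x. \<bar>deriv (deriv (deriv \<psi>)) x\<bar> \<le> K"
  and st: "0 \<le> s" "s \<le> t" "t \<le> T"
 shows "D t \<psi> - D s \<psi> = integral {s..t} (%r. D r (generator a \<psi> r))"
  "continuous_on {0..T} (%r. D r (generator a \<psi> r))"
  "\<bar>D t \<psi> - D s \<psi>\<bar> \<le> 2 * (K + B * K) * (t - s)"
proof -
 note g = generator_integral_continuous[OF wc(1) s\<psi> K(2-4)] generator_integral_continuous[OF wc(2) s\<psi> K(2-4)]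
 show c: "continuous_on {0..T} (%r. D r (generator a \<psi> r))"
  unfolding D_def by (intro continuous_on_diff g)
 have i: "h integrable_on {u..v}" if "continuous_on {0..T} h" "0 \<le> u" "v \<le> T" for h :: "real => real" and u v
  using that by (intro integrable_continuous_interval continuous_on_subset[OF that(1)]) auto
 have e: "D r \<psi> = integral {0..r} (%r. D r (generator a \<psi> r))" if r: "r \<in> {0..T}" for r
 proof -
  have "D r \<psi> = integral {0..r} (%r. \<integral>x. generator a \<psi> r x \<partial>\<nu> r) - integral {0..r} (%r. \<integral>x. generator a \<psi> r x \<partial>\<nu>' r)"
   unfolding D_def fokker_planck_bounded_smooth[OF fp(1) s\<psi> K r] fokker_planck_bounded_smooth[OF fp(2) s\<psi> K r] eq0 by simp
  also have "\<dots> = integral {0..r} (%r. D r (generator a \<psi> r))"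
   unfolding D_def by (rule Henstock_Kurzweil_Integration.integral_diff[symmetric]; rule i[OF g(1)] i[OF g(2)]) (use r in auto)
  finally show ?thesis .
 qed
 have "integral {0..s} (%r. D r (generator a \<psi> r)) + integral {s..t} (%r. D r (generator a \<psi> r)) = integral {0..t} (%r. D r (generator a \<psi> r))"
  using st by (intro Henstock_Kurzweil_Integration.integral_combine i[OF c]) auto
 then show eq: "D t \<psi> - D s \<psi> = integral {s..t} (%r. D r (generator a \<psi> r))"
  using e[of s] e[of t] st by simp
 have "norm (integral {s..t} (%r. D r (generator a \<psi> r))) \<le> integral {s..t} (%_. 2 * (K + B * K))"
 proof (intro integral_norm_bound_integral i[OF c] integrable_const_ivl)
  fix r assume "r \<in> {s..t}"
  then have r: "r \<in> {0..T}" using st by auto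
  have "0 \<le> K" using K(1)[of 0] by linarith
  then have "0 \<le> K + (L * K + B * K)" using lip_driftD(1)[OF a] B0 by simp
  from lipschitz_continuous_real[OF this generator_props(1)[OF s\<psi> K(2-4) r]]
  show "norm (D r (generator a \<psi> r)) \<le> 2 * (K + B * K)"
   using D_bound[OF r _ generator_props(2)[OF s\<psi> K(2-4) r]] by simp
 qed (use st in auto)
 then show "\<bar>D t \<psi> - D s \<psi>\<bar> \<le> 2 * (K + B * K) * (t - s)" unfolding eq using st by (simp add: mult_ac)
qed

text \<open>Gives time continuity of the integrand in Duhamel's formula, where measure, drift and
  gradient of the heat flow all depend on time.\<close>

lemma continuous_D_product:
 assumes g: "!!s x y. s \<in> {0..T} ==> \<bar>g s x - g s y\<bar> \<le> K * \<bar>x - y\<bar>" "!!s x. s \<in> {0..T} ==> \<bar>g s x\<bar> \<le> K"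
  "!!x. continuous_on {0..T} (%s. g s x)"
 shows "continuous_on {0..T} (%s. D s (%x. a s x * g s x))"
  "s \<in> {0..T} ==> continuous_on UNIV (%x. a s x * g s x)"
proof -
 have "0 \<in> {0..T}" using T by simp
 then have "0 \<le> K" using g(2)[of 0 0] by linarith
 then have LK: "0 \<le> L * K + B * K" using lip_driftD(1)[OF a] B0 by simp
 have "continuous_on {0..T} (%s. \<integral>x. a s x * g s x \<partial>\<eta> s)" if "weakly_continuous T \<eta>" for \<eta>
 proof (rule weakly_continuous_param[OF that LK])
  fix s x y assume s: "s \<in> {0..T}"
  show "\<bar>a s x * g s x - a s y * g s y\<bar> \<le> (L * K + B * K) * \<bar>x - y\<bar>" by (rule drift_product(1)[of g, OF g s])
  show "\<bar>a s x * g s x\<bar> \<le> B * K" by (rule drift_product(2)[of g, OF g s])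
 next
  fix x show "continuous_on {0..T} (%s. a s x * g s x)" by (rule drift_product(3)[of g, OF g \<open>0 \<in> {0..T}\<close>])
 qed
 from this[OF wc(1)] this[OF wc(2)] show "continuous_on {0..T} (%s. D s (%x. a s x * g s x))"
  unfolding D_def by (rule continuous_on_diff)
 assume s: "s \<in> {0..T}"
 show "continuous_on UNIV (%x. a s x * g s x)"
  by (rule lipschitz_continuous_real[OF LK]) (rule drift_product(1)[of g, OF g s])
qed

text \<open>With \<open>P\<^sub>r\<close> the heat semigroup, \<open>s \<mapsto> D s (P\<^sub>T\<^sub>-\<^sub>s \<phi>) - \<integral>\<^sub>0\<^sup>s G\<close> has increments of order \<open>h\<^sup>2\<close>, hence is constant.\<close>

lemma duhamel:
 assumes \<phi>: "test_function \<phi>"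
 defines "G \<equiv> %r. D r (%x. a r x * heat T (deriv \<phi>) (T - r) x)"
 shows "D T \<phi> = integral {0..T} G" "continuous_on {0..T} G"
proof -
 define \<phi>k where "\<phi>k k = (deriv ^^ k) \<phi>" for k :: nat
 have \<phi>k: "test_function (\<phi>k k)" "deriv (\<phi>k k) = \<phi>k (Suc k)" for k
  unfolding \<phi>k_def using test_function_funpow[OF \<phi>] by auto
 have \<phi>0: "\<phi>k 0 = \<phi>" "deriv \<phi> = \<phi>k 1" by (simp_all add: \<phi>k_def)
 obtain K where K: "!!k x. k \<le> 6 ==> \<bar>\<phi>k k x\<bar> \<le> K"
  unfolding \<phi>k_def using test_function_derivs_bounded[OF \<phi>] by blast
 \<comment> \<open>Space derivatives commute with the heat semigroup, so \<open>u k r\<close> is the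
   k-th derivative of \<open>u 0 r\<close> and is bounded uniformly in r.\<close>
 define u where "u k r = heat T (\<phi>k k) r" for k r
 have su: "smooth (u k r)" and du: "deriv (u k r) = u (Suc k) r" if "r \<in> {0..T}" for k r
  unfolding u_def using heat_test_function[OF T that \<phi>k(1)] \<phi>k(2) by auto
 have Ku: "\<bar>u k r x\<bar> \<le> K" if "r \<in> {0..T}" "k \<le> 6" for k r x
  unfolding u_def by (rule heat_bound[OF T that(1) smooth_continuous[OF test_function_smooth[OF \<phi>k(1)]] K[OF that(2)]])
 have K0: "0 \<le> K" using K[of 0 0] by auto
 have bcu: "bounded_continuous (u k r)" if "r \<in> {0..T}" "k \<le> 6" for k r
  using smooth_continuous[OF su[OF that(1)]] Ku[OF that] by (rule bounded_continuousI)
 have ref: "T - s \<in> {0..T}" if "s \<in> {0..T}" for s using that by auto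
 have Geq: "G = (%r. D r (%x. a r x * u 1 (T - r) x))" by (simp add: G_def u_def \<phi>0)
 have g1: "\<bar>u 1 (T - s) x - u 1 (T - s) y\<bar> \<le> K * \<bar>x - y\<bar>" if "s \<in> {0..T}" for s x y
  by (rule lipschitz_from_deriv[OF smoothD[OF su[OF ref[OF that]]]]) (simp add: du[OF ref[OF that]] Ku[OF ref[OF that]] del: One_nat_def)
 have g2: "\<bar>u 1 (T - s) x\<bar> \<le> K" if "s \<in> {0..T}" for s x by (rule Ku[OF ref[OF that]]) simp
 have g3: "continuous_on {0..T} (%s. u 1 (T - s) x)" for x unfolding u_def
  by (rule continuous_on_compose2[OF heat_equation(2)[OF T _ \<phi>k(1), of 0]]) (use T in \<open>auto intro!: continuous_intros\<close>)
 note cG = continuous_D_product[of "%s. u 1 (T - s)" K, OF g1 g2 g3]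
 show cont: "continuous_on {0..T} G" unfolding Geq by (rule cG(1))
 have intG: "G integrable_on {v..w}" if "0 \<le> v" "w \<le> T" for v w
  using that by (intro integrable_continuous_interval continuous_on_subset[OF cont]) auto
 define J where "J s = D s (u 0 (T - s)) - integral {0..s} G" for s
 define C where "C = 4 * K + 4 * (B * K)"
 have C0: "0 \<le> C" using K0 B0 by (simp add: C_def)
 have step: "\<bar>J t - J s\<bar> \<le> C * sqrt T * (t - s) * sqrt (t - s)" if st: "0 \<le> s" "s \<le> t" "t \<le> T" for s t
 proof -
  define h where "h = t - s"
  have h: "0 \<le> h" "h \<le> T" using st by (auto simp: h_def)
  have s: "s \<in> {0..T}" and t: "t \<in> {0..T}" using st by auto
  note S = ref[OF s] and S' = ref[OF t]
  let ?\<sigma> = "T - s" and ?\<tau> = "T - t"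
  have d0: "deriv (u 0 ?\<sigma>) = u 1 ?\<sigma>" "deriv (u 1 ?\<sigma>) = u 2 ?\<sigma>" "deriv (u 2 ?\<sigma>) = u 3 ?\<sigma>"
   "deriv (u 3 ?\<sigma>) = u 4 ?\<sigma>" "deriv (u 4 ?\<sigma>) = u 5 ?\<sigma>"
   using du[OF S, of 0] du[OF S, of 1] du[OF S, of 2] du[OF S, of 3] du[OF S, of 4] by (simp_all add: eval_nat_numeral)
  define q where "q r = D r (generator a (u 0 ?\<sigma>) r) - G r" for r
  \<comment> \<open>Over a step J changes in two ways: the measure moves with the test function kept
    at its initial value, and the test function moves with the measure kept at time t. Both changes
    contain \<open>h / 2 * Z\<close>, with opposite signs, and these parts cancel.\<close>
  define Z where "Z = D t (u 2 ?\<sigma>)"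
  have G1: "D t (u 0 ?\<sigma>) - D s (u 0 ?\<sigma>) = integral {s..t} (%r. D r (generator a (u 0 ?\<sigma>) r))"
   "continuous_on {0..T} (%r. D r (generator a (u 0 ?\<sigma>) r))"
   by (rule D_generator(1)[OF su[OF S], where K = K]; simp add: d0 Ku[OF S] st del: One_nat_def)
    (rule D_generator(2)[OF su[OF S], where K = K and s = s and t = t]; simp add: d0 Ku[OF S] st del: One_nat_def)
  have qi: "q integrable_on {s..t}"
   unfolding q_def by (intro integrable_continuous_interval continuous_on_diff continuous_on_subset[OF G1(2)] continuous_on_subset[OF cont]) (use st in auto)
  have A1: "D t (u 0 ?\<sigma>) - D s (u 0 ?\<sigma>) - integral {s..t} G = integral {s..t} q" unfolding G1(1) q_def
   by (rule Henstock_Kurzweil_Integration.integral_diff[symmetric, OF integrable_continuous_interval[OF continuous_on_subset[OF G1(2)]] intG])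
    (use st in auto)
  have A2: "\<bar>D t (u 0 ?\<sigma>) - D t (u 0 ?\<tau>) - h / 2 * Z\<bar> \<le> 2 * (K * h\<^sup>2)"
  proof -
   have bc: "bounded_continuous (%x. u 0 ?\<sigma> x - u 0 ?\<tau> x)"
    using bcu[OF S, of 0] bcu[OF S', of 0] Ku[OF S, of 0] Ku[OF S', of 0]
    by (intro bounded_continuousI[of _ "K + K"] continuous_on_diff order_trans[OF abs_triangle_ineq4] add_mono)
     (simp_all add: bounded_continuous_def)
   have bc2: "bounded_continuous (%x. h / 2 * u 2 ?\<sigma> x)"
   proof (rule bounded_continuousI)
    show "continuous_on UNIV (%x. h / 2 * u 2 ?\<sigma> x)"
     by (rule continuous_on_mult[OF continuous_on_const bcu[OF S, THEN bounded_continuousD]]) simp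
    show "\<bar>h / 2 * u 2 ?\<sigma> x\<bar> \<le> h / 2 * K" for x
     unfolding abs_mult using h Ku[OF S, of 2 x] by (intro mult_mono) auto
   qed
   have "D t (u 0 ?\<sigma>) - D t (u 0 ?\<tau>) - h / 2 * Z = D t (%x. (u 0 ?\<sigma> x - u 0 ?\<tau> x) - h / 2 * u 2 ?\<sigma> x)"
    unfolding Z_def using D_diff[OF t bc bc2] D_diff[OF t bcu[OF S, of 0] bcu[OF S', of 0]] D_scale[of t "h / 2" "u 2 ?\<sigma>"] by simp
   moreover have "\<bar>D t (%x. (u 0 ?\<sigma> x - u 0 ?\<tau> x) - h / 2 * u 2 ?\<sigma> x)\<bar> \<le> 2 * (K * h\<^sup>2)"
   proof (rule D_bound[OF t])
    show "continuous_on UNIV (%x. (u 0 ?\<sigma> x - u 0 ?\<tau> x) - h / 2 * u 2 ?\<sigma> x)"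
     by (rule continuous_on_diff[OF bc[THEN bounded_continuousD] bc2[THEN bounded_continuousD]])
    fix x
    have K4: "\<bar>(deriv ^^ 4) (\<phi>k 0) y\<bar> \<le> K" for y using K[of 4 y] by (simp add: \<phi>k_def)
    have "deriv (deriv (\<phi>k 0)) = \<phi>k 2" using \<phi>k(2) by (simp add: eval_nat_numeral)
    with heat_time_expansion[OF T \<phi>k(1) K4, of ?\<tau> ?\<sigma> x] st
    show "\<bar>(u 0 ?\<sigma> x - u 0 ?\<tau> x) - h / 2 * u 2 ?\<sigma> x\<bar> \<le> K * h\<^sup>2" by (simp add: u_def h_def)
   qed
   ultimately show ?thesis by simp
  qed
  have A3: "\<bar>q r - Z / 2\<bar> \<le> (K + B * K) * h + 2 * (B * (K * h))" if r: "r \<in> {s..t}" for r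
  proof -
   have rT: "r \<in> {0..T}" using r st by auto
   note R = ref[OF rT]
   have ca: "continuous_on UNIV (a r)" by (rule lipschitz_continuous_real[OF lip_driftD(1)[OF a] lip_driftD(3)[OF a rT]])
   have bca: "bounded_continuous (%x. a r x * v x)" if v: "bounded_continuous v" for v
   proof -
    obtain c where c: "!!x. \<bar>v x\<bar> \<le> c" and cv: "continuous_on UNIV v" using v unfolding bounded_continuous_def by blast
    show ?thesis
    proof (rule bounded_continuousI)
     show "continuous_on UNIV (%x. a r x * v x)" by (rule continuous_on_mult[OF ca cv])
     show "\<bar>a r x * v x\<bar> \<le> B * c" for x unfolding abs_mult using B[OF rT] c B0 by (intro mult_mono) auto
    qed
   qed
   have half: "bounded_continuous (%x. 1 / 2 * u 2 ?\<sigma> x)"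
   proof (rule bounded_continuousI)
    show "continuous_on UNIV (%x. 1 / 2 * u 2 ?\<sigma> x)"
     by (rule continuous_on_mult[OF continuous_on_const bcu[OF S, THEN bounded_continuousD]]) simp
    show "\<bar>1 / 2 * u 2 ?\<sigma> x\<bar> \<le> K" for x using Ku[OF S, of 2 x] K0 by simp
   qed
   have "generator a (u 0 ?\<sigma>) r = (%x. 1 / 2 * u 2 ?\<sigma> x + a r x * u 1 ?\<sigma> x)"
    unfolding generator_def[abs_def] d0 by (simp del: One_nat_def)
   then have e1: "D r (generator a (u 0 ?\<sigma>) r) = D r (u 2 ?\<sigma>) / 2 + D r (%x. a r x * u 1 ?\<sigma> x)"
    using D_add[OF rT half bca[OF bcu[OF S, of 1]]] D_scale[of r "1 / 2" "u 2 ?\<sigma>"] by simp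
   have e2: "D r (%x. a r x * u 1 ?\<sigma> x) - G r = D r (%x. a r x * u 1 ?\<sigma> x - a r x * u 1 (T - r) x)"
    unfolding Geq using D_diff[OF rT bca[OF bcu[OF S, of 1]] bca[OF bcu[OF R, of 1]]] by simp
   have b2: "\<bar>D r (%x. a r x * u 1 ?\<sigma> x - a r x * u 1 (T - r) x)\<bar> \<le> 2 * (B * (K * h))"
   proof (rule D_bound[OF rT])
    show "continuous_on UNIV (%x. a r x * u 1 ?\<sigma> x - a r x * u 1 (T - r) x)"
     by (rule continuous_on_diff[OF bca[OF bcu[OF S], THEN bounded_continuousD] bca[OF bcu[OF R], THEN bounded_continuousD]]) simp_all
    fix x
    have K3: "\<bar>deriv (deriv (\<phi>k 1)) y\<bar> \<le> K" for y using K[of 3 y] \<phi>k(2) by (simp add: eval_nat_numeral)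
    have "\<bar>u 1 ?\<sigma> x - u 1 (T - r) x\<bar> \<le> K * (?\<sigma> - (T - r))"
     unfolding u_def using r st by (intro heat_time_lipschitz[OF T \<phi>k(1) K3]) auto
    also have "\<dots> \<le> K * h" using r K0 by (intro mult_left_mono) (auto simp: h_def)
    finally show "\<bar>a r x * u 1 ?\<sigma> x - a r x * u 1 (T - r) x\<bar> \<le> B * (K * h)"
     unfolding right_diff_distrib[symmetric] abs_mult using B[OF rT] B0 by (intro mult_mono) auto
   qed
   have "\<bar>D t (u 2 ?\<sigma>) - D r (u 2 ?\<sigma>)\<bar> \<le> 2 * (K + B * K) * (t - r)"
    by (rule D_generator(3)[OF su[OF S], of 2 K]) (use r st in \<open>simp_all add: d0 Ku[OF S] del: One_nat_def\<close>)
   also have "\<dots> \<le> 2 * (K + B * K) * h" using r K0 B0 by (intro mult_left_mono) (auto simp: h_def)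
   finally have b3: "\<bar>Z - D r (u 2 ?\<sigma>)\<bar> \<le> 2 * ((K + B * K) * h)" by (simp add: Z_def mult_ac)
   have "q r - Z / 2 = (D r (u 2 ?\<sigma>) - Z) / 2 + (D r (%x. a r x * u 1 ?\<sigma> x) - G r)"
    unfolding q_def e1 by (simp add: field_simps)
   then have "q r - Z / 2 = (D r (u 2 ?\<sigma>) - Z) / 2 + D r (%x. a r x * u 1 ?\<sigma> x - a r x * u 1 (T - r) x)"
    unfolding e2 .
   then show ?thesis by (simp only:) (rule half_difference_bound[OF b3 b2])
  qed
  have "integral {s..t} q - h * (Z / 2) = integral {s..t} q - integral {s..t} (%_. Z / 2)" using st by (simp add: h_def)
  also have "\<dots> = integral {s..t} (%r. q r - Z / 2)"
   by (rule Henstock_Kurzweil_Integration.integral_diff[OF qi integrable_const_ivl, symmetric])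
  finally have A4: "integral {s..t} q - h * (Z / 2) = integral {s..t} (%r. q r - Z / 2)" .
  have "norm (integral {s..t} (%r. q r - Z / 2)) \<le> integral {s..t} (%_. (K + B * K) * h + 2 * (B * (K * h)))"
   by (intro integral_norm_bound_integral Henstock_Kurzweil_Integration.integrable_diff qi integrable_const_ivl) (use A3 in auto)
  then have A5: "\<bar>integral {s..t} q - h * (Z / 2)\<bar> \<le> h * ((K + B * K) * h + 2 * (B * (K * h)))"
   unfolding A4 using st by (simp add: h_def)
  have A6: "integral {0..s} G + integral {s..t} G = integral {0..t} G"
   using st by (intro Henstock_Kurzweil_Integration.integral_combine intG) auto
  have "J t - J s = (integral {s..t} q - h * (Z / 2)) - (D t (u 0 ?\<sigma>) - D t (u 0 ?\<tau>) - h / 2 * Z)"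
   unfolding J_def using A1 A6 by (simp add: field_simps)
  then have "\<bar>J t - J s\<bar> \<le> h * ((K + B * K) * h + 2 * (B * (K * h))) + 2 * (K * h\<^sup>2)"
   by (simp only:) (rule order_trans[OF abs_triangle_ineq4 add_mono[OF A5 A2]])
  also have "\<dots> = (3 * K + 3 * (B * K)) * h\<^sup>2" by (simp add: power2_eq_square algebra_simps)
  also have "\<dots> \<le> C * h\<^sup>2" using K0 B0 by (intro mult_right_mono) (auto simp: C_def)
  also have "h\<^sup>2 = h * sqrt h * sqrt h" using h by (simp add: power2_eq_square)
  \<comment> \<open>The error of order h^2 is weakened to the order h^(3/2) that
    \<open>zero_growth_constant\<close> takes.\<close>
  also have "C * (h * sqrt h * sqrt h) \<le> C * (h * sqrt h * sqrt T)" using C0 h by (intro mult_left_mono) auto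
  finally show ?thesis by (simp add: h_def mult_ac)
 qed
 have "J T = J 0" by (rule zero_growth_constant[of T J "C * sqrt T"]) (use step T in auto)
 moreover have "J 0 = 0" by (simp add: J_def D_0)
 moreover have "u 0 0 = \<phi>" unfolding u_def by (simp add: fun_eq_iff heat_0[OF T] \<phi>0)
 ultimately show "D T \<phi> = integral {0..T} G" by (simp add: J_def)
qed

end

lemma integral_inverse_sqrt_bound:
 fixes g :: "real => real"
 assumes uv: "u \<le> v" and c: "0 \<le> c" and g: "continuous_on {u..v} g"
  and b: "!!r. r \<in> {u..<v} ==> \<bar>g r\<bar> \<le> c / sqrt (v - r)"
 shows "\<bar>integral {u..v} g\<bar> \<le> 2 * c * sqrt (v - u)"
proof -
 \<comment> \<open>At the singular point v the quotient \<open>c / sqrt (v - r)\<close> has the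
   value 0 and might not dominate g, so the majorant takes the value of |g| there; one point leaves
   its integral unchanged.\<close>
 define p where "p r = (if r = v then \<bar>g v\<bar> else c / sqrt (v - r))" for r
 have "(p has_integral (- (2 * c * sqrt (v - v)) - - (2 * c * sqrt (v - u)))) {u..v}"
 proof (rule fundamental_theorem_of_calculus_interior[OF uv])
  show "continuous_on {u..v} (%r. - (2 * c * sqrt (v - r)))" by (intro continuous_intros)
  fix r assume r: "r \<in> {u<..<v}"
  have "((%r. - (2 * c * sqrt (v - r))) has_real_derivative c / sqrt (v - r)) (at r)"
   using r by (auto intro!: derivative_eq_intros simp: field_simps)
  then show "((%r. - (2 * c * sqrt (v - r))) has_vector_derivative p r) (at r)"
   using r by (simp add: p_def has_real_derivative_iff_has_vector_derivative)
 qed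
 then have p: "p integrable_on {u..v}" "integral {u..v} p = 2 * c * sqrt (v - u)" by (auto simp: has_integral_iff)
 have "norm (integral {u..v} g) \<le> integral {u..v} p"
  by (intro integral_norm_bound_integral integrable_continuous_interval g p(1)) (use b in \<open>auto simp: p_def\<close>)
 then show ?thesis by (simp add: p(2))
qed

context two_solutions begin

text \<open>The singularity \<open>1/\<surd>(T-r)\<close> of the gradient bound is integrable, so on a short interval the dual norm of \<open>D\<close> is at most half of itself.\<close>

lemma D_contraction:
 assumes t0: "0 \<le> t0" "t0 \<le> T" and small: "2 * B * sqrt (T - t0) \<le> 1 / 2" and c0: "0 \<le> c"
  and zero: "!!s f. s \<in> {0..t0} ==> bounded_continuous f ==> D s f = 0"
  and c: "!!s f C. s \<in> {0..T} ==> continuous_on UNIV f ==> (!!x. \<bar>f x\<bar> \<le> C) ==> \<bar>D s f\<bar> \<le> c * C"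
  and f: "continuous_on UNIV f" "!!x. \<bar>f x\<bar> \<le> C"
 shows "\<bar>D T f\<bar> \<le> c / 2 * C"
proof -
 \<comment> \<open>First for test functions, to which Duhamel's formula applies; continuous f follow
   by approximation with bounds C + 1/(n+1).\<close>
 have test: "\<bar>D T \<phi>\<bar> \<le> c / 2 * K" if \<phi>: "test_function \<phi>" and K: "!!x. \<bar>\<phi> x\<bar> \<le> K" for \<phi> K
 proof -
  define G where "G r = D r (%x. a r x * heat T (deriv \<phi>) (T - r) x)" for r
  have K0: "0 \<le> K" using K[of 0] by linarith
  note d = duhamel[OF \<phi>, folded G_def[abs_def]]
  have i: "G integrable_on {u..v}" if "0 \<le> u" "v \<le> T" for u v
   using that by (intro integrable_continuous_interval continuous_on_subset[OF d(2)]) auto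
  have bnd: "\<bar>a r x * heat T (deriv \<phi>) (T - r) x\<bar> \<le> B * (K / sqrt (T - r))" if "0 \<le> r" "r < T" for r x
   unfolding abs_mult using heat_gradient_bound[OF T \<phi> K, of "T - r" x] B[of r x] B0 that by (intro mult_mono) auto
  have cont: "continuous_on UNIV (%x. a r x * heat T (deriv \<phi>) (T - r) x)" if "r \<in> {0..T}" for r
  proof (intro continuous_on_mult)
   show "continuous_on UNIV (a r)" by (rule lipschitz_continuous_real[OF lip_driftD(1)[OF a] lip_driftD(3)[OF a that]])
   show "continuous_on UNIV (heat T (deriv \<phi>) (T - r))"
    using that by (intro smooth_continuous heat_test_function(2)[OF T _ test_function_deriv[OF \<phi>]]) auto
  qed
  obtain K1 where K1: "!!x. \<bar>deriv \<phi> x\<bar> \<le> K1" using test_function_bounded[OF test_function_deriv[OF \<phi>]] by blast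
  have bc: "bounded_continuous (%x. a r x * heat T (deriv \<phi>) (T - r) x)" if r: "r \<in> {0..T}" for r
  proof (rule bounded_continuousI[OF cont[OF r], of "B * K1"])
   have "T - r \<in> {0..T}" using r by auto
   from heat_bound[OF T this smooth_continuous[OF test_function_smooth[OF test_function_deriv[OF \<phi>]]] K1]
   show "\<bar>a r x * heat T (deriv \<phi>) (T - r) x\<bar> \<le> B * K1" for x
    unfolding abs_mult using B[OF r] B0 by (intro mult_mono) auto
  qed
  have "integral {0..t0} G = integral {0..t0} (%_. 0)"
   by (rule Henstock_Kurzweil_Integration.integral_cong) (use t0 in \<open>simp add: G_def zero bc\<close>)
  moreover have "integral {0..t0} G + integral {t0..T} G = integral {0..T} G"
   using t0 by (intro Henstock_Kurzweil_Integration.integral_combine i) auto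
  moreover have "\<bar>integral {t0..T} G\<bar> \<le> 2 * (c * (B * K)) * sqrt (T - t0)"
  proof (rule integral_inverse_sqrt_bound)
   show "0 \<le> c * (B * K)" using c0 B0 K0 by simp
   show "continuous_on {t0..T} G" using t0 by (intro continuous_on_subset[OF d(2)]) auto
   show "\<bar>G r\<bar> \<le> c * (B * K) / sqrt (T - r)" if "r \<in> {t0..<T}" for r
    using c[of r "%x. a r x * heat T (deriv \<phi>) (T - r) x", OF _ cont bnd] that t0 by (simp add: G_def)
  qed (use t0 in auto)
  moreover have "2 * (c * (B * K)) * sqrt (T - t0) \<le> c / 2 * K"
   using mult_right_mono[OF small, of "c * K"] c0 K0 by (simp add: mult_ac)
  ultimately show ?thesis unfolding d(1) by simp
 qed
 obtain \<phi> where \<phi>: "!!n. test_function (\<phi> n)" "!!n x. \<bar>\<phi> n x\<bar> \<le> C + 1 / Suc n" "!!x. (%n. \<phi> n x) \<longlonglongrightarrow> f x"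
  using continuous_test_function_approx[OF f] by blast
 have TT: "T \<in> {0..T}" using T by simp
 have lim: "(%n. \<integral>x. \<phi> n x \<partial>\<eta> T) \<longlonglongrightarrow> (\<integral>x. f x \<partial>\<eta> T)" if w: "weakly_continuous T \<eta>" for \<eta>
 proof -
  interpret prob_space "\<eta> T" using weakly_continuousD(1)[OF w TT] .
  show ?thesis
  proof (rule integral_dominated_convergence[where w = "%_. C + 1"])
   show "\<phi> n \<in> borel_measurable (\<eta> T)" for n
    using weakly_continuous_bc_integrable[OF w TT test_function_bounded_continuous[OF \<phi>(1)]] by (rule borel_measurable_integrable)
   show "f \<in> borel_measurable (\<eta> T)" using weakly_continuous_integrable[OF w TT f] by (rule borel_measurable_integrable)
   show "AE x in \<eta> T. norm (\<phi> n x) \<le> C + 1" for n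
   proof (rule AE_I2)
    fix x
    have "1 / real (Suc n) \<le> 1" by simp
    then show "norm (\<phi> n x) \<le> C + 1" using \<phi>(2)[of n x] unfolding real_norm_def by linarith
   qed
  qed (use \<phi>(3) in auto)
 qed
 have "(%n. D T (\<phi> n)) \<longlonglongrightarrow> D T f" unfolding D_def by (intro tendsto_diff lim wc)
 then have "(%n. \<bar>D T (\<phi> n)\<bar>) \<longlonglongrightarrow> \<bar>D T f\<bar>" by (rule tendsto_rabs)
 moreover have "(%n. c / 2 * (C + inverse (real (Suc n)))) \<longlonglongrightarrow> c / 2 * (C + 0)"
  by (intro tendsto_intros LIMSEQ_inverse_real_of_nat)
 ultimately have "\<bar>D T f\<bar> \<le> c / 2 * (C + 0)"
  by (rule LIMSEQ_le) (use test[OF \<phi>(1) \<phi>(2)] in \<open>auto simp: inverse_eq_divide\<close>)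
 then show ?thesis by simp
qed

text \<open>\<open>D_contraction\<close> concerns the final time only; shortening the horizon to t
  makes it available at every t.\<close>

lemma restrict_horizon: "0 < t ==> t \<le> T ==> two_solutions t L B a \<nu> \<nu>'"
proof
 assume t: "0 < t" "t \<le> T"
 show "lip_drift t L a" using a t unfolding lip_drift_def by (auto intro: continuous_on_Icc_subset)
 show "\<bar>a s x\<bar> \<le> B" if "s \<in> {0..t}" for s x using B that t by auto
qed (use fp eq0 in \<open>auto intro: fokker_planck_mono\<close>)

text \<open>Induction over successive intervals of length \<delta>. On each of them the trivial dual
  bound 2 is halved by the contraction arbitrarily often.\<close>

lemma D_eq_0:
 assumes "t \<in> {0..T}" "bounded_continuous f" shows "D t f = 0"
proof -
 \<comment> \<open>Chosen so that 2 B sqrt \<delta> = B/(2(B+1)), which is at most 1/2; the summand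
   1 covers B = 0.\<close>
 define \<delta> where "\<delta> = (1 / (4 * (B + 1)))\<^sup>2"
 have \<delta>: "0 < \<delta>" "sqrt \<delta> = 1 / (4 * (B + 1))" using B0 by (simp_all add: \<delta>_def)
 have main: "\<forall>t\<in>{0..T}. t \<le> real n * \<delta> --> (\<forall>f. bounded_continuous f --> D t f = 0)" for n
 proof (induction n)
  case 0
  then show ?case by (auto simp: D_0)
 next
  case (Suc n)
  let ?t0 = "real n * \<delta>"
  have small: "2 * B * sqrt (t - ?t0) \<le> 1 / 2" if "t \<le> real (Suc n) * \<delta>" for t
  proof -
   have "t - ?t0 \<le> \<delta>" using that by (simp add: algebra_simps)
   then have "sqrt (t - ?t0) \<le> 1 / (4 * (B + 1))" unfolding \<delta>(2)[symmetric] by (rule real_sqrt_le_mono)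
   then have "2 * B * sqrt (t - ?t0) \<le> 2 * B * (1 / (4 * (B + 1)))" using B0 by (intro mult_left_mono) auto
   also have "\<dots> \<le> 1 / 2" using B0 by (simp add: field_simps)
   finally show ?thesis .
  qed
  have dec: "\<forall>t\<in>{0..T}. t \<le> real (Suc n) * \<delta> --> (\<forall>(f :: real => real) C. continuous_on UNIV f --> (\<forall>x. \<bar>f x\<bar> \<le> C) --> \<bar>D t f\<bar> \<le> 2 * (1/2)^m * C)" for m
  proof (induction m)
   case 0
   then show ?case using D_bound by auto
  next
   case (Suc m)
   show ?case
   proof (intro ballI impI allI)
    fix t C :: real and f :: "real => real" assume t: "t \<in> {0..T}" "t \<le> real (Suc n) * \<delta>" and f: "continuous_on UNIV f" "\<forall>x. \<bar>f x\<bar> \<le> C"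
    have C0: "0 \<le> C" using f(2)[rule_format, of 0] by linarith
    show "\<bar>D t f\<bar> \<le> 2 * (1/2) ^ Suc m * C"
    proof (cases "t \<le> ?t0")
     case True
     have "D t f = 0" using Suc.IH \<open>\<forall>t\<in>{0..T}. t \<le> real n * \<delta> --> (\<forall>f. bounded_continuous f --> D t f = 0)\<close> t True f
      unfolding bounded_continuous_def by blast
     then show ?thesis using C0 by simp
    next
     case False
     have t00: "0 \<le> ?t0" using \<delta>(1) by simp
     interpret H: two_solutions t L B a \<nu> \<nu>' by (rule restrict_horizon) (use False t00 t in auto)
     have "\<bar>D t f\<bar> \<le> 2 * (1/2)^m / 2 * C"
     proof (rule H.D_contraction[of ?t0])
      show "2 * B * sqrt (t - ?t0) \<le> 1 / 2" by (rule small[OF t(2)])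
      show "D s f = 0" if "s \<in> {0..?t0}" "bounded_continuous f" for s f
       using \<open>\<forall>t\<in>{0..T}. t \<le> real n * \<delta> --> (\<forall>f. bounded_continuous f --> D t f = 0)\<close> that t False by auto
      show "\<bar>D s f\<bar> \<le> 2 * (1/2)^m * C" if "s \<in> {0..t}" "continuous_on UNIV f" "!!x. \<bar>f x\<bar> \<le> C" for s f C
       using Suc.IH that t by (meson atLeastAtMost_iff order_trans)
     qed (use False t00 f in auto)
     then show ?thesis by simp
    qed
   qed
  qed
  show ?case
  proof (intro ballI impI allI)
   fix t :: real and f :: "real => real" assume t: "t \<in> {0..T}" "t \<le> real (Suc n) * \<delta>" and f: "bounded_continuous f"
   obtain C where C: "\<forall>x. \<bar>f x\<bar> \<le> C" using f by (auto simp: bounded_continuous_def)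
   have le: "\<bar>D t f\<bar> \<le> 2 * (1/2)^m * C" for m using dec[of m] t bounded_continuousD[OF f] C by blast
   have "(%m. 2 * (1/2::real)^m * C) \<longlonglongrightarrow> 2 * 0 * C" by (intro tendsto_intros LIMSEQ_power_zero) simp
   then have "\<bar>D t f\<bar> \<le> 2 * 0 * C" by (rule LIMSEQ_le_const) (use le in blast)
   then show "D t f = 0" by simp
  qed
 qed
 obtain n where "t / \<delta> \<le> real n" using real_arch_simple by blast
 then have "t \<le> real n * \<delta>" using \<delta>(1) by (simp add: field_simps)
 then show ?thesis using main[of n] assms by blast
qed

end

text \<open>The functions cos(t x) and sin(t x) are bounded and continuous, and their integrals are
  the real and imaginary parts of the characteristic function.\<close>

lemma prob_measure_eqI_bounded_continuous:
 fixes M N :: "real measure"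
 assumes M: "prob_space M" "sets M = sets borel" and N: "prob_space N" "sets N = sets borel"
  and eq: "!!f. bounded_continuous f ==> (\<integral>x. f x \<partial>M) = (\<integral>x. f x \<partial>N)"
 shows "M = N"
proof (rule Levy_uniqueness)
 have "real_distribution M'" if "prob_space M'" "sets M' = sets borel" for M' :: "real measure"
  using that sets_eq_imp_space_eq[OF that(2)] by (simp add: real_distribution_def real_distribution_axioms_def)
 then show rd: "real_distribution M" "real_distribution N" using M N by auto
 interpret M: real_distribution M by fact
 interpret N: real_distribution N by fact
 show "char M = char N"
 proof
  fix t
  have "(\<integral>x. cos (t * x) \<partial>M) = (\<integral>x. cos (t * x) \<partial>N)" "(\<integral>x. sin (t * x) \<partial>M) = (\<integral>x. sin (t * x) \<partial>N)"
   by (rule eq, rule bounded_continuousI[of _ 1], intro continuous_intros, simp)+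
  moreover have "Re (char M' t) = (\<integral>x. cos (t * x) \<partial>M')" "Im (char M' t) = (\<integral>x. sin (t * x) \<partial>M')"
   if "integrable M' (%x. iexp (t * x))" for M' :: "real measure"
   unfolding char_def integral_Re[OF that, symmetric] integral_Im[OF that, symmetric] by (simp_all add: Re_exp Im_exp)
  moreover have "integrable M (%x. iexp (t * x))" by (rule M.integrable_iexp) auto
  moreover have "integrable N (%x. iexp (t * x))" by (rule N.integrable_iexp) auto
  ultimately show "char M t = char N t" by (simp add: complex_eq_iff)
 qed
qed

theorem fokker_planck_unique:
 assumes T: "0 < T" and a: "lip_drift T L a" and B: "!!s x. s \<in> {0..T} ==> \<bar>a s x\<bar> \<le> B"
  and fp: "fokker_planck T a \<nu>" "fokker_planck T a \<nu>'" and eq0: "\<nu> 0 = \<nu>' 0" and t: "t \<in> {0..T}"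
 shows "\<nu> t = \<nu>' t"
proof -
 interpret two_solutions T L B a \<nu> \<nu>' by unfold_locales (use assms in auto)
 show ?thesis
 proof (rule prob_measure_eqI_bounded_continuous)
  show "(\<integral>x. f x \<partial>\<nu> t) = (\<integral>x. f x \<partial>\<nu>' t)" if "bounded_continuous f" for f
   using D_eq_0[OF t that] by (simp add: D_def)
 qed (use weakly_continuousD[OF wc(1) ] weakly_continuousD[OF wc(2)] t in auto)
qed

section \<open>The mean-field fixed point\<close>

lemma kernel_integral_measurable:
 fixes h :: "'a \<times> real => real"
 assumes \<kappa>: "\<kappa> \<in> borel \<rightarrow>\<^sub>M prob_algebra S" and h: "h \<in> borel_measurable (S \<Otimes>\<^sub>M borel)"
 shows "(%\<omega>. \<integral>x. h (x, \<omega>) \<partial>\<kappa> \<omega>) \<in> borel_measurable borel"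
proof -
 have "(%\<omega>. integral\<^sup>L (distr (\<kappa> \<omega>) (S \<Otimes>\<^sub>M borel) (%x. (x, \<omega>))) h) \<in> borel_measurable borel"
  by (rule measurable_compose[OF measurable_prob_algebraD[OF measurable_semidirect_kernel[OF \<kappa>]] integral_measurable_subprob_algebra[OF h]])
 moreover have "integral\<^sup>L (distr (\<kappa> \<omega>) (S \<Otimes>\<^sub>M borel) (%x. (x, \<omega>))) h = (\<integral>x. h (x, \<omega>) \<partial>\<kappa> \<omega>)" for \<omega>
 proof (rule integral_distr[OF _ h])
  have [measurable_cong]: "sets (\<kappa> \<omega>) = sets S" using measurable_prob_algebraD'[OF \<kappa>] by simp
  show "(%x. (x, \<omega>)) \<in> \<kappa> \<omega> \<rightarrow>\<^sub>M S \<Otimes>\<^sub>M borel" by measurable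
 qed
 ultimately show ?thesis by simp
qed

lemma kernel_section_measurable:
 fixes h :: "'a \<times> real => real"
 assumes \<kappa>: "\<kappa> \<in> borel \<rightarrow>\<^sub>M prob_algebra S" and h: "h \<in> borel_measurable (S \<Otimes>\<^sub>M borel)"
 shows "(%x. h (x, \<omega>)) \<in> borel_measurable (\<kappa> \<omega>)"
proof -
 have [measurable_cong]: "sets (\<kappa> \<omega>) = sets S" using measurable_prob_algebraD'[OF \<kappa>] by simp
 show ?thesis using h by measurable
qed

text \<open>Adding K makes the integrand and its inner integrals nonnegative, which reduces the
  claim to \<open>nn_integral_semidirect\<close>.\<close>

lemma integral_semidirect:
 fixes h :: "'a \<times> real => real"
 assumes \<mu>: "\<mu> \<in> space (prob_algebra borel)" and \<kappa>: "\<kappa> \<in> borel \<rightarrow>\<^sub>M prob_algebra S"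
  and h: "h \<in> borel_measurable (S \<Otimes>\<^sub>M borel)" and K: "!!z. \<bar>h z\<bar> \<le> K"
 shows "(\<integral>z. h z \<partial>semidirect S \<mu> \<kappa>) = (\<integral>\<omega>. \<integral>x. h (x, \<omega>) \<partial>\<kappa> \<omega> \<partial>\<mu>)"
proof -
 let ?l = "semidirect S \<mu> \<kappa>"
 note l = prob_algebraD[OF semidirect_in_space[OF \<mu> \<kappa>]]
 interpret L: prob_space ?l by (rule l)
 interpret M: prob_space \<mu> by (rule prob_algebraD[OF \<mu>])
 have k: "prob_space (\<kappa> \<omega>)" for \<omega> using measurable_prob_algebraD'[OF \<kappa>] by simp
 have hl: "h \<in> borel_measurable ?l" using h by (simp cong: measurable_cong_sets add: l)
 have ihl: "integrable ?l h" using hl K by (intro L.integrable_const_bound[of _ K]) auto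
 have ihk: "integrable (\<kappa> \<omega>) (%x. h (x, \<omega>))" for \<omega>
 proof -
  interpret prob_space "\<kappa> \<omega>" by (rule k)
  show ?thesis using kernel_section_measurable[OF \<kappa> h] K by (intro integrable_const_bound[of _ K]) auto
 qed
 have pos: "0 \<le> h z + K" for z using K[of z] by linarith
 define e where "e \<omega> = (\<integral>x. h (x, \<omega>) \<partial>\<kappa> \<omega>)" for \<omega>
 have me: "e \<in> borel_measurable \<mu>"
  using kernel_integral_measurable[OF \<kappa> h] unfolding e_def by (simp cong: measurable_cong_sets add: prob_algebraD[OF \<mu>])
 have inner: "(\<integral>\<^sup>+x. ennreal (h (x, \<omega>) + K) \<partial>\<kappa> \<omega>) = ennreal (e \<omega> + K)" for \<omega>
 proof -
  interpret prob_space "\<kappa> \<omega>" by (rule k)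
  have "(\<integral>\<^sup>+x. ennreal (h (x, \<omega>) + K) \<partial>\<kappa> \<omega>) = ennreal (\<integral>x. h (x, \<omega>) + K \<partial>\<kappa> \<omega>)"
   by (rule nn_integral_eq_integral) (use ihk pos in auto)
  then show ?thesis using ihk by (simp add: e_def prob_space)
 qed
 have eK: "\<bar>e \<omega>\<bar> \<le> K" for \<omega>
 proof -
  interpret prob_space "\<kappa> \<omega>" by (rule k)
  show ?thesis unfolding e_def by (rule expectation_abs_bound[OF K])
 qed
 have ie: "integrable \<mu> e" using me eK by (intro M.integrable_const_bound[of _ K]) auto
 have "ennreal (\<integral>z. h z + K \<partial>?l) = (\<integral>\<^sup>+z. ennreal (h z + K) \<partial>?l)"
  by (rule nn_integral_eq_integral[symmetric]) (use ihl pos in auto)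
 moreover have "(\<integral>\<^sup>+z. ennreal (h z + K) \<partial>?l) = (\<integral>\<^sup>+\<omega>. ennreal (e \<omega> + K) \<partial>\<mu>)"
  using nn_integral_semidirect[OF \<mu> \<kappa>, of "%z. ennreal (h z + K)"] h by (simp add: inner)
 moreover have "(\<integral>\<^sup>+\<omega>. ennreal (e \<omega> + K) \<partial>\<mu>) = ennreal (\<integral>\<omega>. e \<omega> + K \<partial>\<mu>)"
 proof (rule nn_integral_eq_integral)
  show "AE \<omega> in \<mu>. 0 \<le> e \<omega> + K"
  proof (rule AE_I2)
   show "0 \<le> e \<omega> + K" for \<omega> using eK[of \<omega>] by linarith
  qed
 qed (use ie in simp)
 ultimately have eq: "ennreal (\<integral>z. h z + K \<partial>?l) = ennreal (\<integral>\<omega>. e \<omega> + K \<partial>\<mu>)" by simp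
 have "0 \<le> (\<integral>z. h z + K \<partial>?l)" using pos by (intro integral_nonneg_AE) auto
 moreover have "0 \<le> (\<integral>\<omega>. e \<omega> + K \<partial>\<mu>)"
 proof (intro integral_nonneg_AE AE_I2)
  show "0 \<le> e \<omega> + K" for \<omega> using eK[of \<omega>] by linarith
 qed
 ultimately have "(\<integral>z. h z + K \<partial>?l) = (\<integral>\<omega>. e \<omega> + K \<partial>\<mu>)" using eq by simp
 then have "(\<integral>z. h z \<partial>?l) = (\<integral>\<omega>. e \<omega> \<partial>\<mu>)" using ihl ie by (simp add: L.prob_space M.prob_space)
 then show ?thesis unfolding e_def .
qed

lemma semidirect_cong_AE:
 assumes \<mu>: "\<mu> \<in> space (prob_algebra borel)" and \<kappa>: "\<kappa> \<in> borel \<rightarrow>\<^sub>M prob_algebra S" and \<rho>: "\<rho> \<in> borel \<rightarrow>\<^sub>M prob_algebra S"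
  and eq: "AE \<omega> in \<mu>. \<kappa> \<omega> = \<rho> \<omega>"
 shows "semidirect S \<mu> \<kappa> = semidirect S \<mu> \<rho>"
proof (rule measure_eqI)
 note s = prob_algebraD(2)[OF semidirect_in_space[OF \<mu> \<kappa>]] prob_algebraD(2)[OF semidirect_in_space[OF \<mu> \<rho>]]
 then show "sets (semidirect S \<mu> \<kappa>) = sets (semidirect S \<mu> \<rho>)" by simp
 fix A assume "A \<in> sets (semidirect S \<mu> \<kappa>)"
 then have A: "A \<in> sets (S \<Otimes>\<^sub>M borel)" by (simp add: s)
 show "emeasure (semidirect S \<mu> \<kappa>) A = emeasure (semidirect S \<mu> \<rho>) A"
  unfolding emeasure_semidirect[OF \<mu> \<kappa> A] emeasure_semidirect[OF \<mu> \<rho> A]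
  by (rule nn_integral_cong_AE) (use eq in eventually_elim, simp)
qed

lemma second_marginal_semidirect:
 assumes \<mu>: "\<mu> \<in> space (prob_algebra borel)" and \<kappa>: "\<kappa> \<in> borel \<rightarrow>\<^sub>M prob_algebra S"
 shows "second_marginal (semidirect S \<mu> \<kappa>) = \<mu>"
proof (rule measure_eqI)
 note s = prob_algebraD(2)[OF semidirect_in_space[OF \<mu> \<kappa>]]
 show "sets (second_marginal (semidirect S \<mu> \<kappa>)) = sets \<mu>" by (simp add: second_marginal_def prob_algebraD[OF \<mu>])
 fix A assume "A \<in> sets (second_marginal (semidirect S \<mu> \<kappa>))"
 then have A: "A \<in> sets borel" by (simp add: second_marginal_def)
 have m: "snd \<in> semidirect S \<mu> \<kappa> \<rightarrow>\<^sub>M borel" by (subst measurable_cong_sets[OF s refl]) (rule measurable_snd)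
 have "emeasure (second_marginal (semidirect S \<mu> \<kappa>)) A = (\<integral>\<^sup>+z. indicator A (snd z) \<partial>semidirect S \<mu> \<kappa>)"
  unfolding second_marginal_def using A m by (simp add: nn_integral_distr flip: nn_integral_indicator)
 also have "\<dots> = (\<integral>\<^sup>+\<omega>. \<integral>\<^sup>+x. indicator A \<omega> \<partial>\<kappa> \<omega> \<partial>\<mu>)"
  by (subst nn_integral_semidirect[OF \<mu> \<kappa>]) (use A in auto)
 also have "\<dots> = (\<integral>\<^sup>+\<omega>. indicator A \<omega> \<partial>\<mu>)"
  using measurable_prob_algebraD'(1)[OF \<kappa>] by (simp add: prob_space.emeasure_space_1)
 also have "\<dots> = emeasure \<mu> A" using A by (simp add: prob_algebraD[OF \<mu>])
 finally show "emeasure (second_marginal (semidirect S \<mu> \<kappa>)) A = emeasure \<mu> A" .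
qed

lemma measurable_marginal_kernel:
 assumes T: "0 < T" and \<kappa>: "\<kappa> \<in> borel \<rightarrow>\<^sub>M prob_algebra (path_space T)"
 shows "(%\<omega>. distr (\<kappa> \<omega>) borel (%x. x t)) \<in> (borel :: real measure) \<rightarrow>\<^sub>M prob_algebra borel"
 by (rule measurable_compose[OF \<kappa> measurable_distr_prob_space[OF measurable_path_eval[OF T]]])

lemma measurable_time_eval:
 assumes T: "0 < T"
 shows "(%(x, \<omega>). (x t, \<omega>)) \<in> path_space T \<Otimes>\<^sub>M borel \<rightarrow>\<^sub>M borel \<Otimes>\<^sub>M (borel :: real measure)"
 unfolding case_prod_unfold
 by (rule measurable_Pair[OF measurable_compose[OF measurable_fst measurable_path_eval[OF T]] measurable_snd])

lemma time_marginal_semidirect: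
 assumes T: "0 < T" and \<mu>: "\<mu> \<in> space (prob_algebra borel)" and \<kappa>: "\<kappa> \<in> borel \<rightarrow>\<^sub>M prob_algebra (path_space T)"
 shows "time_marginal (semidirect (path_space T) \<mu> \<kappa>) t = semidirect borel \<mu> (%\<omega>. distr (\<kappa> \<omega>) borel (%x. x t))"
proof (rule measure_eqI)
 note s = prob_algebraD(2)[OF semidirect_in_space[OF \<mu> \<kappa>]]
 note \<kappa>t = measurable_marginal_kernel[OF T \<kappa>, of t]
 note s' = prob_algebraD(2)[OF semidirect_in_space[OF \<mu> \<kappa>t]]
 show "sets (time_marginal (semidirect (path_space T) \<mu> \<kappa>) t) = sets (semidirect borel \<mu> (%\<omega>. distr (\<kappa> \<omega>) borel (%x. x t)))"
  by (simp add: time_marginal_def s')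
 fix A assume "A \<in> sets (time_marginal (semidirect (path_space T) \<mu> \<kappa>) t)"
 then have A: "A \<in> sets (borel \<Otimes>\<^sub>M borel)" by (simp add: time_marginal_def)
 have m: "(%(x, \<omega>). (x t, \<omega>)) \<in> semidirect (path_space T) \<mu> \<kappa> \<rightarrow>\<^sub>M borel \<Otimes>\<^sub>M borel"
  by (subst measurable_cong_sets[OF s refl]) (rule measurable_time_eval[OF T])
 have "emeasure (time_marginal (semidirect (path_space T) \<mu> \<kappa>) t) A =
   (\<integral>\<^sup>+z. indicator A (case z of (x, \<omega>) => (x t, \<omega>)) \<partial>semidirect (path_space T) \<mu> \<kappa>)"
  unfolding time_marginal_def using A m by (simp add: nn_integral_distr flip: nn_integral_indicator)
 also have "\<dots> = (\<integral>\<^sup>+\<omega>. \<integral>\<^sup>+x. indicator A (x t, \<omega>) \<partial>\<kappa> \<omega> \<partial>\<mu>)"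
  by (subst nn_integral_semidirect[OF \<mu> \<kappa>])
   (use measurable_compose[OF measurable_time_eval[OF T, of t] borel_measurable_indicator[OF A]] in \<open>simp_all\<close>)
 also have "\<dots> = (\<integral>\<^sup>+\<omega>. \<integral>\<^sup>+x. indicator A (x, \<omega>) \<partial>distr (\<kappa> \<omega>) borel (%x. x t) \<partial>\<mu>)"
 proof (rule nn_integral_cong)
  fix \<omega>
  have "(%x. x t) \<in> \<kappa> \<omega> \<rightarrow>\<^sub>M borel"
   using measurable_prob_algebraD'(2)[OF \<kappa>] measurable_path_eval[OF T] by (simp cong: measurable_cong_sets)
  moreover have "(%x. indicator A (x, \<omega>) :: ennreal) \<in> borel_measurable borel"
   by (rule measurable_compose[OF _ borel_measurable_indicator[OF A]]) (auto intro: measurable_Pair)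
  ultimately show "(\<integral>\<^sup>+x. indicator A (x t, \<omega>) \<partial>\<kappa> \<omega>) = (\<integral>\<^sup>+x. indicator A (x, \<omega>) \<partial>distr (\<kappa> \<omega>) borel (%x. x t))"
   by (simp add: nn_integral_distr)
 qed
 also have "\<dots> = emeasure (semidirect borel \<mu> (%\<omega>. distr (\<kappa> \<omega>) borel (%x. x t))) A"
  by (rule emeasure_semidirect[OF \<mu> \<kappa>t A, symmetric])
 finally show "emeasure (time_marginal (semidirect (path_space T) \<mu> \<kappa>) t) A =
  emeasure (semidirect borel \<mu> (%\<omega>. distr (\<kappa> \<omega>) borel (%x. x t))) A" .
qed

text \<open>The distribution function of \<gamma>(\<omega>) at a point is a limit of integrals of
  bounded continuous functions, which are continuous in \<omega> by the Feller property; half-lines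
  generate the Borel sets.\<close>

lemma feller_kernel_measurable:
 assumes \<gamma>: "!!\<omega>. \<gamma> \<omega> \<in> space (prob_algebra borel)"
  and feller: "!!\<phi> :: real => real. continuous_on UNIV \<phi> ==> bounded (range \<phi>) ==> continuous_on UNIV (%\<omega>::real. \<integral>x. \<phi> x \<partial>\<gamma> \<omega>)"
 shows "\<gamma> \<in> borel \<rightarrow>\<^sub>M prob_algebra borel"
proof (rule measurable_prob_algebra_generated[where \<Omega> = UNIV and G = "range atMost"])
 show "sets borel = sigma_sets UNIV (range (atMost :: real => _))" by (subst borel_eq_atMost) (simp add: full_SetCompr_eq)
 show "Int_stable (range (atMost :: real => _))"
 proof (rule Int_stableI)
  fix a b :: "real set" assume "a \<in> range atMost" "b \<in> range atMost"
  then obtain x y where "a = {..x}" "b = {..y}" by auto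
  then have "a \<inter> b = {..min x y}" by auto
  then show "a \<inter> b \<in> range atMost" by simp
 qed
 show "prob_space (\<gamma> \<omega>)" "sets (\<gamma> \<omega>) = sets borel" for \<omega> using prob_algebraD[OF \<gamma>] by auto
 fix A assume "A \<in> range (atMost :: real => _)"
 then obtain a where A: "A = {..a}" by auto
 obtain \<phi> :: "nat => real => real" where c\<phi>: "!!n. continuous_on UNIV (\<phi> n)" and \<phi>1: "!!n x. 0 \<le> \<phi> n x \<and> \<phi> n x \<le> 1"
  and lim: "!!x. (%n. \<phi> n x) \<longlonglongrightarrow> indicator {..a} x"
  using atMost_continuous_approx[of a] by blast
 have b\<phi>: "\<bar>\<phi> n x\<bar> \<le> 1" for n x using \<phi>1[of n x] by simp
 have "(%\<omega>. measure (\<gamma> \<omega>) {..a}) \<in> borel_measurable borel"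
 proof (rule borel_measurable_LIMSEQ_real)
  show "(%\<omega>. \<integral>x. \<phi> n x \<partial>\<gamma> \<omega>) \<in> borel_measurable borel" for n
   by (intro borel_measurable_continuous_onI feller c\<phi> boundedI[of _ 1]) (use b\<phi> in auto)
  fix \<omega>
  interpret prob_space "\<gamma> \<omega>" using prob_algebraD[OF \<gamma>] by simp
  have s: "sets (\<gamma> \<omega>) = sets borel" using prob_algebraD[OF \<gamma>] by simp
  have "(%n. \<integral>x. \<phi> n x \<partial>\<gamma> \<omega>) \<longlonglongrightarrow> (\<integral>x. indicator {..a} x \<partial>\<gamma> \<omega>)"
   by (rule integral_dominated_convergence[where w = "%_. 1"])
    (use lim b\<phi> borel_measurable_continuous_onI[OF c\<phi>] in \<open>auto simp: measurable_cong_sets[OF s refl]\<close>)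
  then show "(%n. \<integral>x. \<phi> n x \<partial>\<gamma> \<omega>) \<longlonglongrightarrow> measure (\<gamma> \<omega>) {..a}" using s sets_eq_imp_space_eq[OF s] by simp
 qed
 then have "(%\<omega>. ennreal (measure (\<gamma> \<omega>) {..a})) \<in> borel_measurable borel" by simp
 moreover have "emeasure (\<gamma> \<omega>) A = ennreal (measure (\<gamma> \<omega>) {..a})" for \<omega>
 proof -
  interpret prob_space "\<gamma> \<omega>" using prob_algebraD[OF \<gamma>] by simp
  show ?thesis unfolding A by (rule emeasure_eq_measure)
 qed
 ultimately show "(%\<omega>. emeasure (\<gamma> \<omega>) A) \<in> borel_measurable borel" by simp
qed auto

text \<open>The continuity clause admits integrands that are merely measurable in the disorder
  variable, as the derivative of \<open>f\<close> is; weak continuity of measures on the plane would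
  not cover them.\<close>

definition flow :: "real => (real => (real \<times> real) measure) => bool" where
 "flow T q \<longleftrightarrow> (\<forall>t\<in>{0..T}. q t \<in> space (prob_algebra (borel \<Otimes>\<^sub>M borel))) \<and>
  (\<forall>(h :: real \<times> real => real) K. h \<in> borel_measurable (borel \<Otimes>\<^sub>M borel) --> (\<forall>z. \<bar>h z\<bar> \<le> K) -->
    (\<forall>\<omega>. continuous_on UNIV (%x. h (x, \<omega>))) --> continuous_on {0..T} (%t. \<integral>z. h z \<partial>q t))"

lemma flowD:
 assumes "flow T q"
 shows "t \<in> {0..T} ==> prob_space (q t)" "t \<in> {0..T} ==> sets (q t) = sets (borel \<Otimes>\<^sub>M borel)"
  "h \<in> borel_measurable (borel \<Otimes>\<^sub>M borel) ==> (!!z. \<bar>h z\<bar> \<le> K) ==>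
   (!!\<omega>. continuous_on UNIV (%x. h (x, \<omega>))) ==> continuous_on {0..T} (%t. \<integral>z. (h z :: real) \<partial>q t)"
proof -
 show "t \<in> {0..T} ==> prob_space (q t)" "t \<in> {0..T} ==> sets (q t) = sets (borel \<Otimes>\<^sub>M borel)"
  using assms prob_algebraD unfolding flow_def by blast+
 show "h \<in> borel_measurable (borel \<Otimes>\<^sub>M borel) ==> (!!z. \<bar>h z\<bar> \<le> K) ==>
   (!!\<omega>. continuous_on UNIV (%x. h (x, \<omega>))) ==> continuous_on {0..T} (%t. \<integral>z. (h z :: real) \<partial>q t)"
  using assms unfolding flow_def by blast
qed

lemma time_marginal_integral:
 fixes h :: "real \<times> real => real"
 assumes T: "0 < T" and lam: "lam \<in> path_disorder_measures T" and h: "h \<in> borel_measurable (borel \<Otimes>\<^sub>M borel)"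
 shows "(\<integral>z. h z \<partial>time_marginal lam t) = (\<integral>z. h (fst z t, snd z) \<partial>lam)"
  "(%z. h (fst z t, snd z)) \<in> borel_measurable lam"
proof -
 have s: "sets lam = sets (path_space T \<Otimes>\<^sub>M borel)" using prob_algebraD lam unfolding path_disorder_measures_def by blast
 have m: "(%(x, \<omega>). (x t, \<omega>)) \<in> lam \<rightarrow>\<^sub>M borel \<Otimes>\<^sub>M borel"
  by (subst measurable_cong_sets[OF s refl]) (rule measurable_time_eval[OF T])
 show "(\<integral>z. h z \<partial>time_marginal lam t) = (\<integral>z. h (fst z t, snd z) \<partial>lam)"
  unfolding time_marginal_def by (subst integral_distr[OF m h]) (simp add: case_prod_unfold)
 show "(%z. h (fst z t, snd z)) \<in> borel_measurable lam"
  using measurable_compose[OF m h] by (simp add: case_prod_unfold)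
qed

lemma flow_time_marginal:
 assumes T: "0 < T" and lam: "lam \<in> path_disorder_measures T"
 shows "flow T (time_marginal lam)" unfolding flow_def
proof (intro conjI ballI allI impI)
 have l: "prob_space lam" "sets lam = sets (path_space T \<Otimes>\<^sub>M borel)" "space lam = space (path_space T \<Otimes>\<^sub>M borel)"
  using prob_algebraD lam unfolding path_disorder_measures_def by blast+
 interpret prob_space lam by (rule l)
 fix t
 have m: "(%(x, \<omega>). (x t, \<omega>)) \<in> lam \<rightarrow>\<^sub>M borel \<Otimes>\<^sub>M borel"
  by (subst measurable_cong_sets[OF l(2) refl]) (rule measurable_time_eval[OF T])
 show "time_marginal lam t \<in> space (prob_algebra (borel \<Otimes>\<^sub>M borel))"
  using prob_space_distr[OF m] by (simp add: space_prob_algebra time_marginal_def)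
next
 fix h :: "real \<times> real => real" and K assume h: "h \<in> borel_measurable (borel \<Otimes>\<^sub>M borel)" "\<forall>z. \<bar>h z\<bar> \<le> K" "\<forall>\<omega>. continuous_on UNIV (%x. h (x, \<omega>))"
 have l: "prob_space lam" "space lam = space (path_space T \<Otimes>\<^sub>M borel)"
  using prob_algebraD lam unfolding path_disorder_measures_def by blast+
 interpret prob_space lam by (rule l)
 show "continuous_on {0..T} (%t. \<integral>z. h z \<partial>time_marginal lam t)"
  unfolding time_marginal_integral(1)[OF T lam h(1)]
 proof (rule expectation_continuous[where K = K])
  show "(%z. h (fst z t, snd z)) \<in> borel_measurable lam" for t by (rule time_marginal_integral(2)[OF T lam h(1)])
  fix z assume "z \<in> space lam"
  then have "continuous_on {0..T} (fst z)" by (auto simp: l space_pair_measure space_path_space paths_def)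
  then show "continuous_on {0..T} (%t. h (fst z t, snd z))"
   by (rule continuous_on_compose2[OF h(3)[rule_format, of "snd z"]]) simp
 qed (use h(2) in auto)
qed

text \<open>For almost every \<omega> the inner integral is continuous in time; dominated
  convergence with respect to \<mu> transfers this to the joint flow.\<close>

lemma flow_joint_flow:
 assumes \<mu>: "\<mu> \<in> space (prob_algebra borel)"
  and m: "!!t. t \<in> {0..T} ==> (%\<omega>. \<nu> \<omega> t) \<in> borel \<rightarrow>\<^sub>M prob_algebra borel"
  and c: "AE \<omega> in \<mu>. \<forall>\<phi> :: real => real. continuous_on UNIV \<phi> --> bounded (range \<phi>) --> continuous_on {0..T} (%t. \<integral>x. \<phi> x \<partial>\<nu> \<omega> t)"
 shows "flow T (joint_flow \<mu> \<nu>)" unfolding flow_def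
proof (intro conjI ballI allI impI)
 fix t assume "t \<in> {0..T}"
 from semidirect_in_space[OF \<mu> m[OF this]] show "joint_flow \<mu> \<nu> t \<in> space (prob_algebra (borel \<Otimes>\<^sub>M borel))"
  by (simp add: joint_flow_def)
next
 fix h :: "real \<times> real => real" and K
 assume h: "h \<in> borel_measurable (borel \<Otimes>\<^sub>M borel)" "\<forall>z. \<bar>h z\<bar> \<le> K" "\<forall>\<omega>. continuous_on UNIV (%x. h (x, \<omega>))"
 interpret M: prob_space \<mu> by (rule prob_algebraD[OF \<mu>])
 have eq: "(\<integral>z. h z \<partial>joint_flow \<mu> \<nu> t) = (\<integral>\<omega>. \<integral>x. h (x, \<omega>) \<partial>\<nu> \<omega> t \<partial>\<mu>)" if "t \<in> {0..T}" for t
  unfolding joint_flow_def by (rule integral_semidirect[OF \<mu> m[OF that] h(1)]) (use h(2) in blast)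
 have me: "(%\<omega>. \<integral>x. h (x, \<omega>) \<partial>\<nu> \<omega> t) \<in> borel_measurable \<mu>" if "t \<in> {0..T}" for t
  using kernel_integral_measurable[OF m[OF that] h(1)] by (simp cong: measurable_cong_sets add: prob_algebraD[OF \<mu>])
 have b: "\<bar>\<integral>x. h (x, \<omega>) \<partial>\<nu> \<omega> t\<bar> \<le> K" if t: "t \<in> {0..T}" for \<omega> t
 proof -
  interpret prob_space "\<nu> \<omega> t" using measurable_prob_algebraD'(1)[OF m[OF t]] by simp
  show ?thesis by (rule expectation_abs_bound[OF h(2)[rule_format]])
 qed
 have "continuous_on {0..T} (%t. \<integral>\<omega>. \<integral>x. h (x, \<omega>) \<partial>\<nu> \<omega> t \<partial>\<mu>)"
  unfolding continuous_on_sequentially comp_def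
 proof (intro allI ballI impI)
  fix r s assume s: "s \<in> {0..T}" and "(\<forall>n. r n \<in> {0..T}) \<and> r \<longlonglongrightarrow> s"
  then have r: "!!n. r n \<in> {0..T}" "r \<longlonglongrightarrow> s" by auto
  show "(%n. \<integral>\<omega>. \<integral>x. h (x, \<omega>) \<partial>\<nu> \<omega> (r n) \<partial>\<mu>) \<longlonglongrightarrow> (\<integral>\<omega>. \<integral>x. h (x, \<omega>) \<partial>\<nu> \<omega> s \<partial>\<mu>)"
  proof (rule integral_dominated_convergence[where w = "%_. K"])
   show "AE \<omega> in \<mu>. (%n. \<integral>x. h (x, \<omega>) \<partial>\<nu> \<omega> (r n)) \<longlonglongrightarrow> (\<integral>x. h (x, \<omega>) \<partial>\<nu> \<omega> s)"
    using c
   proof eventually_elim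
    case (elim \<omega>)
    have "bounded (range (%x. h (x, \<omega>)))" using h(2) by (intro boundedI[of _ K]) auto
    then have "continuous_on {0..T} (%t. \<integral>x. h (x, \<omega>) \<partial>\<nu> \<omega> t)" using elim h(3) by blast
    from continuous_on_tendsto_compose[OF this r(2) s] show ?case using r(1) by simp
   qed
  qed (use me r s b in auto)
 qed
 then show "continuous_on {0..T} (%t. \<integral>z. h z \<partial>joint_flow \<mu> \<nu> t)"
  by (rule continuous_on_cong[THEN iffD1, rotated -1]) (use eq in auto)
qed

lemma abs_pow_continuous: "0 \<le> k ==> continuous_on UNIV (%x. abs_pow x k)"
 unfolding abs_pow_def by (cases "k = 0") (auto intro!: continuous_intros continuous_on_powr')

lemma geometric_limit:
 fixes x :: "nat => real"
 assumes x: "!!n. \<bar>x (Suc n) - x n\<bar> \<le> E / 2 ^ n"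
 shows "x \<longlonglongrightarrow> lim x" "\<bar>lim x - x n\<bar> \<le> 2 * E / 2 ^ n"
proof -
 have E0: "0 \<le> E" using x[of 0] by simp
 have far: "\<bar>x (n + k) - x n\<bar> \<le> 2 * E / 2 ^ n - 2 * E / 2 ^ (n + k)" for n k
 proof (induction k)
  case (Suc k)
  have "\<bar>x (n + Suc k) - x n\<bar> \<le> \<bar>x (Suc (n + k)) - x (n + k)\<bar> + \<bar>x (n + k) - x n\<bar>" by simp
  also have "\<dots> \<le> E / 2 ^ (n + k) + (2 * E / 2 ^ n - 2 * E / 2 ^ (n + k))" using x[of "n + k"] Suc.IH by linarith
  also have "\<dots> = 2 * E / 2 ^ n - 2 * E / 2 ^ (n + Suc k)" by (simp add: field_simps)
  finally show ?case .
 qed simp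
 have far': "\<bar>x m - x n\<bar> \<le> 2 * E / 2 ^ n" if nm: "n \<le> m" for m n
 proof -
  obtain k where mk: "m = n + k" using le_Suc_ex[OF nm] by blast
  have "0 \<le> 2 * E / 2 ^ (n + k)" using E0 by simp
  then show ?thesis unfolding mk by (intro order_trans[OF far]) simp
 qed
 have small: "(%n. 2 * E / 2 ^ n) \<longlonglongrightarrow> 0"
  using tendsto_mult_right_zero[OF LIMSEQ_power_zero[of "1/2 :: real"], of "2 * E"] by (simp add: power_divide)
 have "Cauchy x"
 proof (rule CauchyI')
  fix e :: real assume "0 < e"
  then have "\<forall>\<^sub>F n in sequentially. 2 * E / 2 ^ n < e" using small by (intro order_tendstoD)
  then obtain N where N: "2 * E / 2 ^ N < e / 1" and Nn: "!!n. N \<le> n ==> 2 * E / 2 ^ n < e"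
   by (auto simp: eventually_sequentially)
  show "\<exists>M. \<forall>m\<ge>M. \<forall>n>m. dist (x m) (x n) < e"
  proof (intro exI[of _ N] allI impI)
   fix m n assume "N \<le> m" "m < n"
   then show "dist (x m) (x n) < e" using far'[of m n] Nn[of m] by (simp add: dist_real_def abs_minus_commute)
  qed
 qed
 then show l: "x \<longlonglongrightarrow> lim x" by (simp add: Cauchy_convergent_iff convergent_LIMSEQ_iff)
 then have "(%m. \<bar>x m - x n\<bar>) \<longlonglongrightarrow> \<bar>lim x - x n\<bar>" by (intro tendsto_intros)
 then show "\<bar>lim x - x n\<bar> \<le> 2 * E / 2 ^ n" by (rule LIMSEQ_le_const2) (use far' in blast)
qed

section \<open>Interaction fields and the path laws they drive\<close>

locale mean_field =
 fixes T Cf Cg k1 k2 \<tau> :: real and f :: "real => real => real => real" and g :: "real => real => real"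
  and \<gamma> :: "real => real measure" and \<mu> :: "real measure"
 assumes T: "0 < T" and fa: "interaction_assms f Cf" and ga: "local_drift_assms g Cg k1 k2"
  and \<gamma>a: "initial_assms \<gamma> \<tau>" and \<mu>: "\<mu> \<in> space (prob_algebra borel)"
begin

text \<open>The derivative is measurable as the limit of difference quotients with steps 1/(n+1),
  and Lipschitz because the second derivative is bounded.\<close>

lemma dx_f:
 shows dx_bound: "\<bar>dx f x \<omega> \<omega>'\<bar> \<le> Cf" and dx_lipschitz: "\<bar>dx f x \<omega> \<omega>' - dx f y \<omega> \<omega>'\<bar> \<le> Cf * \<bar>x - y\<bar>"
  and dx_measurable: "(%(x, \<omega>, \<omega>'). dx f x \<omega> \<omega>') \<in> borel_measurable (borel \<Otimes>\<^sub>M (borel \<Otimes>\<^sub>M borel))"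
  and Cf0: "0 \<le> Cf"
proof -
 show b: "\<bar>dx f x \<omega> \<omega>'\<bar> \<le> Cf" for x \<omega> \<omega>' using fa unfolding interaction_assms_def by blast
 then show "0 \<le> Cf" using order_trans[OF abs_ge_zero] by blast
 have d2: "((%y. dx f y \<omega> \<omega>') has_real_derivative dx (dx f) x \<omega> \<omega>') (at x)" for x
  using fa unfolding interaction_assms_def dx_def[of "dx f"] by (simp add: field_differentiable_derivI)
 have b2: "\<bar>dx (dx f) x \<omega> \<omega>'\<bar> \<le> Cf" for x using fa unfolding interaction_assms_def by blast
 show "\<bar>dx f x \<omega> \<omega>' - dx f y \<omega> \<omega>'\<bar> \<le> Cf * \<bar>x - y\<bar>"
  by (rule lipschitz_from_deriv[where g = "%y. dx f y \<omega> \<omega>'", OF d2 b2])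
 have d1: "((%y. f y \<omega> \<omega>') has_real_derivative dx f x \<omega> \<omega>') (at x)" for x \<omega> \<omega>'
  using fa unfolding interaction_assms_def dx_def[of f] by (simp add: field_differentiable_derivI)
 have mf: "(%(x, \<omega>, \<omega>'). f x \<omega> \<omega>') \<in> borel_measurable (borel :: (real \<times> real \<times> real) measure)"
  using fa unfolding interaction_assms_def by blast
 let ?h = "%n :: nat. inverse (real (Suc n))"
 have "(%z. dx f (fst z) (fst (snd z)) (snd (snd z))) \<in> borel_measurable (borel :: (real \<times> real \<times> real) measure)"
 proof (rule borel_measurable_LIMSEQ_real)
  fix z :: "real \<times> real \<times> real"
  have "filterlim ?h (at 0) sequentially"
   unfolding filterlim_at using LIMSEQ_inverse_real_of_nat by (auto intro!: always_eventually)
  from filterlim_compose[OF d1[of "fst (snd z)" "snd (snd z)" "fst z", unfolded DERIV_def] this]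
  show "(%n. (f (fst z + ?h n) (fst (snd z)) (snd (snd z)) - f (fst z) (fst (snd z)) (snd (snd z))) / ?h n) \<longlonglongrightarrow>
    dx f (fst z) (fst (snd z)) (snd (snd z))" .
 next
  fix n
  have sh: "(%z :: real \<times> real \<times> real. (fst z + ?h n, snd z)) \<in> borel \<rightarrow>\<^sub>M borel"
   by (intro borel_measurable_continuous_onI continuous_intros)
  have "(%z. f (fst z + ?h n) (fst (snd z)) (snd (snd z))) \<in> borel_measurable (borel :: (real \<times> real \<times> real) measure)"
   using measurable_compose[OF sh mf] by (simp add: case_prod_unfold)
  moreover have "(%z. f (fst z) (fst (snd z)) (snd (snd z))) \<in> borel_measurable (borel :: (real \<times> real \<times> real) measure)"
   using mf by (simp add: case_prod_unfold)
  ultimately show "(%z. (f (fst z + ?h n) (fst (snd z)) (snd (snd z)) - f (fst z) (fst (snd z)) (snd (snd z))) / ?h n) \<in> borel_measurable (borel :: (real \<times> real \<times> real) measure)"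
   by (intro borel_measurable_divide borel_measurable_diff borel_measurable_const)
 qed
 then show "(%(x, \<omega>, \<omega>'). dx f x \<omega> \<omega>') \<in> borel_measurable (borel \<Otimes>\<^sub>M (borel \<Otimes>\<^sub>M borel))"
  by (simp add: borel_prod case_prod_unfold)
qed

lemma dx_section_measurable:
 "(%z. dx f (x - fst z) \<omega> (snd z)) \<in> borel_measurable (borel \<Otimes>\<^sub>M borel)"
 "(%z. dx f (snd (fst z) - fst (snd z)) (fst (fst z)) (snd (snd z))) \<in> borel_measurable ((borel \<Otimes>\<^sub>M borel) \<Otimes>\<^sub>M (borel \<Otimes>\<^sub>M borel))"
proof -
 have "(%z :: real \<times> real. (x - fst z, \<omega>, snd z)) \<in> borel \<Otimes>\<^sub>M borel \<rightarrow>\<^sub>M borel \<Otimes>\<^sub>M (borel \<Otimes>\<^sub>M borel)" by measurable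
 from measurable_compose[OF this dx_measurable]
 show "(%z. dx f (x - fst z) \<omega> (snd z)) \<in> borel_measurable (borel \<Otimes>\<^sub>M borel)" by (simp add: case_prod_unfold)
 have "(%z :: (real \<times> real) \<times> (real \<times> real). (snd (fst z) - fst (snd z), fst (fst z), snd (snd z)))
   \<in> (borel \<Otimes>\<^sub>M borel) \<Otimes>\<^sub>M (borel \<Otimes>\<^sub>M borel) \<rightarrow>\<^sub>M borel \<Otimes>\<^sub>M (borel \<Otimes>\<^sub>M borel)" by measurable
 from measurable_compose[OF this dx_measurable]
 show "(%z. dx f (snd (fst z) - fst (snd z)) (fst (fst z)) (snd (snd z))) \<in> borel_measurable ((borel \<Otimes>\<^sub>M borel) \<Otimes>\<^sub>M (borel \<Otimes>\<^sub>M borel))"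
  by (simp add: case_prod_unfold)
qed

lemma dx_section_continuous: "continuous_on UNIV (%x'. dx f (x - x') \<omega> \<omega>')"
proof -
 have "Cf-lipschitz_on UNIV (%x'. dx f (x - x') \<omega> \<omega>')"
 proof (rule lipschitz_onI)
  show "dist (dx f (x - y) \<omega> \<omega>') (dx f (x - z) \<omega> \<omega>') \<le> Cf * dist y z" for y z
   using dx_lipschitz[of "x - y" \<omega> \<omega>' "x - z"] by (simp add: dist_real_def abs_minus_commute)
 qed (rule Cf0)
 then show ?thesis by (rule lipschitz_on_continuous_on)
qed

text \<open>Joint measurability of \<open>g\<close> follows from joint continuity: the Lipschitz
  bound in x is uniform, and the one in \<omega> is local.\<close>

lemma g_assms:
 shows Cg0: "0 \<le> Cg" and g_bound: "\<bar>g x \<omega>\<bar> \<le> Cg * (1 + abs_pow \<omega> k1)" and g_lipschitz: "\<bar>g x \<omega> - g y \<omega>\<bar> \<le> Cg * \<bar>x - y\<bar>"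
  and g_measurable: "(%(\<omega>, x). g x \<omega>) \<in> borel_measurable (borel \<Otimes>\<^sub>M borel)"
proof -
 show Cg: "0 \<le> Cg" using ga unfolding local_drift_assms_def by simp
 show "\<bar>g x \<omega>\<bar> \<le> Cg * (1 + abs_pow \<omega> k1)" using ga unfolding local_drift_assms_def by blast
 show lip: "\<bar>g x \<omega> - g y \<omega>\<bar> \<le> Cg * \<bar>x - y\<bar>" for x y \<omega> using ga unfolding local_drift_assms_def by blast
 have w: "\<bar>g x \<omega> - g x \<omega>'\<bar> \<le> Cg * \<bar>\<omega> - \<omega>'\<bar> * (1 + abs_pow \<omega> k2 + abs_pow \<omega>' k2)" for x \<omega> \<omega>'
  using ga unfolding local_drift_assms_def by blast
 have k2: "0 \<le> k2" using ga unfolding local_drift_assms_def by blast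
 have "continuous_on UNIV (%z. g (snd z) (fst z))" unfolding continuous_on_sequentially comp_def
 proof (intro allI ballI impI)
  fix r :: "nat => real \<times> real" and s assume "(\<forall>n. r n \<in> UNIV) \<and> r \<longlonglongrightarrow> s"
  then have r: "(%n. fst (r n)) \<longlonglongrightarrow> fst s" "(%n. snd (r n)) \<longlonglongrightarrow> snd s" by (auto intro: tendsto_intros)
  let ?b = "%n. Cg * \<bar>snd (r n) - snd s\<bar> + Cg * \<bar>fst (r n) - fst s\<bar> * (1 + abs_pow (fst (r n)) k2 + abs_pow (fst s) k2)"
  have "(%n. abs_pow (fst (r n)) k2) \<longlonglongrightarrow> abs_pow (fst s) k2"
   by (rule continuous_on_tendsto_compose[OF abs_pow_continuous[OF k2] r(1)]) auto
  then have "?b \<longlonglongrightarrow> Cg * \<bar>snd s - snd s\<bar> + Cg * \<bar>fst s - fst s\<bar> * (1 + abs_pow (fst s) k2 + abs_pow (fst s) k2)"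
   by (intro tendsto_intros r)
  then have b0: "?b \<longlonglongrightarrow> 0" by simp
  have "norm (g (snd (r n)) (fst (r n)) - g (snd s) (fst s)) \<le> ?b n" for n
   using lip[of "snd (r n)" "fst (r n)" "snd s"] w[of "snd s" "fst (r n)" "fst s"] unfolding real_norm_def by linarith
  then have "(%n. g (snd (r n)) (fst (r n)) - g (snd s) (fst s)) \<longlonglongrightarrow> 0"
   by (intro Lim_null_comparison[OF always_eventually b0]) blast
  then show "(%n. g (snd (r n)) (fst (r n))) \<longlonglongrightarrow> g (snd s) (fst s)" by (rule LIM_zero_cancel)
 qed
 from borel_measurable_continuous_onI[OF this]
 show "(%(\<omega>, x). g x \<omega>) \<in> borel_measurable (borel \<Otimes>\<^sub>M borel)" by (simp add: borel_prod case_prod_unfold)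
qed

lemma \<gamma>_space: "\<gamma> \<omega> \<in> space (prob_algebra borel)" and \<gamma>_kernel: "\<gamma> \<in> borel \<rightarrow>\<^sub>M prob_algebra borel"
proof -
 show s: "\<gamma> \<omega> \<in> space (prob_algebra borel)" for \<omega> using \<gamma>a unfolding initial_assms_def by blast
 show "\<gamma> \<in> borel \<rightarrow>\<^sub>M prob_algebra borel"
  by (rule feller_kernel_measurable[OF s]) (use \<gamma>a in \<open>unfold initial_assms_def, blast\<close>)
qed

text \<open>The class in which the fixed point is sought. It contains the field of every flow and is
  closed under limits that are uniform in time; its bounds do not depend on \<omega>.\<close>

definition interaction_field :: "(real => real => real => real) => bool" where
 "interaction_field m \<longleftrightarrow> (\<forall>t\<in>{0..T}. \<forall>\<omega> x. \<bar>m \<omega> t x\<bar> \<le> Cf) \<and> (\<forall>t\<in>{0..T}. \<forall>\<omega> x y. \<bar>m \<omega> t x - m \<omega> t y\<bar> \<le> Cf * \<bar>x - y\<bar>) \<and>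
  (\<forall>\<omega> x. continuous_on {0..T} (%t. m \<omega> t x)) \<and> (\<forall>t\<in>{0..T}. (%(\<omega>, x). m \<omega> t x) \<in> borel_measurable (borel \<Otimes>\<^sub>M borel))"

lemma interaction_fieldD:
 assumes "interaction_field m"
 shows "t \<in> {0..T} ==> \<bar>m \<omega> t x\<bar> \<le> Cf" "t \<in> {0..T} ==> \<bar>m \<omega> t x - m \<omega> t y\<bar> \<le> Cf * \<bar>x - y\<bar>"
  "continuous_on {0..T} (%t. m \<omega> t x)" "t \<in> {0..T} ==> (%(\<omega>, x). m \<omega> t x) \<in> borel_measurable (borel \<Otimes>\<^sub>M borel)"
 using assms unfolding interaction_field_def by blast+

definition field :: "(real => (real \<times> real) measure) => real => real => real => real" where
 "field q \<omega> t x = mean_field_drift f (q t) \<omega> x"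

lemma field_eq: "field q \<omega> t x = - (\<integral>z. dx f (x - fst z) \<omega> (snd z) \<partial>q t)"
 by (simp add: field_def mean_field_drift_def case_prod_unfold)

lemma interaction_field_field:
 assumes q: "flow T q" shows "interaction_field (field q)" unfolding interaction_field_def
proof (intro conjI ballI allI)
 fix t assume t: "t \<in> {0..T}"
 interpret Q: prob_space "q t" by (rule flowD(1)[OF q t])
 note s = flowD(2)[OF q t]
 have i: "integrable (q t) (%z. dx f (x - fst z) \<omega> (snd z))" for x \<omega>
  using dx_bound dx_section_measurable(1)[of x \<omega>]
  by (intro Q.integrable_const_bound[of _ Cf]) (auto simp: measurable_cong_sets[OF s refl])
 fix \<omega> x
 have "\<bar>\<integral>z. dx f (x - fst z) \<omega> (snd z) \<partial>q t\<bar> \<le> Cf" by (rule Q.expectation_abs_bound[OF dx_bound])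
 then show "\<bar>field q \<omega> t x\<bar> \<le> Cf" by (simp add: field_eq)
 fix y
 have "\<bar>(\<integral>z. dx f (y - fst z) \<omega> (snd z) \<partial>q t) - (\<integral>z. dx f (x - fst z) \<omega> (snd z) \<partial>q t)\<bar> \<le> Cf * \<bar>x - y\<bar>"
 proof (rule Q.expectation_difference_bound[OF i i])
  show "\<bar>dx f (y - fst z) \<omega> (snd z) - dx f (x - fst z) \<omega> (snd z)\<bar> \<le> Cf * \<bar>x - y\<bar>" for z
   using dx_lipschitz[of "y - fst z" \<omega> "snd z" "x - fst z"] by (simp add: abs_minus_commute)
 qed
 then show "\<bar>field q \<omega> t x - field q \<omega> t y\<bar> \<le> Cf * \<bar>x - y\<bar>" by (simp add: field_eq)
next
 fix \<omega> x
 have "continuous_on {0..T} (%t. \<integral>z. dx f (x - fst z) \<omega> (snd z) \<partial>q t)"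
  by (rule flowD(3)[OF q dx_section_measurable(1) dx_bound]) (simp add: dx_section_continuous)
 then show "continuous_on {0..T} (%t. field q \<omega> t x)" unfolding field_eq by (rule continuous_on_minus)
next
 fix t assume t: "t \<in> {0..T}"
 interpret Q: prob_space "q t" by (rule flowD(1)[OF q t])
 have "sets ((borel \<Otimes>\<^sub>M borel) \<Otimes>\<^sub>M q t) = sets ((borel \<Otimes>\<^sub>M borel :: (real \<times> real) measure) \<Otimes>\<^sub>M (borel \<Otimes>\<^sub>M borel))"
  by (intro sets_pair_measure_cong refl flowD(2)[OF q t])
 then have "(%z. dx f (snd (fst z) - fst (snd z)) (fst (fst z)) (snd (snd z))) \<in> borel_measurable ((borel \<Otimes>\<^sub>M borel) \<Otimes>\<^sub>M q t)"
  using dx_section_measurable(2) by (simp cong: measurable_cong_sets)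
 then have "(%p. \<integral>z. dx f (snd p - fst z) (fst p) (snd z) \<partial>q t) \<in> borel_measurable (borel \<Otimes>\<^sub>M borel)"
  by (intro Q.borel_measurable_lebesgue_integral) (simp add: case_prod_unfold)
 then have "(%p. - (\<integral>z. dx f (snd p - fst z) (fst p) (snd z) \<partial>q t)) \<in> borel_measurable (borel \<Otimes>\<^sub>M borel)" by (rule borel_measurable_uminus)
 then show "(%(\<omega>, x). field q \<omega> t x) \<in> borel_measurable (borel \<Otimes>\<^sub>M borel)" by (simp add: field_eq case_prod_unfold)
qed

abbreviation "L \<equiv> Cf + Cg"

definition total_drift :: "(real => real => real => real) => real => real => real => real" where
 "total_drift m \<omega> t x = m \<omega> t x + g x \<omega>"

text \<open>The Lipschitz constant is uniform in \<omega>, but the bound grows with \<omega> through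
  \<open>g\<close>. Contraction estimates use the former; the uniqueness theorem for the linear
  equation, which needs bounded drift, is applied to one \<omega> at a time.\<close>

lemma total_drift:
 assumes m: "interaction_field m"
 shows "lip_drift T L (total_drift m \<omega>)"
  "t \<in> {0..T} ==> \<bar>total_drift m \<omega> t x\<bar> \<le> Cf + Cg * (1 + abs_pow \<omega> k1)"
  "t \<in> {0..T} ==> (%(\<omega>, x). total_drift m \<omega> t x) \<in> borel_measurable (borel \<Otimes>\<^sub>M borel)"
proof -
 show "lip_drift T L (total_drift m \<omega>)" unfolding lip_drift_def
 proof (intro conjI allI ballI)
  show "0 \<le> L" using Cf0 Cg0 by simp
  show "continuous_on {0..T} (%t. total_drift m \<omega> t x)" for x
   unfolding total_drift_def by (intro continuous_on_add interaction_fieldD(3)[OF m] continuous_on_const)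
  show "\<bar>total_drift m \<omega> t x - total_drift m \<omega> t y\<bar> \<le> L * \<bar>x - y\<bar>" if "t \<in> {0..T}" for t x y
   unfolding total_drift_def distrib_right using interaction_fieldD(2)[OF m that, of \<omega> x y] g_lipschitz[of x \<omega> y] by linarith
 qed
 show "\<bar>total_drift m \<omega> t x\<bar> \<le> Cf + Cg * (1 + abs_pow \<omega> k1)" if "t \<in> {0..T}"
  unfolding total_drift_def using interaction_fieldD(1)[OF m that, of \<omega> x] g_bound[of x \<omega>] by linarith
 show "(%(\<omega>, x). total_drift m \<omega> t x) \<in> borel_measurable (borel \<Otimes>\<^sub>M borel)" if "t \<in> {0..T}"
  using borel_measurable_add[OF interaction_fieldD(4)[OF m that] g_measurable] by (simp add: total_drift_def case_prod_unfold)
qed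

definition path_kernel :: "(real => real => real => real) => real => (real => real) measure" where
 "path_kernel m \<omega> = sde_dist T (total_drift m \<omega>) (\<gamma> \<omega>)"

definition law :: "(real => real => real => real) => ((real => real) \<times> real) measure" where
 "law m = semidirect (path_space T) \<mu> (path_kernel m)"

lemma path_kernel_measurable: "interaction_field m ==> path_kernel m \<in> borel \<rightarrow>\<^sub>M prob_algebra (path_space T)"
 unfolding path_kernel_def[abs_def] using sde_dist_kernel[OF T total_drift(1) total_drift(3) \<gamma>_kernel] by blast

lemma law_in_space: "interaction_field m ==> law m \<in> path_disorder_measures T"
 unfolding law_def path_disorder_measures_def by (intro semidirect_in_space \<mu> path_kernel_measurable)

lemma path_law_eq: "flow T q ==> path_law T f g \<gamma> q = path_kernel (field q)"
proof
 fix \<omega> assume q: "flow T q"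
 have "path_law T f g \<gamma> q \<omega> = sde_law T (total_drift (field q) \<omega>) (\<gamma> \<omega>)"
  by (simp add: path_law_def total_drift_def[abs_def] field_def)
 also have "\<dots> = path_kernel (field q) \<omega>"
  unfolding path_kernel_def by (rule sde_law_eq[OF T total_drift(1)[OF interaction_field_field[OF q]] \<gamma>_space])
 finally show "path_law T f g \<gamma> q \<omega> = path_kernel (field q) \<omega>" .
qed

lemma path_law_joint_eq: "flow T q ==> path_law_joint T f g \<gamma> \<mu> q = law (field q)"
 by (simp add: path_law_joint_def law_def path_law_eq)

end

text \<open>Synchronous coupling: both equations are run with the same initial value and the same
  noise, so pathwise stability controls the difference of expectations.\<close>

lemma sde_dist_difference:
 fixes F :: "real => real"
 assumes T: "0 < T" and a: "lip_drift T L a" and a': "lip_drift T L a'" and \<rho>: "\<rho> \<in> space (prob_algebra borel)"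
  and \<kappa>: "L < \<kappa>" and D: "0 \<le> D" and d: "!!s x. s \<in> {0..T} ==> \<bar>a s x - a' s x\<bar> \<le> D * exp (\<kappa> * s)"
  and F: "!!x y. \<bar>F x - F y\<bar> \<le> K * \<bar>x - y\<bar>" "!!x. \<bar>F x\<bar> \<le> C" and K: "0 \<le> K" and t: "t \<in> {0..T}"
 shows "\<bar>(\<integral>x. F (x t) \<partial>sde_dist T a \<rho>) - (\<integral>x. F (x t) \<partial>sde_dist T a' \<rho>)\<bar> \<le> K * (D / (\<kappa> - L) * exp (\<kappa> * t))"
proof -
 have s\<rho>: "sets \<rho> = sets borel" and p\<rho>: "prob_space \<rho>" using prob_algebraD[OF \<rho>] by auto
 interpret R: prob_space \<rho> by fact
 interpret W: prob_space "wiener T" by (rule prob_space_wiener[OF T])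
 have "K-lipschitz_on UNIV F" using F(1) K by (intro lipschitz_onI) (auto simp: dist_real_def)
 then have "F \<in> borel_measurable borel" by (intro borel_measurable_continuous_onI lipschitz_on_continuous_on)
 then have mF: "(%x. F (x t)) \<in> borel_measurable (path_space T)" by (rule measurable_compose[OF measurable_path_eval[OF T]])
 note i = sde_dist_integral[where F = "%x. F (x t)" and K = C, OF T a \<rho> mF F(2)]
 note i' = sde_dist_integral[where F = "%x. F (x t)" and K = C, OF T a' \<rho> mF F(2)]
 have iw: "integrable (wiener T) (%w. F (sde_path T a \<xi> w t))" "integrable (wiener T) (%w. F (sde_path T a' \<xi> w t))" for \<xi>
  using i(3)[of \<xi>] i'(3)[of \<xi>] F(2) by (auto intro!: W.integrable_const_bound[of _ C])
 have b: "\<bar>\<integral>w. F (X w) \<partial>wiener T\<bar> \<le> C" for X by (rule W.expectation_abs_bound[OF F(2)])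
 have i\<rho>: "integrable \<rho> (%\<xi>. \<integral>w. F (sde_path T a \<xi> w t) \<partial>wiener T)" "integrable \<rho> (%\<xi>. \<integral>w. F (sde_path T a' \<xi> w t) \<partial>wiener T)"
  by (rule R.integrable_const_bound[of _ C]; use i(2) i'(2) b in \<open>auto simp: measurable_cong_sets[OF s\<rho> refl]\<close>)+
 show ?thesis unfolding i(1) i'(1)
 proof (rule R.expectation_difference_bound[OF i\<rho>], rule W.expectation_difference_bound[OF iw])
  fix \<xi> w assume "w \<in> space (wiener T)"
  then have w: "continuous_on {0..T} w" by (auto simp: space_wiener paths_def)
  have x: "continuous_on {0..T} (sde_path T a \<xi> w)" "continuous_on {0..T} (sde_path T a' \<xi> w)"
   using sde_path_in_paths[OF a w] sde_path_in_paths[OF a' w] by (auto simp: paths_def)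
  have "\<bar>sde_path T a \<xi> w t - sde_path T a' \<xi> w t\<bar> \<le> D / (\<kappa> - L) * exp (\<kappa> * t)"
   by (rule ode_stability[OF a a' less_imp_le[OF T] \<kappa> D x sde_path_eq[OF a w] sde_path_eq[OF a' w] d t])
  then have "K * \<bar>sde_path T a \<xi> w t - sde_path T a' \<xi> w t\<bar> \<le> K * (D / (\<kappa> - L) * exp (\<kappa> * t))" using K by (rule mult_left_mono)
  then show "\<bar>F (sde_path T a \<xi> w t) - F (sde_path T a' \<xi> w t)\<bar> \<le> K * (D / (\<kappa> - L) * exp (\<kappa> * t))"
   by (rule order_trans[OF F(1)])
 qed
qed

lemma sde_dist_cong:
 assumes T: "0 < T" and a: "lip_drift T L a" and a': "lip_drift T L a'" and \<rho>: "\<rho> \<in> space (prob_algebra borel)"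
  and eq: "!!s x. s \<in> {0..T} ==> a s x = a' s x"
 shows "sde_dist T a \<rho> = sde_dist T a' \<rho>" unfolding sde_dist_def
proof (rule distr_cong)
 fix z assume "z \<in> space (\<rho> \<Otimes>\<^sub>M wiener T)"
 then have w: "continuous_on {0..T} (snd z)" by (auto simp: space_pair_measure space_wiener paths_def)
 have "ode_sol a (driver (fst z) (snd z)) t = ode_sol a' (driver (fst z) (snd z)) t" if "t \<in> {0..T}" for t
  using ode_sol_cong[OF a a' less_imp_le[OF T] continuous_on_driver[OF w] continuous_on_driver[OF w] eq refl that] by simp
 then show "(case z of (\<xi>, w) => sde_path T a \<xi> w) = (case z of (\<xi>, w) => sde_path T a' \<xi> w)"
  by (auto simp: sde_path_def case_prod_unfold fun_eq_iff restrict_def)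
qed auto

section \<open>The mean-field map and its fixed point\<close>

context mean_field begin

definition update :: "(real => real => real => real) => real => real => real => real" where
 "update m = field (time_marginal (law m))"

lemma interaction_field_update: "interaction_field m ==> interaction_field (update m)"
 unfolding update_def by (intro interaction_field_field flow_time_marginal[OF T] law_in_space)

lemma law_cong:
 assumes m: "interaction_field m" and m': "interaction_field m'" and eq: "!!\<omega> t x. t \<in> {0..T} ==> m \<omega> t x = m' \<omega> t x"
 shows "law m = law m'"
proof -
 have "path_kernel m \<omega> = path_kernel m' \<omega>" for \<omega> unfolding path_kernel_def
  by (rule sde_dist_cong[OF T total_drift(1)[OF m] total_drift(1)[OF m'] \<gamma>_space]) (simp add: total_drift_def eq)
 then have "path_kernel m = path_kernel m'" by (rule ext)
 then show ?thesis by (simp add: law_def)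
qed

lemma update_eq:
 assumes m: "interaction_field m"
 shows "update m \<omega> t x = - (\<integral>\<omega>'. \<integral>y. dx f (x - y t) \<omega> \<omega>' \<partial>path_kernel m \<omega>' \<partial>\<mu>)"
  "(%\<omega>'. \<integral>y. dx f (x - y t) \<omega> \<omega>' \<partial>path_kernel m \<omega>') \<in> borel_measurable borel"
  "\<bar>\<integral>y. dx f (x - y t) \<omega> \<omega>' \<partial>path_kernel m \<omega>'\<bar> \<le> Cf"
proof -
 let ?h = "%z. dx f (x - fst z t) \<omega> (snd z)"
 have mh: "?h \<in> borel_measurable (path_space T \<Otimes>\<^sub>M borel)"
  using measurable_compose[OF measurable_time_eval[OF T, of t] dx_section_measurable(1)[of x \<omega>]] by (simp add: case_prod_unfold)
 note k = path_kernel_measurable[OF m]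
 have "update m \<omega> t x = - (\<integral>z. ?h z \<partial>law m)"
  unfolding update_def field_eq by (simp add: time_marginal_integral(1)[OF T law_in_space[OF m] dx_section_measurable(1)])
 moreover have "(\<integral>z. ?h z \<partial>law m) = (\<integral>\<omega>'. \<integral>y. ?h (y, \<omega>') \<partial>path_kernel m \<omega>' \<partial>\<mu>)"
  unfolding law_def by (rule integral_semidirect[OF \<mu> k mh dx_bound])
 ultimately show "update m \<omega> t x = - (\<integral>\<omega>'. \<integral>y. dx f (x - y t) \<omega> \<omega>' \<partial>path_kernel m \<omega>' \<partial>\<mu>)" by simp
 show "(%\<omega>'. \<integral>y. dx f (x - y t) \<omega> \<omega>' \<partial>path_kernel m \<omega>') \<in> borel_measurable borel"
  using kernel_integral_measurable[OF k mh] by simp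
 interpret K: prob_space "path_kernel m \<omega>'" using measurable_prob_algebraD'(1)[OF k] by simp
 show "\<bar>\<integral>y. dx f (x - y t) \<omega> \<omega>' \<partial>path_kernel m \<omega>'\<bar> \<le> Cf" by (rule K.expectation_abs_bound[OF dx_bound])
qed

text \<open>The excess \<open>2 * Cf + 2\<close> over the Lipschitz constant makes Cf/(rate - L) at
  most 1/2 and stays positive when Cf = 0.\<close>

abbreviation "rate \<equiv> L + (2 * Cf + 2)"

lemma rate_pos: "0 \<le> rate" using Cf0 Cg0 by simp

text \<open>A change of the field moves the coupled paths by at most D/(rate - L) times the weight,
  and averaging the derivative of \<open>f\<close>, which is Lipschitz with constant
  \<open>Cf\<close>, costs another factor \<open>Cf\<close>.\<close>

lemma update_contraction:
 assumes m: "interaction_field m" and m': "interaction_field m'" and D: "0 \<le> D"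
  and d: "!!\<omega> s x. s \<in> {0..T} ==> \<bar>m \<omega> s x - m' \<omega> s x\<bar> \<le> D * exp (rate * s)" and t: "t \<in> {0..T}"
 shows "\<bar>update m \<omega> t x - update m' \<omega> t x\<bar> \<le> D / 2 * exp (rate * t)"
proof -
 interpret M: prob_space \<mu> by (rule prob_algebraD[OF \<mu>])
 have i: "integrable \<mu> (%\<omega>'. \<integral>y. dx f (x - y t) \<omega> \<omega>' \<partial>path_kernel m \<omega>')" if "interaction_field m" for m
  using update_eq(2,3)[OF that] by (intro M.integrable_const_bound[of _ Cf]) (auto simp: measurable_cong_sets[OF prob_algebraD(2)[OF \<mu>] refl])
 have "\<bar>(\<integral>\<omega>'. \<integral>y. dx f (x - y t) \<omega> \<omega>' \<partial>path_kernel m \<omega>' \<partial>\<mu>) - (\<integral>\<omega>'. \<integral>y. dx f (x - y t) \<omega> \<omega>' \<partial>path_kernel m' \<omega>' \<partial>\<mu>)\<bar>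
   \<le> Cf * (D / (rate - L) * exp (rate * t))"
 proof (rule M.expectation_difference_bound[OF i[OF m] i[OF m']])
  fix \<omega>'
  show "\<bar>(\<integral>y. dx f (x - y t) \<omega> \<omega>' \<partial>path_kernel m \<omega>') - (\<integral>y. dx f (x - y t) \<omega> \<omega>' \<partial>path_kernel m' \<omega>')\<bar> \<le> Cf * (D / (rate - L) * exp (rate * t))"
   unfolding path_kernel_def
  proof (rule sde_dist_difference[where F = "%y. dx f (x - y) \<omega> \<omega>'", OF T total_drift(1)[OF m] total_drift(1)[OF m'] \<gamma>_space _ D _ _ dx_bound Cf0 t])
   show "L < rate" using Cf0 by simp
   show "\<bar>total_drift m \<omega>' s y - total_drift m' \<omega>' s y\<bar> \<le> D * exp (rate * s)" if "s \<in> {0..T}" for s y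
    using d[OF that] by (simp add: total_drift_def)
   show "\<bar>dx f (x - y) \<omega> \<omega>' - dx f (x - z) \<omega> \<omega>'\<bar> \<le> Cf * \<bar>y - z\<bar>" for y z
    using dx_lipschitz[of "x - y" \<omega> \<omega>' "x - z"] by (simp add: abs_minus_commute)
  qed
 qed
 moreover have "Cf * (D / (rate - L) * exp (rate * t)) \<le> D / 2 * exp (rate * t)"
 proof -
  have "Cf * (D / (rate - L) * exp (rate * t)) = (Cf / (2 * Cf + 2)) * (D * exp (rate * t))" by simp
  also have "\<dots> \<le> 1 / 2 * (D * exp (rate * t))" using Cf0 D by (intro mult_right_mono) (auto simp: field_simps)
  finally show ?thesis by simp
 qed
 ultimately show ?thesis
  unfolding update_eq(1)[OF m] update_eq(1)[OF m'] minus_diff_minus abs_minus_cancel by (rule order_trans)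
qed

lemma exp_rate: "t \<in> {0..T} ==> 1 \<le> exp (rate * t)" "t \<in> {0..T} ==> exp (rate * t) \<le> exp (rate * T)"
 using rate_pos by (auto intro!: mult_left_mono mult_nonneg_nonneg)

lemma tendsto_div_2_power: "(%n. E / 2 ^ n) \<longlonglongrightarrow> (0::real)"
 using tendsto_mult_right_zero[OF LIMSEQ_power_zero[of "1/2 :: real"], of E] by (simp add: power_divide)

text \<open>Two fields differ by at most 2 Cf to begin with, and for fixed points the contraction
  halves this bound arbitrarily often.\<close>

lemma update_fixed_point_unique:
 assumes m: "interaction_field m" and m': "interaction_field m'"
  and fix1: "!!\<omega> t x. t \<in> {0..T} ==> update m \<omega> t x = m \<omega> t x" and fix2: "!!\<omega> t x. t \<in> {0..T} ==> update m' \<omega> t x = m' \<omega> t x"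
  and t: "t \<in> {0..T}"
 shows "m \<omega> t x = m' \<omega> t x"
proof -
 have "\<forall>\<omega>. \<forall>t\<in>{0..T}. \<forall>x. \<bar>m \<omega> t x - m' \<omega> t x\<bar> \<le> 2 * Cf / 2 ^ n * exp (rate * t)" for n
 proof (induction n)
  case 0
  show ?case
  proof (intro allI ballI)
   fix \<omega> t x assume t: "t \<in> {0..T}"
   have "\<bar>m \<omega> t x - m' \<omega> t x\<bar> \<le> 2 * Cf * 1"
    using interaction_fieldD(1)[OF m t, of \<omega> x] interaction_fieldD(1)[OF m' t, of \<omega> x] by linarith
   also have "\<dots> \<le> 2 * Cf * exp (rate * t)" using exp_rate(1)[OF t] Cf0 by (intro mult_left_mono) auto
   finally show "\<bar>m \<omega> t x - m' \<omega> t x\<bar> \<le> 2 * Cf / 2 ^ 0 * exp (rate * t)" by simp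
  qed
 next
  case (Suc n)
  show ?case
  proof (intro allI ballI)
   fix \<omega> t x assume t: "t \<in> {0..T}"
   have "\<bar>update m \<omega> t x - update m' \<omega> t x\<bar> \<le> 2 * Cf / 2 ^ n / 2 * exp (rate * t)"
    by (rule update_contraction[OF m m' _ _ t]) (use Suc Cf0 in auto)
   then show "\<bar>m \<omega> t x - m' \<omega> t x\<bar> \<le> 2 * Cf / 2 ^ Suc n * exp (rate * t)" by (simp add: fix1[OF t] fix2[OF t] mult.commute)
  qed
 qed
 then have le: "\<bar>m \<omega> t x - m' \<omega> t x\<bar> \<le> (2 * Cf * exp (rate * t)) / 2 ^ n" for n using t by simp
 have "\<bar>m \<omega> t x - m' \<omega> t x\<bar> \<le> 0"
  by (rule LIMSEQ_le_const[OF tendsto_div_2_power[of "2 * Cf * exp (rate * t)"]]) (use le in blast)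
 then show ?thesis by simp
qed

primrec iterate :: "nat => real => real => real => real" where
 "iterate 0 = (%_ _ _. 0)"
| "iterate (Suc n) = update (iterate n)"

lemma interaction_field_iterate: "interaction_field (iterate n)"
proof (induction n)
 case 0
 show ?case using Cf0 by (simp add: interaction_field_def)
qed (simp add: interaction_field_update)

lemma iterate_difference:
 "t \<in> {0..T} ==> \<bar>iterate (Suc n) \<omega> t x - iterate n \<omega> t x\<bar> \<le> Cf / 2 ^ n * exp (rate * t)"
proof (induction n arbitrary: \<omega> t x)
 case 0
 have "\<bar>iterate (Suc 0) \<omega> t x - iterate 0 \<omega> t x\<bar> \<le> Cf * 1"
  using interaction_fieldD(1)[OF interaction_field_iterate[of "Suc 0"] 0, of \<omega> x] by simp
 also have "\<dots> \<le> Cf * exp (rate * t)" using exp_rate(1)[OF 0] Cf0 by (intro mult_left_mono) auto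
 finally show ?case by simp
next
 case (Suc n)
 have "\<bar>update (iterate (Suc n)) \<omega> t x - update (iterate n) \<omega> t x\<bar> \<le> Cf / 2 ^ n / 2 * exp (rate * t)"
  by (rule update_contraction[OF interaction_field_iterate interaction_field_iterate _ Suc.IH Suc.prems]) (use Cf0 in auto)
 moreover have "Cf / 2 ^ n / 2 = Cf / 2 ^ Suc n" by simp
 ultimately show ?case unfolding iterate.simps(2)[of "Suc n"] iterate.simps(2)[of n, symmetric] by metis
qed

lemma update_fixed_point_exists:
 obtains m where "interaction_field m" "!!\<omega> t x. t \<in> {0..T} ==> update m \<omega> t x = m \<omega> t x"
proof -
 define E where "E = Cf * exp (rate * T)"
 have E0: "0 \<le> E" using Cf0 by (simp add: E_def)
 define m where "m \<omega> t x = lim (%n. iterate n \<omega> t x)" for \<omega> t x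
 have diff: "\<bar>iterate (Suc n) \<omega> t x - iterate n \<omega> t x\<bar> \<le> E / 2 ^ n" if t: "t \<in> {0..T}" for n \<omega> t x
 proof -
  have "Cf / 2 ^ n * exp (rate * t) \<le> Cf / 2 ^ n * exp (rate * T)" using exp_rate(2)[OF t] Cf0 by (intro mult_left_mono) auto
  then show ?thesis using iterate_difference[OF t, of n \<omega> x] by (simp add: E_def)
 qed
 have lim: "(%n. iterate n \<omega> t x) \<longlonglongrightarrow> m \<omega> t x" and near: "\<bar>m \<omega> t x - iterate n \<omega> t x\<bar> \<le> 2 * E / 2 ^ n" if t: "t \<in> {0..T}" for \<omega> t x n
  unfolding m_def using geometric_limit[where x = "%n. iterate n \<omega> t x", OF diff[OF t]] by auto
 note I = interaction_fieldD[OF interaction_field_iterate]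
 have m: "interaction_field m" unfolding interaction_field_def
 proof (intro conjI ballI allI)
  fix t \<omega> x assume t: "t \<in> {0..T}"
  show "\<bar>m \<omega> t x\<bar> \<le> Cf" by (rule LIMSEQ_le_const2[OF tendsto_rabs[OF lim[OF t]]]) (use I(1)[OF t] in blast)
  fix y
  show "\<bar>m \<omega> t x - m \<omega> t y\<bar> \<le> Cf * \<bar>x - y\<bar>"
   by (rule LIMSEQ_le_const2[OF tendsto_rabs[OF tendsto_diff[OF lim[OF t] lim[OF t]]]]) (use I(2)[OF t] in blast)
 next
  fix \<omega> x
  show "continuous_on {0..T} (%t. m \<omega> t x)"
  proof (rule uniform_limit_theorem[where F = sequentially and f = "%n t. iterate n \<omega> t x"])
   show "uniform_limit {0..T} (%n t. iterate n \<omega> t x) (%t. m \<omega> t x) sequentially"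
   proof (rule uniform_limitI)
    fix e :: real assume "0 < e"
    then have "\<forall>\<^sub>F n in sequentially. 2 * E / 2 ^ n < e" using tendsto_div_2_power[of "2 * E"] by (intro order_tendstoD)
    then show "\<forall>\<^sub>F n in sequentially. \<forall>t\<in>{0..T}. dist (iterate n \<omega> t x) (m \<omega> t x) < e"
    proof eventually_elim
     case (elim n)
     show ?case
     proof
      fix t assume t: "t \<in> {0..T}"
      show "dist (iterate n \<omega> t x) (m \<omega> t x) < e" using near[OF t, of \<omega> x n] elim by (simp add: dist_real_def abs_minus_commute)
     qed
    qed
   qed
  qed (use I(3) in auto)
 next
  fix t assume t: "t \<in> {0..T}"
  have "(%p. m (fst p) t (snd p)) \<in> borel_measurable (borel \<Otimes>\<^sub>M borel)"
   by (rule borel_measurable_LIMSEQ_real[of _ "%n p. iterate n (fst p) t (snd p)"]) (use lim[OF t] I(4)[OF t] in \<open>auto simp: case_prod_unfold\<close>)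
  then show "(%(\<omega>, x). m \<omega> t x) \<in> borel_measurable (borel \<Otimes>\<^sub>M borel)" by (simp add: case_prod_unfold)
 qed
 have "update m \<omega> t x = m \<omega> t x" if t: "t \<in> {0..T}" for \<omega> t x
 proof -
  have "\<bar>update m \<omega> t x - m \<omega> t x\<bar> \<le> (E * exp (rate * T) + E) / 2 ^ n" for n
  proof -
   have "\<bar>update m \<omega> t x - update (iterate n) \<omega> t x\<bar> \<le> 2 * E / 2 ^ n / 2 * exp (rate * t)"
   proof (rule update_contraction[OF m interaction_field_iterate _ _ t])
    show "0 \<le> 2 * E / 2 ^ n" using E0 by simp
    fix \<omega> s x assume s: "s \<in> {0..T}"
    have "2 * E / 2 ^ n * 1 \<le> 2 * E / 2 ^ n * exp (rate * s)" using exp_rate(1)[OF s] E0 by (intro mult_left_mono) auto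
    then show "\<bar>m \<omega> s x - iterate n \<omega> s x\<bar> \<le> 2 * E / 2 ^ n * exp (rate * s)" using near[OF s, of \<omega> x n] by simp
   qed
   moreover have "2 * E / 2 ^ n / 2 * exp (rate * t) \<le> E / 2 ^ n * exp (rate * T)"
    using mult_left_mono[OF exp_rate(2)[OF t], of "E / 2 ^ n"] E0 by simp
   \<comment> \<open>\<open>update (iterate n)\<close> is the next iterate, whose distance from the
     limit has half the bound for index n.\<close>
   moreover have "\<bar>m \<omega> t x - update (iterate n) \<omega> t x\<bar> \<le> E / 2 ^ n" using near[OF t, of \<omega> x "Suc n"] by simp
   moreover have "(E * exp (rate * T) + E) / 2 ^ n = E / 2 ^ n * exp (rate * T) + E / 2 ^ n" by (simp add: add_divide_distrib)
   ultimately show ?thesis by linarith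
  qed
  then have "\<bar>update m \<omega> t x - m \<omega> t x\<bar> \<le> 0"
   by (intro LIMSEQ_le_const[OF tendsto_div_2_power[of "E * exp (rate * T) + E"]]) blast
  then show ?thesis by simp
 qed
 with m show thesis by (rule that)
qed

text \<open>Uniqueness is phrased for flows rather than for measures so that it serves twice: for
  zeros of the rate function, with q their time marginals, and for weak solutions, with q their
  joint flow.\<close>

lemma mean_field_fixed_point:
 obtains lam where "lam \<in> path_disorder_measures T"
  "!!q. flow T q ==> (!!t. t \<in> {0..T} ==> time_marginal (law (field q)) t = q t) ==> law (field q) = lam"
  "law (field (time_marginal lam)) = lam"
proof -
 obtain m where m: "interaction_field m" and fp: "!!\<omega> t x. t \<in> {0..T} ==> update m \<omega> t x = m \<omega> t x"
  using update_fixed_point_exists by blast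
 show thesis
 proof (rule that)
  show "law m \<in> path_disorder_measures T" by (rule law_in_space[OF m])
  show "law (field (time_marginal (law m))) = law m"
   using law_cong[OF interaction_field_update[OF m] m fp] by (simp add: update_def)
  fix q assume q: "flow T q" and eq: "!!t. t \<in> {0..T} ==> time_marginal (law (field q)) t = q t"
  note fq = interaction_field_field[OF q]
  have "update (field q) \<omega> t x = field q \<omega> t x" if "t \<in> {0..T}" for \<omega> t x
   by (simp add: update_def field_eq eq[OF that])
  from update_fixed_point_unique[OF fq m this fp] show "law (field q) = law m" by (intro law_cong fq m)
 qed
qed

end

section \<open>Zeros of the rate function and weak solutions\<close>

lemma (in bounded_drift) generator_LBINT:
 assumes w: "weakly_continuous T \<nu>" and \<phi>: "test_function \<phi>" and t: "t \<in> {0..T}"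
 shows "(LBINT s:{0..t}. \<integral>x. generator a \<phi> s x \<partial>\<nu> s) = integral {0..t} (%s. \<integral>x. generator a \<phi> s x \<partial>\<nu> s)"
proof (rule LBINT_eq_integral(2))
 obtain K where K: "!!k x. k \<le> 3 ==> \<bar>(deriv ^^ k) \<phi> x\<bar> \<le> K" using test_function_derivs_bounded[OF \<phi>] by blast
 have "continuous_on {0..T} (%s. \<integral>x. generator a \<phi> s x \<partial>\<nu> s)"
  by (rule generator_integral_continuous[OF w test_function_smooth[OF \<phi>], of K])
   (use K[of 1] K[of 2] K[of 3] in \<open>simp_all add: numeral_2_eq_2 numeral_3_eq_3\<close>)
 then show "continuous_on {0..t} (%s. \<integral>x. generator a \<phi> s x \<partial>\<nu> s)" by (rule continuous_on_subset) (use t in auto)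
qed

lemma sde_dist_fokker_planck:
 assumes T: "0 < T" and a: "lip_drift T L a" and \<rho>: "\<rho> \<in> space (prob_algebra borel)"
  and B: "!!s x. s \<in> {0..T} ==> \<bar>a s x\<bar> \<le> B"
 shows "fokker_planck T a (%t. distr (sde_dist T a \<rho>) borel (%x. x t))"
proof -
 let ?P = "sde_dist T a \<rho>" and ?\<nu> = "%t. distr (sde_dist T a \<rho>) borel (%x. x t)"
 note P = prob_algebraD[OF sde_dist_in_space[OF T a \<rho>]]
 interpret P: prob_space ?P by (rule P)
 have ev: "(%x. x t) \<in> ?P \<rightarrow>\<^sub>M borel" for t
  by (subst measurable_cong_sets[OF P(2) refl]) (rule measurable_path_eval[OF T])
 have int: "(\<integral>x. h x \<partial>?\<nu> t) = (\<integral>x. h (x t) \<partial>?P)" if "continuous_on UNIV h" for h :: "real => real" and t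
  by (rule integral_distr[OF ev borel_measurable_continuous_onI[OF that]])
 have cw: "continuous_on {0..T} x" if "x \<in> space ?P" for x using that by (simp add: P space_path_space paths_def)
 have wc: "weakly_continuous T ?\<nu>" unfolding weakly_continuous_def
 proof (intro conjI ballI allI impI)
  show "?\<nu> t \<in> space (prob_algebra borel)" for t using P.prob_space_distr[OF ev] by (simp add: space_prob_algebra)
  fix \<phi> :: "real => real" assume \<phi>: "continuous_on UNIV \<phi>" "bounded (range \<phi>)"
  obtain K where K: "!!x. \<bar>\<phi> x\<bar> \<le> K" using \<phi>(2) by (auto simp: bounded_iff)
  show "continuous_on {0..T} (%t. \<integral>x. \<phi> x \<partial>?\<nu> t)" unfolding int[OF \<phi>(1)]
  proof (rule P.expectation_continuous[where K = K])
   show "(%x. \<phi> (x t)) \<in> borel_measurable ?P" for t by (rule measurable_compose[OF ev borel_measurable_continuous_onI[OF \<phi>(1)]])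
   show "continuous_on {0..T} (%t. \<phi> (x t))" if "x \<in> space ?P" for x
    by (rule continuous_on_compose2[OF \<phi>(1) cw[OF that]]) simp
  qed (rule K)
 qed
 show ?thesis unfolding fokker_planck_def
 proof (intro conjI wc allI impI ballI)
  fix \<phi> t assume \<phi>: "test_function \<phi>" and t: "t \<in> {0..T}"
  note s0 = test_function_smooth[OF \<phi>] note s1 = smooth_deriv[OF s0] note s2 = smooth_deriv[OF s1]
  obtain K where K: "!!k x. k \<le> 3 ==> \<bar>(deriv ^^ k) \<phi> x\<bar> \<le> K" using test_function_derivs_bounded[OF \<phi>] by blast
  have K': "\<bar>\<phi> x\<bar> \<le> K" "\<bar>deriv \<phi> x\<bar> \<le> K" "\<bar>deriv (deriv \<phi>) x\<bar> \<le> K" "\<bar>deriv (deriv (deriv \<phi>)) x\<bar> \<le> K" for x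
   using K[of 0 x] K[of 1 x] K[of 2 x] K[of 3 x] by (simp_all add: numeral_2_eq_2 numeral_3_eq_3)
  have "(\<integral>x. \<phi> (x t) \<partial>?P) = (\<integral>x. \<phi> x \<partial>\<rho>) + integral {0..t} (%s. \<integral>x. deriv (deriv \<phi>) (x s) / 2 + a s (x s) * deriv \<phi> (x s) \<partial>?P)"
   by (rule sde_dist_weak_formulation[OF T a \<rho> B smoothD[OF s0] smoothD[OF s1] smoothD[OF s2] K' t])
  moreover have "integral {0..t} (%s. \<integral>x. deriv (deriv \<phi>) (x s) / 2 + a s (x s) * deriv \<phi> (x s) \<partial>?P) =
    integral {0..t} (%s. \<integral>x. generator a \<phi> s x \<partial>?\<nu> s)"
  proof (rule Henstock_Kurzweil_Integration.integral_cong)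
   fix s assume "s \<in> {0..t}" then have s: "s \<in> {0..T}" using t by auto
   have "continuous_on UNIV (a s)" by (rule lipschitz_continuous_real[OF lip_driftD(1)[OF a] lip_driftD(3)[OF a s]])
   then have "continuous_on UNIV (generator a \<phi> s)"
    unfolding generator_def[abs_def] using smooth_continuous[OF s1] smooth_continuous[OF s2] by (intro continuous_intros) auto
   from int[OF this, of s]
   show "(\<integral>x. deriv (deriv \<phi>) (x s) / 2 + a s (x s) * deriv \<phi> (x s) \<partial>?P) = (\<integral>x. generator a \<phi> s x \<partial>?\<nu> s)"
    by (simp add: generator_def)
  qed
  moreover have "?\<nu> 0 = \<rho>" by (rule sde_dist_initial[OF T a \<rho>])
  ultimately show "(\<integral>x. \<phi> x \<partial>?\<nu> t) = (\<integral>x. \<phi> x \<partial>?\<nu> 0) + integral {0..t} (%s. \<integral>x. generator a \<phi> s x \<partial>?\<nu> s)"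
   using int[OF smooth_continuous[OF s0], of t] by simp
 qed
qed

context mean_field begin

text \<open>With its own flow frozen, the coupled system splits into one linear Fokker-Planck
  equation for each \<omega>. The Lebesgue and gauge integrals over time agree because the integrand
  is continuous.\<close>

lemma weak_solution_at_iff:
 assumes q: "flow T (joint_flow \<mu> \<nu>)" and m: "!!t. t \<in> {0..T} ==> (%\<omega>. \<nu> \<omega> t) \<in> borel \<rightarrow>\<^sub>M prob_algebra borel"
 shows "((\<forall>\<phi> :: real => real. continuous_on UNIV \<phi> --> bounded (range \<phi>) --> continuous_on {0..T} (%t. \<integral>x. \<phi> x \<partial>\<nu> \<omega> t)) \<and>
    \<nu> \<omega> 0 = \<gamma> \<omega> \<and>
    (\<forall>\<phi>. test_function \<phi> --> (\<forall>t\<in>{0..T}.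
     (\<integral>x. \<phi> x \<partial>\<nu> \<omega> t) = (\<integral>x. \<phi> x \<partial>\<nu> \<omega> 0) +
      (LBINT s:{0..t}. (\<integral>x. deriv (deriv \<phi>) x / 2 +
        (mean_field_drift f (joint_flow \<mu> \<nu> s) \<omega> x + g x \<omega>) * deriv \<phi> x \<partial>\<nu> \<omega> s))))) \<longleftrightarrow>
  fokker_planck T (total_drift (field (joint_flow \<mu> \<nu>)) \<omega>) (\<nu> \<omega>) \<and> \<nu> \<omega> 0 = \<gamma> \<omega>" (is "?C \<and> ?I \<and> ?E \<longleftrightarrow> _")
proof -
 let ?a = "total_drift (field (joint_flow \<mu> \<nu>)) \<omega>"
 note F = interaction_field_field[OF q]
 interpret BD: bounded_drift T L "Cf + Cg * (1 + abs_pow \<omega> k1)" ?a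
  by unfold_locales (rule T total_drift(1)[OF F] total_drift(2)[OF F], assumption?)+
 have gen: "deriv (deriv \<phi>) x / 2 + (mean_field_drift f (joint_flow \<mu> \<nu> s) \<omega> x + g x \<omega>) * deriv \<phi> x = generator ?a \<phi> s x" for \<phi> s x
  by (simp add: generator_def total_drift_def field_def)
 have sp: "\<nu> \<omega> t \<in> space (prob_algebra borel)" if "t \<in> {0..T}" for t using measurable_space[OF m[OF that]] by simp
 have C: "?C \<longleftrightarrow> weakly_continuous T (\<nu> \<omega>)" unfolding weakly_continuous_def using sp by blast
 have E: "?E \<longleftrightarrow> (\<forall>\<phi>. test_function \<phi> --> (\<forall>t\<in>{0..T}. (\<integral>x. \<phi> x \<partial>\<nu> \<omega> t) = (\<integral>x. \<phi> x \<partial>\<nu> \<omega> 0) +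
    integral {0..t} (%s. \<integral>x. generator ?a \<phi> s x \<partial>\<nu> \<omega> s)))" if w: "weakly_continuous T (\<nu> \<omega>)"
  unfolding gen using BD.generator_LBINT[OF w] by (intro iff_allI imp_cong refl ball_cong) simp
 show ?thesis unfolding fokker_planck_def C using E by blast
qed

lemma flow_of_weak_solution:
 "mckean_vlasov_weak_solution T f g \<gamma> \<mu> \<nu> ==> flow T (joint_flow \<mu> \<nu>)"
 unfolding mckean_vlasov_weak_solution_def
 by (rule flow_joint_flow[OF \<mu>]) (blast, elim conjE, erule eventually_mono, blast)

text \<open>For fixed \<omega> both sides solve the same linear equation with initial law
  \<gamma>(\<omega>), and the drift is bounded for that \<omega>.\<close>

lemma marginals_of_weak_solution:
 assumes \<nu>: "mckean_vlasov_weak_solution T f g \<gamma> \<mu> \<nu>"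
 shows "AE \<omega> in \<mu>. \<forall>t\<in>{0..T}. \<nu> \<omega> t = distr (path_kernel (field (joint_flow \<mu> \<nu>)) \<omega>) borel (%x. x t)"
proof -
 note q = flow_of_weak_solution[OF \<nu>]
 note F = interaction_field_field[OF q]
 have m: "!!t. t \<in> {0..T} ==> (%\<omega>. \<nu> \<omega> t) \<in> borel \<rightarrow>\<^sub>M prob_algebra borel"
  using \<nu> unfolding mckean_vlasov_weak_solution_def by blast
 have "AE \<omega> in \<mu>. fokker_planck T (total_drift (field (joint_flow \<mu> \<nu>)) \<omega>) (\<nu> \<omega>) \<and> \<nu> \<omega> 0 = \<gamma> \<omega>"
  by (rule eventually_mono[OF conjunct2[OF \<nu>[unfolded mckean_vlasov_weak_solution_def]]])
   (rule iffD1[OF weak_solution_at_iff[OF q m]], assumption)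
 then show ?thesis
 proof eventually_elim
  case (elim \<omega>)
  note d = total_drift(1)[OF F, of \<omega>] and B = total_drift(2)[OF F, of _ \<omega>]
  show ?case
  proof
   fix t assume t: "t \<in> {0..T}"
   show "\<nu> \<omega> t = distr (path_kernel (field (joint_flow \<mu> \<nu>)) \<omega>) borel (%x. x t)"
    unfolding path_kernel_def
    by (rule fokker_planck_unique[OF T d B _ sde_dist_fokker_planck[OF T d \<gamma>_space B] _ t])
     (use elim sde_dist_initial[OF T d \<gamma>_space] in auto)
  qed
 qed
qed

lemma rate_function_disintegration:
 assumes lam: "lam \<in> path_disorder_measures T" "second_marginal lam = \<mu>" and \<kappa>: "disintegration T lam \<kappa>"
 shows "rate_function T f g \<gamma> \<mu> lam = (\<integral>\<^sup>+ \<omega>. relative_entropy (\<kappa> \<omega>) (path_law T f g \<gamma> (time_marginal lam) \<omega>) \<partial>\<mu>)"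
proof -
 note q = flow_time_marginal[OF T lam(1)]
 obtain G where G: "countable G" "Int_stable G" "G \<subseteq> Pow (space (path_space T))" "sets (path_space T) = sigma_sets (space (path_space T)) G"
  using path_space_countable_generator[OF T] unfolding space_path_space by metis
 have k: "\<kappa> \<in> borel \<rightarrow>\<^sub>M prob_algebra (path_space T)" and eq: "lam = semidirect (path_space T) \<mu> \<kappa>"
  using \<kappa> lam(2) unfolding disintegration_def by auto
 have "relative_entropy (semidirect (path_space T) \<mu> \<kappa>) (law (field (time_marginal lam))) =
   (\<integral>\<^sup>+ \<omega>. relative_entropy (\<kappa> \<omega>) (path_kernel (field (time_marginal lam)) \<omega>) \<partial>\<mu>)"
  unfolding law_def
  by (rule relative_entropy_semidirect[OF \<mu> k path_kernel_measurable[OF interaction_field_field[OF q]] G])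
 then show ?thesis
  using lam(2) unfolding rate_function_def path_law_joint_eq[OF q] path_law_eq[OF q] eq[symmetric] by simp
qed

text \<open>The case distinction in the rate function disappears, since a measure of the form
  \<open>law m\<close> has second marginal \<mu>.\<close>

lemma rate_function_eq_0_iff:
 assumes lam: "lam \<in> path_disorder_measures T"
 shows "rate_function T f g \<gamma> \<mu> lam = 0 \<longleftrightarrow> lam = law (field (time_marginal lam))"
proof -
 note q = flow_time_marginal[OF T lam]
 note F = interaction_field_field[OF q]
 note P = prob_algebraD[OF law_in_space[OF F, unfolded path_disorder_measures_def]]
 note Q = prob_algebraD[OF lam[unfolded path_disorder_measures_def]]
 have "second_marginal (law (field (time_marginal lam))) = \<mu>"
  unfolding law_def by (rule second_marginal_semidirect[OF \<mu> path_kernel_measurable[OF F]])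
 moreover have "relative_entropy lam (law (field (time_marginal lam))) = 0 \<longleftrightarrow> lam = law (field (time_marginal lam))"
  by (rule relative_entropy_eq_0_iff[OF P(1) Q(1)]) (simp add: P Q)
 ultimately show ?thesis unfolding rate_function_def path_law_joint_eq[OF q] by auto
qed

text \<open>The path law driven by the joint flow has the weak solution as its marginals, so it
  reproduces that flow and the uniqueness clause applies.\<close>

lemma path_law_joint_weak_solution:
 assumes fp: "!!q. flow T q ==> (!!t. t \<in> {0..T} ==> time_marginal (law (field q)) t = q t) ==> law (field q) = lam"
  and \<nu>: "mckean_vlasov_weak_solution T f g \<gamma> \<mu> \<nu>"
 shows "law (field (joint_flow \<mu> \<nu>)) = lam"
proof -
 note q = flow_of_weak_solution[OF \<nu>]
 note k = path_kernel_measurable[OF interaction_field_field[OF q]]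
 have m: "!!t. t \<in> {0..T} ==> (%\<omega>. \<nu> \<omega> t) \<in> borel \<rightarrow>\<^sub>M prob_algebra borel"
  using \<nu> unfolding mckean_vlasov_weak_solution_def by blast
 show ?thesis
 proof (rule fp[OF q])
  fix t assume t: "t \<in> {0..T}"
  show "time_marginal (law (field (joint_flow \<mu> \<nu>))) t = joint_flow \<mu> \<nu> t"
   unfolding law_def time_marginal_semidirect[OF T \<mu> k] joint_flow_def[of \<mu> \<nu> t]
  proof (rule semidirect_cong_AE[OF \<mu> measurable_marginal_kernel[OF T k] m[OF t]])
   show "AE \<omega> in \<mu>. distr (path_kernel (field (joint_flow \<mu> \<nu>)) \<omega>) borel (%x. x t) = \<nu> \<omega> t"
    using marginals_of_weak_solution[OF \<nu>] by eventually_elim (use t in auto)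
  qed
 qed
qed

lemma disintegration_AE:
 assumes lam: "lam = law (field q)" and q: "flow T q" and \<kappa>: "disintegration T lam \<kappa>"
 shows "AE \<omega> in \<mu>. \<kappa> \<omega> = path_kernel (field q) \<omega>"
proof -
 note k = path_kernel_measurable[OF interaction_field_field[OF q]]
 obtain G where G: "countable G" "Int_stable G" "G \<subseteq> Pow (space (path_space T))" "sets (path_space T) = sigma_sets (space (path_space T)) G"
  using path_space_countable_generator[OF T] unfolding space_path_space by metis
 have sm: "second_marginal lam = \<mu>" unfolding lam law_def by (rule second_marginal_semidirect[OF \<mu> k])
 have k': "\<kappa> \<in> borel \<rightarrow>\<^sub>M prob_algebra (path_space T)" and eq: "lam = semidirect (path_space T) \<mu> \<kappa>"
  using \<kappa> unfolding disintegration_def sm by auto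
 show ?thesis by (rule semidirect_eq_AE[OF \<mu> k' k G]) (simp add: eq[symmetric] lam flip: law_def)
qed

text \<open>Any disintegration agrees almost everywhere with the path kernel, and its joint flow is
  the flow of time marginals; so the drift in the equation is the one that generated the
  law.\<close>

lemma fixed_point_weak_solution:
 assumes lam: "lam \<in> path_disorder_measures T" "law (field (time_marginal lam)) = lam" and \<kappa>: "disintegration T lam \<kappa>"
 shows "mckean_vlasov_weak_solution T f g \<gamma> \<mu> (%\<omega> t. distr (\<kappa> \<omega>) borel (%x. x t))"
proof -
 note q = flow_time_marginal[OF T lam(1)]
 note F = interaction_field_field[OF q]
 let ?\<nu> = "%\<omega> t. distr (\<kappa> \<omega>) borel (%x. x t)"
 have sm: "second_marginal lam = \<mu>"
  using second_marginal_semidirect[OF \<mu> path_kernel_measurable[OF F]] unfolding law_def[symmetric] lam(2) .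
 have k: "\<kappa> \<in> borel \<rightarrow>\<^sub>M prob_algebra (path_space T)" and eq: "lam = semidirect (path_space T) \<mu> \<kappa>"
  using \<kappa> unfolding disintegration_def sm by auto
 have jf: "joint_flow \<mu> ?\<nu> = time_marginal lam"
  unfolding joint_flow_def by (rule ext) (subst eq, rule time_marginal_semidirect[OF T \<mu> k, symmetric])
 have m: "!!t. t \<in> {0..T} ==> (%\<omega>. ?\<nu> \<omega> t) \<in> borel \<rightarrow>\<^sub>M prob_algebra borel" by (rule measurable_marginal_kernel[OF T k])
 have "AE \<omega> in \<mu>. fokker_planck T (total_drift (field (joint_flow \<mu> ?\<nu>)) \<omega>) (?\<nu> \<omega>) \<and> ?\<nu> \<omega> 0 = \<gamma> \<omega>"
  using disintegration_AE[OF lam(2)[symmetric] q \<kappa>]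
 proof eventually_elim
  case (elim \<omega>)
  note d = total_drift(1)[OF F, of \<omega>] and B = total_drift(2)[OF F, of _ \<omega>]
  show ?case unfolding jf elim path_kernel_def
   using sde_dist_fokker_planck[OF T d \<gamma>_space B] sde_dist_initial[OF T d \<gamma>_space] by blast
 qed
 moreover have qj: "flow T (joint_flow \<mu> ?\<nu>)" unfolding jf by (rule q)
 moreover have "AE \<omega> in \<mu>. fokker_planck T (total_drift (field (joint_flow \<mu> ?\<nu>)) \<omega>) (?\<nu> \<omega>) \<and> ?\<nu> \<omega> 0 = \<gamma> \<omega> ==> ?thesis"
  unfolding mckean_vlasov_weak_solution_def
  by (rule conjI[OF ballI[OF m]], assumption, erule eventually_mono) (rule iffD2[OF weak_solution_at_iff[OF qj m]], assumption)
 ultimately show ?thesis by blast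
qed

end

text \<open>The characterisation is given in both directions: every disintegration of the zero has
  the unique weak solution as its marginals, and every weak solution rebuilds the zero as the path
  law driven by its joint flow.\<close>

theorem proposition1p8:
  fixes T Cf Cg k1 k2 \<tau> p \<iota> :: real
    and f :: "real \<Rightarrow> real \<Rightarrow> real \<Rightarrow> real"
    and g :: "real \<Rightarrow> real \<Rightarrow> real"
    and \<gamma> :: "real \<Rightarrow> real measure"
    and w :: "nat \<Rightarrow> real"
    and \<mu> :: "real measure"
  assumes "T > 0"
    and "interaction_assms f Cf"
    and "local_drift_assms g Cg k1 k2"
    and "initial_assms \<gamma> \<tau>"
    and "disorder_assms \<gamma> \<tau> k1 k2 w \<mu> p \<iota>"
  shows
    "(\<forall>lam \<in> path_disorder_measures T. \<forall>\<kappa>.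
        second_marginal lam = \<mu> \<and> disintegration T lam \<kappa> \<longrightarrow>
        rate_function T f g \<gamma> \<mu> lam =
          (\<integral>\<^sup>+ \<omega>. relative_entropy (\<kappa> \<omega>) (path_law T f g \<gamma> (time_marginal lam) \<omega>) \<partial>\<mu>)) \<and>
     (\<exists>lam_star \<in> path_disorder_measures T.
        (\<forall>lam \<in> path_disorder_measures T. rate_function T f g \<gamma> \<mu> lam = 0 \<longleftrightarrow> lam = lam_star) \<and>
        second_marginal lam_star = \<mu> \<and>
        (\<exists>\<kappa>. disintegration T lam_star \<kappa>) \<and>
        (\<forall>\<kappa>. disintegration T lam_star \<kappa> \<longrightarrow>
           unique_mckean_vlasov_weak_solution T f g \<gamma> \<mu> (\<lambda>\<omega> t. distr (\<kappa> \<omega>) borel (\<lambda>x. x t))) \<and>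
        (\<forall>\<nu>. mckean_vlasov_weak_solution T f g \<gamma> \<mu> \<nu> \<longrightarrow>
           lam_star = path_law_joint T f g \<gamma> \<mu> (joint_flow \<mu> \<nu>)))"
proof -
 interpret mean_field T Cf Cg k1 k2 \<tau> f g \<gamma> \<mu>
  by unfold_locales (use assms in \<open>auto simp: disorder_assms_def\<close>)
 obtain lam where lam: "lam \<in> path_disorder_measures T"
  and fp: "!!q. flow T q ==> (!!t. t \<in> {0..T} ==> time_marginal (law (field q)) t = q t) ==> law (field q) = lam"
  and self: "law (field (time_marginal lam)) = lam" using mean_field_fixed_point by blast
 note k = path_kernel_measurable[OF interaction_field_field[OF flow_time_marginal[OF T lam]]]
 have sm: "second_marginal lam = \<mu>"
  using second_marginal_semidirect[OF \<mu> k] unfolding law_def[symmetric] self .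
 show ?thesis
 proof (intro conjI bexI[OF _ lam] ballI allI impI, goal_cases)
  case (1 lam' \<kappa>)
  then show ?case using rate_function_disintegration by blast
 next
  case (2 lam')
  show ?case unfolding rate_function_eq_0_iff[OF 2]
  proof
   assume e: "lam' = law (field (time_marginal lam'))"
   \<comment> \<open>A zero reproduces its own time marginals, so it falls under the uniqueness
     clause for flows.\<close>
   have "law (field (time_marginal lam')) = lam" by (rule fp[OF flow_time_marginal[OF T 2]]) (simp only: e[symmetric])
   then show "lam' = lam" using e by simp
  qed (simp add: self)
 next
  case 3
  show ?case by (rule sm)
 next
  case 4
  show ?case unfolding disintegration_def sm using k self[symmetric] unfolding law_def by blast
 next
  case (5 \<kappa>)
  show ?case unfolding unique_mckean_vlasov_weak_solution_def
  proof (intro conjI allI impI)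
   show "mckean_vlasov_weak_solution T f g \<gamma> \<mu> (%\<omega> t. distr (\<kappa> \<omega>) borel (%x. x t))"
    by (rule fixed_point_weak_solution[OF lam self 5])
   fix \<nu> assume \<nu>: "mckean_vlasov_weak_solution T f g \<gamma> \<mu> \<nu>"
   \<comment> \<open>The weak solution generates the same measure \<open>lam\<close>, whose
     disintegration is determined up to null sets; comparing marginals in time gives
     uniqueness.\<close>
   have "lam = law (field (joint_flow \<mu> \<nu>))" using path_law_joint_weak_solution[OF fp \<nu>] by simp
   from disintegration_AE[OF this flow_of_weak_solution[OF \<nu>] 5] marginals_of_weak_solution[OF \<nu>]
   show "AE \<omega> in \<mu>. \<forall>t\<in>{0..T}. \<nu> \<omega> t = distr (\<kappa> \<omega>) borel (%x. x t)" by eventually_elim auto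
  qed
 next
  case (6 \<nu>)
  then show ?case
   using path_law_joint_weak_solution[OF fp 6] path_law_joint_eq[OF flow_of_weak_solution[OF 6]] by simp
 qed
qed

end
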